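(* Let $S\subset\mathbb{C}$ be compact and let $\mu$ be a Borel probability measure with support $S$ which is noble with respect to a division $(U_i)_i$, $(V_j)_j$ of the components of $\mathbb{C}\setminus S$. Let $(q_k)_k$ be a sequence of polynomials, $\deg q_k=n_k\to\infty$, which is noble with respect to $(\mu,(U_i)_i,(V_j)_j)$. Then $(q_k')_k$ is also noble with respect to $(\mu,(U_i)_i,(V_j)_j)$. In particular, for every $m=0,1,2,\ldots$, the root distributions $\mu_k^m$ of $q_k^{(m)}$ satisfy $\mu_k^m\to\mu$ weak-star as $k\to\infty$.
   Context: For a non-zero polynomial $q(z)=\gamma\prod_{j=1}^n(z-z_j)$ its root distribution is $\mu_q=\frac1n\sum_{j=1}^n\delta_{z_j}$. Write $\mu_k=\mu_{q_k}$ and $\mu_k^m=\mu_{q_k^{(m)}}$. For a compactly supported Borel probability measure $\mu$ its potential is $p_\mu(z)=\int\log|z-w|\,d\mu(w)$. $m_2$ denotes planar Lebesgue measure. A connected set is non-trivial if it contains more than one point. Definition (centering): Let $C\subset\mathbb{C}$ be non-empty and compact. A sequence of polynomials $(q_k)_k$ centers on $C$ if there exist $R>0$ and $k_0$ such that (1) all zeros of $q_k$ lie in $\mathbb{D}(0,R)$ for $k\ge k_0$; (2) for every closed $L\subset\mathbb{C}$ with $L\cap C=\emptyset$ there is $M(L)$ such that the number of zeros of $q_k$ in $L$ (with multiplicity) is at most $M(L)$ for $k\ge k_0$. Definition (noble measure): Let $\mu$ be a Borel probability measure with compact support $S$, and let $(W_l)_l$ be the components of the interior of $S$. $\mu$ is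 noble with respect to a division of the connected components of $\mathbb{C}\setminus S$ into two families $(U_i)_i$ and $(V_j)_j$ if: (1) $(U_i)_i$ contains the unbounded component $U_1=\Omega$; (2) $p_\mu$ is non-constant on every $U_i$; (3) every $z\in\bigcup_j\partial V_j$ lies in the closure of a non-trivial connected component of $\bigcup_i\overline{U_i}\cup\bigcup_l\overline{W_l}$; (4) $\mu(\bigcup_j\overline{V_j})=0$; (5) $m_2\big(\partial S\setminus(\bigcup_i\partial U_i\cup\bigcup_j\partial V_j\cup\bigcup_l\partial W_l)\big)=0$. Definition (noble sequence): if $\mu$ is noble with respect to $(U_i)_i,(V_j)_j$ and $C=\mathbb{C}\setminus\bigcup_iU_i$, a polynomial sequence $(q_k)_k$ is noble with respect to $(\mu,(U_i)_i,(V_j)_j)$ if $(q_k)_k$ centers on $C$ and $\mu_k\to\mu$ weak-star. *)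

theory Defs
  imports "HOL-Analysis.Analysis" "HOL-Probability.Probability"
    "HOL-Computational_Algebra.Polynomial"
begin

definition root_dist :: "complex poly \<Rightarrow> complex measure" where
  "root_dist q = measure_pmf (pmf_of_multiset (proots q))"

definition weak_star_conv :: "(nat \<Rightarrow> complex measure) \<Rightarrow> complex measure \<Rightarrow> bool" where
  "weak_star_conv \<mu>s \<mu> \<longleftrightarrow>
     (\<forall>f :: complex \<Rightarrow> real. continuous_on UNIV f \<and> compact (closure {z. f z \<noteq> 0}) \<longrightarrow>
        (\<lambda>k. integral\<^sup>L (\<mu>s k) f) \<longlonglongrightarrow> integral\<^sup>L \<mu> f)"

definition msupport :: "complex measure \<Rightarrow> complex set" where
  "msupport \<mu> = {z. \<forall>e>0. emeasure \<mu> (ball z e) > 0}"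

definition potential :: "complex measure \<Rightarrow> complex \<Rightarrow> real" where
  "potential \<mu> z = integral\<^sup>L \<mu> (\<lambda>w. ln (cmod (z - w)))"

definition zeros_in :: "complex poly \<Rightarrow> complex set \<Rightarrow> nat" where
  "zeros_in q L = size (filter_mset (\<lambda>z. z \<in> L) (proots q))"

definition centers_on :: "(nat \<Rightarrow> complex poly) \<Rightarrow> complex set \<Rightarrow> bool" where
  "centers_on q C \<longleftrightarrow>
     (\<exists>R>0. \<exists>k0. (\<forall>k\<ge>k0. \<forall>z. poly (q k) z = 0 \<longrightarrow> z \<in> ball 0 R) \<and>
        (\<forall>L. closed L \<and> L \<inter> C = {} \<longrightarrow> (\<exists>M. \<forall>k\<ge>k0. zeros_in (q k) L \<le> M)))"

definition nontrivial :: "'a set \<Rightarrow> bool" where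
  "nontrivial A \<longleftrightarrow> (\<exists>a\<in>A. \<exists>b\<in>A. a \<noteq> b)"

definition noble_measure :: "complex measure \<Rightarrow> complex set set \<Rightarrow> complex set set \<Rightarrow> bool" where
  "noble_measure \<mu> Us Vs \<longleftrightarrow>
     (let S = msupport \<mu>; Ws = components (interior S) in
       prob_space \<mu> \<and> sets \<mu> = sets borel \<and> compact S \<and>
       Us \<union> Vs = components (- S) \<and> Us \<inter> Vs = {} \<and>
       (\<exists>U\<in>Us. \<not> bounded U) \<and>
       (\<forall>U\<in>Us. \<exists>z1\<in>U. \<exists>z2\<in>U. potential \<mu> z1 \<noteq> potential \<mu> z2) \<and>
       (\<forall>V\<in>Vs. \<forall>z\<in>frontier V. \<exists>K\<in>components ((\<Union>U\<in>Us. closure U) \<union> (\<Union>W\<in>Ws. closure W)).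
            nontrivial K \<and> z \<in> closure K) \<and>
       measure \<mu> (\<Union>V\<in>Vs. closure V) = 0 \<and>
       (frontier S - ((\<Union>U\<in>Us. frontier U) \<union> (\<Union>V\<in>Vs. frontier V) \<union> (\<Union>W\<in>Ws. frontier W)))
          \<in> null_sets lebesgue)"

definition noble_seq :: "(nat \<Rightarrow> complex poly) \<Rightarrow> complex measure \<Rightarrow> complex set set \<Rightarrow> complex set set \<Rightarrow> bool" where
  "noble_seq q \<mu> Us Vs \<longleftrightarrow>
     noble_measure \<mu> Us Vs \<and> centers_on q (- (\<Union>Us)) \<and>
     weak_star_conv (\<lambda>k. root_dist (q k)) \<mu>"

end

(*
  Let p and C be the potential and the Cauchy transform of mu, and let p_k, C_k and p'_k be the
  potentials and the Cauchy transform belonging to q_k and q_k'. Since C_k = q_k' / (n_k q_k), one has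
  (n_k - 1) p'_k = n_k p_k + ln |C_k|, and p_k -> p, C_k -> C in L^1_loc. Hence limsup p'_k <= p in the
  mean, and p'_k -> p in measure where C is nonzero. Everything is done with the regularised kernels
  ln (max r |z - w|), the means of ln |z - w| over circles of radius r, so that no subsequential limit
  measure is needed.

  Lower bound off the components V of the complement of the support on which p is constant: if
  C = 0 almost everywhere on {p > b} near x for some b < p(x), then max p b is constant on almost every
  horizontal and vertical line near x, so p is constant near x and x lies in such a V. Otherwise
  p'_k is almost as large as b at points arbitrarily close to x.

  Lower bound on V: V is one of the V_j, so mu (closure V) = 0. Replace p'_k by p on the other constant
  components. The result is still submean (a local property at each point), so f = p - p'_k, restricted
  to V, has M_r f - f bounded above by the mass of mu near V. Testing against |z|^2, for which
  M_r |z|^2 - |z|^2 = r^2, the integral of f over V tends to 0.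

  Finally, C is not identically 0 on U_i, and q_k has boundedly many zeros near a given point of U_i, so
  a Jensen-type estimate bounds the number of zeros of q_k' there.
*)
theory Submission
  imports Defs "HOL-Complex_Analysis.Complex_Analysis"
    "HOL-Computational_Algebra.Fundamental_Theorem_Algebra"
begin

section \<open>Logarithmic kernels\<close>

text \<open>The obstacle is the zero set of C: there ln |C_k| / (n_k - 1) has no lower bound, so
  p'_k may fall below p. If C vanishes on part of a neighbourhood, one good point nearby still
  suffices, because the regularised potentials are Lipschitz with a constant that does not depend on
  k. Only inside a component with constant potential are there no good points at all. Such
  components may be infinite in number and accumulate at the boundary of V, and nothing is known
  beforehand about p'_k on the neighbours; hence the replacement on all of them at once, by a
  construction that needs the lower bound only on their frontiers. The test function |z|^2 asks for
  no regularity of the frontier of V. It yields r^2 times the integral of f, against errors of the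
  form r^2 times the mass within 3 r of V, s^2 for the regularisation radius s, and the tolerance
  eps. So r is fixed first, from mu (closure V) = 0, then s small against r, then eps small against
  r^2, and k last.\<close>

lemma emeasure_lborel_ball_complex:
  fixes y :: complex
  assumes "0 \<le> r"
  shows "emeasure lborel (ball y r) = ennreal (pi * r\<^sup>2)"
  using assms by (simp add: emeasure_ball unit_ball_vol_2)

text \<open>Dyadic annuli replace polar coordinates: where the distance to \<open>y\<close> lies
  between \<rho> / 2^(j+1) and \<rho> / 2^j, the integrand is at most the single term
  \<open>g j\<close>, and the integrals of the \<open>g j\<close> form a geometric series with sum 4
  pi \<rho>. The exact value is 2 pi \<rho>; only linearity in \<rho> matters, and 16 is a round
  bound for 4 pi.\<close>

lemma nn_integral_inverse_norm_le:
  fixes y :: complex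
  assumes \<rho>: "0 < \<rho>"
  shows "(\<integral>\<^sup>+ z. ennreal (indicator (ball y \<rho>) z / cmod (z - y)) \<partial>lborel) \<le> ennreal (16 * \<rho>)"
proof -
  define g where "g j z = ennreal (2 ^ (j + 1) / \<rho>) * indicator (ball y (\<rho> / 2 ^ j)) z" for j :: nat and z :: complex
  have pt: "ennreal (indicator (ball y \<rho>) z / cmod (z - y)) \<le> (\<Sum>j. g j z)" for z
  proof (cases "z \<in> ball y \<rho> \<and> z \<noteq> y")
    case True
    define d where "d = cmod (z - y)"
    have d: "0 < d" "d < \<rho>" using True by (auto simp: d_def dist_norm norm_minus_commute)
    obtain n where n: "(1/2) ^ n < d / \<rho>"
      using real_arch_pow_inv[of "d / \<rho>" "1/2"] d \<rho> by auto
    \<comment> \<open>\<open>m\<close> is positive because d < \<rho>. Its own inequality bounds d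
      from below, and minimality bounds d from above at the predecessor \<open>j\<close>, so
      \<open>j\<close> is the index of the annulus.\<close>
    define m where "m = (LEAST n. (1/2) ^ n \<le> d / \<rho>)"
    have m1: "(1/2) ^ m \<le> d / \<rho>"
      unfolding m_def by (rule LeastI[of _ n]) (use n in simp)
    have "m \<noteq> 0" using m1 d \<rho> by (intro notI) (simp add: field_simps)
    then obtain j where j: "m = Suc j" by (cases m) auto
    have "\<not> (1/2) ^ j \<le> d / \<rho>" using not_less_Least[of j "\<lambda>n. (1/2) ^ n \<le> d / \<rho>"] j by (auto simp: m_def)
    then have in_ball: "z \<in> ball y (\<rho> / 2 ^ j)"
      using \<rho> by (auto simp: d_def dist_norm norm_minus_commute field_simps power_one_over)
    have "1 / d \<le> 2 ^ (j + 1) / \<rho>"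
      using m1 d \<rho> by (simp add: j field_simps power_one_over)
    then have "ennreal (indicator (ball y \<rho>) z / cmod (z - y)) \<le> g j z"
      using True in_ball by (auto simp: g_def d_def intro!: ennreal_leI)
    also have "\<dots> \<le> (\<Sum>j. g j z)"
      using sum_le_suminf[of "\<lambda>j. g j z" "{j}"] by simp
    finally show ?thesis .
  qed auto
  have meas: "(\<integral>\<^sup>+ z. g j z \<partial>lborel) = ennreal (2 * pi * \<rho> * (1/2) ^ j)" for j
  proof -
    have "(\<integral>\<^sup>+ z. g j z \<partial>lborel) = ennreal (2 ^ (j + 1) / \<rho>) * ennreal (pi * (\<rho> / 2 ^ j)\<^sup>2)"
      using \<rho> by (simp add: g_def nn_integral_cmult_indicator emeasure_lborel_ball_complex)
    also have "\<dots> = ennreal (2 * pi * \<rho> * (1/2) ^ j)"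
      using \<rho> by (simp add: ennreal_mult[symmetric] power2_eq_square field_simps power_one_over)
    finally show ?thesis .
  qed
  have "(\<integral>\<^sup>+ z. ennreal (indicator (ball y \<rho>) z / cmod (z - y)) \<partial>lborel) \<le> (\<integral>\<^sup>+ z. (\<Sum>j. g j z) \<partial>lborel)"
    by (intro nn_integral_mono pt)
  also have "\<dots> = (\<Sum>j. \<integral>\<^sup>+ z. g j z \<partial>lborel)"
    unfolding g_def by (intro nn_integral_suminf borel_measurable_times_ennreal borel_measurable_const borel_measurable_indicator) simp_all
  also have "\<dots> = (\<Sum>j. ennreal (2 * pi * \<rho> * (1/2) ^ j))" by (simp add: meas)
  also have "\<dots> = ennreal (\<Sum>j. 2 * pi * \<rho> * (1/2) ^ j)"
    using \<rho> by (intro suminf_ennreal2) (auto intro!: summable_mult)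
  also have "(\<Sum>j. 2 * pi * \<rho> * (1/2) ^ j) = 4 * pi * \<rho>"
    by (subst suminf_mult) (auto simp: suminf_geometric)
  also have "ennreal (4 * pi * \<rho>) \<le> ennreal (16 * \<rho>)"
    using \<rho> pi_less_4 by (intro ennreal_leI) (auto intro!: mult_right_mono)
  finally show ?thesis .
qed

text \<open>By ln x <= x - 1 the logarithm is Lipschitz with constant 1 / r from r on, and
  truncation at r is 1-Lipschitz. The constant does not depend on any measure, which makes the
  regularised potentials equicontinuous in k.\<close>

lemma ln_max_lipschitz:
  fixes a b r :: real
  assumes "0 < r"
  shows "\<bar>ln (max r a) - ln (max r b)\<bar> \<le> \<bar>a - b\<bar> / r"
proof -
  have *: "ln (max r a) - ln (max r b) \<le> \<bar>a - b\<bar> / r" for a b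
  proof -
    have "ln (max r a) - ln (max r b) = ln (max r a / max r b)"
      using assms by (subst ln_div) auto
    also have "\<dots> \<le> max r a / max r b - 1"
      using assms by (intro ln_le_minus_one) (auto simp: less_max_iff_disj)
    also have "\<dots> = (max r a - max r b) / max r b" using assms by (auto simp: field_simps less_max_iff_disj)
    also have "\<dots> \<le> \<bar>a - b\<bar> / r"
      using assms by (intro frac_le) auto
    finally show ?thesis .
  qed
  have "ln (max r b) - ln (max r a) \<le> \<bar>a - b\<bar> / r"
    using *[of b a] by (simp add: abs_minus_commute)
  with *[of a b] show ?thesis by linarith
qed

text \<open>The error of truncating the logarithm is dominated by a multiple of 1 / d on the disc d
  < r, so it can be measured by the same \<open>near_potential\<close> as the error of smoothing the
  Cauchy kernel.\<close>

lemma ln_max_diff_le: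
  fixes d r :: real
  assumes "0 < r" "0 < d"
  shows "ln (max r d) - ln d \<le> (if d < r then r / d else 0)"
proof (cases "d < r")
  case True
  have "ln r - ln d = ln (r / d)" using assms by (simp add: ln_div)
  also have "\<dots> \<le> r / d" using assms by (simp add: ln_bound)
  finally show ?thesis using True by (simp add: max_def)
qed (auto simp: max_def)

section \<open>Regularised potentials of probability measures on a disc\<close>

definition log_potential :: "complex measure \<Rightarrow> real \<Rightarrow> complex \<Rightarrow> real" where
  "log_potential \<sigma> r z = (\<integral>y. ln (max r (cmod (z - y))) \<partial>\<sigma>)"

definition cauchy_transform :: "complex measure \<Rightarrow> complex \<Rightarrow> complex" where
  "cauchy_transform \<sigma> z = (\<integral>y. 1 / (z - y) \<partial>\<sigma>)"

text \<open>The part of the potential with kernel 1 / |z - y| that comes from distances below t. It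
  is the common error term: truncating ln at r costs at most r times it (with t = r), smoothing the
  Cauchy kernel below t costs at most it, and for a probability measure its area integral is at most
  16 t.\<close>

definition near_potential :: "complex measure \<Rightarrow> real \<Rightarrow> complex \<Rightarrow> real" where
  "near_potential \<sigma> t z = (\<integral>y. indicator (ball z t) y / cmod (z - y) \<partial>\<sigma>)"

text \<open>Both clauses guard against default values: a divergent Bochner integral is 0, and an
  atom at z would pass unseen through 1 / 0 = 0 and ln 0 = 0. On a disc, integrability of 1 / |z -
  y| also yields that of ln |z - y|.\<close>

definition regular_point :: "complex measure \<Rightarrow> complex \<Rightarrow> bool" where
  "regular_point \<sigma> z \<longleftrightarrow> integrable \<sigma> (\<lambda>y. 1 / cmod (z - y)) \<and> (AE y in \<sigma>. y \<noteq> z)"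

locale disc_prob = prob_space \<sigma> for \<sigma> :: "complex measure" +
  fixes R :: real
  assumes sets_eq_borel [measurable_cong]: "sets \<sigma> = sets borel"
    and AE_in_disc: "AE y in \<sigma>. cmod y \<le> R"
begin

lemma R_nonneg: "0 \<le> R"
proof -
  have "\<exists>y. cmod y \<le> R"
    using AE_in_disc AE_contr[of "\<lambda>y. cmod y \<le> R"] emeasure_space_1 
    by (metis (mono_tags, lifting) AE_mp not_AE_zero_E AE_I2 AE_False prob_space.AE_const[OF prob_space_axioms] eventually_mono)
  then show ?thesis using norm_ge_zero order_trans by blast
qed

lemma integrable_ln_max:
  assumes "0 < r"
  shows "integrable \<sigma> (\<lambda>y. ln (max r (cmod (z - y))))"
proof (rule integrable_const_bound)
  show "AE y in \<sigma>. norm (ln (max r (cmod (z - y)))) \<le> \<bar>ln r\<bar> + (cmod z + R) / r"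
    using AE_in_disc
  proof eventually_elim
    case (elim y)
    have "\<bar>ln (max r (cmod (z - y))) - ln (max r 0)\<bar> \<le> \<bar>cmod (z - y) - 0\<bar> / r"
      by (rule ln_max_lipschitz[OF assms])
    also have "\<dots> \<le> (cmod z + R) / r"
      using norm_triangle_ineq4[of z y] elim assms by (intro divide_right_mono) auto
    finally have "\<bar>ln (max r (cmod (z - y))) - ln r\<bar> \<le> (cmod z + R) / r" using assms by simp
    then show ?case unfolding real_norm_def by linarith
  qed
qed measurable

lemma log_potential_lipschitz:
  assumes "0 < r"
  shows "\<bar>log_potential \<sigma> r z - log_potential \<sigma> r z'\<bar> \<le> cmod (z - z') / r"
proof -
  have "\<bar>log_potential \<sigma> r z - log_potential \<sigma> r z'\<bar> 
      = \<bar>\<integral>y. ln (max r (cmod (z - y))) - ln (max r (cmod (z' - y))) \<partial>\<sigma>\<bar>"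
    by (simp add: log_potential_def integrable_ln_max assms)
  also have "\<dots> \<le> (\<integral>y. \<bar>ln (max r (cmod (z - y))) - ln (max r (cmod (z' - y)))\<bar> \<partial>\<sigma>)"
    by (rule integral_abs_bound)
  also have "\<dots> \<le> (\<integral>y. cmod (z - z') / r \<partial>\<sigma>)"
  proof (intro integral_mono)
    fix y
    show "\<bar>ln (max r (cmod (z - y))) - ln (max r (cmod (z' - y)))\<bar> \<le> cmod (z - z') / r"
      using ln_max_lipschitz[OF assms, of "cmod (z - y)" "cmod (z' - y)"] norm_triangle_ineq3[of "z - y" "z' - y"] assms
      by (smt (verit) add_diff_cancel diff_add_cancel divide_right_mono minus_diff_eq  diff_diff_eq2 norm_minus_commute)
  qed (auto intro!: integrable_abs integrable_diff integrable_ln_max assms)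
  also have "\<dots> = cmod (z - z') / r" by (simp add: prob_space)
  finally show ?thesis .
qed

lemma continuous_log_potential:
  assumes "0 < r"
  shows "continuous_on A (log_potential \<sigma> r)"
proof (rule continuous_on_subset)
  have "(1/r)-lipschitz_on UNIV (log_potential \<sigma> r)"
    using log_potential_lipschitz[OF assms] assms
    by (intro lipschitz_onI) (auto simp: dist_real_def dist_norm)
  then show "continuous_on UNIV (log_potential \<sigma> r)" by (rule lipschitz_on_continuous_on)
qed simp

lemma measurable_log_potential [measurable]: "0 < r \<Longrightarrow> log_potential \<sigma> r \<in> borel_measurable borel"
  by (intro borel_measurable_continuous_onI continuous_log_potential)

lemma log_potential_mono:
  assumes "0 < r" "r \<le> s"
  shows "log_potential \<sigma> r z \<le> log_potential \<sigma> s z"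
  unfolding log_potential_def using assms
  by (intro integral_mono integrable_ln_max) (auto simp: le_max_iff_disj less_max_iff_disj intro!: ln_mono)

lemma log_potential_ge_ln:
  assumes "0 < r"
  shows "ln r \<le> log_potential \<sigma> r z"
proof -
  have "(\<integral>y. ln r \<partial>\<sigma>) \<le> log_potential \<sigma> r z"
    unfolding log_potential_def using assms
    by (intro integral_mono integrable_ln_max) (auto simp: le_max_iff_disj intro!: ln_mono)
  then show ?thesis by (simp add: prob_space)
qed

lemma log_potential_le:
  assumes "0 < r" "r \<le> D" "cmod z + R \<le> D"
  shows "log_potential \<sigma> r z \<le> ln D"
proof -
  have "log_potential \<sigma> r z \<le> (\<integral>y. ln D \<partial>\<sigma>)"
    unfolding log_potential_def
  proof (intro integral_mono_AE integrable_ln_max assms)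
    show "AE y in \<sigma>. ln (max r (cmod (z - y))) \<le> ln D"
      using AE_in_disc
    proof eventually_elim
      case (elim y)
      then show ?case using assms norm_triangle_ineq4[of z y]
        by (intro ln_mono) (auto simp: less_max_iff_disj)
    qed
  qed auto
  then show ?thesis by (simp add: prob_space)
qed

end

section \<open>Circle means\<close>

lemma nn_integral_inverse_norm_le':
  fixes y :: complex
  assumes "0 < \<rho>"
  shows "(\<integral>\<^sup>+ z. ennreal (if cmod (z - y) < \<rho> then 1 / cmod (z - y) else 0) \<partial>lborel) \<le> ennreal (16 * \<rho>)"
proof -
  have "(\<integral>\<^sup>+ z. ennreal (if cmod (z - y) < \<rho> then 1 / cmod (z - y) else 0) \<partial>lborel)
      = (\<integral>\<^sup>+ z. ennreal (indicator (ball y \<rho>) z / cmod (z - y)) \<partial>lborel)"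
    by (intro nn_integral_cong arg_cong[where f=ennreal]) (auto simp: indicator_def dist_norm norm_minus_commute)
  then show ?thesis using nn_integral_inverse_norm_le[OF assms, of y] by simp
qed

section \<open>Translation invariance and the uniform measure on circles\<close>

lemma AE_lborel_translate:
  fixes c :: complex
  assumes "AE z in lborel. P z"
  shows "AE z in lborel. P (z + c)"
proof -
  have "AE z in distr lborel borel ((+) c). P z"
    unfolding lborel_distr_plus by (rule assms)
  then have "AE z in lborel. P (c + z)"
    by (rule AE_distrD[rotated]) simp
  then show ?thesis by (simp add: add.commute)
qed

lemma nn_integral_lborel_translate:
  fixes c :: complex
  assumes [measurable]: "f \<in> borel_measurable borel"
  shows "(\<integral>\<^sup>+z. f (z + c) \<partial>lborel) = (\<integral>\<^sup>+z. f z \<partial>lborel)"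
proof -
  have "(\<integral>\<^sup>+z. f z \<partial>lborel) = (\<integral>\<^sup>+z. f z \<partial>distr lborel borel ((+) c))"
    by (simp add: lborel_distr_plus)
  also have "\<dots> = (\<integral>\<^sup>+z. f (c + z) \<partial>lborel)"
    by (subst nn_integral_distr) auto
  finally show ?thesis by (simp add: add.commute)
qed

text \<open>Normalised arc length, carried by the parameter t as a measure on the reals. Being a
  probability measure it enters product measures, so that circle means are exchanged with integrals
  over y and z by Tonelli and Fubini.\<close>

definition circ :: "real measure" where
  "circ = density lborel (\<lambda>t. ennreal (indicator {0..2*pi} t / (2 * pi)))"

lemma sets_circ [measurable_cong, simp]: "sets circ = sets borel"
  by (simp add: circ_def)

lemma space_circ [simp]: "space circ = UNIV"
  by (simp add: circ_def)

lemma nn_integral_circ: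
  assumes [measurable]: "f \<in> borel_measurable borel"
  shows "(\<integral>\<^sup>+t. f t \<partial>circ) = (\<integral>\<^sup>+t. ennreal (indicator {0..2*pi} t / (2 * pi)) * f t \<partial>lborel)"
  unfolding circ_def by (subst nn_integral_density) auto

lemma prob_space_circ: "prob_space circ"
proof
  have "emeasure circ (space circ) = (\<integral>\<^sup>+t. 1 \<partial>circ)" by simp
  also have "\<dots> = (\<integral>\<^sup>+t. ennreal (1 / (2 * pi)) * indicator {0..2*pi} t \<partial>lborel)"
    by (subst nn_integral_circ) (auto intro!: nn_integral_cong simp: indicator_def)
  also have "\<dots> = ennreal (1 / (2 * pi)) * ennreal (2 * pi)"
    by (subst nn_integral_cmult_indicator) auto
  also have "\<dots> = 1" by (simp add: ennreal_mult[symmetric])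
  finally show "emeasure circ (space circ) = 1" .
qed

interpretation circ: prob_space circ by (rule prob_space_circ)

lemma integrable_circ_bounded:
  fixes f :: "real \<Rightarrow> 'a :: {banach, second_countable_topology}"
  assumes "f \<in> borel_measurable borel" "\<And>t. norm (f t) \<le> B"
  shows "integrable circ f"
  using assms by (intro circ.integrable_const_bound[where B=B]) auto

lemma integrable_circ_continuous:
  fixes f :: "real \<Rightarrow> 'a :: {banach, second_countable_topology}"
  assumes "continuous_on UNIV f"
  shows "integrable circ f"
proof -
  have "compact (f ` {0..2*pi})"
    by (rule compact_continuous_image[OF continuous_on_subset[OF assms]]) auto
  then have "bounded (f ` {0..2*pi})" by (rule compact_imp_bounded)
  then obtain B where "\<forall>x\<in>f ` {0..2*pi}. norm x \<le> B"
    unfolding bounded_iff by auto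
  then have "AE t in circ. norm (f t) \<le> B"
    unfolding circ_def by (subst AE_density) (auto simp: indicator_def)
  then show ?thesis
    using borel_measurable_continuous_onI[OF assms] by (intro circ.integrable_const_bound) simp_all
qed

text \<open>Cauchy's integral formula on the circle: the denominator u - z cancels the factor r cis
  t in the derivative of the parametrisation, and only a factor i remains.\<close>

lemma circ_mean_holomorphic:
  fixes r R :: real
  assumes f: "f holomorphic_on ball z R" and r: "0 < r" "r < R"
  shows "(\<integral>t. f (z + r * cis t) \<partial>circ) = f z"
proof -
  have sub: "cball z r \<subseteq> ball z R" using r by auto
  have "((\<lambda>u. f u / (u - z)) has_contour_integral (2 * pi * \<i> * f z)) (circlepath z r)"
    using Cauchy_integral_circlepath_simple[OF holomorphic_on_subset[OF f sub], of z] r by simp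
  then have "((\<lambda>t. f (z + r * cis t) / (z + r * cis t - z) * r * \<i> * cis t) has_integral 2 * pi * \<i> * f z) {0..2*pi}"
    unfolding circlepath_def by (subst (asm) has_contour_integral_part_circlepath_iff) auto
  also have "(\<lambda>t. f (z + r * cis t) / (z + r * cis t - z) * r * \<i> * cis t) = (\<lambda>t. \<i> * f (z + r * cis t))"
    using r by (auto simp: fun_eq_iff)
  finally have "((\<lambda>t. (-\<i>) * (\<i> * f (z + r * cis t))) has_integral (-\<i>) * (2 * pi * \<i> * f z)) {0..2*pi}"
    by (rule has_integral_mult_right)
  then have "((\<lambda>t. f (z + r * cis t)) has_integral (-\<i>) * (2 * pi * \<i> * f z)) {0..2*pi}"
    by (rule has_integral_eq[rotated]) (simp only: minus_mult_left[symmetric] complex_i_mult_minus minus_minus)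
  moreover have "(-\<i>) * (2 * pi * \<i> * f z) = 2 * pi * f z" by (simp add: complex_eq_iff)
  ultimately have hk: "((\<lambda>t. f (z + r * cis t)) has_integral 2 * pi * f z) {0..2*pi}" by metis
  have in_ball: "z + r * cis t \<in> ball z R" for t
    using r by (auto simp: dist_norm norm_mult)
  have cont: "continuous_on UNIV (\<lambda>t. f (z + r * cis t))"
    using in_ball by (intro continuous_on_compose2[OF holomorphic_on_imp_continuous_on[OF f]] continuous_intros) auto
  have si: "set_integrable lborel {0..2*pi} (\<lambda>t. f (z + r * cis t))"
    by (intro borel_integrable_atLeastAtMost' continuous_on_subset[OF cont]) auto
  have "(\<integral>t. f (z + r * cis t) \<partial>circ) = (\<integral>t. (indicator {0..2*pi} t / (2 * pi)) *\<^sub>R f (z + r * cis t) \<partial>lborel)"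
    unfolding circ_def using borel_measurable_continuous_onI[OF cont]
    by (subst integral_density) (auto simp: indicator_def)
  also have "\<dots> = (\<integral>t. (1 / (2 * pi)) *\<^sub>R (indicator {0..2*pi} t *\<^sub>R f (z + r * cis t)) \<partial>lborel)"
    by (intro Bochner_Integration.integral_cong) (auto simp: indicator_def)
  also have "\<dots> = (1 / (2 * pi)) *\<^sub>R (LINT t:{0..2*pi}|lborel. f (z + r * cis t))"
    unfolding set_lebesgue_integral_def by (rule integral_scaleR_right)
  also have "(LINT t:{0..2*pi}|lborel. f (z + r * cis t)) = 2 * pi * f z"
    using set_borel_integral_eq_integral(2)[OF si] hk by (simp add: integral_unique)
  finally show ?thesis by (simp add: scaleR_conv_of_real)
qed

lemma ln_norm_one_plus:
  assumes "cmod w < 1"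
  shows "Re (Ln (1 + w)) = ln (cmod (1 + w))"
proof -
  have "1 + w \<noteq> 0" using assms by (metis add_eq_0_iff norm_minus_cancel norm_one less_irrefl)
  then show ?thesis by simp
qed

lemma holomorphic_Ln_one_plus:
  "(\<lambda>w. Ln (1 + a * w)) holomorphic_on {w. cmod (a * w) < 1}"
proof (intro holomorphic_intros)
  fix w assume "w \<in> {w. cmod (a * w) < 1}"
  then have "Re (1 + a * w) > 0" using abs_Re_le_cmod[of "a * w"] by simp
  then show "1 + a * w \<notin> \<real>\<^sub>\<le>\<^sub>0" by (auto simp: complex_nonpos_Reals_iff)
qed

text \<open>Since |a| < 1, the function Ln (1 + a w) is holomorphic on a disc of radius above 1 and
  vanishes at 0, so its mean over the unit circle is 0; the claim is the real part.\<close>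

lemma circ_mean_ln_one_plus:
  assumes "cmod a < 1"
  shows "(\<integral>t. ln (cmod (1 + a * cis t)) \<partial>circ) = 0"
proof -
  obtain \<rho> where \<rho>: "1 < \<rho>" "cmod a * \<rho> < 1"
  proof (cases "a = 0")
    case False
    have "1 < (1 / cmod a + 1) / 2" "cmod a * ((1 / cmod a + 1) / 2) < 1"
      using assms False by (auto simp: field_simps)
    then show ?thesis using that by blast
  qed (use that[of 2] in auto)
  have hol: "(\<lambda>w. Ln (1 + a * w)) holomorphic_on ball 0 \<rho>"
  proof (rule holomorphic_on_subset[OF holomorphic_Ln_one_plus])
    show "ball 0 \<rho> \<subseteq> {w. cmod (a * w) < 1}"
      using \<rho> by (auto simp: norm_mult) (metis less_eq_real_def mult_left_mono norm_ge_zero order_le_less_trans)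
  qed
  have 0: "(\<integral>t. Ln (1 + a * cis t) \<partial>circ) = 0"
    using circ_mean_holomorphic[OF hol, of 1] \<rho> by simp
  have int: "integrable circ (\<lambda>t. Ln (1 + a * cis t))"
    using assms by (intro integrable_circ_continuous continuous_on_compose2[OF holomorphic_on_imp_continuous_on[OF hol]] continuous_intros)
      (use \<rho> in auto)
  have "(\<integral>t. ln (cmod (1 + a * cis t)) \<partial>circ) = (\<integral>t. Re (Ln (1 + a * cis t)) \<partial>circ)"
    using assms by (intro Bochner_Integration.integral_cong refl ln_norm_one_plus[symmetric]) (simp add: norm_mult)
  also have "\<dots> = Re (\<integral>t. Ln (1 + a * cis t) \<partial>circ)"
    using int by (rule integral_Re)
  finally show ?thesis using 0 by simp
qed

text \<open>Jensen's formula for a single zero. The case |\<zeta>| = r, where the integrand is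
  unbounded, is left out; in the later integration over the plane it concerns a sphere, which is a
  null set.\<close>

lemma circ_mean_ln:
  assumes r: "0 < r" and ne: "cmod \<zeta> \<noteq> r"
  shows "integrable circ (\<lambda>t. ln (cmod (\<zeta> + r * cis t)))"
    and "(\<integral>t. ln (cmod (\<zeta> + r * cis t)) \<partial>circ) = ln (max r (cmod \<zeta>))"
proof -
  have nz: "\<zeta> + r * cis t \<noteq> 0" for t
  proof
    assume "\<zeta> + r * cis t = 0"
    then have "cmod \<zeta> = cmod (r * cis t)" by (metis add_eq_0_iff norm_minus_cancel)
    with ne r show False by (simp add: norm_mult)
  qed
  show "integrable circ (\<lambda>t. ln (cmod (\<zeta> + r * cis t)))"
    using nz by (intro integrable_circ_continuous continuous_intros) auto
  show "(\<integral>t. ln (cmod (\<zeta> + r * cis t)) \<partial>circ) = ln (max r (cmod \<zeta>))"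
  proof (cases "cmod \<zeta> < r")
    case True
    \<comment> \<open>A zero inside the circle is reflected: conjugation and multiplication by
      \<open>cis t\<close> keep the modulus and turn |\<zeta> + r cis t| into r |1 + a cis t| with
      |a| < 1.\<close>
    define a where "a = cnj \<zeta> / r"
    have a: "cmod a < 1" using True r by (simp add: a_def norm_divide)
    have eq: "ln (cmod (\<zeta> + r * cis t)) = ln r + ln (cmod (1 + a * cis t))" for t
    proof -
      have "cmod (\<zeta> + r * cis t) = cmod (cnj (\<zeta> + r * cis t) * cis t)"
        by (simp only: norm_mult complex_mod_cnj norm_cis mult_1_right)
      also have "cnj (\<zeta> + r * cis t) * cis t = r * (1 + a * cis t)"
      proof -
        have "cnj (cis t) * cis t = 1" by (simp add: cis_cnj cis_mult)
        then have "cnj (\<zeta> + r * cis t) * cis t = cnj \<zeta> * cis t + r" by (simp add: algebra_simps)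
        then show ?thesis using r by (simp add: a_def algebra_simps)
      qed
      also have "cmod \<dots> = r * cmod (1 + a * cis t)" using r by (simp add: norm_mult)
      finally have e: "cmod (\<zeta> + r * cis t) = r * cmod (1 + a * cis t)" .
      have "cmod (1 + a * cis t) \<noteq> 0" using e nz[of t] by (metis mult_zero_right norm_eq_zero)
      then show ?thesis using r e by (simp add: ln_mult)
    qed
    have "integrable circ (\<lambda>t. ln (cmod (1 + a * cis t)))"
    proof (intro integrable_circ_continuous continuous_intros ballI)
      fix t
      show "cmod (1 + a * cis t) \<noteq> 0"
        using a by (metis add_eq_0_iff norm_cis norm_eq_zero norm_minus_cancel norm_mult norm_one mult.right_neutral less_irrefl)
    qed
    then show ?thesis using r True a
      by (simp add: eq circ_mean_ln_one_plus max_def circ.prob_space[simplified])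
  next
    case False
    with ne r have gt: "r < cmod \<zeta>" by simp
    define a where "a = r / \<zeta>"
    have a: "cmod a < 1" using gt r by (simp add: a_def norm_divide divide_less_eq_1)
    have eq: "ln (cmod (\<zeta> + r * cis t)) = ln (cmod \<zeta>) + ln (cmod (1 + a * cis t))" for t
    proof -
      have "\<zeta> + r * cis t = \<zeta> * (1 + a * cis t)"
        using gt r by (auto simp: a_def algebra_simps)
      then have e: "cmod (\<zeta> + r * cis t) = cmod \<zeta> * cmod (1 + a * cis t)" by (simp add: norm_mult)
      have "cmod (1 + a * cis t) \<noteq> 0" using e nz[of t] by (metis mult_zero_right norm_eq_zero)
      moreover have "cmod \<zeta> \<noteq> 0" using gt r by linarith
      ultimately show ?thesis using e by (simp add: ln_mult)
    qed
    have "integrable circ (\<lambda>t. ln (cmod (1 + a * cis t)))"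
    proof (intro integrable_circ_continuous continuous_intros ballI)
      fix t
      show "cmod (1 + a * cis t) \<noteq> 0"
        using a by (metis add_eq_0_iff norm_cis norm_eq_zero norm_minus_cancel norm_mult norm_one mult.right_neutral less_irrefl)
    qed
    then show ?thesis using r gt a
      by (simp add: eq circ_mean_ln_one_plus max_def circ.prob_space[simplified])
  qed
qed

section \<open>Regular points and near potentials\<close>

context disc_prob
begin

interpretation pair: pair_sigma_finite lborel \<sigma> ..

lemma space_eq_UNIV [simp]: "space \<sigma> = UNIV"
  using sets_eq_imp_space_eq[OF sets_eq_borel] by simp

lemma measurable_potential [measurable]: "potential \<sigma> \<in> borel_measurable borel"
  unfolding potential_def by measurable

lemma measurable_cauchy [measurable]: "cauchy_transform \<sigma> \<in> borel_measurable borel"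
  unfolding cauchy_transform_def by measurable

lemma near_potential_eq: "near_potential \<sigma> t z = (\<integral>y. (if cmod (z - y) < t then 1 / cmod (z - y) else 0) \<partial>\<sigma>)"
  unfolding near_potential_def
  by (intro Bochner_Integration.integral_cong) (auto simp: indicator_def dist_norm norm_minus_commute)

lemma measurable_near_potential [measurable]: "near_potential \<sigma> t \<in> borel_measurable borel"
  unfolding near_potential_eq[abs_def] by measurable

text \<open>Tonelli, with the planar bound 16 t for each fixed \<open>y\<close>. For z in
  \<open>N\<close> only points y of \<open>A\<close> lie within t of z, so the total mass is
  replaced by \<open>measure \<sigma> A\<close>; this localisation later makes the error near a null
  component small.\<close>

lemma nn_integral_near_le:
  assumes t: "0 < t" and A [measurable]: "A \<in> sets borel" "N \<in> sets borel"
    and sub: "\<And>z. z \<in> N \<Longrightarrow> ball z t \<subseteq> A"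
  shows "(\<integral>\<^sup>+z. indicator N z * (\<integral>\<^sup>+y. ennreal (if cmod (z - y) < t then 1 / cmod (z - y) else 0) \<partial>\<sigma>) \<partial>lborel)
      \<le> ennreal (16 * t * measure \<sigma> A)"
proof -
  have "(\<integral>\<^sup>+z. indicator N z * (\<integral>\<^sup>+y. ennreal (if cmod (z - y) < t then 1 / cmod (z - y) else 0) \<partial>\<sigma>) \<partial>lborel)
     = (\<integral>\<^sup>+z. (\<integral>\<^sup>+y. indicator N z * ennreal (if cmod (z - y) < t then 1 / cmod (z - y) else 0) \<partial>\<sigma>) \<partial>lborel)"
    by (intro nn_integral_cong nn_integral_cmult[symmetric]) measurable
  also have "\<dots> = (\<integral>\<^sup>+y. (\<integral>\<^sup>+z. indicator N z * ennreal (if cmod (z - y) < t then 1 / cmod (z - y) else 0) \<partial>lborel) \<partial>\<sigma>)"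
    by (rule pair.Fubini'[symmetric]) measurable
  also have "\<dots> \<le> (\<integral>\<^sup>+y. ennreal (16 * t) * indicator A y \<partial>\<sigma>)"
  proof (intro nn_integral_mono)
    fix y
    have "(\<integral>\<^sup>+z. indicator N z * ennreal (if cmod (z - y) < t then 1 / cmod (z - y) else 0) \<partial>lborel)
       \<le> (\<integral>\<^sup>+z. indicator A y * ennreal (if cmod (z - y) < t then 1 / cmod (z - y) else 0) \<partial>lborel)"
    proof (intro nn_integral_mono)
      fix z
      show "indicator N z * ennreal (if cmod (z - y) < t then 1 / cmod (z - y) else 0)
        \<le> indicator A y * ennreal (if cmod (z - y) < t then 1 / cmod (z - y) else 0)"
      proof (cases "z \<in> N \<and> cmod (z - y) < t")
        case True
        then have "y \<in> ball z t" by (simp add: dist_norm)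
        then have "y \<in> A" using sub True by blast
        then show ?thesis using True by simp
      qed auto
    qed
    also have "\<dots> \<le> indicator A y * ennreal (16 * t)"
      by (subst nn_integral_cmult) (auto intro!: mult_left_mono nn_integral_inverse_norm_le' t)
    finally show "(\<integral>\<^sup>+z. indicator N z * ennreal (if cmod (z - y) < t then 1 / cmod (z - y) else 0) \<partial>lborel)
      \<le> ennreal (16 * t) * indicator A y" by (simp add: mult.commute)
  qed
  also have "\<dots> = ennreal (16 * t) * emeasure \<sigma> A"
    by (subst nn_integral_cmult_indicator) auto
  also have "\<dots> = ennreal (16 * t * measure \<sigma> A)"
    using t by (simp add: emeasure_eq_measure ennreal_mult)
  finally show ?thesis .
qed

text \<open>The near part has a finite area integral, so it is finite at almost every z, and the far
  part of 1 / |z - y| is at most 1. The diagonal y = z is null in the product because for fixed y it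
  is a single point z.\<close>

lemma AE_regular_point: "AE z in lborel. regular_point \<sigma> z"
proof -
  have "(\<integral>\<^sup>+z. (\<integral>\<^sup>+y. ennreal (if cmod (z - y) < 1 then 1 / cmod (z - y) else 0) \<partial>\<sigma>) \<partial>lborel) \<le> ennreal 16"
    using nn_integral_near_le[of 1 UNIV UNIV] prob_space by simp
  then have "AE z in lborel. (\<integral>\<^sup>+y. ennreal (if cmod (z - y) < 1 then 1 / cmod (z - y) else 0) \<partial>\<sigma>) \<noteq> \<infinity>"
    by (intro nn_integral_noteq_infinite) (auto simp: top_unique)
  moreover have "AE z in lborel. AE y in \<sigma>. y \<noteq> z"
  proof -
    have "{p \<in> space (lborel \<Otimes>\<^sub>M \<sigma>). snd p \<noteq> fst p} \<in> sets (lborel \<Otimes>\<^sub>M \<sigma>)" by measurable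
    then show ?thesis
      using pair.AE_commute[of "\<lambda>z y. y \<noteq> z"] AE_lborel_singleton by (auto simp: eq_commute)
  qed
  ultimately show ?thesis
  proof eventually_elim
    case (elim z)
    have "integrable \<sigma> (\<lambda>y. 1 + (if cmod (z - y) < 1 then 1 / cmod (z - y) else 0))"
    proof (intro Bochner_Integration.integrable_add integrableI_bounded)
      show "(\<integral>\<^sup>+y. ennreal (norm (if cmod (z - y) < 1 then 1 / cmod (z - y) else 0)) \<partial>\<sigma>) < \<infinity>"
        using elim(1) by (simp add: less_top if_distrib cong: if_cong)
    qed (auto simp: emeasure_space_1[simplified])
    then have "integrable \<sigma> (\<lambda>y. 1 / cmod (z - y))"
      by (rule Bochner_Integration.integrable_bound) (auto intro!: AE_I2 simp: divide_le_eq_1)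
    then show ?case using elim unfolding regular_point_def by auto
  qed
qed

lemma regular_point_integrable:
  assumes "regular_point \<sigma> z"
  shows "integrable \<sigma> (\<lambda>y. 1 / cmod (z - y))" "integrable \<sigma> (\<lambda>y. 1 / (z - y))"
    "integrable \<sigma> (\<lambda>y. ln (cmod (z - y)))"
    "integrable \<sigma> (\<lambda>y. if cmod (z - y) < t then 1 / cmod (z - y) else 0)"
    "AE y in \<sigma>. y \<noteq> z"
proof -
  show 1: "integrable \<sigma> (\<lambda>y. 1 / cmod (z - y))" and ne: "AE y in \<sigma>. y \<noteq> z"
    using assms unfolding regular_point_def by auto
  show "integrable \<sigma> (\<lambda>y. 1 / (z - y))"
    by (rule Bochner_Integration.integrable_bound[OF 1]) (auto simp: norm_divide)
  show "integrable \<sigma> (\<lambda>y. if cmod (z - y) < t then 1 / cmod (z - y) else 0)"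
    by (rule Bochner_Integration.integrable_bound[OF 1]) auto
  have "integrable \<sigma> (\<lambda>y. 1 / cmod (z - y) + (cmod z + R))" using 1 by auto
  then show "integrable \<sigma> (\<lambda>y. ln (cmod (z - y)))"
  proof (rule Bochner_Integration.integrable_bound)
    show "AE y in \<sigma>. norm (ln (cmod (z - y))) \<le> norm (1 / cmod (z - y) + (cmod z + R))"
      using AE_in_disc ne
    proof eventually_elim
      case (elim y)
      define d where "d = cmod (z - y)"
      have d: "0 < d" "d \<le> cmod z + R" using elim norm_triangle_ineq4[of z y] by (auto simp: d_def)
      \<comment> \<open>The same inequality, for d and for 1 / d, bounds the logarithm from above by
        d and from below by - 1 / d.\<close>
      have "ln d \<le> d" using d(1) by (rule ln_bound)
      moreover have "ln (1 / d) \<le> 1 / d" using d by (intro ln_bound) auto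
      ultimately have "\<bar>ln d\<bar> \<le> 1 / d + (cmod z + R)"
        using d by (auto simp: ln_div abs_le_iff intro: order_trans add_increasing add_increasing2)
      then show ?case unfolding d_def by simp
    qed
  qed auto
qed

lemma ennreal_near_potential:
  assumes "regular_point \<sigma> z"
  shows "ennreal (near_potential \<sigma> t z) = (\<integral>\<^sup>+y. ennreal (if cmod (z - y) < t then 1 / cmod (z - y) else 0) \<partial>\<sigma>)"
  unfolding near_potential_eq
  by (rule nn_integral_eq_integral[symmetric]) (auto intro: regular_point_integrable[OF assms])

lemma near_potential_nonneg: "0 \<le> near_potential \<sigma> t z"
  unfolding near_potential_eq by (intro Bochner_Integration.integral_nonneg) auto

lemma nn_integral_near_potential_le:
  assumes "0 < t" "A \<in> sets borel" "N \<in> sets borel" "\<And>z. z \<in> N \<Longrightarrow> ball z t \<subseteq> A"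
  shows "(\<integral>\<^sup>+z. indicator N z * ennreal (near_potential \<sigma> t z) \<partial>lborel) \<le> ennreal (16 * t * measure \<sigma> A)"
proof -
  have "(\<integral>\<^sup>+z. indicator N z * ennreal (near_potential \<sigma> t z) \<partial>lborel)
    = (\<integral>\<^sup>+z. indicator N z * (\<integral>\<^sup>+y. ennreal (if cmod (z - y) < t then 1 / cmod (z - y) else 0) \<partial>\<sigma>) \<partial>lborel)"
    using AE_regular_point by (intro nn_integral_cong_AE) (auto simp: ennreal_near_potential)
  then show ?thesis using nn_integral_near_le[OF assms] by simp
qed

lemma potential_le_log_potential:
  assumes "regular_point \<sigma> z" "0 < r"
  shows "potential \<sigma> z \<le> log_potential \<sigma> r z"
  unfolding potential_def log_potential_def
proof (intro integral_mono_AE integrable_ln_max regular_point_integrable(3) assms)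
  show "AE y in \<sigma>. ln (cmod (z - y)) \<le> ln (max r (cmod (z - y)))"
    using regular_point_integrable(5)[OF assms(1)]
    by eventually_elim (use assms in \<open>auto intro!: ln_mono\<close>)
qed

lemma log_potential_minus_potential_le:
  assumes "regular_point \<sigma> z" "0 < r"
  shows "log_potential \<sigma> r z - potential \<sigma> z \<le> r * near_potential \<sigma> r z"
proof -
  note i = integrable_ln_max[OF assms(2)] regular_point_integrable[OF assms(1)]
  have "log_potential \<sigma> r z - potential \<sigma> z = (\<integral>y. ln (max r (cmod (z - y))) - ln (cmod (z - y)) \<partial>\<sigma>)"
    unfolding potential_def log_potential_def using i by simp
  also have "\<dots> \<le> (\<integral>y. r * (if cmod (z - y) < r then 1 / cmod (z - y) else 0) \<partial>\<sigma>)"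
  proof (intro integral_mono_AE)
    show "AE y in \<sigma>. ln (max r (cmod (z - y))) - ln (cmod (z - y)) \<le> r * (if cmod (z - y) < r then 1 / cmod (z - y) else 0)"
      using i(6)
    proof eventually_elim
      case (elim y)
      then have "0 < cmod (z - y)" by simp
      from ln_max_diff_le[OF assms(2) this] show ?case by (auto split: if_splits)
    qed
  qed (use i in auto)
  finally show ?thesis by (simp add: near_potential_eq)
qed

end

lemma nn_integral_circ_ln:
  assumes r: "0 < r" and ne: "cmod \<zeta> \<noteq> r" and D: "cmod \<zeta> + r \<le> D"
  shows "(\<integral>\<^sup>+t. ennreal (ln D - ln (cmod (\<zeta> + r * cis t))) \<partial>circ) = ennreal (ln D - ln (max r (cmod \<zeta>)))"
proof -
  note m = circ_mean_ln[OF r ne]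
  have "(\<integral>\<^sup>+t. ennreal (ln D - ln (cmod (\<zeta> + r * cis t))) \<partial>circ)
      = ennreal (\<integral>t. ln D - ln (cmod (\<zeta> + r * cis t)) \<partial>circ)"
  proof (rule nn_integral_eq_integral)
    show "AE t in circ. 0 \<le> ln D - ln (cmod (\<zeta> + r * cis t))"
    proof (intro AE_I2)
      fix t
      have "\<zeta> + r * cis t \<noteq> 0"
      proof
        assume "\<zeta> + r * cis t = 0"
        then have "cmod \<zeta> = cmod (r * cis t)" by (metis add_eq_0_iff norm_minus_cancel)
        with ne r show False by (simp add: norm_mult)
      qed
      moreover have "cmod (\<zeta> + r * cis t) \<le> D"
        using norm_triangle_ineq[of \<zeta> "r * cis t"] D r by (simp add: norm_mult)
      ultimately show "0 \<le> ln D - ln (cmod (\<zeta> + r * cis t))" by (auto intro!: ln_mono)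
    qed
  qed (use m in auto)
  also have "(\<integral>t. ln D - ln (cmod (\<zeta> + r * cis t)) \<partial>circ) = ln D - ln (max r (cmod \<zeta>))"
    using m by (simp add: circ.prob_space[simplified])
  finally show ?thesis .
qed

text \<open>Negative reals are embedded as 0, so this is subadditivity of the positive part. It lets
  one-sided estimates run in \<open>ennreal\<close>.\<close>

lemma ennreal_add_le: "ennreal (a + b) \<le> ennreal a + ennreal b"
proof (cases "0 \<le> a \<and> 0 \<le> b")
  case False
  then have "ennreal (a + b) \<le> ennreal (max a b)" by (intro ennreal_leI) auto
  also have "\<dots> \<le> ennreal a + ennreal b" by (simp add: max_def)
  finally show ?thesis .
qed (simp add: ennreal_plus)

section \<open>Regularised potentials as averages, and their comparison\<close>

context disc_prob
begin

interpretation pair: pair_sigma_finite lborel \<sigma> ..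
interpretation pc: pair_sigma_finite lborel circ
  by (intro pair_sigma_finite.intro lborel.sigma_finite_measure_axioms circ.sigma_finite_measure_axioms)
interpretation cs: pair_sigma_finite circ \<sigma>
  by (intro pair_sigma_finite.intro circ.sigma_finite_measure_axioms sigma_finite_measure_axioms)

text \<open>Subtraction from \<open>ln D\<close> makes the kernel nonnegative on the relevant disc,
  so that Tonelli applies afterwards without integrability conditions.\<close>

lemma ennreal_ln_minus_log_potential:
  assumes "0 < r" "r \<le> D" "cmod z + R \<le> D"
  shows "ennreal (ln D - log_potential \<sigma> r z) = (\<integral>\<^sup>+y. ennreal (ln D - ln (max r (cmod (z - y)))) \<partial>\<sigma>)"
proof -
  have "(\<integral>\<^sup>+y. ennreal (ln D - ln (max r (cmod (z - y)))) \<partial>\<sigma>) = ennreal (\<integral>y. ln D - ln (max r (cmod (z - y))) \<partial>\<sigma>)"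
  proof (rule nn_integral_eq_integral)
    show "AE y in \<sigma>. 0 \<le> ln D - ln (max r (cmod (z - y)))"
      using AE_in_disc
    proof eventually_elim
      case (elim y)
      then show ?case using assms norm_triangle_ineq4[of z y]
        by (auto simp: less_max_iff_disj intro!: ln_mono)
    qed
  qed (use assms in \<open>auto intro!: integrable_ln_max\<close>)
  also have "(\<integral>y. ln D - ln (max r (cmod (z - y))) \<partial>\<sigma>) = ln D - log_potential \<sigma> r z"
    using integrable_ln_max[OF assms(1), of z] by (simp add: log_potential_def prob_space[simplified])
  finally show ?thesis ..
qed

lemma ennreal_ln_minus_potential:
  assumes "regular_point \<sigma> z" "cmod z + R \<le> D"
  shows "ennreal (ln D - potential \<sigma> z) = (\<integral>\<^sup>+y. ennreal (ln D - ln (cmod (z - y))) \<partial>\<sigma>)"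
proof -
  note i = regular_point_integrable[OF assms(1)]
  have "(\<integral>\<^sup>+y. ennreal (ln D - ln (cmod (z - y))) \<partial>\<sigma>) = ennreal (\<integral>y. ln D - ln (cmod (z - y)) \<partial>\<sigma>)"
  proof (rule nn_integral_eq_integral)
    show "AE y in \<sigma>. 0 \<le> ln D - ln (cmod (z - y))"
      using AE_in_disc i(5)
    proof eventually_elim
      case (elim y)
      then show ?case using assms norm_triangle_ineq4[of z y]
        by (auto intro!: ln_mono)
    qed
  qed (use i in auto)
  also have "(\<integral>y. ln D - ln (cmod (z - y)) \<partial>\<sigma>) = ln D - potential \<sigma> z"
    using i by (simp add: potential_def prob_space[simplified])
  finally show ?thesis ..
qed

text \<open>The regularised potential is the circle mean of the potential. The formula is stated
  after integration over \<open>B\<close>, because at a single z it would need the potential to be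
  regular along one particular circle. Integrated, the exceptions are null: the sphere |z - y| = r
  for each y, and the translates by - r cis t of the irregular points for each t.\<close>

lemma nn_integral_log_potential_mean:
  assumes r: "0 < r" and B [measurable]: "B \<in> sets borel" and B_sub: "B \<subseteq> cball 0 R'" and D: "R' + r + R \<le> D" "0 < D" "0 \<le> R'"
  shows "(\<integral>\<^sup>+z. indicator B z * ennreal (ln D - log_potential \<sigma> r z) \<partial>lborel)
    = (\<integral>\<^sup>+t. (\<integral>\<^sup>+z. indicator B z * ennreal (ln D - potential \<sigma> (z + r * cis t)) \<partial>lborel) \<partial>circ)"
proof -
  have [measurable]: "cis \<in> borel_measurable borel"
    by (intro borel_measurable_continuous_onI continuous_intros)
  have Bn: "cmod z \<le> R'" if "z \<in> B" for z using B_sub that by auto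
  have "(\<integral>\<^sup>+z. indicator B z * ennreal (ln D - log_potential \<sigma> r z) \<partial>lborel)
      = (\<integral>\<^sup>+z. (\<integral>\<^sup>+y. indicator B z * ennreal (ln D - ln (max r (cmod (z - y)))) \<partial>\<sigma>) \<partial>lborel)"
  proof (intro nn_integral_cong)
    fix z
    show "indicator B z * ennreal (ln D - log_potential \<sigma> r z)
       = (\<integral>\<^sup>+y. indicator B z * ennreal (ln D - ln (max r (cmod (z - y)))) \<partial>\<sigma>)"
      using ennreal_ln_minus_log_potential[of r D z] r D Bn[of z] R_nonneg
      by (cases "z \<in> B") auto
  qed
  also have "\<dots> = (\<integral>\<^sup>+y. (\<integral>\<^sup>+z. indicator B z * ennreal (ln D - ln (max r (cmod (z - y)))) \<partial>lborel) \<partial>\<sigma>)"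
    by (rule pair.Fubini'[symmetric]) measurable
  also have "\<dots> = (\<integral>\<^sup>+y. (\<integral>\<^sup>+z. (\<integral>\<^sup>+t. indicator B z * ennreal (ln D - ln (cmod (z + r * cis t - y))) \<partial>circ) \<partial>lborel) \<partial>\<sigma>)"
  proof (intro nn_integral_cong_AE)
    show "AE y in \<sigma>. (\<integral>\<^sup>+z. indicator B z * ennreal (ln D - ln (max r (cmod (z - y)))) \<partial>lborel)
        = (\<integral>\<^sup>+z. (\<integral>\<^sup>+t. indicator B z * ennreal (ln D - ln (cmod (z + r * cis t - y))) \<partial>circ) \<partial>lborel)"
      using AE_in_disc
    proof eventually_elim
      case (elim y)
      have "negligible (sphere y r)" by (rule negligible_sphere)
      then have "AE z in lebesgue. z \<notin> sphere y r"
        using AE_not_in negligible_iff_null_sets by blast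
      then have ae: "AE z in lborel. z \<notin> sphere y r"
        by (simp add: AE_completion_iff)
      show ?case
      proof (intro nn_integral_cong_AE)
        show "AE z in lborel. indicator B z * ennreal (ln D - ln (max r (cmod (z - y))))
          = (\<integral>\<^sup>+t. indicator B z * ennreal (ln D - ln (cmod (z + r * cis t - y))) \<partial>circ)"
          using ae
        proof eventually_elim
          case (elim z)
          show ?case
          proof (cases "z \<in> B")
            case True
            have "cmod (z - y) \<noteq> r" using elim by (auto simp: dist_norm norm_minus_commute)
            moreover have "cmod (z - y) + r \<le> D"
              using Bn[OF True] \<open>cmod y \<le> R\<close> D norm_triangle_ineq4[of z y] by linarith
            ultimately have "(\<integral>\<^sup>+t. ennreal (ln D - ln (cmod (z - y + r * cis t))) \<partial>circ) = ennreal (ln D - ln (max r (cmod (z - y))))"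
              by (rule nn_integral_circ_ln[OF r])
            then show ?thesis using True by (simp add: algebra_simps)
          qed auto
        qed
      qed
    qed
  qed
  also have "\<dots> = (\<integral>\<^sup>+y. (\<integral>\<^sup>+t. (\<integral>\<^sup>+z. indicator B z * ennreal (ln D - ln (cmod (z + r * cis t - y))) \<partial>lborel) \<partial>circ) \<partial>\<sigma>)"
    by (intro nn_integral_cong pc.Fubini'[symmetric]) measurable
  also have "\<dots> = (\<integral>\<^sup>+t. (\<integral>\<^sup>+y. (\<integral>\<^sup>+z. indicator B z * ennreal (ln D - ln (cmod (z + r * cis t - y))) \<partial>lborel) \<partial>\<sigma>) \<partial>circ)"
    by (rule cs.Fubini') measurable
  also have "\<dots> = (\<integral>\<^sup>+t. (\<integral>\<^sup>+z. (\<integral>\<^sup>+y. indicator B z * ennreal (ln D - ln (cmod (z + r * cis t - y))) \<partial>\<sigma>) \<partial>lborel) \<partial>circ)"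
    by (intro nn_integral_cong pair.Fubini') measurable
  also have "\<dots> = (\<integral>\<^sup>+t. (\<integral>\<^sup>+z. indicator B z * ennreal (ln D - potential \<sigma> (z + r * cis t)) \<partial>lborel) \<partial>circ)"
  proof (rule nn_integral_cong, rule nn_integral_cong_AE)
    fix t
    show "AE z in lborel. (\<integral>\<^sup>+y. indicator B z * ennreal (ln D - ln (cmod (z + r * cis t - y))) \<partial>\<sigma>)
       = indicator B z * ennreal (ln D - potential \<sigma> (z + r * cis t))"
      using AE_lborel_translate[OF AE_regular_point, of "r * cis t"]
    proof eventually_elim
      case (elim z)
      show ?case
      proof (cases "z \<in> B")
        case True
        have "cmod (z + r * cis t) + R \<le> D"
          using Bn[OF True] D r norm_triangle_ineq[of z "r * cis t"] by (simp add: norm_mult)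
        from ennreal_ln_minus_potential[OF elim this] show ?thesis using True by simp
      qed auto
    qed
  qed
  finally show ?thesis .
qed

text \<open>The mean value formula is averaged over a tiny disc about x: for each t almost every
  translated point obeys the bound, and the Lipschitz estimate brings the average back to x with
  error \<open>e\<close>. In this way an almost everywhere bound on the potential becomes a bound at
  every point.\<close>

lemma log_potential_le_of_AE:
  assumes ae: "AE z in lborel. z \<in> ball x \<rho> \<longrightarrow> potential \<sigma> z \<le> \<kappa>" and r: "0 < r" "r < \<rho>"
  shows "log_potential \<sigma> r x \<le> \<kappa>"
proof (rule field_le_epsilon)
  fix e :: real assume e: "0 < e"
  \<comment> \<open>\<eta> + r <= \<rho> keeps all circles inside the ball, and \<eta> <= e r makes
    the oscillation of \<open>log_potential \<sigma> r\<close> over the tiny disc at most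
    \<open>e\<close>.\<close>
  define \<eta> where "\<eta> = min (\<rho> - r) (e * r)"
  have \<eta>: "0 < \<eta>" "\<eta> + r \<le> \<rho>" "\<eta> \<le> e * r" using r e by (auto simp: \<eta>_def)
  define R' where "R' = cmod x + \<eta>"
  \<comment> \<open>The exponential keeps the two differences compared at the end nonnegative, so
    that nothing is lost in \<open>ennreal\<close>; the other entry makes \<open>D\<close>
    admissible in the mean value formula.\<close>
  define D where "D = max (exp (max \<kappa> (log_potential \<sigma> r x))) (R' + r + R)"
  have D0: "0 < D" unfolding D_def by (simp add: less_max_iff_disj)
  have R': "0 \<le> R'" using \<eta> by (simp add: R'_def)
  have "ln (exp (max \<kappa> (log_potential \<sigma> r x))) \<le> ln D" using D0 by (intro ln_mono) (auto simp: D_def)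
  then have lnD: "\<kappa> \<le> ln D" "log_potential \<sigma> r x \<le> ln D" by auto
  have sub: "ball x \<eta> \<subseteq> cball 0 R'"
  proof
    fix z assume "z \<in> ball x \<eta>"
    then show "z \<in> cball 0 R'" using norm_triangle_ineq2[of z x] by (simp add: R'_def dist_norm norm_minus_commute)
  qed
  have vol: "emeasure lborel (ball x \<eta>) = ennreal (pi * \<eta>\<^sup>2)" using \<eta> by (simp add: emeasure_lborel_ball_complex)
  have "ennreal (ln D - \<kappa>) * ennreal (pi * \<eta>\<^sup>2) = (\<integral>\<^sup>+t. (\<integral>\<^sup>+z. ennreal (ln D - \<kappa>) * indicator (ball x \<eta>) z \<partial>lborel) \<partial>circ)"
    by (simp add: vol nn_integral_cmult_indicator circ.emeasure_space_1[simplified])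
  also have "\<dots> \<le> (\<integral>\<^sup>+t. (\<integral>\<^sup>+z. indicator (ball x \<eta>) z * ennreal (ln D - potential \<sigma> (z + r * cis t)) \<partial>lborel) \<partial>circ)"
  proof (rule nn_integral_mono, rule nn_integral_mono_AE)
    fix t
    show "AE z in lborel. ennreal (ln D - \<kappa>) * indicator (ball x \<eta>) z \<le> indicator (ball x \<eta>) z * ennreal (ln D - potential \<sigma> (z + r * cis t))"
      using AE_lborel_translate[OF ae, of "r * cis t"]
    proof eventually_elim
      case (elim z)
      show ?case
      proof (cases "z \<in> ball x \<eta>")
        case True
        then have "cmod (z + r * cis t - x) < \<rho>"
          using norm_triangle_ineq[of "z - x" "r * cis t"] \<eta> r
          by (simp add: dist_norm norm_mult norm_minus_commute algebra_simps)
        then show ?thesis using elim True by (auto simp: dist_norm norm_minus_commute intro!: ennreal_leI)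
      qed auto
    qed
  qed
  also have "\<dots> = (\<integral>\<^sup>+z. indicator (ball x \<eta>) z * ennreal (ln D - log_potential \<sigma> r z) \<partial>lborel)"
    by (rule nn_integral_log_potential_mean[symmetric]) (use r sub D0 R' in \<open>auto simp: D_def\<close>)
  also have "\<dots> \<le> (\<integral>\<^sup>+z. ennreal (ln D - log_potential \<sigma> r x + e) * indicator (ball x \<eta>) z \<partial>lborel)"
  proof (intro nn_integral_mono)
    fix z
    show "indicator (ball x \<eta>) z * ennreal (ln D - log_potential \<sigma> r z) \<le> ennreal (ln D - log_potential \<sigma> r x + e) * indicator (ball x \<eta>) z"
    proof (cases "z \<in> ball x \<eta>")
      case True
      have "\<bar>log_potential \<sigma> r x - log_potential \<sigma> r z\<bar> \<le> cmod (x - z) / r" by (rule log_potential_lipschitz[OF r(1)])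
      also have "\<dots> \<le> e" using True \<eta>(3) r by (auto simp: dist_norm field_simps)
      finally show ?thesis using True by (auto intro!: ennreal_leI)
    qed auto
  qed
  also have "\<dots> = ennreal (ln D - log_potential \<sigma> r x + e) * ennreal (pi * \<eta>\<^sup>2)"
    by (simp add: vol nn_integral_cmult_indicator)
  finally have "ennreal ((ln D - \<kappa>) * (pi * \<eta>\<^sup>2)) \<le> ennreal ((ln D - log_potential \<sigma> r x + e) * (pi * \<eta>\<^sup>2))"
    using lnD e by (simp add: ennreal_mult)
  then have "(ln D - \<kappa>) * (pi * \<eta>\<^sup>2) \<le> (ln D - log_potential \<sigma> r x + e) * (pi * \<eta>\<^sup>2)"
    using lnD e by (subst (asm) ennreal_le_iff) auto
  then show "log_potential \<sigma> r x \<le> \<kappa> + e" using \<eta> by (simp add: mult_le_cancel_right)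
qed

lemma log_potential_ge_of_AE:
  assumes ae: "AE z in lborel. z \<in> ball x \<rho> \<longrightarrow> \<kappa> \<le> potential \<sigma> z" and r: "0 < r" "r < \<rho>"
  shows "\<kappa> \<le> log_potential \<sigma> r x"
proof (rule field_le_epsilon)
  fix e :: real assume e: "0 < e"
  define \<eta> where "\<eta> = min (\<rho> - r) (e * r)"
  have \<eta>: "0 < \<eta>" "\<eta> + r \<le> \<rho>" "\<eta> \<le> e * r" using r e by (auto simp: \<eta>_def)
  define R' where "R' = cmod x + \<eta>"
  define D where "D = max (exp (max \<kappa> (log_potential \<sigma> r x + e))) (R' + r + R)"
  have D0: "0 < D" unfolding D_def by (simp add: less_max_iff_disj)
  have R': "0 \<le> R'" using \<eta> by (simp add: R'_def)
  have "ln (exp (max \<kappa> (log_potential \<sigma> r x + e))) \<le> ln D" using D0 by (intro ln_mono) (auto simp: D_def)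
  then have lnD: "\<kappa> \<le> ln D" "log_potential \<sigma> r x + e \<le> ln D" by auto
  have sub: "ball x \<eta> \<subseteq> cball 0 R'"
  proof
    fix z assume "z \<in> ball x \<eta>"
    then show "z \<in> cball 0 R'" using norm_triangle_ineq2[of z x] by (simp add: R'_def dist_norm norm_minus_commute)
  qed
  have vol: "emeasure lborel (ball x \<eta>) = ennreal (pi * \<eta>\<^sup>2)" using \<eta> by (simp add: emeasure_lborel_ball_complex)
  have "ennreal (ln D - log_potential \<sigma> r x - e) * ennreal (pi * \<eta>\<^sup>2) = (\<integral>\<^sup>+z. ennreal (ln D - log_potential \<sigma> r x - e) * indicator (ball x \<eta>) z \<partial>lborel)"
    by (simp add: vol nn_integral_cmult_indicator)
  also have "\<dots> \<le> (\<integral>\<^sup>+z. indicator (ball x \<eta>) z * ennreal (ln D - log_potential \<sigma> r z) \<partial>lborel)"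
  proof (intro nn_integral_mono)
    fix z
    show "ennreal (ln D - log_potential \<sigma> r x - e) * indicator (ball x \<eta>) z \<le> indicator (ball x \<eta>) z * ennreal (ln D - log_potential \<sigma> r z)"
    proof (cases "z \<in> ball x \<eta>")
      case True
      have "\<bar>log_potential \<sigma> r x - log_potential \<sigma> r z\<bar> \<le> cmod (x - z) / r" by (rule log_potential_lipschitz[OF r(1)])
      also have "\<dots> \<le> e" using True \<eta>(3) r by (auto simp: dist_norm field_simps)
      finally show ?thesis using True by (auto intro!: ennreal_leI)
    qed auto
  qed
  also have "\<dots> = (\<integral>\<^sup>+t. (\<integral>\<^sup>+z. indicator (ball x \<eta>) z * ennreal (ln D - potential \<sigma> (z + r * cis t)) \<partial>lborel) \<partial>circ)"
    by (rule nn_integral_log_potential_mean) (use r sub D0 R' in \<open>auto simp: D_def\<close>)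
  also have "\<dots> \<le> (\<integral>\<^sup>+t. (\<integral>\<^sup>+z. ennreal (ln D - \<kappa>) * indicator (ball x \<eta>) z \<partial>lborel) \<partial>circ)"
  proof (rule nn_integral_mono, rule nn_integral_mono_AE)
    fix t
    show "AE z in lborel. indicator (ball x \<eta>) z * ennreal (ln D - potential \<sigma> (z + r * cis t)) \<le> ennreal (ln D - \<kappa>) * indicator (ball x \<eta>) z"
      using AE_lborel_translate[OF ae, of "r * cis t"]
    proof eventually_elim
      case (elim z)
      show ?case
      proof (cases "z \<in> ball x \<eta>")
        case True
        then have "cmod (z + r * cis t - x) < \<rho>"
          using norm_triangle_ineq[of "z - x" "r * cis t"] \<eta> r
          by (simp add: dist_norm norm_mult norm_minus_commute algebra_simps)
        then show ?thesis using elim True by (auto simp: dist_norm norm_minus_commute intro!: ennreal_leI)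
      qed auto
    qed
  qed
  also have "\<dots> = ennreal (ln D - \<kappa>) * ennreal (pi * \<eta>\<^sup>2)"
    by (simp add: vol nn_integral_cmult_indicator circ.emeasure_space_1[simplified])
  finally have "ennreal ((ln D - log_potential \<sigma> r x - e) * (pi * \<eta>\<^sup>2)) \<le> ennreal ((ln D - \<kappa>) * (pi * \<eta>\<^sup>2))"
    using lnD e by (simp add: ennreal_mult)
  then have "(ln D - log_potential \<sigma> r x - e) * (pi * \<eta>\<^sup>2) \<le> (ln D - \<kappa>) * (pi * \<eta>\<^sup>2)"
    using lnD e by (subst (asm) ennreal_le_iff) auto
  then show "\<kappa> \<le> log_potential \<sigma> r x + e" using \<eta> by (simp add: mult_le_cancel_right)
qed

end

text \<open>Turns an L1 bound on the positive part of a difference of potentials, majorised by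
  \<open>e\<close>, into a pointwise bound on the regularised potentials. Averaging over
  \<open>ball x \<eta>\<close> costs \<epsilon> divided by the area of the ball, and moving from z
  to x costs \<eta> / r for each of the two potentials.\<close>

lemma log_potential_compare:
  assumes s: "disc_prob \<sigma> R" and t: "disc_prob \<tau> R"
    and r: "0 < r" and \<eta>: "0 < \<eta>" and x: "cmod x + \<eta> + r \<le> R1"
    and e [measurable]: "e \<in> borel_measurable borel"
    and ae: "AE z in lborel. z \<in> cball 0 R1 \<longrightarrow> ennreal (potential \<sigma> z - potential \<tau> z) \<le> e z"
    and le: "(\<integral>\<^sup>+z. indicator (cball 0 R1) z * e z \<partial>lborel) \<le> ennreal \<epsilon>" and \<epsilon>: "0 \<le> \<epsilon>"
  shows "log_potential \<sigma> r x - log_potential \<tau> r x \<le> 2 * \<eta> / r + \<epsilon> / (pi * \<eta>\<^sup>2)"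
proof -
  interpret s: disc_prob \<sigma> R by fact
  interpret t: disc_prob \<tau> R by fact
  have [measurable]: "cis \<in> borel_measurable borel"
    by (intro borel_measurable_continuous_onI continuous_intros)
  define R' where "R' = cmod x + \<eta>"
  have R': "0 \<le> R'" using \<eta> by (simp add: R'_def)
  define D where "D = R' + r + R"
  have D0: "0 < D" using R' r s.R_nonneg by (simp add: D_def)
  have sub: "ball x \<eta> \<subseteq> cball 0 R'"
  proof
    fix z assume "z \<in> ball x \<eta>"
    then show "z \<in> cball 0 R'" using norm_triangle_ineq2[of z x] by (simp add: R'_def dist_norm norm_minus_commute)
  qed
  have lnD: "log_potential \<sigma> r x \<le> ln D" 
    by (rule s.log_potential_le) (use r R' s.R_nonneg \<eta> in \<open>auto simp: D_def R'_def\<close>)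
  have vol: "emeasure lborel (ball x \<eta>) = ennreal (pi * \<eta>\<^sup>2)" using \<eta> by (simp add: emeasure_lborel_ball_complex)
  have er: "0 \<le> \<eta> / r" using \<eta> r by simp
  have osc: "cmod (x - z) / r \<le> \<eta> / r" if "z \<in> ball x \<eta>" for z
    using that r by (auto simp: dist_norm intro!: divide_right_mono)
  have "ennreal (ln D - log_potential \<tau> r x - \<eta> / r) * ennreal (pi * \<eta>\<^sup>2) = (\<integral>\<^sup>+z. ennreal (ln D - log_potential \<tau> r x - \<eta> / r) * indicator (ball x \<eta>) z \<partial>lborel)"
    by (simp add: vol nn_integral_cmult_indicator)
  also have "\<dots> \<le> (\<integral>\<^sup>+z. indicator (ball x \<eta>) z * ennreal (ln D - log_potential \<tau> r z) \<partial>lborel)"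
  proof (intro nn_integral_mono)
    fix z
    show "ennreal (ln D - log_potential \<tau> r x - \<eta> / r) * indicator (ball x \<eta>) z \<le> indicator (ball x \<eta>) z * ennreal (ln D - log_potential \<tau> r z)"
      using t.log_potential_lipschitz[OF r(1), of x z] osc[of z]
      by (cases "z \<in> ball x \<eta>") (auto intro!: ennreal_leI)
  qed
  also have "\<dots> = (\<integral>\<^sup>+t. (\<integral>\<^sup>+z. indicator (ball x \<eta>) z * ennreal (ln D - potential \<tau> (z + r * cis t)) \<partial>lborel) \<partial>circ)"
    by (rule t.nn_integral_log_potential_mean) (use r sub D0 R' in \<open>auto simp: D_def\<close>)
  also have "\<dots> \<le> (\<integral>\<^sup>+t. (\<integral>\<^sup>+z. indicator (ball x \<eta>) z * ennreal (ln D - potential \<sigma> (z + r * cis t)) \<partial>lborel) + ennreal \<epsilon> \<partial>circ)"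
  proof (intro nn_integral_mono)
    fix t
    have "(\<integral>\<^sup>+z. indicator (ball x \<eta>) z * ennreal (ln D - potential \<tau> (z + r * cis t)) \<partial>lborel)
      \<le> (\<integral>\<^sup>+z. indicator (ball x \<eta>) z * ennreal (ln D - potential \<sigma> (z + r * cis t)) 
          + indicator (cball 0 R1) (z + r * cis t) * e (z + r * cis t) \<partial>lborel)"
    proof (intro nn_integral_mono_AE)
      show "AE z in lborel. indicator (ball x \<eta>) z * ennreal (ln D - potential \<tau> (z + r * cis t))
        \<le> indicator (ball x \<eta>) z * ennreal (ln D - potential \<sigma> (z + r * cis t)) 
          + indicator (cball 0 R1) (z + r * cis t) * e (z + r * cis t)"
        using AE_lborel_translate[OF ae, of "r * cis t"] 
      proof eventually_elim
        case (elim z)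
        show ?case
        proof (cases "z \<in> ball x \<eta>")
          case True
          then have "cmod z \<le> R'" using sub by auto
          then have in_b: "z + r * cis t \<in> cball 0 R1"
            using norm_triangle_ineq[of z "r * cis t"] x r by (simp add: norm_mult R'_def)
          have "ln D - potential \<tau> (z + r * cis t) = (ln D - potential \<sigma> (z + r * cis t)) + (potential \<sigma> (z + r * cis t) - potential \<tau> (z + r * cis t))" by simp
          then have "ennreal (ln D - potential \<tau> (z + r * cis t)) \<le> ennreal (ln D - potential \<sigma> (z + r * cis t)) + ennreal (potential \<sigma> (z + r * cis t) - potential \<tau> (z + r * cis t))"
            by (metis ennreal_add_le)
          also have "\<dots> \<le> ennreal (ln D - potential \<sigma> (z + r * cis t)) + e (z + r * cis t)"
            using elim in_b by (intro add_left_mono) auto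
          finally show ?thesis using True in_b by simp
        qed auto
      qed
    qed
    also have "\<dots> = (\<integral>\<^sup>+z. indicator (ball x \<eta>) z * ennreal (ln D - potential \<sigma> (z + r * cis t)) \<partial>lborel)
          + (\<integral>\<^sup>+z. indicator (cball 0 R1) (z + r * cis t) * e (z + r * cis t) \<partial>lborel)"
    proof (rule nn_integral_add)
      have [measurable]: "ball x \<eta> \<in> sets borel" "cball 0 R1 \<in> sets (borel :: complex measure)" by auto
      show "(\<lambda>z. indicator (ball x \<eta>) z * ennreal (ln D - potential \<sigma> (z + r * cis t))) \<in> borel_measurable lborel"
        by measurable
      show "(\<lambda>z. indicator (cball 0 R1) (z + r * cis t) * e (z + r * cis t)) \<in> borel_measurable lborel"
        by measurable
    qed
    also have "(\<integral>\<^sup>+z. indicator (cball 0 R1) (z + r * cis t) * e (z + r * cis t) \<partial>lborel) = (\<integral>\<^sup>+z. indicator (cball 0 R1) z * e z \<partial>lborel)"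
      by (rule nn_integral_lborel_translate) (intro borel_measurable_times_ennreal borel_measurable_indicator e; simp)
    finally show "(\<integral>\<^sup>+z. indicator (ball x \<eta>) z * ennreal (ln D - potential \<tau> (z + r * cis t)) \<partial>lborel)
      \<le> (\<integral>\<^sup>+z. indicator (ball x \<eta>) z * ennreal (ln D - potential \<sigma> (z + r * cis t)) \<partial>lborel) + ennreal \<epsilon>"
      using le by (meson add_left_mono order_trans)
  qed
  also have "\<dots> = (\<integral>\<^sup>+t. (\<integral>\<^sup>+z. indicator (ball x \<eta>) z * ennreal (ln D - potential \<sigma> (z + r * cis t)) \<partial>lborel) \<partial>circ) + ennreal \<epsilon>"
  proof -
    have [measurable]: "ball x \<eta> \<in> sets borel" by auto
    have "(\<lambda>t. \<integral>\<^sup>+z. indicator (ball x \<eta>) z * ennreal (ln D - potential \<sigma> (z + r * cis t)) \<partial>lborel) \<in> borel_measurable circ"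
      by measurable
    then show ?thesis by (subst nn_integral_add) (simp_all add: circ.emeasure_space_1[simplified])
  qed
  also have "(\<integral>\<^sup>+t. (\<integral>\<^sup>+z. indicator (ball x \<eta>) z * ennreal (ln D - potential \<sigma> (z + r * cis t)) \<partial>lborel) \<partial>circ)
     = (\<integral>\<^sup>+z. indicator (ball x \<eta>) z * ennreal (ln D - log_potential \<sigma> r z) \<partial>lborel)"
    by (rule s.nn_integral_log_potential_mean[symmetric]) (use r sub D0 R' in \<open>auto simp: D_def\<close>)
  also have "(\<integral>\<^sup>+z. indicator (ball x \<eta>) z * ennreal (ln D - log_potential \<sigma> r z) \<partial>lborel)
     \<le> (\<integral>\<^sup>+z. ennreal (ln D - log_potential \<sigma> r x + \<eta> / r) * indicator (ball x \<eta>) z \<partial>lborel)"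
  proof (intro nn_integral_mono)
    fix z
    show "indicator (ball x \<eta>) z * ennreal (ln D - log_potential \<sigma> r z) \<le> ennreal (ln D - log_potential \<sigma> r x + \<eta> / r) * indicator (ball x \<eta>) z"
      using s.log_potential_lipschitz[OF r(1), of x z] osc[of z]
      by (cases "z \<in> ball x \<eta>") (auto intro!: ennreal_leI)
  qed
  also have "\<dots> = ennreal (ln D - log_potential \<sigma> r x + \<eta> / r) * ennreal (pi * \<eta>\<^sup>2)"
    by (simp add: vol nn_integral_cmult_indicator)
  finally have *: "ennreal (ln D - log_potential \<tau> r x - \<eta> / r) * ennreal (pi * \<eta>\<^sup>2)
      \<le> ennreal (ln D - log_potential \<sigma> r x + \<eta> / r) * ennreal (pi * \<eta>\<^sup>2) + ennreal \<epsilon>"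
    by (simp add: add_right_mono)
  define a where "a = ln D - log_potential \<tau> r x - \<eta> / r"
  define b where "b = ln D - log_potential \<sigma> r x + \<eta> / r"
  define c where "c = pi * \<eta>\<^sup>2"
  have b: "0 \<le> b" using lnD er by (simp add: b_def)
  have c: "0 < c" using \<eta> by (simp add: c_def)
  have "a * c \<le> b * c + \<epsilon>"
  proof (cases "0 \<le> a")
    case True
    have "ennreal (a * c) \<le> ennreal (b * c + \<epsilon>)"
      using * True b c \<epsilon> by (simp add: a_def[symmetric] b_def[symmetric] c_def[symmetric] ennreal_mult ennreal_plus)
    then show ?thesis using b c \<epsilon> by (subst (asm) ennreal_le_iff) auto
  next
    case False
    then have "a * c \<le> 0" using c by (simp add: mult_nonpos_nonneg)
    also have "0 \<le> b * c + \<epsilon>" using b c \<epsilon> by simp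
    finally show ?thesis .
  qed
  then have "a \<le> b + \<epsilon> / c" using c by (simp add: field_simps)
  then show ?thesis by (simp add: a_def b_def c_def)
qed

section \<open>Convergence of potentials\<close>

lemma (in disc_prob) integrable_continuous_fun:
  fixes f :: "complex \<Rightarrow> 'b :: {banach, second_countable_topology}"
  assumes f: "continuous_on UNIV f"
  shows "integrable \<sigma> f"
proof -
  have "compact (f ` cball 0 R)"
    by (rule compact_continuous_image[OF continuous_on_subset[OF f]]) auto
  then have "bounded (f ` cball 0 R)" by (rule compact_imp_bounded)
  then obtain B where B: "\<forall>x\<in>f ` cball 0 R. norm x \<le> B"
    unfolding bounded_iff by auto
  have "AE y in \<sigma>. norm (f y) \<le> B"
    using AE_in_disc by eventually_elim (use B in auto)
  then show ?thesis
    using borel_measurable_continuous_onI[OF f] sets_eq_borel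
    by (intro integrable_const_bound) (simp_all cong: measurable_cong_sets)
qed

locale disc_conv =
  fixes \<sigma> :: "nat \<Rightarrow> complex measure" and \<mu> :: "complex measure" and R :: real
  assumes disc_k: "\<And>k. disc_prob (\<sigma> k) R" and disc_lim: "disc_prob \<mu> R"
    and weak_conv: "weak_star_conv \<sigma> \<mu>"
begin

sublocale lim: disc_prob \<mu> R by (rule disc_lim)

text \<open>A cutoff equal to 1 on the disc changes no integral, so convergence for compactly
  supported test functions extends to all continuous ones.\<close>

lemma tendsto_integral_real:
  fixes f :: "complex \<Rightarrow> real"
  assumes f: "continuous_on UNIV f"
  shows "(\<lambda>k. integral\<^sup>L (\<sigma> k) f) \<longlonglongrightarrow> integral\<^sup>L \<mu> f"
proof -
  define cut where "cut z = max 0 (min 1 (R + 1 - cmod z))" for z :: complex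
  define g where "g z = cut z * f z" for z
  have g: "continuous_on UNIV g"
    unfolding g_def cut_def by (intro continuous_intros f)
  have "{z. g z \<noteq> 0} \<subseteq> cball 0 (R + 1)" by (auto simp: g_def cut_def max_def min_def split: if_splits)
  then have "closure {z. g z \<noteq> 0} \<subseteq> cball 0 (R + 1)" by (rule closure_minimal) auto
  then have "compact (closure {z. g z \<noteq> 0})"
    by (meson bounded_cball bounded_subset closed_closure compact_eq_bounded_closed)
  then have "(\<lambda>k. integral\<^sup>L (\<sigma> k) g) \<longlonglongrightarrow> integral\<^sup>L \<mu> g"
    using weak_conv g unfolding weak_star_conv_def by blast
  moreover have "integral\<^sup>L \<nu> g = integral\<^sup>L \<nu> f" if "disc_prob \<nu> R" for \<nu>
  proof -
    interpret n: disc_prob \<nu> R by fact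
    have "AE y in \<nu>. g y = f y"
      using n.AE_in_disc by eventually_elim (auto simp: g_def cut_def)
    then show ?thesis
      using borel_measurable_continuous_onI[OF f] borel_measurable_continuous_onI[OF g] n.sets_eq_borel
      by (intro integral_cong_AE) (simp_all cong: measurable_cong_sets)
  qed
  ultimately show ?thesis using disc_k disc_lim by simp
qed

lemma tendsto_integral_complex:
  fixes f :: "complex \<Rightarrow> complex"
  assumes f: "continuous_on UNIV f"
  shows "(\<lambda>k. integral\<^sup>L (\<sigma> k) f) \<longlonglongrightarrow> integral\<^sup>L \<mu> f"
proof -
  have i: "integrable \<nu> f" if "disc_prob \<nu> R" for \<nu>
    using disc_prob.integrable_continuous_fun[OF that f] .
  have "(\<lambda>k. \<integral>y. Re (f y) \<partial>\<sigma> k) \<longlonglongrightarrow> (\<integral>y. Re (f y) \<partial>\<mu>)" "(\<lambda>k. \<integral>y. Im (f y) \<partial>\<sigma> k) \<longlonglongrightarrow> (\<integral>y. Im (f y) \<partial>\<mu>)"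
    by (intro tendsto_integral_real continuous_intros f)+
  then show ?thesis
    unfolding tendsto_complex_iff using i[OF disc_k] i[OF disc_lim] by (simp add: integral_Re integral_Im)
qed

text \<open>The kernel is a continuous part plus an error that lives on |\<zeta>| < \<delta>. The
  error is bounded by \<open>near_potential\<close>, whose area integral is at most 16 \<delta> for
  every k. For the continuous part weak convergence gives pointwise limits, and dominated
  convergence does the rest. The logarithm and the Cauchy kernel both satisfy the bound 1 /
  |\<zeta>|, hence the general form.\<close>

lemma L1_tendsto_kernel:
  fixes \<kappa> :: "complex \<Rightarrow> complex" and \<kappa>' :: "real \<Rightarrow> complex \<Rightarrow> complex"
  assumes [measurable]: "\<kappa> \<in> borel_measurable borel"
    and int: "\<And>\<nu> z. disc_prob \<nu> R \<Longrightarrow> regular_point \<nu> z \<Longrightarrow> integrable \<nu> (\<lambda>y. \<kappa> (z - y))"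
    and cont: "\<And>\<delta>. 0 < \<delta> \<Longrightarrow> \<delta> < 1 \<Longrightarrow> continuous_on UNIV (\<kappa>' \<delta>)"
    and diff: "\<And>\<delta> \<zeta>. 0 < \<delta> \<Longrightarrow> \<delta> < 1 \<Longrightarrow> \<zeta> \<noteq> 0 \<Longrightarrow> cmod (\<kappa> \<zeta> - \<kappa>' \<delta> \<zeta>) \<le> (if cmod \<zeta> < \<delta> then 1 / cmod \<zeta> else 0)"
  shows "(\<lambda>k. \<integral>\<^sup>+z. indicator (cball 0 \<rho>) z * ennreal (cmod ((\<integral>y. \<kappa> (z - y) \<partial>\<sigma> k) - (\<integral>y. \<kappa> (z - y) \<partial>\<mu>))) \<partial>lborel) \<longlonglongrightarrow> 0"
proof (rule order_tendstoI)
  fix a :: ennreal assume "0 < a"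
  then obtain e where e: "0 < e" "ennreal e \<le> a" 
    by (cases a) (auto intro: that[of 1])
  \<comment> \<open>The truncation errors for \<open>\<sigma> k\<close> and for \<mu> cost 16
    \<delta> each; e / 64 leaves half of e to the continuous part.\<close>
  define \<delta> where "\<delta> = min (1/2) (e / 64)"
  have \<delta>: "0 < \<delta>" "\<delta> < 1" "32 * \<delta> \<le> e / 2" using e by (auto simp: \<delta>_def min_def)
  define F where "F \<nu> z = (\<integral>y. \<kappa>' \<delta> (z - y) \<partial>\<nu>)" for \<nu> z
  note c' = cont[OF \<delta>(1,2)]
  have ck: "continuous_on UNIV (\<lambda>y. \<kappa>' \<delta> (z - y))" for z
    by (intro continuous_on_compose2[OF c'] continuous_intros) auto
  have [measurable]: "\<kappa>' \<delta> \<in> borel_measurable borel" by (rule borel_measurable_continuous_onI[OF c'])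
  have "bounded (\<kappa>' \<delta> ` cball 0 (\<rho> + R))"
    by (intro compact_imp_bounded compact_continuous_image continuous_on_subset[OF c']) auto
  then obtain B where B: "\<forall>x\<in>\<kappa>' \<delta> ` cball 0 (\<rho> + R). norm x \<le> B" unfolding bounded_iff by auto
  have Fb: "cmod (F \<nu> z) \<le> B" if \<nu>: "disc_prob \<nu> R" and z: "z \<in> cball 0 \<rho>" for \<nu> z
  proof -
    interpret n: disc_prob \<nu> R by fact
    have "cmod (F \<nu> z) \<le> (\<integral>y. cmod (\<kappa>' \<delta> (z - y)) \<partial>\<nu>)"
      unfolding F_def by (rule integral_norm_bound)
    also have "\<dots> \<le> (\<integral>y. B \<partial>\<nu>)"
    proof (intro integral_mono_AE)
      show "AE y in \<nu>. cmod (\<kappa>' \<delta> (z - y)) \<le> B"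
        using n.AE_in_disc
      proof eventually_elim
        case (elim y)
        then have "z - y \<in> cball 0 (\<rho> + R)" using z norm_triangle_ineq4[of z y] by simp
        then show ?case using B by blast
      qed
    qed (use n.integrable_continuous_fun[OF ck] in auto)
    finally show ?thesis by (simp add: n.prob_space[simplified])
  qed
  have Fm [measurable]: "F \<nu> \<in> borel_measurable borel" if \<nu>: "disc_prob \<nu> R" for \<nu>
  proof -
    interpret n: disc_prob \<nu> R by fact
    show ?thesis unfolding F_def by measurable
  qed
  have Flim: "(\<lambda>k. F (\<sigma> k) z) \<longlonglongrightarrow> F \<mu> z" for z
    unfolding F_def by (rule tendsto_integral_complex[OF ck])
  note [measurable] = Fm[OF disc_k] Fm[OF disc_lim]
  have b [measurable]: "cball 0 \<rho> \<in> sets (borel :: complex measure)" by simp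
  have "(\<lambda>k. \<integral>\<^sup>+z. indicator (cball 0 \<rho>) z * ennreal (cmod (F (\<sigma> k) z - F \<mu> z)) \<partial>lborel) \<longlonglongrightarrow> (\<integral>\<^sup>+z. 0 \<partial>(lborel :: complex measure))"
  proof (rule nn_integral_dominated_convergence[where w="\<lambda>z::complex. ennreal (2 * B) * indicator (cball 0 \<rho>) z"])
    fix k
    show "AE z in lborel. indicator (cball 0 \<rho>) z * ennreal (cmod (F (\<sigma> k) z - F \<mu> z)) \<le> ennreal (2 * B) * indicator (cball 0 \<rho>) z"
    proof (intro AE_I2)
      fix z
      show "indicator (cball 0 \<rho>) z * ennreal (cmod (F (\<sigma> k) z - F \<mu> z)) \<le> ennreal (2 * B) * indicator (cball 0 \<rho>) z"
        using Fb[OF disc_k, of z k] Fb[OF disc_lim, of z] norm_triangle_ineq4[of "F (\<sigma> k) z" "F \<mu> z"]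
        by (cases "z \<in> cball 0 \<rho>") (auto intro!: ennreal_leI)
    qed
  next
    show "(\<integral>\<^sup>+z. ennreal (2 * B) * indicator (cball 0 \<rho>) z \<partial>(lborel :: complex measure)) < \<infinity>"
      using emeasure_bounded_finite[OF bounded_cball, of "0 :: complex" \<rho>]
      by (subst nn_integral_cmult_indicator) (auto simp: ennreal_mult_less_top)
  next
    show "AE z in lborel. (\<lambda>k. indicator (cball 0 \<rho>) z * ennreal (cmod (F (\<sigma> k) z - F \<mu> z))) \<longlonglongrightarrow> 0"
    proof (intro AE_I2)
      fix z
      have "(\<lambda>k. cmod (F (\<sigma> k) z - F \<mu> z)) \<longlonglongrightarrow> 0"
        using Flim[of z] by (simp add: tendsto_norm_zero_iff LIM_zero_iff)
      then have "(\<lambda>k. ennreal (cmod (F (\<sigma> k) z - F \<mu> z))) \<longlonglongrightarrow> ennreal 0" by (rule tendsto_ennrealI)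
      then show "(\<lambda>k. indicator (cball 0 \<rho>) z * ennreal (cmod (F (\<sigma> k) z - F \<mu> z))) \<longlonglongrightarrow> 0"
        by (cases "z \<in> cball 0 \<rho>") auto
    qed
  qed measurable
  then have "(\<lambda>k. \<integral>\<^sup>+z. indicator (cball 0 \<rho>) z * ennreal (cmod (F (\<sigma> k) z - F \<mu> z)) \<partial>lborel) \<longlonglongrightarrow> 0" by simp
  then have ev: "\<forall>\<^sub>F k in sequentially. (\<integral>\<^sup>+z. indicator (cball 0 \<rho>) z * ennreal (cmod (F (\<sigma> k) z - F \<mu> z)) \<partial>lborel) < ennreal (e / 2)"
    using e by (intro order_tendstoD(2)) auto
  have split: "cmod ((\<integral>y. \<kappa> (z - y) \<partial>\<nu>) - F \<nu> z) \<le> near_potential \<nu> \<delta> z"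
    if \<nu>: "disc_prob \<nu> R" and z: "regular_point \<nu> z" for \<nu> z
  proof -
    interpret n: disc_prob \<nu> R by fact
    note i = int[OF \<nu> z] n.integrable_continuous_fun[OF ck, of z] n.regular_point_integrable[OF z]
    have "cmod ((\<integral>y. \<kappa> (z - y) \<partial>\<nu>) - F \<nu> z) = cmod (\<integral>y. \<kappa> (z - y) - \<kappa>' \<delta> (z - y) \<partial>\<nu>)"
      unfolding F_def using i by simp
    also have "\<dots> \<le> (\<integral>y. cmod (\<kappa> (z - y) - \<kappa>' \<delta> (z - y)) \<partial>\<nu>)" by (rule integral_norm_bound)
    also have "\<dots> \<le> (\<integral>y. (if cmod (z - y) < \<delta> then 1 / cmod (z - y) else 0) \<partial>\<nu>)"
    proof (intro integral_mono_AE)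
      show "AE y in \<nu>. cmod (\<kappa> (z - y) - \<kappa>' \<delta> (z - y)) \<le> (if cmod (z - y) < \<delta> then 1 / cmod (z - y) else 0)"
        using i(7) by eventually_elim (use diff[OF \<delta>(1,2)] in auto)
    qed (use i in auto)
    finally show ?thesis by (simp add: n.near_potential_eq)
  qed
  have near: "(\<integral>\<^sup>+z. ennreal (near_potential \<nu> \<delta> z) \<partial>lborel) \<le> ennreal (16 * \<delta>)" if \<nu>: "disc_prob \<nu> R" for \<nu>
  proof -
    interpret n: disc_prob \<nu> R by fact
    show ?thesis using n.nn_integral_near_potential_le[of \<delta> UNIV UNIV] \<delta> by (simp add: n.prob_space[simplified])
  qed
  show "\<forall>\<^sub>F k in sequentially. (\<integral>\<^sup>+z. indicator (cball 0 \<rho>) z * ennreal (cmod ((\<integral>y. \<kappa> (z - y) \<partial>\<sigma> k) - (\<integral>y. \<kappa> (z - y) \<partial>\<mu>))) \<partial>lborel) < a"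
    using ev
  proof eventually_elim
    case (elim k)
    interpret s: disc_prob "\<sigma> k" R by (rule disc_k)
    have "(\<integral>\<^sup>+z. indicator (cball 0 \<rho>) z * ennreal (cmod ((\<integral>y. \<kappa> (z - y) \<partial>\<sigma> k) - (\<integral>y. \<kappa> (z - y) \<partial>\<mu>))) \<partial>lborel)
      \<le> (\<integral>\<^sup>+z. indicator (cball 0 \<rho>) z * ennreal (cmod (F (\<sigma> k) z - F \<mu> z)) + (ennreal (near_potential (\<sigma> k) \<delta> z) + ennreal (near_potential \<mu> \<delta> z)) \<partial>lborel)"
    proof (rule nn_integral_mono_AE)
      show "AE z in lborel. indicator (cball 0 \<rho>) z * ennreal (cmod ((\<integral>y. \<kappa> (z - y) \<partial>\<sigma> k) - (\<integral>y. \<kappa> (z - y) \<partial>\<mu>)))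
        \<le> indicator (cball 0 \<rho>) z * ennreal (cmod (F (\<sigma> k) z - F \<mu> z)) + (ennreal (near_potential (\<sigma> k) \<delta> z) + ennreal (near_potential \<mu> \<delta> z))"
        using s.AE_regular_point lim.AE_regular_point
      proof eventually_elim
        case (elim z)
        define a b where "a = (\<integral>y. \<kappa> (z - y) \<partial>\<sigma> k)" and "b = (\<integral>y. \<kappa> (z - y) \<partial>\<mu>)"
        have "a - b = (F (\<sigma> k) z - F \<mu> z) + (a - F (\<sigma> k) z) - (b - F \<mu> z)" by simp
        then have "cmod (a - b) \<le> cmod (F (\<sigma> k) z - F \<mu> z) + cmod (a - F (\<sigma> k) z) + cmod (b - F \<mu> z)"
          by (smt (verit) norm_triangle_ineq4 norm_triangle_ineq)
        then have "cmod (a - b) \<le> cmod (F (\<sigma> k) z - F \<mu> z) + (near_potential (\<sigma> k) \<delta> z + near_potential \<mu> \<delta> z)"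
          using split[OF disc_k elim(1)] split[OF disc_lim elim(2)] by (simp add: a_def b_def)
        then have "ennreal (cmod (a - b)) \<le> ennreal (cmod (F (\<sigma> k) z - F \<mu> z)) + (ennreal (near_potential (\<sigma> k) \<delta> z) + ennreal (near_potential \<mu> \<delta> z))"
          using s.near_potential_nonneg lim.near_potential_nonneg
          by (simp add: ennreal_plus[symmetric] ennreal_leI del: ennreal_plus)
        then show ?case unfolding a_def[symmetric] b_def[symmetric] by (cases "z \<in> cball 0 \<rho>") auto
      qed
    qed
    also have "\<dots> = (\<integral>\<^sup>+z. indicator (cball 0 \<rho>) z * ennreal (cmod (F (\<sigma> k) z - F \<mu> z)) \<partial>lborel)
        + ((\<integral>\<^sup>+z. ennreal (near_potential (\<sigma> k) \<delta> z) \<partial>lborel) + (\<integral>\<^sup>+z. ennreal (near_potential \<mu> \<delta> z) \<partial>lborel))"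
      by (simp add: nn_integral_add)
    also have "\<dots> \<le> (\<integral>\<^sup>+z. indicator (cball 0 \<rho>) z * ennreal (cmod (F (\<sigma> k) z - F \<mu> z)) \<partial>lborel) + (ennreal (16 * \<delta>) + ennreal (16 * \<delta>))"
      by (intro add_left_mono add_mono near disc_k disc_lim)
    also have "\<dots> < ennreal (e / 2) + (ennreal (16 * \<delta>) + ennreal (16 * \<delta>))"
      using elim by (simp add: ennreal_add_left_cancel_less add.commute)
    also have "\<dots> = ennreal (e / 2 + 32 * \<delta>)" using e \<delta> by (simp add: ennreal_plus[symmetric] del: ennreal_plus)
    also have "\<dots> \<le> ennreal e" using \<delta> by (intro ennreal_leI) auto
    also have "\<dots> \<le> a" by (rule e)
    finally show ?case .
  qed
qed auto

lemma L1_tendsto_potential: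
  "(\<lambda>k. \<integral>\<^sup>+z. indicator (cball 0 \<rho>) z * ennreal \<bar>potential (\<sigma> k) z - potential \<mu> z\<bar> \<partial>lborel) \<longlonglongrightarrow> 0"
proof -
  have "(\<lambda>k. \<integral>\<^sup>+z. indicator (cball 0 \<rho>) z * ennreal (cmod ((\<integral>y. of_real (ln (cmod (z - y))) \<partial>\<sigma> k) - (\<integral>y. of_real (ln (cmod (z - y))) \<partial>\<mu>))) \<partial>lborel) \<longlonglongrightarrow> 0"
  proof (rule L1_tendsto_kernel[where \<kappa>' = "\<lambda>\<delta> \<zeta>. of_real (ln (max \<delta> (cmod \<zeta>)))"])
    show "integrable \<nu> (\<lambda>y. complex_of_real (ln (cmod (z - y))))" if "disc_prob \<nu> R" "regular_point \<nu> z" for \<nu> z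
      using disc_prob.regular_point_integrable(3)[OF that] by simp
  next
    fix \<delta> :: real assume \<delta>: "0 < \<delta>" "\<delta> < 1"
    show "continuous_on UNIV (\<lambda>\<zeta>. complex_of_real (ln (max \<delta> (cmod \<zeta>))))"
      using \<delta> by (intro continuous_intros) (auto simp: less_max_iff_disj intro!: order.strict_implies_not_eq[symmetric])
    fix \<zeta> :: complex assume \<zeta>: "\<zeta> \<noteq> 0"
    have "cmod (complex_of_real (ln (cmod \<zeta>)) - complex_of_real (ln (max \<delta> (cmod \<zeta>)))) = \<bar>ln (cmod \<zeta>) - ln (max \<delta> (cmod \<zeta>))\<bar>"
      by (simp flip: of_real_diff)
    also have "\<dots> = ln (max \<delta> (cmod \<zeta>)) - ln (cmod \<zeta>)"
    proof -
      have "ln (cmod \<zeta>) \<le> ln (max \<delta> (cmod \<zeta>))" using \<zeta> by (intro ln_mono) auto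
      then show ?thesis by simp
    qed
    also have "\<dots> \<le> (if cmod \<zeta> < \<delta> then \<delta> / cmod \<zeta> else 0)"
      using \<zeta> \<delta> by (intro ln_max_diff_le) auto
    also have "\<dots> \<le> (if cmod \<zeta> < \<delta> then 1 / cmod \<zeta> else 0)"
      using \<zeta> \<delta> by (auto intro!: divide_right_mono)
    finally show "cmod (complex_of_real (ln (cmod \<zeta>)) - complex_of_real (ln (max \<delta> (cmod \<zeta>)))) \<le> (if cmod \<zeta> < \<delta> then 1 / cmod \<zeta> else 0)" .
  qed measurable
  then show ?thesis by (simp add: potential_def flip: of_real_diff)
qed

lemma L1_tendsto_cauchy:
  "(\<lambda>k. \<integral>\<^sup>+z. indicator (cball 0 \<rho>) z * ennreal (cmod (cauchy_transform (\<sigma> k) z - cauchy_transform \<mu> z)) \<partial>lborel) \<longlonglongrightarrow> 0"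
  unfolding cauchy_transform_def
\<comment> \<open>The smoothed kernel equals 1 / \<zeta> for |\<zeta>| >= \<delta> and cnj \<zeta> /
  \<delta>^2 inside, the two agreeing on the circle; inside, it differs from 1 / \<zeta> by the
  factor 1 - |\<zeta>|^2 / \<delta>^2, which lies between 0 and 1.\<close>
proof (rule L1_tendsto_kernel[where \<kappa> = "\<lambda>\<zeta>. 1 / \<zeta>" and \<kappa>' = "\<lambda>\<delta> \<zeta>. cnj \<zeta> / of_real ((max \<delta> (cmod \<zeta>))\<^sup>2)"])
  show "integrable \<nu> (\<lambda>y. 1 / (z - y))" if "disc_prob \<nu> R" "regular_point \<nu> z" for \<nu> z
    using disc_prob.regular_point_integrable(2)[OF that] by simp
next
  fix \<delta> :: real assume \<delta>: "0 < \<delta>" "\<delta> < 1"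
  show "continuous_on UNIV (\<lambda>\<zeta>. cnj \<zeta> / of_real ((max \<delta> (cmod \<zeta>))\<^sup>2))"
    using \<delta> by (intro continuous_intros) (auto simp: less_max_iff_disj max_def)
  fix \<zeta> :: complex assume \<zeta>: "\<zeta> \<noteq> 0"
  have inv: "1 / \<zeta> = cnj \<zeta> / of_real ((cmod \<zeta>)\<^sup>2)"
    using \<zeta> by (simp add: complex_div_cnj[of 1])
  show "cmod (1 / \<zeta> - cnj \<zeta> / of_real ((max \<delta> (cmod \<zeta>))\<^sup>2)) \<le> (if cmod \<zeta> < \<delta> then 1 / cmod \<zeta> else 0)"
  proof (cases "cmod \<zeta> < \<delta>")
    case True
    define d where "d = cmod \<zeta>"
    have d: "0 < d" "d < \<delta>" using \<zeta> True by (auto simp: d_def)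
    have "1 / \<zeta> - cnj \<zeta> / of_real (\<delta>\<^sup>2) = (1 / \<zeta>) * of_real (1 - d\<^sup>2 / \<delta>\<^sup>2)"
      using \<zeta> \<delta> unfolding inv d_def by (simp add: field_simps)
    then have "cmod (1 / \<zeta> - cnj \<zeta> / of_real (\<delta>\<^sup>2)) = (1 / d) * \<bar>1 - d\<^sup>2 / \<delta>\<^sup>2\<bar>"
      by (simp only: norm_mult norm_of_real norm_divide norm_one d_def)
    also have "\<dots> \<le> (1 / d) * 1"
    proof (intro mult_left_mono)
      have "d\<^sup>2 / \<delta>\<^sup>2 \<le> 1" using d by (simp add: power_mono)
      then show "\<bar>1 - d\<^sup>2 / \<delta>\<^sup>2\<bar> \<le> 1" by (simp add: abs_le_iff)
    qed (use d in auto)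
    finally show ?thesis using True by (simp add: max_def d_def)
  qed (use inv in \<open>auto simp: max_def\<close>)
qed measurable

end

text \<open>Markov's inequality: an integrand that is at least \<tau> almost everywhere on
  \<open>E\<close> has integral at least \<tau> times the measure of \<open>E\<close>. The null set
  \<open>N k\<close> may vary with k, so the point found can also satisfy every identity known
  almost everywhere for that k.\<close>

lemma eventually_ex_small:
  fixes e :: "nat \<Rightarrow> 'a :: euclidean_space \<Rightarrow> ennreal"
  assumes lim: "(\<lambda>k. \<integral>\<^sup>+z. indicator E z * e k z \<partial>lborel) \<longlonglongrightarrow> 0"
    and E: "E \<in> sets borel" "emeasure lborel E \<noteq> 0" and \<tau>: "0 < \<tau>"
    and N: "\<And>k. AE z in lborel. z \<notin> N k"
  shows "\<forall>\<^sub>F k in sequentially. \<exists>z\<in>E - N k. e k z < ennreal \<tau>"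
proof -
  have "0 < ennreal \<tau> * emeasure lborel E" using E \<tau> by (simp add: ennreal_zero_less_mult_iff zero_less_iff_neq_zero)
  with lim have "\<forall>\<^sub>F k in sequentially. (\<integral>\<^sup>+z. indicator E z * e k z \<partial>lborel) < ennreal \<tau> * emeasure lborel E"
    by (rule order_tendstoD(2))
  then show ?thesis
  proof eventually_elim
    case (elim k)
    show ?case
    proof (rule ccontr)
      assume neg: "\<not> ?case"
      have "ennreal \<tau> * emeasure lborel E = (\<integral>\<^sup>+z. ennreal \<tau> * indicator E z \<partial>lborel)"
        using E by (simp add: nn_integral_cmult_indicator)
      also have "\<dots> \<le> (\<integral>\<^sup>+z. indicator E z * e k z \<partial>lborel)"
      proof (rule nn_integral_mono_AE)
        show "AE z in lborel. ennreal \<tau> * indicator E z \<le> indicator E z * e k z"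
          using N[of k] by eventually_elim (use neg in \<open>auto simp: indicator_def not_less\<close>)
      qed
      finally show False using elim by simp
    qed
  qed
qed

section \<open>Potentials along lines\<close>

lemma measurable_Complex [measurable]: "(\<lambda>p. Complex (fst p) (snd p)) \<in> borel_measurable borel"
  unfolding Complex_eq by (intro borel_measurable_continuous_onI continuous_intros)

lemma lborel_complex_eq:
  "(lborel :: complex measure) = distr (lborel \<Otimes>\<^sub>M lborel) borel (\<lambda>p. Complex (fst p) (snd p))"
proof (rule lborel_eqI)
  fix l u :: complex assume le: "\<And>b. b \<in> Basis \<Longrightarrow> l \<bullet> b \<le> u \<bullet> b"
  have "Re l \<le> Re u" "Im l \<le> Im u" using le[of 1] le[of \<i>] by (auto simp: Basis_complex_def)
  have m: "(\<lambda>p. Complex (fst p) (snd p)) \<in> measurable (lborel \<Otimes>\<^sub>M lborel) borel"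
    by (simp add: lborel_prod)
  have vi: "(\<lambda>p. Complex (fst p) (snd p)) -` box l u = {Re l<..<Re u} \<times> {Im l<..<Im u}"
    by (auto simp: box_def Basis_complex_def)
  have "emeasure (distr (lborel \<Otimes>\<^sub>M lborel) borel (\<lambda>p. Complex (fst p) (snd p))) (box l u)
     = emeasure (lborel \<Otimes>\<^sub>M lborel) ({Re l<..<Re u} \<times> {Im l<..<Im u})"
    using m by (subst emeasure_distr) (simp_all add: vi space_pair_measure)
  also have "\<dots> = emeasure lborel {Re l<..<Re u} * emeasure lborel {Im l<..<Im u}"
    by (rule lborel.emeasure_pair_measure_Times) auto
  also have "\<dots> = ennreal (\<Prod>b\<in>Basis. (u - l) \<bullet> b)"
    using \<open>Re l \<le> Re u\<close> \<open>Im l \<le> Im u\<close> by (simp add: Basis_complex_def ennreal_mult)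
  finally show "emeasure (distr (lborel \<Otimes>\<^sub>M lborel) borel (\<lambda>p. Complex (fst p) (snd p))) (box l u) = ennreal (\<Prod>b\<in>Basis. (u - l) \<bullet> b)" .
qed simp

lemma AE_complex_iff:
  assumes P [measurable]: "Measurable.pred borel P"
  shows "(AE z in lborel. P z) \<longleftrightarrow> (AE x in lborel. AE y in lborel. P (Complex x y))"
    and "(AE z in lborel. P z) \<longleftrightarrow> (AE y in lborel. AE x in lborel. P (Complex x y))"
proof -
  have m: "(\<lambda>p. Complex (fst p) (snd p)) \<in> measurable (lborel \<Otimes>\<^sub>M lborel) borel"
    by (simp add: lborel_prod)
  have s: "{p \<in> space (lborel \<Otimes>\<^sub>M lborel). P (Complex (fst p) (snd p))} \<in> sets (lborel \<Otimes>\<^sub>M lborel)"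
    using measurable_compose[OF m P] by (simp add: pred_def)
  have "(AE z in lborel. P z) \<longleftrightarrow> (AE p in lborel \<Otimes>\<^sub>M lborel. P (Complex (fst p) (snd p)))"
    using P by (subst lborel_complex_eq, subst AE_distr_iff) (simp_all add: m pred_def)
  also have "\<dots> \<longleftrightarrow> (AE x in lborel. AE y in lborel. P (Complex x y))"
    using s by (subst lborel_pair.AE_pair_iff[symmetric]) auto
  finally show 1: "(AE z in lborel. P z) \<longleftrightarrow> (AE x in lborel. AE y in lborel. P (Complex x y))" .
  show "(AE z in lborel. P z) \<longleftrightarrow> (AE y in lborel. AE x in lborel. P (Complex x y))"
    unfolding 1 using s by (intro lborel_pair.AE_commute) auto
qed

text \<open>The forward half of the Fubini equivalence for arbitrary \<open>P\<close>: the
  exceptional set need not be measurable, so a Borel null set that contains it takes its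
  place.\<close>

lemma AE_complexD:
  assumes "AE z in lborel. P z"
  shows "AE x in lborel. AE y in lborel. P (Complex x y)" "AE y in lborel. AE x in lborel. P (Complex x y)"
proof -
  obtain N where N: "{z. \<not> P z} \<subseteq> N" "N \<in> sets borel" "emeasure lborel N = 0"
    using assms by (auto elim!: AE_E)
  have p: "Measurable.pred borel (\<lambda>z. z \<notin> N)" using N(2) by measurable
  have "AE z in lborel. z \<notin> N" using N by (auto intro!: AE_not_in simp: null_sets_def)
  then have a: "AE x in lborel. AE y in lborel. Complex x y \<notin> N" "AE y in lborel. AE x in lborel. Complex x y \<notin> N"
    using AE_complex_iff[OF p] by auto
  show "AE x in lborel. AE y in lborel. P (Complex x y)"
    using a(1) by (rule eventually_mono) (use N(1) in \<open>auto elim!: eventually_mono\<close>)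
  show "AE y in lborel. AE x in lborel. P (Complex x y)"
    using a(2) by (rule eventually_mono) (use N(1) in \<open>auto elim!: eventually_mono\<close>)
qed

lemma nn_integral_complex:
  assumes [measurable]: "f \<in> borel_measurable borel"
  shows "(\<integral>\<^sup>+z. f z \<partial>lborel) = (\<integral>\<^sup>+x. \<integral>\<^sup>+y. f (Complex x y) \<partial>lborel \<partial>lborel)"
    and "(\<integral>\<^sup>+z. f z \<partial>lborel) = (\<integral>\<^sup>+y. \<integral>\<^sup>+x. f (Complex x y) \<partial>lborel \<partial>lborel)"
proof -
  have m: "(\<lambda>p. Complex (fst p) (snd p)) \<in> measurable (lborel \<Otimes>\<^sub>M lborel) borel"
    by (simp add: lborel_prod)
  have m2: "(\<lambda>p. f (Complex (fst p) (snd p))) \<in> borel_measurable (lborel \<Otimes>\<^sub>M lborel)"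
    by (rule measurable_compose[OF m]) simp
  have e: "(\<integral>\<^sup>+z. f z \<partial>lborel) = (\<integral>\<^sup>+p. f (Complex (fst p) (snd p)) \<partial>(lborel \<Otimes>\<^sub>M lborel))"
    by (subst lborel_complex_eq, subst nn_integral_distr) (simp_all add: m)
  show "(\<integral>\<^sup>+z. f z \<partial>lborel) = (\<integral>\<^sup>+x. \<integral>\<^sup>+y. f (Complex x y) \<partial>lborel \<partial>lborel)"
    unfolding e using lborel.nn_integral_fst[OF m2] by simp
  show "(\<integral>\<^sup>+z. f z \<partial>lborel) = (\<integral>\<^sup>+y. \<integral>\<^sup>+x. f (Complex x y) \<partial>lborel \<partial>lborel)"
    unfolding e using lborel_pair.nn_integral_snd[OF m2] by simp
qed

text \<open>Half the logarithm of the squared modulus is differentiated, so that only a quadratic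
  polynomial in t stands inside the logarithm.\<close>

lemma ln_norm_has_derivative_line:
  assumes ne: "a + of_real t * e \<noteq> y"
  shows "((\<lambda>t. ln (cmod (a + of_real t * e - y))) has_real_derivative Re (e / (a + of_real t * e - y))) (at t within A)"
proof -
  define w where "w = a + of_real t * e - y"
  have w: "w \<noteq> 0" using ne by (simp add: w_def)
  have d: "((\<lambda>t. (cmod (a + of_real t * e - y))\<^sup>2) has_real_derivative 2 * (w \<bullet> e)) (at t within A)"
  proof -
    have "(cmod (a + of_real t * e - y))\<^sup>2 = (Re a + t * Re e - Re y)\<^sup>2 + (Im a + t * Im e - Im y)\<^sup>2" for t
      by (simp add: cmod_power2)
    moreover have "((\<lambda>t. (Re a + t * Re e - Re y)\<^sup>2 + (Im a + t * Im e - Im y)\<^sup>2) has_real_derivative 2 * (w \<bullet> e)) (at t within A)"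
      by (auto intro!: derivative_eq_intros simp: w_def inner_complex_def algebra_simps)
    ultimately show ?thesis by simp
  qed
  have "((\<lambda>t. ln ((cmod (a + of_real t * e - y))\<^sup>2) / 2) has_real_derivative (1 / (cmod w)\<^sup>2 * (2 * (w \<bullet> e))) / 2) (at t within A)"
    by (intro DERIV_cdivide DERIV_chain2[OF _ d], unfold w_def[symmetric], rule DERIV_ln_divide) (use w in simp)
  moreover have "ln ((cmod z)\<^sup>2) / 2 = ln (cmod z)" for z by (simp add: ln_realpow)
  moreover have "(1 / (cmod w)\<^sup>2 * (2 * (w \<bullet> e))) / 2 = Re (e / w)"
  proof -
    have "Re (e / w) = (w \<bullet> e) / (cmod w)\<^sup>2"
      by (simp add: Re_divide inner_complex_def cmod_power2 mult.commute)
    then show ?thesis by simp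
  qed
  ultimately show ?thesis by (simp add: w_def)
qed

section \<open>Absolute continuity of potentials along lines\<close>

context disc_prob
begin

interpretation lp: pair_sigma_finite "lborel :: real measure" \<sigma> ..

text \<open>For y off the line the fundamental theorem of calculus applies to the logarithmic
  kernel, and \<open>fin\<close> allows Fubini, so that differences of the potential are integrals
  of Re (e C). The difference of two such kernels is integrable, which is why integrability at one
  point of the line spreads to the others; without it \<open>potential\<close> would have the
  default value 0 there.\<close>

lemma potential_line:
  fixes a e :: complex and u v :: real
  assumes e: "cmod e = 1"
    and off: "AE y in \<sigma>. \<forall>t. a + of_real t * e \<noteq> y"
    and fin: "(\<integral>\<^sup>+t. indicator {u<..<v} t * (\<integral>\<^sup>+y. ennreal (1 / cmod (a + of_real t * e - y)) \<partial>\<sigma>) \<partial>lborel) < \<infinity>"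
    and st: "u < s" "s \<le> t" "t < v"
  shows "integrable lborel (\<lambda>x. indicator {s..t} x * Re (e * cauchy_transform \<sigma> (a + of_real x * e)))"
    and "integrable \<sigma> (\<lambda>y. ln (cmod (a + of_real t * e - y))) \<longleftrightarrow> integrable \<sigma> (\<lambda>y. ln (cmod (a + of_real s * e - y)))"
    and "integrable \<sigma> (\<lambda>y. ln (cmod (a + of_real s * e - y))) \<Longrightarrow> 
      potential \<sigma> (a + of_real t * e) - potential \<sigma> (a + of_real s * e)
      = (\<integral>x. indicator {s..t} x * Re (e * cauchy_transform \<sigma> (a + of_real x * e)) \<partial>lborel)"
proof -
  define f where "f x y = indicator {s..t} x * Re (e / (a + of_real x * e - y))" for x y
  have [measurable]: "(\<lambda>p. f (fst p) (snd p)) \<in> borel_measurable (lborel \<Otimes>\<^sub>M \<sigma>)"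
    unfolding f_def by measurable
  have fb: "ennreal \<bar>f x y\<bar> \<le> indicator {u<..<v} x * ennreal (1 / cmod (a + of_real x * e - y))" for x y
    using abs_Re_le_cmod[of "e / (a + of_real x * e - y)"] e st
    by (auto simp: f_def indicator_def norm_divide intro!: ennreal_leI)
  have "(\<integral>\<^sup>+p. ennreal \<bar>f (fst p) (snd p)\<bar> \<partial>(lborel \<Otimes>\<^sub>M \<sigma>)) = (\<integral>\<^sup>+x. \<integral>\<^sup>+y. ennreal \<bar>f x y\<bar> \<partial>\<sigma> \<partial>lborel)"
    by (subst nn_integral_fst[symmetric]) auto
  also have "\<dots> \<le> (\<integral>\<^sup>+x. \<integral>\<^sup>+y. indicator {u<..<v} x * ennreal (1 / cmod (a + of_real x * e - y)) \<partial>\<sigma> \<partial>lborel)"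
    by (intro nn_integral_mono fb)
  also have "\<dots> = (\<integral>\<^sup>+x. indicator {u<..<v} x * (\<integral>\<^sup>+y. ennreal (1 / cmod (a + of_real x * e - y)) \<partial>\<sigma>) \<partial>lborel)"
    by (intro nn_integral_cong nn_integral_cmult) measurable
  finally have "(\<integral>\<^sup>+p. ennreal (norm (f (fst p) (snd p))) \<partial>(lborel \<Otimes>\<^sub>M \<sigma>)) < \<infinity>"
    using fin by (simp add: order_le_less_trans)
  then have "integrable (lborel \<Otimes>\<^sub>M \<sigma>) (\<lambda>p. f (fst p) (snd p))"
    by (intro integrableI_bounded) auto
  then have int_f: "integrable (lborel \<Otimes>\<^sub>M \<sigma>) (case_prod f)" by (simp add: case_prod_beta')
  have fub: "(\<integral>y. (\<integral>x. f x y \<partial>lborel) \<partial>\<sigma>) = (\<integral>x. (\<integral>y. f x y \<partial>\<sigma>) \<partial>lborel)"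
    by (rule lp.Fubini_integral[OF int_f])
  have ftc: "AE y in \<sigma>. (\<integral>x. f x y \<partial>lborel) = ln (cmod (a + of_real t * e - y)) - ln (cmod (a + of_real s * e - y))"
    using off
  proof eventually_elim
    case (elim y)
    have c: "continuous_on {s..t} (\<lambda>x. Re (e / (a + of_real x * e - y)))"
      using elim by (intro continuous_intros) (auto simp: algebra_simps)
    have "(\<integral>x. indicator {s..t} x *\<^sub>R Re (e / (a + of_real x * e - y)) \<partial>lborel)
       = ln (cmod (a + of_real t * e - y)) - ln (cmod (a + of_real s * e - y))"
      using st(2) c
      by (intro integral_FTC_atLeastAtMost)
         (use elim in \<open>auto simp: has_real_derivative_iff_has_vector_derivative[symmetric] intro!: ln_norm_has_derivative_line\<close>)
    then show ?case by (simp add: f_def)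
  qed
  have fy: "integrable \<sigma> (\<lambda>y. \<integral>x. f x y \<partial>lborel)"
    using lp.integrable_snd[OF int_f] .
  have [measurable]: "(\<lambda>y. \<integral>x. f x y \<partial>lborel) \<in> borel_measurable \<sigma>" using fy by (rule borel_measurable_integrable)
  have "integrable \<sigma> (\<lambda>y. \<integral>x. f x y \<partial>lborel) \<longleftrightarrow> integrable \<sigma> (\<lambda>y. ln (cmod (a + of_real t * e - y)) - ln (cmod (a + of_real s * e - y)))"
    using ftc by (intro integrable_cong_AE) auto
  with fy have il: "integrable \<sigma> (\<lambda>y. ln (cmod (a + of_real t * e - y)) - ln (cmod (a + of_real s * e - y)))" by simp
  show iff: "integrable \<sigma> (\<lambda>y. ln (cmod (a + of_real t * e - y))) \<longleftrightarrow> integrable \<sigma> (\<lambda>y. ln (cmod (a + of_real s * e - y)))"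
    using Bochner_Integration.integrable_add[OF il, of "\<lambda>y. ln (cmod (a + of_real s * e - y))"]
      Bochner_Integration.integrable_diff[OF _ il, of "\<lambda>y. ln (cmod (a + of_real t * e - y))"] by auto
  have "AE x in lborel. indicator {u<..<v} x * (\<integral>\<^sup>+y. ennreal (1 / cmod (a + of_real x * e - y)) \<partial>\<sigma>) \<noteq> \<infinity>"
    using fin by (intro nn_integral_noteq_infinite) auto
  then have C: "AE x in lborel. (\<integral>y. f x y \<partial>\<sigma>) = indicator {s..t} x * Re (e * cauchy_transform \<sigma> (a + of_real x * e))"
  proof eventually_elim
    case (elim x)
    show ?case
    proof (cases "x \<in> {s..t}")
      case True
      then have "(\<integral>\<^sup>+y. ennreal (1 / cmod (a + of_real x * e - y)) \<partial>\<sigma>) \<noteq> \<infinity>" using elim st by auto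
      then have "integrable \<sigma> (\<lambda>y. 1 / (a + of_real x * e - y))"
        by (intro integrableI_bounded) (auto simp: norm_divide less_top[symmetric])
      then have i: "integrable \<sigma> (\<lambda>y. e * (1 / (a + of_real x * e - y)))" by (rule integrable_mult_right)
      have "Re (e * cauchy_transform \<sigma> (a + of_real x * e)) = Re (\<integral>y. e * (1 / (a + of_real x * e - y)) \<partial>\<sigma>)"
        by (simp only: cauchy_transform_def integral_mult_right_zero)
      also have "\<dots> = (\<integral>y. Re (e * (1 / (a + of_real x * e - y))) \<partial>\<sigma>)" using integral_Re[OF i] by simp
      finally show ?thesis using True by (simp add: f_def)
    qed (simp add: f_def)
  qed
  have ix: "integrable lborel (\<lambda>x. \<integral>y. f x y \<partial>\<sigma>)" using lp.integrable_fst[OF int_f] .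
  have [measurable]: "(\<lambda>x. indicator {s..t} x * Re (e * cauchy_transform \<sigma> (a + of_real x * e))) \<in> borel_measurable lborel"
    by measurable
  have "integrable lborel (\<lambda>x. \<integral>y. f x y \<partial>\<sigma>) \<longleftrightarrow> integrable lborel (\<lambda>x. indicator {s..t} x * Re (e * cauchy_transform \<sigma> (a + of_real x * e)))"
    using C ix by (intro integrable_cong_AE) auto
  then show "integrable lborel (\<lambda>x. indicator {s..t} x * Re (e * cauchy_transform \<sigma> (a + of_real x * e)))" using ix by simp
  assume ints: "integrable \<sigma> (\<lambda>y. ln (cmod (a + of_real s * e - y)))"
  then have it: "integrable \<sigma> (\<lambda>y. ln (cmod (a + of_real t * e - y)))" using iff by simp
  have "potential \<sigma> (a + of_real t * e) - potential \<sigma> (a + of_real s * e) = (\<integral>y. ln (cmod (a + of_real t * e - y)) - ln (cmod (a + of_real s * e - y)) \<partial>\<sigma>)"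
    unfolding potential_def using ints it by simp
  also have "\<dots> = (\<integral>y. (\<integral>x. f x y \<partial>lborel) \<partial>\<sigma>)"
    using ftc fy by (intro integral_cong_AE) (auto elim: eventually_mono)
  also have "\<dots> = (\<integral>x. indicator {s..t} x * Re (e * cauchy_transform \<sigma> (a + of_real x * e)) \<partial>lborel)"
    unfolding fub using C ix by (intro integral_cong_AE) auto
  finally show "potential \<sigma> (a + of_real t * e) - potential \<sigma> (a + of_real s * e)
      = (\<integral>x. indicator {s..t} x * Re (e * cauchy_transform \<sigma> (a + of_real x * e)) \<partial>lborel)" .
qed

end

lemma ex_of_AE_interval:
  fixes u v :: real
  assumes ae: "AE x in lborel. u < x \<and> x < v \<longrightarrow> P x" and "u < v"
  shows "\<exists>x. u < x \<and> x < v \<and> P x"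
proof (rule ccontr)
  assume neg: "\<nexists>x. u < x \<and> x < v \<and> P x"
  have "AE x in lborel. x \<notin> {u<..<v}"
    using ae by eventually_elim (use neg in auto)
  then have "{u<..<v} \<in> null_sets lborel"
    by (subst AE_iff_null_sets) auto
  then show False using \<open>u < v\<close> by (auto simp: null_sets_def)
qed

context disc_prob
begin

text \<open>A dichotomy: either the potential is at most \<open>b\<close> on the whole open segment,
  or it is constant there. At a point with value above \<open>b\<close>, continuity keeps the value
  above \<open>b\<close> nearby, where C = 0 almost everywhere, so the potential is locally
  constant. Its level set is therefore open, and relatively closed by continuity, in a connected
  interval.\<close>

lemma truncated_potential_line_const:
  fixes a e :: complex and u v b :: real
  assumes e: "cmod e = 1"
    and off: "AE y in \<sigma>. \<forall>t. a + of_real t * e \<noteq> y"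
    and fin: "(\<integral>\<^sup>+t. indicator {u<..<v} t * (\<integral>\<^sup>+y. ennreal (1 / cmod (a + of_real t * e - y)) \<partial>\<sigma>) \<partial>lborel) < \<infinity>"
    and reg: "\<exists>t. u < t \<and> t < v \<and> integrable \<sigma> (\<lambda>y. ln (cmod (a + of_real t * e - y)))"
    and ae: "AE t in lborel. u < t \<and> t < v \<longrightarrow> cauchy_transform \<sigma> (a + of_real t * e) = 0 \<or> potential \<sigma> (a + of_real t * e) \<le> b"
    and st: "s \<in> {u<..<v}" "t \<in> {u<..<v}"
  shows "max b (potential \<sigma> (a + of_real s * e)) = max b (potential \<sigma> (a + of_real t * e))"
proof -
  define \<phi> where "\<phi> t = potential \<sigma> (a + of_real t * e)" for t
  define G where "G x = Re (e * cauchy_transform \<sigma> (a + of_real x * e))" for x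
  note L = potential_line[OF e off fin]
  have all_int: "integrable \<sigma> (\<lambda>y. ln (cmod (a + of_real t * e - y)))" if "u < t" "t < v" for t
  proof -
    obtain t0 where t0: "u < t0" "t0 < v" "integrable \<sigma> (\<lambda>y. ln (cmod (a + of_real t0 * e - y)))"
      using reg by blast
    show ?thesis using L(2)[of t0 t] L(2)[of t t0] t0 that by (cases "t0 \<le> t") auto
  qed
  have G_int: "set_integrable lborel {s..t} G" if "u < s" "s \<le> t" "t < v" for s t
    using L(1)[OF that] by (simp add: set_integrable_def G_def)
  have diff: "\<phi> t - \<phi> s = (LINT x:{s..t}|lborel. G x)" if "u < s" "s \<le> t" "t < v" for s t
    using L(3)[OF that all_int] that by (simp add: set_lebesgue_integral_def G_def \<phi>_def)
  have cont1: "continuous_on {s..t} \<phi>" if "u < s" "s \<le> t" "t < v" for s t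
  proof -
    have "G integrable_on {s..t}" using set_borel_integral_eq_integral(1)[OF G_int[OF that]] .
    then have "continuous_on {s..t} (\<lambda>x. \<phi> s + integral {s..x} G)"
      by (intro continuous_intros indefinite_integral_continuous_1)
    moreover have "\<phi> s + integral {s..x} G = \<phi> x" if x: "x \<in> {s..t}" for x
      using diff[of s x] set_borel_integral_eq_integral(2)[OF G_int[of s x]] that \<open>u < s\<close> \<open>t < v\<close> by auto
    ultimately show ?thesis by (rule continuous_on_eq)
  qed
  have cont: "continuous_on {u<..<v} \<phi>"
  proof (rule continuous_at_imp_continuous_on, rule ballI)
    fix t assume "t \<in> {u<..<v}"
    then have "u < (u + t) / 2" "(t + v) / 2 < v" "t \<in> interior {(u + t) / 2..(t + v) / 2}"
      by (auto simp: field_simps)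
    then show "isCont \<phi> t" using continuous_on_interior[OF cont1[of "(u + t) / 2" "(t + v) / 2"]] by auto
  qed
  have key: "\<phi> t = \<phi> t0" if t0: "t0 \<in> {u<..<v}" "b < \<phi> t0" and t: "t \<in> {u<..<v}" for t t0
  proof -
    have "open {x \<in> {u<..<v}. \<phi> x = \<phi> t0}"
      unfolding open_contains_ball
    proof
      fix x assume "x \<in> {x \<in> {u<..<v}. \<phi> x = \<phi> t0}"
      then have x: "x \<in> {u<..<v}" "b < \<phi> x" "\<phi> x = \<phi> t0" using t0 by auto
      have "open ({u<..<v} \<inter> \<phi> -` {b<..})"
        using cont by (intro continuous_open_preimage) auto
      then obtain \<delta> where \<delta>: "\<delta> > 0" "ball x \<delta> \<subseteq> {u<..<v} \<inter> \<phi> -` {b<..}"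
        using x open_contains_ball by (metis IntI greaterThan_iff vimageI)
      have zero: "\<phi> q = \<phi> p" if pq: "p \<le> q" "p \<in> ball x \<delta>" "q \<in> ball x \<delta>" for p q
      proof -
        have sub: "{p..q} \<subseteq> ball x \<delta>" using pq by (auto simp: dist_real_def)
        have "p \<in> {u<..<v}" "q \<in> {u<..<v}" using pq \<delta> by auto
        then have "\<phi> q - \<phi> p = (LINT x:{p..q}|lborel. G x)" using pq by (intro diff) auto
        also have "\<dots> = (LINT x:{p..q}|lborel. 0)"
          unfolding set_lebesgue_integral_def
        proof (intro integral_cong_AE)
          show "(\<lambda>x. indicator {p..q} x *\<^sub>R G x) \<in> borel_measurable lborel"
            unfolding G_def by measurable
          show "AE x in lborel. indicator {p..q} x *\<^sub>R G x = indicator {p..q} x *\<^sub>R 0"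
            using ae
          proof eventually_elim
            case (elim y)
            show ?case
            proof (cases "y \<in> {p..q}")
              case True
              then have "y \<in> {u<..<v} \<inter> \<phi> -` {b<..}" using sub \<delta>(2) by (meson subsetD)
              then have "b < \<phi> y" "u < y" "y < v" by auto
              then show ?thesis using elim by (auto simp: \<phi>_def G_def)
            qed auto
          qed
        qed auto
        finally show ?thesis by simp
      qed
      have "ball x \<delta> \<subseteq> {x \<in> {u<..<v}. \<phi> x = \<phi> t0}"
      proof
        fix y assume y: "y \<in> ball x \<delta>"
        have "x \<in> ball x \<delta>" using \<delta> by simp
        then have "\<phi> y = \<phi> x" using zero[of x y] zero[of y x] y by (cases "x \<le> y") auto
        then show "y \<in> {x \<in> {u<..<v}. \<phi> x = \<phi> t0}" using y \<delta> x by auto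
      qed
      then show "\<exists>e>0. ball x e \<subseteq> {x \<in> {u<..<v}. \<phi> x = \<phi> t0}" using \<delta> by blast
    qed
    then have "\<forall>x\<in>{u<..<v}. \<phi> x = \<phi> t0"
      by (intro continuous_levelset_open[OF _ cont]) (use t0 in auto)
    then show ?thesis using t by blast
  qed
  show ?thesis
    using key[of s t] key[of t s] st unfolding \<phi>_def by (smt (verit))
qed

text \<open>Almost every horizontal and almost every vertical line satisfies the conditions of the
  one-dimensional result. A single good horizontal line meets all good vertical lines, so the
  constants on the latter agree.\<close>

lemma truncated_potential_AE_const:
  fixes x :: complex and b :: real
  assumes \<rho>: "0 < \<rho>"
    and ae: "AE z in lborel. z \<in> ball x \<rho> \<longrightarrow> cauchy_transform \<sigma> z = 0 \<or> potential \<sigma> z \<le> b"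
  shows "\<exists>\<kappa>. AE z in lborel. z \<in> ball x (\<rho> / 2) \<longrightarrow> max b (potential \<sigma> z) = \<kappa>"
proof -
  \<comment> \<open>Half the side of a square about x. It lies in \<open>ball x \<rho>\<close>
    because |Re| + |Im| < 2 w = \<rho>, and it contains \<open>ball x (\<rho> / 2)\<close>.\<close>
  define w where "w = \<rho> / 2"
  have w: "0 < w" using \<rho> by (simp add: w_def)
  define u1 v1 u2 v2 where "u1 = Re x - w" and "v1 = Re x + w" and "u2 = Im x - w" and "v2 = Im x + w"
  have uv: "u1 < v1" "u2 < v2" using w by (auto simp: u1_def u2_def v1_def v2_def)
  have Q_sub: "Complex s t \<in> ball x \<rho>" if "u1 < s" "s < v1" "u2 < t" "t < v2" for s t
  proof -
    have "cmod (Complex s t - x) \<le> \<bar>Re (Complex s t - x)\<bar> + \<bar>Im (Complex s t - x)\<bar>" by (rule cmod_le)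
    also have "\<dots> < \<rho>" using that by (auto simp: u1_def u2_def v1_def v2_def w_def abs_if)
    finally show ?thesis by (simp add: dist_norm norm_minus_commute)
  qed
  define H where "H z = (\<integral>\<^sup>+y. ennreal (1 / cmod (z - y)) \<partial>\<sigma>)" for z
  have [measurable]: "H \<in> borel_measurable borel" unfolding H_def by measurable
  have H_fin: "(\<integral>\<^sup>+z. indicator (ball x \<rho>) z * H z \<partial>lborel) < \<infinity>"
  proof -
    have "(\<integral>\<^sup>+z. indicator (ball x \<rho>) z * H z \<partial>lborel)
      \<le> (\<integral>\<^sup>+z. ennreal 1 * indicator (ball x \<rho>) z + indicator UNIV z * (\<integral>\<^sup>+y. ennreal (if cmod (z - y) < 1 then 1 / cmod (z - y) else 0) \<partial>\<sigma>) \<partial>lborel)"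
    proof (intro nn_integral_mono)
      fix z
      have "H z \<le> (\<integral>\<^sup>+y. 1 + ennreal (if cmod (z - y) < 1 then 1 / cmod (z - y) else 0) \<partial>\<sigma>)"
        unfolding H_def
      proof (intro nn_integral_mono)
        fix y
        have "1 / cmod (z - y) \<le> 1 + (if cmod (z - y) < 1 then 1 / cmod (z - y) else 0)"
          by (auto simp: divide_le_eq_1)
        then have "ennreal (1 / cmod (z - y)) \<le> ennreal (1 + (if cmod (z - y) < 1 then 1 / cmod (z - y) else 0))" by (rule ennreal_leI)
        then show "ennreal (1 / cmod (z - y)) \<le> 1 + ennreal (if cmod (z - y) < 1 then 1 / cmod (z - y) else 0)"
          by (subst (asm) ennreal_plus) auto
      qed
      also have "\<dots> = 1 + (\<integral>\<^sup>+y. ennreal (if cmod (z - y) < 1 then 1 / cmod (z - y) else 0) \<partial>\<sigma>)"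
        by (subst nn_integral_add) (auto simp: emeasure_space_1[simplified])
      finally show "indicator (ball x \<rho>) z * H z \<le> ennreal 1 * indicator (ball x \<rho>) z + indicator UNIV z * (\<integral>\<^sup>+y. ennreal (if cmod (z - y) < 1 then 1 / cmod (z - y) else 0) \<partial>\<sigma>)"
        by (cases "z \<in> ball x \<rho>") auto
    qed
    also have "\<dots> = emeasure lborel (ball x \<rho>) + (\<integral>\<^sup>+z. indicator UNIV z * (\<integral>\<^sup>+y. ennreal (if cmod (z - y) < 1 then 1 / cmod (z - y) else 0) \<partial>\<sigma>) \<partial>lborel)"
      by (subst nn_integral_add) (auto intro!: borel_measurable_indicator)
    also have "\<dots> \<le> emeasure lborel (ball x \<rho>) + ennreal (16 * 1 * measure \<sigma> UNIV)"
      by (intro add_left_mono nn_integral_near_le) auto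
    also have "\<dots> < \<infinity>" using emeasure_bounded_finite[OF bounded_ball, of x \<rho>] by simp
    finally show ?thesis .
  qed
  have H_fin1: "AE h in lborel. (\<integral>\<^sup>+t. indicator (ball x \<rho>) (Complex t h) * H (Complex t h) \<partial>lborel) \<noteq> \<infinity>"
  proof (rule nn_integral_noteq_infinite)
    have b [measurable]: "ball x \<rho> \<in> sets borel" by simp
    have [measurable]: "(\<lambda>z. indicator (ball x \<rho>) z * H z) \<in> borel_measurable borel" by measurable
    have "(\<lambda>p. indicator (ball x \<rho>) (Complex (fst p) (snd p)) * H (Complex (fst p) (snd p))) \<in> borel_measurable (lborel \<Otimes>\<^sub>M lborel)"
      by (rule measurable_compose[OF _ \<open>(\<lambda>z. indicator (ball x \<rho>) z * H z) \<in> borel_measurable borel\<close>]) (simp add: lborel_prod)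
    then have "(\<lambda>p. indicator (ball x \<rho>) (Complex (snd p) (fst p)) * H (Complex (snd p) (fst p))) \<in> borel_measurable (lborel \<Otimes>\<^sub>M lborel)"
      by (subst (asm) measurable_pair_swap_iff) (simp add: case_prod_beta)
    then show "(\<lambda>h. \<integral>\<^sup>+t. indicator (ball x \<rho>) (Complex t h) * H (Complex t h) \<partial>lborel) \<in> borel_measurable lborel"
      by (intro lborel.borel_measurable_nn_integral) (simp add: case_prod_beta)
    show "(\<integral>\<^sup>+h. \<integral>\<^sup>+t. indicator (ball x \<rho>) (Complex t h) * H (Complex t h) \<partial>lborel \<partial>lborel) \<noteq> \<infinity>"
      using H_fin by (subst (asm) nn_integral_complex(2)) auto
  qed
  have H_fin2: "AE s in lborel. (\<integral>\<^sup>+t. indicator (ball x \<rho>) (Complex s t) * H (Complex s t) \<partial>lborel) \<noteq> \<infinity>"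
  proof (rule nn_integral_noteq_infinite)
    have b [measurable]: "ball x \<rho> \<in> sets borel" by simp
    have [measurable]: "(\<lambda>z. indicator (ball x \<rho>) z * H z) \<in> borel_measurable borel" by measurable
    have "(\<lambda>p. indicator (ball x \<rho>) (Complex (fst p) (snd p)) * H (Complex (fst p) (snd p))) \<in> borel_measurable (lborel \<Otimes>\<^sub>M lborel)"
      by (rule measurable_compose[OF _ \<open>(\<lambda>z. indicator (ball x \<rho>) z * H z) \<in> borel_measurable borel\<close>]) (simp add: lborel_prod)
    then show "(\<lambda>h. \<integral>\<^sup>+t. indicator (ball x \<rho>) (Complex h t) * H (Complex h t) \<partial>lborel) \<in> borel_measurable lborel"
      by (intro lborel.borel_measurable_nn_integral) (simp add: case_prod_beta)
    show "(\<integral>\<^sup>+h. \<integral>\<^sup>+t. indicator (ball x \<rho>) (Complex h t) * H (Complex h t) \<partial>lborel \<partial>lborel) \<noteq> \<infinity>"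
      using H_fin by (subst (asm) nn_integral_complex(1)) auto
  qed
  define g where "g z = max b (potential \<sigma> z)" for z
  have off1: "AE h in lborel. AE y in \<sigma>. h \<noteq> Im y"
  proof -
    interpret lp: pair_sigma_finite "lborel :: real measure" \<sigma> ..
    have "(AE h in lborel. AE y in \<sigma>. h \<noteq> Im y) \<longleftrightarrow> (AE y in \<sigma>. AE h in lborel. h \<noteq> Im y)"
      by (intro lp.AE_commute) measurable
    moreover have "AE y in \<sigma>. AE h in lborel. h \<noteq> Im y" by (rule AE_I2, rule AE_lborel_singleton)
    ultimately show ?thesis by simp
  qed
  have off2: "AE h in lborel. AE y in \<sigma>. h \<noteq> Re y"
  proof -
    interpret lp: pair_sigma_finite "lborel :: real measure" \<sigma> ..
    have "(AE h in lborel. AE y in \<sigma>. h \<noteq> Re y) \<longleftrightarrow> (AE y in \<sigma>. AE h in lborel. h \<noteq> Re y)"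
      by (intro lp.AE_commute) measurable
    moreover have "AE y in \<sigma>. AE h in lborel. h \<noteq> Re y" by (rule AE_I2, rule AE_lborel_singleton)
    ultimately show ?thesis by simp
  qed
  have hor: "AE h in lborel. u2 < h \<and> h < v2 \<longrightarrow> (\<forall>s\<in>{u1<..<v1}. \<forall>t\<in>{u1<..<v1}. g (Complex s h) = g (Complex t h))"
    using H_fin1 off1 AE_complexD(2)[OF AE_regular_point] AE_complexD(2)[OF ae]
  proof eventually_elim
    case (elim h)
    show ?case
    proof (intro impI ballI)
      assume h: "u2 < h \<and> h < v2"
      fix s t assume st: "s \<in> {u1<..<v1}" "t \<in> {u1<..<v1}"
      have line: "Complex 0 h + of_real t * 1 = Complex t h" for t by (simp add: complex_eq_iff)
      have "max b (potential \<sigma> (Complex 0 h + of_real s * 1)) = max b (potential \<sigma> (Complex 0 h + of_real t * 1))"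
      proof (rule truncated_potential_line_const[where u=u1 and v=v1])
        show "AE y in \<sigma>. \<forall>t. Complex 0 h + of_real t * 1 \<noteq> y"
          using elim(2) unfolding line by eventually_elim auto
        have "(\<integral>\<^sup>+t. indicator {u1<..<v1} t * (\<integral>\<^sup>+y. ennreal (1 / cmod (Complex 0 h + of_real t * 1 - y)) \<partial>\<sigma>) \<partial>lborel)
          \<le> (\<integral>\<^sup>+t. indicator (ball x \<rho>) (Complex t h) * H (Complex t h) \<partial>lborel)"
          unfolding line H_def[symmetric] using Q_sub h
          by (intro nn_integral_mono mult_right_mono) (auto simp: indicator_def)
        then show "(\<integral>\<^sup>+t. indicator {u1<..<v1} t * (\<integral>\<^sup>+y. ennreal (1 / cmod (Complex 0 h + of_real t * 1 - y)) \<partial>\<sigma>) \<partial>lborel) < \<infinity>"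
          by (rule order_le_less_trans) (use elim(1) in \<open>simp add: less_top[symmetric]\<close>)
        have "AE t in lborel. u1 < t \<and> t < v1 \<longrightarrow> integrable \<sigma> (\<lambda>y. ln (cmod (Complex t h - y)))"
          using elim(3) by eventually_elim (auto intro: regular_point_integrable)
        from ex_of_AE_interval[OF this uv(1)] show "\<exists>t>u1. t < v1 \<and> integrable \<sigma> (\<lambda>y. ln (cmod (Complex 0 h + of_real t * 1 - y)))"
          unfolding line by simp 
        show "AE t in lborel. u1 < t \<and> t < v1 \<longrightarrow> cauchy_transform \<sigma> (Complex 0 h + of_real t * 1) = 0 \<or> potential \<sigma> (Complex 0 h + of_real t * 1) \<le> b"
          unfolding line using elim(4) by eventually_elim (use Q_sub h in auto)
      qed (use st in auto)
      then show "g (Complex s h) = g (Complex t h)" unfolding line g_def .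
    qed
  qed
  have ver: "AE r in lborel. u1 < r \<and> r < v1 \<longrightarrow> (\<forall>s\<in>{u2<..<v2}. \<forall>t\<in>{u2<..<v2}. g (Complex r s) = g (Complex r t))"
    using H_fin2 off2 AE_complexD(1)[OF AE_regular_point] AE_complexD(1)[OF ae]
  proof eventually_elim
    case (elim h)
    show ?case
    proof (intro impI ballI)
      assume h: "u1 < h \<and> h < v1"
      fix s t assume st: "s \<in> {u2<..<v2}" "t \<in> {u2<..<v2}"
      have line: "Complex h 0 + of_real t * \<i> = Complex h t" for t by (simp add: complex_eq_iff)
      have "max b (potential \<sigma> (Complex h 0 + of_real s * \<i>)) = max b (potential \<sigma> (Complex h 0 + of_real t * \<i>))"
      proof (rule truncated_potential_line_const[where u=u2 and v=v2])
        show "AE y in \<sigma>. \<forall>t. Complex h 0 + of_real t * \<i> \<noteq> y"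
          using elim(2) unfolding line by eventually_elim auto
        have "(\<integral>\<^sup>+t. indicator {u2<..<v2} t * (\<integral>\<^sup>+y. ennreal (1 / cmod (Complex h 0 + of_real t * \<i> - y)) \<partial>\<sigma>) \<partial>lborel)
          \<le> (\<integral>\<^sup>+t. indicator (ball x \<rho>) (Complex h t) * H (Complex h t) \<partial>lborel)"
          unfolding line H_def[symmetric] using Q_sub h
          by (intro nn_integral_mono mult_right_mono) (auto simp: indicator_def)
        then show "(\<integral>\<^sup>+t. indicator {u2<..<v2} t * (\<integral>\<^sup>+y. ennreal (1 / cmod (Complex h 0 + of_real t * \<i> - y)) \<partial>\<sigma>) \<partial>lborel) < \<infinity>"
          by (rule order_le_less_trans) (use elim(1) in \<open>simp add: less_top[symmetric]\<close>)
        have "AE t in lborel. u2 < t \<and> t < v2 \<longrightarrow> integrable \<sigma> (\<lambda>y. ln (cmod (Complex h t - y)))"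
          using elim(3) by eventually_elim (auto intro: regular_point_integrable)
        from ex_of_AE_interval[OF this uv(2)] show "\<exists>t>u2. t < v2 \<and> integrable \<sigma> (\<lambda>y. ln (cmod (Complex h 0 + of_real t * \<i> - y)))"
          unfolding line by simp 
        show "AE t in lborel. u2 < t \<and> t < v2 \<longrightarrow> cauchy_transform \<sigma> (Complex h 0 + of_real t * \<i>) = 0 \<or> potential \<sigma> (Complex h 0 + of_real t * \<i>) \<le> b"
          unfolding line using elim(4) by eventually_elim (use Q_sub h in auto)
      qed (use st in auto)
      then show "g (Complex h s) = g (Complex h t)" unfolding line g_def .
    qed
  qed
  obtain h0 where h0: "u2 < h0" "h0 < v2" "\<forall>s\<in>{u1<..<v1}. \<forall>t\<in>{u1<..<v1}. g (Complex s h0) = g (Complex t h0)"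
    using ex_of_AE_interval[OF hor uv(2)] by auto
  define \<kappa> where "\<kappa> = g (Complex (Re x) h0)"
  have rx: "Re x \<in> {u1<..<v1}" using w by (auto simp: u1_def v1_def)
  have [measurable]: "g \<in> borel_measurable borel" unfolding g_def by measurable
  have "AE s in lborel. AE t in lborel. u1 < s \<and> s < v1 \<and> u2 < t \<and> t < v2 \<longrightarrow> g (Complex s t) = \<kappa>"
    using ver
  proof eventually_elim
    case (elim s)
    have "u1 < s \<and> s < v1 \<and> u2 < t \<and> t < v2 \<longrightarrow> g (Complex s t) = \<kappa>" for t
    proof
      assume st: "u1 < s \<and> s < v1 \<and> u2 < t \<and> t < v2"
      then have "g (Complex s t) = g (Complex s h0)" using elim h0(1,2) by (meson greaterThanLessThan_iff)
      also have "\<dots> = \<kappa>" using h0(3) st rx unfolding \<kappa>_def by (meson greaterThanLessThan_iff)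
      finally show "g (Complex s t) = \<kappa>" .
    qed
    then show ?case by simp
  qed
  moreover have "Measurable.pred borel (\<lambda>z. u1 < Re z \<and> Re z < v1 \<and> u2 < Im z \<and> Im z < v2 \<longrightarrow> g z = \<kappa>)"
    by measurable
  ultimately have "AE z in lborel. u1 < Re z \<and> Re z < v1 \<and> u2 < Im z \<and> Im z < v2 \<longrightarrow> g z = \<kappa>"
    by (subst AE_complex_iff(1)) simp_all
  then have "AE z in lborel. z \<in> ball x (\<rho> / 2) \<longrightarrow> g z = \<kappa>"
  proof eventually_elim
    case (elim z)
    show ?case
    proof
      assume "z \<in> ball x (\<rho> / 2)"
      then have "cmod (z - x) < w" by (simp add: dist_norm norm_minus_commute w_def)
      then have "\<bar>Re z - Re x\<bar> < w" "\<bar>Im z - Im x\<bar> < w"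
        using abs_Re_le_cmod[of "z - x"] abs_Im_le_cmod[of "z - x"] by auto
      then show "g z = \<kappa>" using elim by (auto simp: u1_def u2_def v1_def v2_def)
    qed
  qed
  then show ?thesis unfolding g_def by blast
qed

text \<open>The truncation is removed: a constant at most b' would push \<open>log_potential\<close>
  at x below \<open>b\<close>. Once the potential is constant near x, the regularised potentials at
  x agree for all small radii. The difference of two truncated kernels is nonnegative and positive
  near x, so there can be no mass near x.\<close>

lemma potential_const_of_AE:
  fixes x :: complex and b b' :: real
  assumes \<rho>: "0 < \<rho>"
    and ae: "AE z in lborel. z \<in> ball x \<rho> \<longrightarrow> cauchy_transform \<sigma> z = 0 \<or> potential \<sigma> z \<le> b'"
    and b: "b' < b" "\<And>r. 0 < r \<Longrightarrow> b \<le> log_potential \<sigma> r x"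
  shows "\<exists>r>0. emeasure \<sigma> (ball x r) = 0 \<and> (\<exists>\<kappa>. AE z in lborel. z \<in> ball x r \<longrightarrow> potential \<sigma> z = \<kappa>)"
proof -
  obtain \<kappa> where \<kappa>: "AE z in lborel. z \<in> ball x (\<rho> / 2) \<longrightarrow> max b' (potential \<sigma> z) = \<kappa>"
    using truncated_potential_AE_const[OF \<rho> ae] by blast
  have "b' < \<kappa>"
  proof (rule ccontr)
    assume "\<not> b' < \<kappa>"
    then have "AE z in lborel. z \<in> ball x (\<rho> / 2) \<longrightarrow> potential \<sigma> z \<le> b'"
      using \<kappa> by (auto elim!: eventually_mono)
    then have "log_potential \<sigma> (\<rho> / 4) x \<le> b'" by (rule log_potential_le_of_AE) (use \<rho> in auto)
    then show False using b(1) b(2)[of "\<rho> / 4"] \<rho> by auto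
  qed
  then have p: "AE z in lborel. z \<in> ball x (\<rho> / 2) \<longrightarrow> potential \<sigma> z = \<kappa>"
    using \<kappa>
  proof eventually_elim
    case (elim z)
    with \<open>b' < \<kappa>\<close> show ?case by (auto simp: max_def split: if_splits)
  qed
  have P: "log_potential \<sigma> r x = \<kappa>" if "0 < r" "r < \<rho> / 2" for r
    by (intro antisym log_potential_le_of_AE[where \<rho>="\<rho> / 2"] log_potential_ge_of_AE[where \<rho>="\<rho> / 2"])
      (use p that in \<open>auto elim!: eventually_mono\<close>)
  define r1 r2 where "r1 = \<rho> / 8" and "r2 = \<rho> / 4"
  have r: "0 < r1" "r1 < r2" "r2 < \<rho> / 2" using \<rho> by (auto simp: r1_def r2_def)
  have int: "integrable \<sigma> (\<lambda>y. ln (max r2 (cmod (x - y))) - ln (max r1 (cmod (x - y))))"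
    using r by (intro Bochner_Integration.integrable_diff integrable_ln_max) auto
  have "(\<integral>y. ln (max r2 (cmod (x - y))) - ln (max r1 (cmod (x - y))) \<partial>\<sigma>) = 0"
    using P[of r1] P[of r2] r integrable_ln_max[of r1 x] integrable_ln_max[of r2 x]
    by (simp add: log_potential_def)
  moreover have "0 \<le> ln (max r2 (cmod (x - y))) - ln (max r1 (cmod (x - y)))" for y
  proof -
    have "ln (max r1 (cmod (x - y))) \<le> ln (max r2 (cmod (x - y)))"
      using r by (intro ln_mono) (auto simp: less_max_iff_disj)
    then show ?thesis by simp
  qed
  ultimately have "AE y in \<sigma>. ln (max r2 (cmod (x - y))) - ln (max r1 (cmod (x - y))) = 0"
    using integral_nonneg_eq_0_iff_AE[OF int] by simp
  then have "AE y in \<sigma>. y \<notin> ball x r2"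
  proof eventually_elim
    case (elim y)
    show ?case
    proof
      assume "y \<in> ball x r2"
      then have d: "max r1 (cmod (x - y)) < r2" using r by (auto simp: dist_norm)
      then have "ln (max r1 (cmod (x - y))) < ln r2" using r by (subst ln_less_cancel_iff) (auto simp: less_max_iff_disj)
      then show False using elim d by (simp add: max_def split: if_splits)
    qed
  qed
  then have "emeasure \<sigma> (ball x r2) = 0"
    using AE_iff_null_sets[of "ball x r2" \<sigma>] sets_eq_borel by auto
  moreover have "AE z in lborel. z \<in> ball x r2 \<longrightarrow> potential \<sigma> z = \<kappa>"
    using p by eventually_elim (use \<open>0 < \<rho>\<close> in \<open>auto simp: r2_def\<close>)
  moreover have "0 < r2" using r by simp
  ultimately show ?thesis by blast
qed

end

section \<open>The submean inequality\<close>

definition circle_mean :: "(complex \<Rightarrow> real) \<Rightarrow> complex \<Rightarrow> real \<Rightarrow> real" where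
  "circle_mean v z r = (\<integral>t. v (z + r * cis t) \<partial>circ)"

lemma measurable_cis [measurable]: "cis \<in> borel_measurable borel"
  by (intro borel_measurable_continuous_onI continuous_intros)

lemma integrable_circle:
  fixes v :: "complex \<Rightarrow> 'a :: {banach, second_countable_topology}"
  assumes "continuous_on UNIV v"
  shows "integrable circ (\<lambda>t. v (z + of_real r * cis t))"
  by (intro integrable_circ_continuous continuous_on_compose2[OF assms] continuous_intros) auto

section \<open>Harmonic approximation of boundary values on a circle\<close>

definition trig_poly :: "(complex \<Rightarrow> real) \<Rightarrow> bool" where
  "trig_poly f \<longleftrightarrow> (\<exists>p. \<forall>w. cmod w = 1 \<longrightarrow> f w = Re (poly p w))"

lemma trig_poly_add: "trig_poly f \<Longrightarrow> trig_poly g \<Longrightarrow> trig_poly (\<lambda>w. f w + g w)"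
  unfolding trig_poly_def by (metis (no_types, lifting) poly_add plus_complex.sel(1))

lemma trig_poly_sum: "finite A \<Longrightarrow> (\<And>i. i \<in> A \<Longrightarrow> trig_poly (f i)) \<Longrightarrow> trig_poly (\<lambda>w. \<Sum>i\<in>A. f i w)"
proof (induction A rule: finite_induct)
  case empty
  show ?case unfolding trig_poly_def by (rule exI[of _ 0]) simp
next
  case (insert x A)
  then show ?case by (simp add: trig_poly_add)
qed

text \<open>On the unit circle cnj w is 1 / w, and Re x Re y = Re (x y + x cnj y) / 2. With the
  larger exponent in the factor that is not conjugated, the product of two terms is again the real
  part of a polynomial.\<close>

lemma trig_poly_monom_mult: "trig_poly (\<lambda>w. Re (a * w ^ i) * Re (b * w ^ j))"
proof -
  have *: "trig_poly (\<lambda>w. Re (a * w ^ i) * Re (b * w ^ j))" if "j \<le> i" for a b i j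
    unfolding trig_poly_def
  proof (intro exI allI impI)
    fix w :: complex assume w: "cmod w = 1"
    have 1: "w * cnj w = 1" using complex_norm_square[of w] w by simp
    have "w ^ i * cnj w ^ j = w ^ (i - j) * (w * cnj w) ^ j"
      using that by (simp add: power_mult_distrib flip: power_add)
    then have e: "w ^ i * cnj w ^ j = w ^ (i - j)" using 1 by simp
    have "Re x * Re y = Re (x * y / 2 + x * cnj y / 2)" for x y by (simp add: field_simps)
    then have "Re (a * w ^ i) * Re (b * w ^ j) = Re ((a * w ^ i) * (b * w ^ j) / 2 + (a * w ^ i) * cnj (b * w ^ j) / 2)" .
    also have "(a * w ^ i) * (b * w ^ j) / 2 + (a * w ^ i) * cnj (b * w ^ j) / 2 = a * b / 2 * w ^ (i + j) + a * cnj b / 2 * (w ^ i * cnj w ^ j)"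
      by (simp add: power_add algebra_simps)
    also have "\<dots> = poly (monom (a * b / 2) (i + j) + monom (a * cnj b / 2) (i - j)) w"
      by (simp add: e poly_monom)
    finally show "Re (a * w ^ i) * Re (b * w ^ j) = Re (poly (monom (a * b / 2) (i + j) + monom (a * cnj b / 2) (i - j)) w)" .
  qed
  show ?thesis
  proof (cases "j \<le> i")
    case False
    then show ?thesis using *[of i j b a] by (simp add: mult.commute)
  qed (rule *)
qed

lemma trig_poly_mult:
  assumes "trig_poly f" "trig_poly g"
  shows "trig_poly (\<lambda>w. f w * g w)"
proof -
  obtain p q where p: "\<And>w. cmod w = 1 \<Longrightarrow> f w = Re (poly p w)" and q: "\<And>w. cmod w = 1 \<Longrightarrow> g w = Re (poly q w)"
    using assms unfolding trig_poly_def by blast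
  have "trig_poly (\<lambda>w. \<Sum>i\<le>degree p. \<Sum>j\<le>degree q. Re (coeff p i * w ^ i) * Re (coeff q j * w ^ j))"
    by (intro trig_poly_sum trig_poly_monom_mult) auto
  moreover have "f w * g w = (\<Sum>i\<le>degree p. \<Sum>j\<le>degree q. Re (coeff p i * w ^ i) * Re (coeff q j * w ^ j))" if "cmod w = 1" for w
    using p[OF that] q[OF that] by (simp only: poly_altdef Re_sum sum_product)
  ultimately show ?thesis unfolding trig_poly_def by simp
qed

lemma trig_poly_real_polynomial_function:
  assumes "real_polynomial_function f"
  shows "trig_poly f"
  using assms
proof (induction rule: real_polynomial_function.induct)
  case (linear f)
  interpret bounded_linear f by fact
  have "f w = Re (poly [:0, of_real (f 1) - \<i> * of_real (f \<i>):] w)" for w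
  proof -
    have "w = Re w *\<^sub>R 1 + Im w *\<^sub>R \<i>" by (simp add: complex_eq_iff)
    then have "f w = Re w * f 1 + Im w * f \<i>" by (metis add real_scaleR_def scaleR)
    then show ?thesis by (simp add: algebra_simps)
  qed
  then show ?case unfolding trig_poly_def by blast
next
  case (const c)
  show ?case unfolding trig_poly_def by (rule exI[of _ "[:of_real c:]"]) simp
next
  case (add f g)
  then show ?case by (simp add: trig_poly_add)
next
  case (mult f g)
  then show ?case by (simp add: trig_poly_mult)
qed

text \<open>Stone-Weierstrass supplies a real polynomial in the two coordinates; on the circle it is
  the real part of a complex polynomial, which is harmonic in the whole plane. This solves the
  Dirichlet problem approximately, without a Poisson integral.\<close>

lemma trig_poly_approx:
  assumes "continuous_on UNIV v" "0 < \<epsilon>"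
  shows "\<exists>p. \<forall>w. cmod w = 1 \<longrightarrow> \<bar>v w - Re (poly p w)\<bar> < \<epsilon>"
proof -
  have "compact (sphere (0 :: complex) 1)" by simp
  then obtain g where g: "real_polynomial_function g" "\<And>x. x \<in> sphere 0 1 \<Longrightarrow> \<bar>v x - g x\<bar> < \<epsilon>"
    using Stone_Weierstrass_real_polynomial_function[of "sphere 0 1" v \<epsilon>] assms continuous_on_subset by blast
  then show ?thesis using trig_poly_real_polynomial_function[OF g(1)] unfolding trig_poly_def
    by (metis dist_0_norm mem_sphere)
qed

lemma circle_mean_Re_poly:
  assumes "0 < r"
  shows "circle_mean (\<lambda>z. Re (poly p (a + b * z))) z r = Re (poly p (a + b * z))"
proof -
  have h: "(\<lambda>z. poly p (a + b * z)) holomorphic_on A" for A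
    by (intro holomorphic_intros)
  have "integrable circ (\<lambda>t. poly p (a + b * (z + of_real r * cis t)))"
    by (rule integrable_circle[where v="\<lambda>z. poly p (a + b * z)"]) (intro continuous_intros)
  then have "circle_mean (\<lambda>z. Re (poly p (a + b * z))) z r = Re (\<integral>t. poly p (a + b * (z + of_real r * cis t)) \<partial>circ)"
    unfolding circle_mean_def by (rule integral_Re)
  also have "(\<integral>t. poly p (a + b * (z + of_real r * cis t)) \<partial>circ) = poly p (a + b * z)"
    using circ_mean_holomorphic[OF h, of r "r + 1" z] assms by simp
  finally show ?thesis .
qed

text \<open>A locally submean continuous function lies below the harmonic polynomials that approximate
  its boundary values on a circle, by the maximum principle.\<close>

lemma local_submean_imp_submean:
  assumes cont: "continuous_on UNIV v"
    and loc: "\<And>z. \<exists>\<rho>>0. \<forall>r. 0 < r \<and> r < \<rho> \<longrightarrow> v z \<le> circle_mean v z r"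
    and R: "0 < R"
  shows "v z0 \<le> circle_mean v z0 R"
proof (rule field_le_epsilon)
  fix e' :: real assume e': "0 < e'"
  define e where "e = e' / 2"
  have e: "0 < e" using e' by (simp add: e_def)
  have "continuous_on UNIV (\<lambda>w::complex. v (z0 + R * w))"
    by (intro continuous_on_compose2[OF cont] continuous_intros) auto
  from trig_poly_approx[OF this e] obtain p
    where p: "\<And>w::complex. cmod w = 1 \<Longrightarrow> \<bar>v (z0 + R * w) - Re (poly p w)\<bar> < e" by auto
  define a where "a = - z0 / R"
  define b where "b = 1 / complex_of_real R"
  define h where "h z = Re (poly p (a + b * z))" for z
  have h_circle: "h (z0 + R * w) = Re (poly p w)" for w :: complex
    using R by (simp add: h_def a_def b_def field_simps)
  have h_cont: "continuous_on A h" for A unfolding h_def by (intro continuous_intros)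
  define u where "u z = v z - h z" for z
  have u_cont: "continuous_on A u" for A
    unfolding u_def by (intro continuous_intros h_cont continuous_on_subset[OF cont]) auto
  have u_sphere: "u z < e" if "cmod (z - z0) = R" for z
  proof -
    have "z = z0 + R * ((z - z0) / R)" using R by simp
    moreover have "cmod ((z - z0) / R) = 1" using that R by (simp add: norm_divide)
    ultimately show ?thesis using p[of "(z - z0) / R"] h_circle[of "(z - z0) / R"] unfolding u_def by force
  qed
  have "u z0 \<le> e"
  proof (rule ccontr)
    assume big: "\<not> u z0 \<le> e"
    have "\<exists>x\<in>cball z0 R. \<forall>y\<in>cball z0 R. u y \<le> u x"
      using R by (intro continuous_attains_sup u_cont) auto
    then obtain x where x: "x \<in> cball z0 R" "\<And>y. y \<in> cball z0 R \<Longrightarrow> u y \<le> u x" by blast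
    define A where "A = cball z0 R \<inter> u -` {u x}"
    have "compact A"
      unfolding A_def by (intro compact_Int_closed compact_cball closed_vimage u_cont) auto
    moreover have "A \<noteq> {}" using x by (auto simp: A_def)
    \<comment> \<open>Among the maximum points of \<open>u\<close> one with greatest real part is
      taken. Equality in the mean inequality makes almost every point of a small circle about it a
      maximum point too, and for 0 < t < 1 such a point has a larger real part.\<close>
    ultimately have "\<exists>w\<in>A. \<forall>y\<in>A. Re y \<le> Re w"
      by (intro continuous_attains_sup continuous_intros)
    then obtain w where w: "w \<in> A" "\<And>y. y \<in> A \<Longrightarrow> Re y \<le> Re w" by blast
    have uw: "u w = u x" "w \<in> cball z0 R" using w by (auto simp: A_def)
    have "e < u x" using big x(2)[of z0] R by simp
    then have "cmod (w - z0) \<noteq> R" using u_sphere[of w] uw by auto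
    then have wR: "cmod (w - z0) < R" using uw by (auto simp: dist_norm norm_minus_commute)
    obtain \<rho> where \<rho>: "\<rho> > 0" "\<And>r. 0 < r \<Longrightarrow> r < \<rho> \<Longrightarrow> v w \<le> circle_mean v w r" using loc[of w] by blast
    define r where "r = min \<rho> (R - cmod (w - z0)) / 2"
    have r: "0 < r" "r < \<rho>" "r < R - cmod (w - z0)" using \<rho> wR by (auto simp: r_def)
    have in_D: "w + r * cis t \<in> cball z0 R" for t
      using norm_triangle_ineq[of "w - z0" "r * cis t"] r
      by (simp add: dist_norm norm_minus_commute norm_mult algebra_simps)
    have int_u: "integrable circ (\<lambda>t. u (w + of_real r * cis t))" by (rule integrable_circle[OF u_cont])
    have "u w \<le> circle_mean v w r - circle_mean h w r"
      using \<rho>(2)[of r] r circle_mean_Re_poly[of r p a b w] by (simp add: u_def h_def[abs_def])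
    also have "\<dots> = (\<integral>t. u (w + r * cis t) \<partial>circ)"
      unfolding circle_mean_def u_def
      using integrable_circle[OF cont, of w r] integrable_circle[OF h_cont, of w r] by simp
    finally have "(\<integral>t. u w - u (w + r * cis t) \<partial>circ) \<le> 0"
      using int_u by (simp add: circ.prob_space[simplified])
    moreover have nn: "0 \<le> u w - u (w + r * cis t)" for t using x(2)[OF in_D] uw by simp
    ultimately have "(\<integral>t. u w - u (w + r * cis t) \<partial>circ) = 0"
      by (intro antisym Bochner_Integration.integral_nonneg) auto
    then have "AE t in circ. u w - u (w + r * cis t) = 0"
      using int_u nn by (subst (asm) integral_nonneg_eq_0_iff_AE) auto
    then have "AE t in lborel. t \<in> {0..2*pi} \<longrightarrow> u w - u (w + r * cis t) = 0"
      unfolding circ_def by (subst (asm) AE_density) (auto simp: indicator_def elim!: eventually_mono)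
    then have "AE t in lborel. 0 < t \<and> t < 1 \<longrightarrow> u w - u (w + r * cis t) = 0"
      by eventually_elim (use pi_gt3 in auto)
    from ex_of_AE_interval[OF this] obtain t where t: "0 < t" "t < 1" "u w = u (w + r * cis t)" by auto
    then have "w + r * cis t \<in> A" using in_D uw by (auto simp: A_def)
    then have "Re (w + r * cis t) \<le> Re w" by (rule w(2))
    then have "cos t \<le> 0" using r by (simp add: mult_le_0_iff)
    moreover have "0 < cos t" using t pi_gt3 by (intro cos_gt_zero_pi) auto
    ultimately show False by simp
  qed
  then have "v z0 \<le> h z0 + e" by (simp add: u_def)
  also have "h z0 = circle_mean h z0 R" unfolding h_def using circle_mean_Re_poly[OF R] by simp
  also have "circle_mean h z0 R \<le> (\<integral>t. v (z0 + R * cis t) + e \<partial>circ)"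
    unfolding circle_mean_def
  proof (intro integral_mono)
    fix t
    show "h (z0 + R * cis t) \<le> v (z0 + R * cis t) + e"
      using p[of "cis t"] h_circle[of "cis t"] by auto
  qed (use integrable_circle[OF h_cont, of z0 R] integrable_circle[OF cont, of z0 R] in auto)
  also have "\<dots> = circle_mean v z0 R + e"
    unfolding circle_mean_def using integrable_circle[OF cont, of z0 R] by (simp add: circ.prob_space[simplified])
  finally show "v z0 \<le> circle_mean v z0 R + e'" by (simp add: e_def)
qed

text \<open>Measures how far the truncated logarithm is from being harmonic at scale r. By Fubini
  its integral against \<sigma> is the same quantity for
  \<open>log_potential \<sigma> s\<close>.\<close>

definition mean_excess :: "real \<Rightarrow> real \<Rightarrow> complex \<Rightarrow> real" where
  "mean_excess r s \<zeta> = circle_mean (\<lambda>w. ln (max s (cmod w))) \<zeta> r - ln (max s (cmod \<zeta>))"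

lemma continuous_ln_max: "0 < s \<Longrightarrow> continuous_on A (\<lambda>w. ln (max s (cmod w)))"
  by (intro continuous_intros) (auto simp: less_max_iff_disj max_def)

text \<open>For |\<zeta>| < s the kernel has its minimum ln s at \<zeta>. For |\<zeta>| >= s it
  equals ln |\<zeta>| there and dominates ln |w| on the circle, whose mean is exactly ln |\<zeta>|
  because r < s <= |\<zeta>|.\<close>

lemma mean_excess_nonneg:
  assumes "0 < r" "r < s"
  shows "0 \<le> mean_excess r s \<zeta>"
proof (cases "cmod \<zeta> < s")
  case True
  have "(\<integral>t. ln s \<partial>circ) \<le> circle_mean (\<lambda>w. ln (max s (cmod w))) \<zeta> r"
    unfolding circle_mean_def using assms
    by (intro integral_mono integrable_circle continuous_ln_max) (auto intro!: ln_mono simp: less_max_iff_disj)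
  then show ?thesis using True by (simp add: mean_excess_def circ.prob_space[simplified] max_def)
next
  case False
  then have ne: "cmod \<zeta> \<noteq> r" using assms by auto
  have "(\<integral>t. ln (cmod (\<zeta> + r * cis t)) \<partial>circ) \<le> circle_mean (\<lambda>w. ln (max s (cmod w))) \<zeta> r"
    unfolding circle_mean_def
  proof (intro integral_mono circ_mean_ln assms ne)
    show "integrable circ (\<lambda>t. ln (max s (cmod (\<zeta> + r * cis t))))"
      using assms by (intro integrable_circle continuous_ln_max) auto
    fix t
    have "\<zeta> + r * cis t \<noteq> 0"
    proof
      assume "\<zeta> + r * cis t = 0"
      then have "cmod \<zeta> = cmod (r * cis t)" by (metis add_eq_0_iff norm_minus_cancel)
      with ne assms show False by (simp add: norm_mult)
    qed
    then show "ln (cmod (\<zeta> + r * cis t)) \<le> ln (max s (cmod (\<zeta> + r * cis t)))" by (intro ln_mono) auto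
  qed
  then show ?thesis using circ_mean_ln(2)[OF assms(1) ne] assms False by (simp add: mean_excess_def max_def)
qed

text \<open>For |\<zeta>| >= r + s the circle stays where the kernel is the harmonic function ln
  |w|, so the excess vanishes. Nearer to 0, the Lipschitz bound at level max s |\<zeta>| gives at
  most r / |\<zeta>|.\<close>

lemma mean_excess_le:
  assumes "0 < r" "0 < s" "\<zeta> \<noteq> 0"
  shows "mean_excess r s \<zeta> \<le> (if cmod \<zeta> < r + s then r / cmod \<zeta> else 0)"
proof (cases "cmod \<zeta> < r + s")
  case True
  define s' where "s' = max s (cmod \<zeta>)"
  have s': "0 < s'" "cmod \<zeta> \<le> s'" using assms by (auto simp: s'_def less_max_iff_disj)
  have "circle_mean (\<lambda>w. ln (max s (cmod w))) \<zeta> r \<le> (\<integral>t. ln s' + r / cmod \<zeta> \<partial>circ)"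
    unfolding circle_mean_def
  proof (intro integral_mono integrable_circle continuous_ln_max assms)
    fix t
    have n: "cmod (\<zeta> + r * cis t) \<le> cmod \<zeta> + r" using norm_triangle_ineq[of \<zeta> "r * cis t"] assms by (simp add: norm_mult)
    have "ln (max s (cmod (\<zeta> + r * cis t))) \<le> ln (max s' (cmod \<zeta> + r))"
      using n assms by (intro ln_mono) (auto simp: s'_def less_max_iff_disj)
    also have "\<dots> \<le> ln (max s' (cmod \<zeta>)) + r / s'"
      using ln_max_lipschitz[OF s'(1), of "cmod \<zeta> + r" "cmod \<zeta>"] assms by simp
    also have "max s' (cmod \<zeta>) = s'" using s' by (simp add: max_def)
    also have "ln s' + r / s' \<le> ln s' + r / cmod \<zeta>"
      using assms s' by (intro add_left_mono divide_left_mono) auto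
    finally show "ln (max s (cmod (\<zeta> + r * cis t))) \<le> ln s' + r / cmod \<zeta>" .
  qed auto
  then show ?thesis using True by (simp add: mean_excess_def circ.prob_space[simplified] s'_def)
next
  case False
  then have ne: "cmod \<zeta> \<noteq> r" using assms by auto
  have "max s (cmod (\<zeta> + r * cis t)) = cmod (\<zeta> + r * cis t)" for t
  proof -
    have "cmod \<zeta> \<le> cmod (\<zeta> + r * cis t) + cmod (r * cis t)" using norm_triangle_ineq4[of "\<zeta> + r * cis t" "r * cis t"] by simp
    then show ?thesis using False assms by (simp add: norm_mult max_def)
  qed
  then have "circle_mean (\<lambda>w. ln (max s (cmod w))) \<zeta> r = ln (cmod \<zeta>)"
    using circ_mean_ln(2)[OF assms(1) ne] False assms by (simp add: circle_mean_def max_def)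
  then show ?thesis using False assms by (simp add: mean_excess_def max_def)
qed

context disc_prob
begin

interpretation cs: pair_sigma_finite circ \<sigma>
  by (intro pair_sigma_finite.intro circ.sigma_finite_measure_axioms sigma_finite_measure_axioms)
interpretation cp: pair_prob_space circ \<sigma> ..

lemma circle_mean_log_potential:
  assumes r: "0 < r" and s: "0 < s"
  shows "integrable \<sigma> (\<lambda>y. mean_excess r s (z - y))"
    and "circle_mean (log_potential \<sigma> s) z r - log_potential \<sigma> s z = (\<integral>y. mean_excess r s (z - y) \<partial>\<sigma>)"
proof -
  define f where "f t y = ln (max s (cmod (z + r * cis t - y))) - ln (max s (cmod (z - y)))" for t y
  have fb: "\<bar>f t y\<bar> \<le> r / s" for t y
  proof -
    have "\<bar>cmod (z + r * cis t - y) - cmod (z - y)\<bar> \<le> cmod ((z + r * cis t - y) - (z - y))" by (rule norm_triangle_ineq3)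
    also have "\<dots> = r" using r by (simp add: norm_mult)
    finally show ?thesis using ln_max_lipschitz[OF s, of "cmod (z + r * cis t - y)" "cmod (z - y)"] s
      unfolding f_def by (meson divide_right_mono less_imp_le order_trans)
  qed
  have m: "case_prod f \<in> borel_measurable (circ \<Otimes>\<^sub>M \<sigma>)" unfolding f_def by measurable
  have int: "integrable (circ \<Otimes>\<^sub>M \<sigma>) (case_prod f)"
    using fb m by (intro cp.P.integrable_const_bound[where B="r / s"]) (auto intro!: AE_I2)
  have fub: "(\<integral>y. (\<integral>t. f t y \<partial>circ) \<partial>\<sigma>) = (\<integral>t. (\<integral>y. f t y \<partial>\<sigma>) \<partial>circ)"
    by (rule cs.Fubini_integral[OF int])
  have k: "(\<integral>t. f t y \<partial>circ) = mean_excess r s (z - y)" for y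
    unfolding f_def mean_excess_def circle_mean_def
    using integrable_circle[OF continuous_ln_max[OF s], of "z - y" r] by (simp add: circ.prob_space[simplified] algebra_simps)
  have "(\<integral>y. f t y \<partial>\<sigma>) = log_potential \<sigma> s (z + r * cis t) - log_potential \<sigma> s z" for t
    unfolding f_def log_potential_def by (intro Bochner_Integration.integral_diff integrable_ln_max s)
  then have "(\<integral>t. (\<integral>y. f t y \<partial>\<sigma>) \<partial>circ) = circle_mean (log_potential \<sigma> s) z r - log_potential \<sigma> s z"
    unfolding circle_mean_def
    using integrable_circle[OF continuous_log_potential[OF s], of z r] by (simp add: circ.prob_space[simplified])
  with fub show "circle_mean (log_potential \<sigma> s) z r - log_potential \<sigma> s z = (\<integral>y. mean_excess r s (z - y) \<partial>\<sigma>)"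
    by (simp add: k)
  show "integrable \<sigma> (\<lambda>y. mean_excess r s (z - y))"
    using cs.integrable_snd[OF int] by (simp add: k)
qed

lemma log_potential_local_submean:
  assumes "0 < r" "r < s"
  shows "log_potential \<sigma> s z \<le> circle_mean (log_potential \<sigma> s) z r"
proof -
  have "0 \<le> (\<integral>y. mean_excess r s (z - y) \<partial>\<sigma>)"
    using mean_excess_nonneg[OF assms] by (intro Bochner_Integration.integral_nonneg) auto
  then show ?thesis using circle_mean_log_potential(2)[of r s z] assms by simp
qed

text \<open>Only mass within r + s of z keeps the regularised potential from being harmonic at scale
  r. This local form is what later confines the error to the mass near one component.\<close>

lemma circle_mean_log_potential_le:
  assumes z: "regular_point \<sigma> z" and r: "0 < r" and s: "0 < s"
  shows "circle_mean (log_potential \<sigma> s) z r - log_potential \<sigma> s z \<le> r * near_potential \<sigma> (r + s) z"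
proof -
  note i = regular_point_integrable[OF z]
  have "(\<integral>y. mean_excess r s (z - y) \<partial>\<sigma>) \<le> (\<integral>y. r * (if cmod (z - y) < r + s then 1 / cmod (z - y) else 0) \<partial>\<sigma>)"
  proof (intro integral_mono_AE circle_mean_log_potential(1) r s)
    show "AE y in \<sigma>. mean_excess r s (z - y) \<le> r * (if cmod (z - y) < r + s then 1 / cmod (z - y) else 0)"
      using i(5)
    proof eventually_elim
      case (elim y)
      then have "z - y \<noteq> 0" by simp
      from mean_excess_le[OF r s this] show ?case by (auto split: if_splits)
    qed
  qed (use i(4) in auto)
  then show ?thesis unfolding circle_mean_log_potential(2)[OF r s] near_potential_eq by simp
qed

end

section \<open>Root measures of polynomials\<close>

lemma integral_root_dist:
  fixes f :: "complex \<Rightarrow> 'b :: {banach, second_countable_topology}"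
  assumes "0 < degree q"
  shows "integral\<^sup>L (root_dist q) f = (\<Sum>x\<in>#proots q. f x) /\<^sub>R real (degree q)"
proof -
  have ne: "proots q \<noteq> {#}" using assms size_proots_complex[of q] by auto
  have "integral\<^sup>L (root_dist q) f = (\<Sum>a\<in>set_mset (proots q). pmf (pmf_of_multiset (proots q)) a *\<^sub>R f a)"
    unfolding root_dist_def using ne by (intro integral_measure_pmf) auto
  also have "\<dots> = (\<Sum>a\<in>set_mset (proots q). (count (proots q) a *\<^sub>R f a)) /\<^sub>R real (degree q)"
    using ne by (simp add: size_proots_complex scaleR_sum_right divide_inverse mult.commute)
  also have "(\<Sum>a\<in>set_mset A. (count A a *\<^sub>R f a)) = (\<Sum>x\<in>#A. f x)" for A
  proof (induction A)
    case (add x A)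
    have "(\<Sum>a\<in>set_mset (add_mset x A). (count (add_mset x A) a *\<^sub>R f a))
      = (\<Sum>a\<in>insert x (set_mset A). count A a *\<^sub>R f a + (if a = x then f a else 0))"
      by (intro sum.cong) (auto simp: algebra_simps)
    also have "\<dots> = (\<Sum>a\<in>insert x (set_mset A). count A a *\<^sub>R f a) + f x"
      by (simp add: sum.distrib)
    also have "(\<Sum>a\<in>insert x (set_mset A). count A a *\<^sub>R f a) = (\<Sum>a\<in>set_mset A. count A a *\<^sub>R f a)"
      by (cases "x \<in># A") (auto simp: insert_absorb not_in_iff)
    finally show ?case using add by simp
  qed simp
  finally show ?thesis .
qed

text \<open>\<open>root_dist\<close> carries the discrete \<sigma>-algebra of a pmf. The
  push-forward to the Borel sets makes \<open>disc_prob\<close>, and with it products with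
  \<open>lborel\<close>, available.\<close>

definition root_measure :: "complex poly \<Rightarrow> complex measure" where
  "root_measure q = distr (root_dist q) borel (\<lambda>x. x)"

lemma integral_root_measure:
  fixes f :: "complex \<Rightarrow> 'b :: {banach, second_countable_topology}"
  assumes "0 < degree q" and [measurable]: "f \<in> borel_measurable borel"
  shows "integral\<^sup>L (root_measure q) f = (\<Sum>x\<in>#proots q. f x) /\<^sub>R real (degree q)"
proof -
  have "integral\<^sup>L (root_measure q) f = integral\<^sup>L (root_dist q) f"
    unfolding root_measure_def by (rule integral_distr) (auto simp: root_dist_def)
  then show ?thesis using integral_root_dist[OF assms(1)] by simp
qed

lemma weak_star_conv_root_measure:
  "weak_star_conv (\<lambda>k. root_measure (q k)) \<mu> \<longleftrightarrow> weak_star_conv (\<lambda>k. root_dist (q k)) \<mu>"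
proof -
  have "integral\<^sup>L (root_measure p) f = integral\<^sup>L (root_dist p) f" if "continuous_on UNIV f" for p and f :: "complex \<Rightarrow> real"
    unfolding root_measure_def using borel_measurable_continuous_onI[OF that]
    by (intro integral_distr) (auto simp: root_dist_def)
  then show ?thesis unfolding weak_star_conv_def by (simp cong: conj_cong imp_cong)
qed

lemma disc_prob_root_measure:
  assumes "0 < degree q" and roots: "\<And>z. poly q z = 0 \<Longrightarrow> cmod z \<le> R"
  shows "disc_prob (root_measure q) R"
proof -
  have ne: "proots q \<noteq> {#}" "q \<noteq> 0" using assms size_proots_complex[of q] by auto
  have "prob_space (root_measure q)"
    unfolding root_measure_def root_dist_def
    by (rule prob_space.prob_space_distr[OF prob_space_measure_pmf]) simp
  moreover have "AE y in root_measure q. cmod y \<le> R"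
    unfolding root_measure_def root_dist_def
    using roots ne by (subst AE_distr_iff) (auto simp: AE_measure_pmf_iff)
  moreover have "sets (root_measure q) = sets borel" by (simp add: root_measure_def)
  ultimately show ?thesis by (simp add: disc_prob_def disc_prob_axioms_def)
qed

lemma poly_eq_prod_roots: "poly q z = lead_coeff q * (\<Prod>w\<in>#proots q. z - w)" for q :: "complex poly"
proof -
  have "poly q z = poly (smult (lead_coeff q) (\<Prod>x\<in>#proots q. [:-x, 1:])) z"
    by (simp only: complex_poly_decompose_multiset)
  also have "\<dots> = lead_coeff q * (\<Prod>w\<in>#proots q. z - w)"
    by (simp add: poly_prod_mset multiset.map_comp o_def)
  finally show ?thesis .
qed

lemma ln_norm_prod_mset:
  fixes z :: complex
  shows "z \<notin># A \<Longrightarrow> ln (cmod (\<Prod>w\<in>#A. z - w)) = (\<Sum>w\<in>#A. ln (cmod (z - w)))"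
proof (induction A)
  case (add x A)
  then have "(\<Prod>w\<in>#A. z - w) \<noteq> 0" by (auto simp: prod_mset_zero_iff)
  then show ?case using add by (simp add: norm_mult ln_mult)
qed simp

lemma poly_pderiv_prod_mset:
  fixes z :: complex
  shows "z \<notin># A \<Longrightarrow> poly (pderiv (\<Prod>x\<in>#A. [:-x, 1:])) z = (\<Prod>w\<in>#A. z - w) * (\<Sum>w\<in>#A. 1 / (z - w))"
proof (induction A)
  case (add x A)
  have p: "poly (\<Prod>x\<in>#A. [:-x, 1:]) z = (\<Prod>w\<in>#A. z - w)"
    by (simp add: poly_prod_mset multiset.map_comp o_def)
  have "poly (pderiv (\<Prod>x\<in>#add_mset x A. [:-x, 1:])) z
     = (z - x) * poly (pderiv (\<Prod>x\<in>#A. [:-x, 1:])) z + (\<Prod>w\<in>#A. z - w)"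
    by (simp add: pderiv_mult pderiv_pCons p algebra_simps del: mult_pCons_left)
  also have "poly (pderiv (\<Prod>x\<in>#A. [:-x, 1:])) z = (\<Prod>w\<in>#A. z - w) * (\<Sum>w\<in>#A. 1 / (z - w))"
    using add by simp
  also have "(z - x) * ((\<Prod>w\<in>#A. z - w) * (\<Sum>w\<in>#A. 1 / (z - w))) + (\<Prod>w\<in>#A. z - w)
      = (\<Prod>w\<in>#add_mset x A. z - w) * (\<Sum>w\<in>#add_mset x A. 1 / (z - w))"
    using add.prems by (simp add: field_simps)
  finally show ?case .
qed (simp add: pderiv_1)

lemma poly_pderiv_eq:
  fixes q :: "complex poly"
  assumes "poly q z \<noteq> 0"
  shows "poly (pderiv q) z = poly q z * (\<Sum>w\<in>#proots q. 1 / (z - w))"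
proof -
  have q: "q \<noteq> 0" using assms by auto
  then have nz: "z \<notin># proots q" using assms by simp
  have "pderiv q = pderiv (smult (lead_coeff q) (\<Prod>x\<in>#proots q. [:-x, 1:]))"
    by (simp only: complex_poly_decompose_multiset)
  then have "poly (pderiv q) z = lead_coeff q * poly (pderiv (\<Prod>x\<in>#proots q. [:-x, 1:])) z"
    by (simp only: pderiv_smult poly_smult)
  then show ?thesis using poly_pderiv_prod_mset[OF nz] by (simp add: poly_eq_prod_roots[of q])
qed

lemma potential_root_measure:
  assumes "0 < degree q" "poly q z \<noteq> 0"
  shows "real (degree q) * potential (root_measure q) z = ln (cmod (poly q z)) - ln (cmod (lead_coeff q))"
proof -
  have q: "q \<noteq> 0" using assms by auto
  then have nz: "z \<notin># proots q" using assms by simp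
  have "potential (root_measure q) z = (\<Sum>w\<in>#proots q. ln (cmod (z - w))) / degree q"
    unfolding potential_def using assms(1) by (subst integral_root_measure) (auto simp: divide_inverse mult.commute)
  also have "(\<Sum>w\<in>#proots q. ln (cmod (z - w))) = ln (cmod (\<Prod>w\<in>#proots q. z - w))"
    using ln_norm_prod_mset[OF nz] by simp
  also have "\<dots> = ln (cmod (poly q z)) - ln (cmod (lead_coeff q))"
  proof -
    have "(\<Prod>w\<in>#proots q. z - w) \<noteq> 0" using nz by (auto simp: prod_mset_zero_iff)
    then show ?thesis using q unfolding poly_eq_prod_roots[of q] norm_mult by (subst ln_mult_pos) auto
  qed
  finally show ?thesis using assms by simp
qed

lemma cauchy_root_measure:
  assumes "0 < degree q" "poly q z \<noteq> 0"
  shows "cauchy_transform (root_measure q) z = poly (pderiv q) z / (degree q * poly q z)"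
proof -
  have "cauchy_transform (root_measure q) z = (\<Sum>w\<in>#proots q. 1 / (z - w)) / degree q"
    unfolding cauchy_transform_def using assms(1)
    by (subst integral_root_measure) (auto simp: divide_inverse scaleR_conv_of_real mult.commute)
  then show ?thesis using poly_pderiv_eq[OF assms(2)] assms by simp
qed

text \<open>The logarithm of q' = n q C. The leading coefficient of q' is n times that of q, and the
  resulting ln n cancels the one from the factor n in front of C.\<close>

lemma potential_pderiv:
  assumes n: "2 \<le> degree q" and nz: "poly q z \<noteq> 0" "poly (pderiv q) z \<noteq> 0"
  shows "(real (degree q) - 1) * potential (root_measure (pderiv q)) z
    = real (degree q) * potential (root_measure q) z + ln (cmod (cauchy_transform (root_measure q) z))"
proof -
  define n where "n = degree q"
  have d: "degree (pderiv q) = n - 1" by (simp add: degree_pderiv n_def)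
  have n2: "2 \<le> n" using n by (simp add: n_def)
  have lc: "lead_coeff (pderiv q) = of_nat n * lead_coeff q"
    using n2 by (simp add: coeff_pderiv d) (simp add: n_def)
  have q0: "lead_coeff q \<noteq> 0" using nz by auto
  have "(real n - 1) * potential (root_measure (pderiv q)) z = ln (cmod (poly (pderiv q) z)) - ln (n * cmod (lead_coeff q))"
    using potential_root_measure[of "pderiv q" z] n2 nz(2) unfolding lc by (simp add: d norm_mult of_nat_diff)
  also have "ln (n * cmod (lead_coeff q)) = ln n + ln (cmod (lead_coeff q))"
    using q0 n2 by (simp add: ln_mult_pos)
  also have "ln (cmod (poly (pderiv q) z)) - (ln n + ln (cmod (lead_coeff q)))
     = (ln (cmod (poly q z)) - ln (cmod (lead_coeff q))) + (ln (cmod (poly (pderiv q) z)) - ln n - ln (cmod (poly q z)))" by simp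
  also have "ln (cmod (poly (pderiv q) z)) - ln n - ln (cmod (poly q z)) = ln (cmod (cauchy_transform (root_measure q) z))"
  proof -
    have "cmod (cauchy_transform (root_measure q) z) = cmod (poly (pderiv q) z) / (n * cmod (poly q z))"
      using cauchy_root_measure[of q z] n nz by (simp add: n_def norm_divide norm_mult)
    then show ?thesis using nz n2 by (simp add: ln_div ln_mult_pos)
  qed
  also have "ln (cmod (poly q z)) - ln (cmod (lead_coeff q)) = real n * potential (root_measure q) z"
    using potential_root_measure[of q z] n nz by (simp add: n_def)
  finally show ?thesis by (simp add: n_def)
qed

text \<open>The Gauss-Lucas theorem for a disc: if all roots \<^term>\<open>w\<close> have smaller modulus than \<^term>\<open>z\<close>,
  then every \<^term>\<open>z / (z - w)\<close> has positive real part.\<close>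

lemma pderiv_roots_in_disc:
  fixes q :: "complex poly"
  assumes n: "0 < degree q" and roots: "\<And>w. poly q w = 0 \<Longrightarrow> cmod w < R" and z: "poly (pderiv q) z = 0"
  shows "cmod z < R"
proof (rule ccontr)
  assume "\<not> cmod z < R"
  then have zR: "R \<le> cmod z" by simp
  have q: "q \<noteq> 0" using n by auto
  have nz: "poly q z \<noteq> 0" using roots[of z] zR by auto
  have ne: "proots q \<noteq> {#}" using n size_proots_complex[of q] by auto
  have "(\<Sum>w\<in>#proots q. 1 / (z - w)) = 0" using poly_pderiv_eq[OF nz] z nz by simp
  then have 0: "Re (z * (\<Sum>w\<in>#proots q. 1 / (z - w))) = 0" by simp
  have sum: "Re (z * (\<Sum>w\<in>#A. 1 / (z - w))) = (\<Sum>w\<in>#A. Re (z / (z - w)))" for A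
    by (induction A) (simp_all add: algebra_simps)
  have pos: "0 < Re (z / (z - w))" if "w \<in># proots q" for w
  proof -
    have w: "cmod w < cmod z" using roots[of w] that q zR by auto
    have "Re (z * cnj w) \<le> cmod z * cmod w" using complex_Re_le_cmod[of "z * cnj w"] by (simp add: norm_mult)
    also have "\<dots> < cmod z * cmod z" using w by (intro mult_strict_left_mono) (auto intro: le_less_trans[OF norm_ge_zero])
    also have "\<dots> = (Re z)\<^sup>2 + (Im z)\<^sup>2" unfolding cmod_power2[symmetric] by (rule power2_eq_square[symmetric])
    finally have "0 < Re z * Re (z - w) + Im z * Im (z - w)" by (simp add: algebra_simps power2_eq_square)
    moreover have "0 < (Re (z - w))\<^sup>2 + (Im (z - w))\<^sup>2"
    proof -
      have "z \<noteq> w" using w by auto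
      then show ?thesis by (auto simp: sum_power2_gt_zero_iff complex_eq_iff)
    qed
    ultimately show ?thesis by (simp add: Re_divide)
  qed
  have "A \<noteq> {#} \<Longrightarrow> (\<And>w. w \<in># A \<Longrightarrow> 0 < Re (z / (z - w))) \<Longrightarrow> 0 < (\<Sum>w\<in>#A. Re (z / (z - w)))" for A
  proof (induction A)
    case (add x A)
    show ?case
    proof (cases "A = {#}")
      case False
      then have "0 < (\<Sum>w\<in>#A. Re (z / (z - w)))" using add by auto
      then show ?thesis using add.prems(2)[of x] by simp
    qed (use add.prems(2)[of x] in simp)
  qed simp
  from this[OF ne pos] show False using 0 unfolding sum by simp
qed

lemma AE_not_root:
  fixes q :: "complex poly"
  assumes "q \<noteq> 0"
  shows "AE z in lborel. poly q z \<noteq> 0"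
proof -
  have "{z. poly q z = 0} \<in> null_sets lborel"
    using poly_roots_finite[OF assms] by (intro finite_imp_null_set_lborel)
  then show ?thesis by (rule AE_not_in[THEN eventually_mono]) auto
qed

section \<open>Potentials of the derivatives: identity almost everywhere, upper bound, lower
  bound\<close>

locale root_seq =
  fixes q :: "nat \<Rightarrow> complex poly" and \<mu> :: "complex measure" and R :: real
  assumes degree_ge_2: "\<And>k. 2 \<le> degree (q k)"
    and degree_lim: "filterlim (\<lambda>k. degree (q k)) at_top sequentially"
    and roots_in_disc: "\<And>k z. poly (q k) z = 0 \<Longrightarrow> cmod z < R"
    and lim_disc: "disc_prob \<mu> R"
    and weak_roots: "weak_star_conv (\<lambda>k. root_dist (q k)) \<mu>"
begin

abbreviation "\<sigma> k \<equiv> root_measure (q k)"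
abbreviation "\<sigma>' k \<equiv> root_measure (pderiv (q k))"

lemma disc_k: "disc_prob (\<sigma> k) R"
  using degree_ge_2[of k] roots_in_disc[of k] by (intro disc_prob_root_measure) (auto intro: less_imp_le)

lemma disc_k': "disc_prob (\<sigma>' k) R"
proof (intro disc_prob_root_measure)
  show "0 < degree (pderiv (q k))" using degree_ge_2[of k] by (simp add: degree_pderiv)
  show "cmod z \<le> R" if "poly (pderiv (q k)) z = 0" for z
    using pderiv_roots_in_disc[of "q k" R z] degree_ge_2[of k] roots_in_disc[of k] that by (auto intro: less_imp_le)
qed

sublocale disc_conv \<sigma> \<mu> R
  by (intro disc_conv.intro disc_k lim_disc) (simp add: weak_star_conv_root_measure weak_roots)

lemma pderiv_nonzero: "pderiv (q k) \<noteq> 0" "q k \<noteq> 0"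
  using degree_ge_2[of k] by (auto simp: pderiv_eq_0_iff)

lemma degree_inverse_tendsto: "(\<lambda>k. c / (real (degree (q k)) - 1)) \<longlonglongrightarrow> 0"
proof -
  have "filterlim (\<lambda>k. real (degree (q k))) at_top sequentially"
    by (rule filterlim_compose[OF filterlim_real_sequentially degree_lim])
  then have "filterlim (\<lambda>k. real (degree (q k)) - 1) at_top sequentially"
    using filterlim_tendsto_add_at_top[OF tendsto_const[of "-1"]] by force
  then show ?thesis by (intro tendsto_divide_0[OF tendsto_const] filterlim_at_top_imp_at_infinity)
qed

text \<open>The identity is solved for the potential of the derivative, so that the correction to
  p_k carries the factor 1 / (n_k - 1). All exceptional points are gathered here: for each k the
  irregular points are null and the roots finite in number.\<close>

lemma AE_potential_pderiv:
  "AE z in lborel. regular_point (\<sigma> k) z \<and> regular_point (\<sigma>' k) z \<and> poly (q k) z \<noteq> 0 \<and> poly (pderiv (q k)) z \<noteq> 0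
     \<and> potential (\<sigma>' k) z = potential (\<sigma> k) z + (potential (\<sigma> k) z + ln (cmod (cauchy_transform (\<sigma> k) z))) / (real (degree (q k)) - 1)"
  using disc_prob.AE_regular_point[OF disc_k[of k]] disc_prob.AE_regular_point[OF disc_k'[of k]]
    AE_not_root[OF pderiv_nonzero(1)[of k]] AE_not_root[OF pderiv_nonzero(2)[of k]]
proof eventually_elim
  case (elim z)
  define n where "n = real (degree (q k))"
  have n: "0 < n - 1" using degree_ge_2[of k] by (simp add: n_def)
  have "(n - 1) * potential (\<sigma>' k) z = n * potential (\<sigma> k) z + ln (cmod (cauchy_transform (\<sigma> k) z))"
    using potential_pderiv[OF degree_ge_2[of k]] elim by (simp add: n_def)
  then have "potential (\<sigma>' k) z = potential (\<sigma> k) z + (potential (\<sigma> k) z + ln (cmod (cauchy_transform (\<sigma> k) z))) / (n - 1)"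
    using n by (simp add: field_simps)
  then show ?case using elim by (simp add: n_def)
qed

lemma norm_cauchy_le:
  assumes \<nu>: "disc_prob \<nu> R" and z: "regular_point \<nu> z"
  shows "cmod (cauchy_transform \<nu> z) \<le> 1 + near_potential \<nu> 1 z"
proof -
  interpret n: disc_prob \<nu> R by fact
  note i = n.regular_point_integrable[OF z]
  have "cmod (cauchy_transform \<nu> z) \<le> (\<integral>y. cmod (1 / (z - y)) \<partial>\<nu>)"
    unfolding cauchy_transform_def by (rule integral_norm_bound)
  also have "\<dots> \<le> (\<integral>y. 1 + (if cmod (z - y) < 1 then 1 / cmod (z - y) else 0) \<partial>\<nu>)"
    using i by (intro integral_mono) (auto simp: norm_divide divide_le_eq_1)
  also have "\<dots> = 1 + near_potential \<nu> 1 z"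
    using i by (simp add: n.near_potential_eq n.prob_space[simplified])
  finally show ?thesis .
qed

text \<open>Since ln |C_k| <= |C_k| <= 1 + \<open>near_potential (\<sigma> k) 1\<close>, the
  correction is at most a function with bounded L1 norm divided by n_k - 1. Hence the positive part
  of p'_k - p tends to 0 in L1 on discs, and \<open>log_potential_compare\<close> makes this a bound
  that is uniform on discs.\<close>

lemma log_potential_pderiv_upper:
  assumes s: "0 < s" and \<epsilon>: "0 < \<epsilon>"
  shows "\<forall>\<^sub>F k in sequentially. \<forall>z\<in>cball 0 R1. log_potential (\<sigma>' k) s z \<le> log_potential \<mu> s z + \<epsilon>"
proof -
  \<comment> \<open>With this \<eta> and \<open>\<epsilon>1\<close> below, each of the two terms of
    the comparison equals \<epsilon> / 2.\<close>
  define \<eta> where "\<eta> = \<epsilon> * s / 4"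
  have \<eta>: "0 < \<eta>" "2 * \<eta> / s = \<epsilon> / 2" using s \<epsilon> by (auto simp: \<eta>_def)
  define R2 where "R2 = \<bar>R1\<bar> + \<eta> + s"
  have R2: "0 < R2" using \<eta> s by (simp add: R2_def)
  have R0: "0 \<le> R" by (rule lim.R_nonneg)
  define c where "c = ln (R2 + R + 1)"
  have c: "0 \<le> c" using R2 R0 by (simp add: c_def)
  define N where "N k = real (degree (q k)) - 1" for k
  have N: "0 < N k" for k using degree_ge_2[of k] by (simp add: N_def)
  define e where "e k z = ennreal \<bar>potential (\<sigma> k) z - potential \<mu> z\<bar> + ennreal ((c + 1 + near_potential (\<sigma> k) 1 z) / N k)" for k z
  have m [measurable]: "potential (\<sigma> k) \<in> borel_measurable borel" "near_potential (\<sigma> k) 1 \<in> borel_measurable borel" for k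
    using disc_prob.measurable_potential[OF disc_k] disc_prob.measurable_near_potential[OF disc_k] by auto
  have em [measurable]: "e k \<in> borel_measurable borel" for k unfolding e_def by measurable
  have cb [measurable]: "cball (0::complex) R2 \<in> sets borel" by simp
  \<comment> \<open>Bounds the integral of c + 1 + near potential over the disc; 16 is the planar
    bound for radius 1 and total mass 1.\<close>
  define K where "K = (c + 1) * measure lborel (cball (0 :: complex) R2) + 16"
  have K: "0 \<le> K" using c by (simp add: K_def)
  have eint: "(\<integral>\<^sup>+z. indicator (cball 0 R2) z * e k z \<partial>lborel)
    \<le> (\<integral>\<^sup>+z. indicator (cball 0 R2) z * ennreal \<bar>potential (\<sigma> k) z - potential \<mu> z\<bar> \<partial>lborel) + ennreal (K / N k)" for k
  proof -
    interpret s: disc_prob "\<sigma> k" R by (rule disc_k)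
    have "(\<integral>\<^sup>+z. indicator (cball 0 R2) z * e k z \<partial>lborel)
      = (\<integral>\<^sup>+z. indicator (cball 0 R2) z * ennreal \<bar>potential (\<sigma> k) z - potential \<mu> z\<bar> 
          + ennreal (1 / N k) * (ennreal (c + 1) * indicator (cball 0 R2) z + indicator (cball 0 R2) z * ennreal (near_potential (\<sigma> k) 1 z)) \<partial>lborel)"
    proof (intro nn_integral_cong)
      fix z
      have "ennreal ((c + 1 + near_potential (\<sigma> k) 1 z) / N k) = ennreal (1 / N k) * (ennreal (c + 1) + ennreal (near_potential (\<sigma> k) 1 z))"
        using N[of k] c s.near_potential_nonneg[of 1 z]
        by (simp add: ennreal_mult[symmetric] ennreal_plus[symmetric] del: ennreal_plus)
      then show "indicator (cball 0 R2) z * e k z = indicator (cball 0 R2) z * ennreal \<bar>potential (\<sigma> k) z - potential \<mu> z\<bar> 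
          + ennreal (1 / N k) * (ennreal (c + 1) * indicator (cball 0 R2) z + indicator (cball 0 R2) z * ennreal (near_potential (\<sigma> k) 1 z))"
        unfolding e_def by (cases "z \<in> cball 0 R2") (auto simp: distrib_left)
    qed
    also have "\<dots> = (\<integral>\<^sup>+z. indicator (cball 0 R2) z * ennreal \<bar>potential (\<sigma> k) z - potential \<mu> z\<bar> \<partial>lborel)
        + ennreal (1 / N k) * ((\<integral>\<^sup>+z. ennreal (c + 1) * indicator (cball 0 R2) z \<partial>(lborel :: complex measure)) + (\<integral>\<^sup>+z. indicator (cball 0 R2) z * ennreal (near_potential (\<sigma> k) 1 z) \<partial>lborel))"
    proof -
      let ?a = "\<lambda>z. indicator (cball 0 R2) z * ennreal \<bar>potential (\<sigma> k) z - potential \<mu> z\<bar>"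
      let ?b = "\<lambda>z :: complex. ennreal (c + 1) * indicator (cball 0 R2) z"
      let ?c = "\<lambda>z. indicator (cball 0 R2) z * ennreal (near_potential (\<sigma> k) 1 z)"
      have "?a \<in> borel_measurable lborel" "?b \<in> borel_measurable lborel" "?c \<in> borel_measurable lborel" by measurable
      then show ?thesis by (subst nn_integral_add, simp, simp, subst nn_integral_cmult, simp, subst nn_integral_add, simp_all)
    qed
    also have "\<dots> \<le> (\<integral>\<^sup>+z. indicator (cball 0 R2) z * ennreal \<bar>potential (\<sigma> k) z - potential \<mu> z\<bar> \<partial>lborel)
        + ennreal (1 / N k) * (ennreal ((c + 1) * measure lborel (cball (0 :: complex) R2)) + ennreal 16)"
    proof (intro add_left_mono mult_left_mono add_mono)
      have "emeasure lborel (cball (0 :: complex) R2) = ennreal (measure lborel (cball (0 :: complex) R2))"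
        using emeasure_bounded_finite[OF bounded_cball, of "0 :: complex" R2] by (intro emeasure_eq_ennreal_measure) auto
      then show "(\<integral>\<^sup>+z. ennreal (c + 1) * indicator (cball 0 R2) z \<partial>(lborel :: complex measure)) \<le> ennreal ((c + 1) * measure lborel (cball (0 :: complex) R2))"
        using c by (subst nn_integral_cmult_indicator) (auto simp: ennreal_mult)
      show "(\<integral>\<^sup>+z. indicator (cball 0 R2) z * ennreal (near_potential (\<sigma> k) 1 z) \<partial>lborel) \<le> ennreal 16"
        using s.nn_integral_near_potential_le[of 1 UNIV "cball 0 R2"] by (simp add: s.prob_space[simplified])
    qed auto
    also have "ennreal (1 / N k) * (ennreal ((c + 1) * measure lborel (cball (0 :: complex) R2)) + ennreal 16) = ennreal (K / N k)"
    proof -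
      have "ennreal ((c + 1) * measure lborel (cball (0 :: complex) R2)) + ennreal 16 = ennreal K"
        unfolding K_def using c by (intro ennreal_plus[symmetric]) auto
      moreover have "ennreal (1 / N k) * ennreal K = ennreal (K / N k)"
        using N[of k] K by (simp add: ennreal_mult[symmetric])
      ultimately show ?thesis by simp
    qed
    finally show ?thesis .
  qed
  define \<epsilon>1 where "\<epsilon>1 = \<epsilon> / 2 * (pi * \<eta>\<^sup>2)"
  have \<epsilon>1: "0 < \<epsilon>1" using \<epsilon> \<eta> by (simp add: \<epsilon>1_def)
  have "\<forall>\<^sub>F k in sequentially. (\<integral>\<^sup>+z. indicator (cball 0 R2) z * ennreal \<bar>potential (\<sigma> k) z - potential \<mu> z\<bar> \<partial>lborel) < ennreal (\<epsilon>1 / 2)"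
    using L1_tendsto_potential[of R2] \<epsilon>1 by (intro order_tendstoD(2)) auto
  moreover have "\<forall>\<^sub>F k in sequentially. K / N k < \<epsilon>1 / 2"
    using degree_inverse_tendsto[of K] \<epsilon>1 unfolding N_def by (intro order_tendstoD(2)) auto
  ultimately show ?thesis
  proof eventually_elim
    case (elim k)
    interpret s: disc_prob "\<sigma> k" R by (rule disc_k)
    have le: "(\<integral>\<^sup>+z. indicator (cball 0 R2) z * e k z \<partial>lborel) \<le> ennreal \<epsilon>1"
    proof -
      have "(\<integral>\<^sup>+z. indicator (cball 0 R2) z * e k z \<partial>lborel) \<le> ennreal (\<epsilon>1 / 2) + ennreal (K / N k)"
        using eint[of k] elim(1) by (meson add_right_mono less_imp_le order_trans)
      also have "\<dots> \<le> ennreal (\<epsilon>1 / 2) + ennreal (\<epsilon>1 / 2)"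
        using elim(2) by (intro add_left_mono ennreal_leI) auto
      finally show ?thesis using \<epsilon>1 by (simp add: ennreal_plus[symmetric] del: ennreal_plus)
    qed
    have ae: "AE z in lborel. z \<in> cball 0 R2 \<longrightarrow> ennreal (potential (\<sigma>' k) z - potential \<mu> z) \<le> e k z"
      using AE_potential_pderiv[of k]
    proof eventually_elim
      case (elim z)
      show ?case
      proof
        assume z: "z \<in> cball 0 R2"
        have reg: "regular_point (\<sigma> k) z" using elim by simp
        have p1: "potential (\<sigma> k) z \<le> c"
        proof -
          have "potential (\<sigma> k) z \<le> log_potential (\<sigma> k) 1 z" by (rule s.potential_le_log_potential[OF reg]) simp
          also have "\<dots> \<le> c" unfolding c_def by (rule s.log_potential_le) (use z R2 R0 in auto)
          finally show ?thesis .
        qed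
        have nz: "cauchy_transform (\<sigma> k) z \<noteq> 0"
          using cauchy_root_measure[of "q k" z] elim degree_ge_2[of k] by auto
        then have "ln (cmod (cauchy_transform (\<sigma> k) z)) \<le> cmod (cauchy_transform (\<sigma> k) z)" by (intro ln_bound) auto
        also have "\<dots> \<le> 1 + near_potential (\<sigma> k) 1 z" by (rule norm_cauchy_le[OF disc_k reg])
        finally have "(potential (\<sigma> k) z + ln (cmod (cauchy_transform (\<sigma> k) z))) / N k \<le> (c + 1 + near_potential (\<sigma> k) 1 z) / N k"
          using p1 N[of k] by (intro divide_right_mono) auto
        then have "potential (\<sigma>' k) z - potential \<mu> z \<le> \<bar>potential (\<sigma> k) z - potential \<mu> z\<bar> + (c + 1 + near_potential (\<sigma> k) 1 z) / N k"
          using elim unfolding N_def by auto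
        then have "ennreal (potential (\<sigma>' k) z - potential \<mu> z) \<le> ennreal (\<bar>potential (\<sigma> k) z - potential \<mu> z\<bar> + (c + 1 + near_potential (\<sigma> k) 1 z) / N k)"
          by (rule ennreal_leI)
        also have "\<dots> \<le> e k z" unfolding e_def by (rule ennreal_add_le)
        finally show "ennreal (potential (\<sigma>' k) z - potential \<mu> z) \<le> e k z" .
      qed
    qed
    show ?case
    proof
      fix z :: complex assume "z \<in> cball 0 R1"
      then have z: "cmod z + \<eta> + s \<le> R2" by (simp add: R2_def)
      have "log_potential (\<sigma>' k) s z - log_potential \<mu> s z \<le> 2 * \<eta> / s + \<epsilon>1 / (pi * \<eta>\<^sup>2)"
        by (rule log_potential_compare[OF disc_k' lim_disc s \<eta>(1) z em ae le]) (use \<epsilon>1 in simp)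
      also have "\<dots> = \<epsilon>" using \<eta> by (simp add: \<epsilon>1_def)
      finally show "log_potential (\<sigma>' k) s z \<le> log_potential \<mu> s z + \<epsilon>" by simp
    qed
  qed
qed

text \<open>One good point per k is enough. On a set of positive measure |C| exceeds a fixed 1 / (m
  + 1), and for large k some point of it has p_k and C_k close to p and C. There ln |C_k| is bounded
  below independently of k, so its share fades with 1 / (n_k - 1), and the Lipschitz bound carries
  the estimate from that point to x.\<close>

lemma log_potential_pderiv_lower:
  assumes pos: "\<And>\<rho>. 0 < \<rho> \<Longrightarrow> emeasure lborel {z \<in> ball x \<rho>. cauchy_transform \<mu> z \<noteq> 0 \<and> b < potential \<mu> z} \<noteq> 0"
    and s: "0 < s" and \<epsilon>: "0 < \<epsilon>"
  shows "\<forall>\<^sub>F k in sequentially. b - \<epsilon> \<le> log_potential (\<sigma>' k) s x"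
proof -
  \<comment> \<open>Moving from a point of \<open>ball x \<rho>\<close> to x changes the potential
    regularised at radius s by at most \<epsilon> / 4.\<close>
  define \<rho> where "\<rho> = s * \<epsilon> / 4"
  have \<rho>: "0 < \<rho>" "\<rho> / s = \<epsilon> / 4" using s \<epsilon> by (auto simp: \<rho>_def)
  define E where "E m = {z \<in> ball x \<rho>. 1 / real (Suc m) < cmod (cauchy_transform \<mu> z) \<and> b < potential \<mu> z}" for m
  have bm [measurable]: "ball x \<rho> \<in> sets borel" by simp
  have Em: "E m \<in> sets borel" for m unfolding E_def by measurable
  have "\<exists>m. emeasure lborel (E m) \<noteq> 0"
  proof (rule ccontr)
    assume "\<nexists>m. emeasure lborel (E m) \<noteq> 0"
    then have "(\<Union>m. E m) \<in> null_sets lborel" using Em by (intro null_sets_UN) (auto simp: null_sets_def)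
    moreover have "{z \<in> ball x \<rho>. cauchy_transform \<mu> z \<noteq> 0 \<and> b < potential \<mu> z} \<subseteq> (\<Union>m. E m)"
    proof
      fix z assume z: "z \<in> {z \<in> ball x \<rho>. cauchy_transform \<mu> z \<noteq> 0 \<and> b < potential \<mu> z}"
      then obtain m where "inverse (real (Suc m)) < cmod (cauchy_transform \<mu> z)"
        using reals_Archimedean[of "cmod (cauchy_transform \<mu> z)"] by auto
      then have "z \<in> E m" using z by (simp add: E_def inverse_eq_divide)
      then show "z \<in> (\<Union>m. E m)" by blast
    qed
    moreover have "{z \<in> ball x \<rho>. cauchy_transform \<mu> z \<noteq> 0 \<and> b < potential \<mu> z} \<in> sets lborel" by measurable
    ultimately have "{z \<in> ball x \<rho>. cauchy_transform \<mu> z \<noteq> 0 \<and> b < potential \<mu> z} \<in> null_sets lborel"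
      by (meson null_sets_subset)
    then show False using pos[OF \<rho>(1)] by auto
  qed
  then obtain m where m: "emeasure lborel (E m) \<noteq> 0" by blast
  define \<tau> where "\<tau> = min (\<epsilon> / 4) (1 / (2 * real (Suc m)))"
  have \<tau>: "0 < \<tau>" "\<tau> \<le> \<epsilon> / 4" "\<tau> \<le> 1 / (2 * real (Suc m))" using \<epsilon> by (auto simp: \<tau>_def)
  define e where "e k z = ennreal \<bar>potential (\<sigma> k) z - potential \<mu> z\<bar> + ennreal (cmod (cauchy_transform (\<sigma> k) z - cauchy_transform \<mu> z))" for k z
  define \<rho>' where "\<rho>' = cmod x + \<rho>"
  have E_sub: "E m \<subseteq> cball 0 \<rho>'"
  proof
    fix z assume "z \<in> E m"
    then show "z \<in> cball 0 \<rho>'" using norm_triangle_ineq2[of z x] by (simp add: E_def \<rho>'_def dist_norm norm_minus_commute)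
  qed
  have [measurable]: "potential (\<sigma> k) \<in> borel_measurable borel" "cauchy_transform (\<sigma> k) \<in> borel_measurable borel" for k
    using disc_prob.measurable_potential[OF disc_k] disc_prob.measurable_cauchy[OF disc_k] by auto
  have [measurable]: "cball (0::complex) \<rho>' \<in> sets borel" by simp
  have lim2: "(\<lambda>k. (\<integral>\<^sup>+z. indicator (cball 0 \<rho>') z * ennreal \<bar>potential (\<sigma> k) z - potential \<mu> z\<bar> \<partial>lborel) 
     + (\<integral>\<^sup>+z. indicator (cball 0 \<rho>') z * ennreal (cmod (cauchy_transform (\<sigma> k) z - cauchy_transform \<mu> z)) \<partial>lborel)) \<longlonglongrightarrow> 0 + 0"
    by (intro tendsto_add L1_tendsto_potential L1_tendsto_cauchy)
  have le2: "(\<integral>\<^sup>+z. indicator (E m) z * e k z \<partial>lborel) \<le> (\<integral>\<^sup>+z. indicator (cball 0 \<rho>') z * ennreal \<bar>potential (\<sigma> k) z - potential \<mu> z\<bar> \<partial>lborel) 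
     + (\<integral>\<^sup>+z. indicator (cball 0 \<rho>') z * ennreal (cmod (cauchy_transform (\<sigma> k) z - cauchy_transform \<mu> z)) \<partial>lborel)" for k
  proof -
    have "(\<integral>\<^sup>+z. indicator (E m) z * e k z \<partial>lborel) \<le> (\<integral>\<^sup>+z. indicator (cball 0 \<rho>') z * ennreal \<bar>potential (\<sigma> k) z - potential \<mu> z\<bar> 
      + indicator (cball 0 \<rho>') z * ennreal (cmod (cauchy_transform (\<sigma> k) z - cauchy_transform \<mu> z)) \<partial>lborel)"
      using E_sub by (intro nn_integral_mono) (auto simp: e_def indicator_def)
    also have "\<dots> = (\<integral>\<^sup>+z. indicator (cball 0 \<rho>') z * ennreal \<bar>potential (\<sigma> k) z - potential \<mu> z\<bar> \<partial>lborel) 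
     + (\<integral>\<^sup>+z. indicator (cball 0 \<rho>') z * ennreal (cmod (cauchy_transform (\<sigma> k) z - cauchy_transform \<mu> z)) \<partial>lborel)"
      by (subst nn_integral_add) measurable
    finally show ?thesis .
  qed
  have lim0: "(\<lambda>k. \<integral>\<^sup>+z. indicator (E m) z * e k z \<partial>lborel) \<longlonglongrightarrow> 0"
    using lim2 le2 by (intro tendsto_sandwich[OF _ _ tendsto_const lim2[unfolded add_0]] always_eventually allI) simp_all
  define Nk where "Nk k = {z. \<not> (regular_point (\<sigma> k) z \<and> regular_point (\<sigma>' k) z \<and> poly (q k) z \<noteq> 0 \<and> poly (pderiv (q k)) z \<noteq> 0
     \<and> potential (\<sigma>' k) z = potential (\<sigma> k) z + (potential (\<sigma> k) z + ln (cmod (cauchy_transform (\<sigma> k) z))) / (real (degree (q k)) - 1))}" for k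
  have "AE z in lborel. z \<notin> Nk k" for k
    using AE_potential_pderiv[of k] by eventually_elim (simp add: Nk_def)
  then have ex: "\<forall>\<^sub>F k in sequentially. \<exists>z\<in>E m - Nk k. e k z < ennreal \<tau>"
    by (intro eventually_ex_small[OF lim0 Em m \<tau>(1)])
  \<comment> \<open>A lower bound, independent of k, for p_k + ln |C_k| at the good point.\<close>
  define d where "d = b - \<epsilon> / 4 + ln (1 / (2 * real (Suc m)))"
  have "\<forall>\<^sub>F k in sequentially. - (\<epsilon> / 4) < d / (real (degree (q k)) - 1)"
    using degree_inverse_tendsto[of d] \<epsilon> by (intro order_tendstoD(1)) auto
  with ex show ?thesis
  proof eventually_elim
    case (elim k)
    interpret s': disc_prob "\<sigma>' k" R by (rule disc_k')
    define N where "N = real (degree (q k)) - 1"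
    have N: "0 < N" using degree_ge_2[of k] by (simp add: N_def)
    obtain z where z: "z \<in> E m" "z \<notin> Nk k" "e k z < ennreal \<tau>" using elim by blast
    have "ennreal \<bar>potential (\<sigma> k) z - potential \<mu> z\<bar> < ennreal \<tau>"
      using z(3) unfolding e_def by (rule le_less_trans[rotated]) simp
    then have e1: "\<bar>potential (\<sigma> k) z - potential \<mu> z\<bar> < \<tau>" by (subst (asm) ennreal_less_iff) auto
    have "ennreal (cmod (cauchy_transform (\<sigma> k) z - cauchy_transform \<mu> z)) < ennreal \<tau>"
      using z(3) unfolding e_def by (rule le_less_trans[rotated]) simp
    then have e2: "cmod (cauchy_transform (\<sigma> k) z - cauchy_transform \<mu> z) < \<tau>" by (subst (asm) ennreal_less_iff) auto
    have C: "1 / (2 * real (Suc m)) < cmod (cauchy_transform (\<sigma> k) z)"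
    proof -
      have "1 / real (Suc m) < cmod (cauchy_transform \<mu> z)" using z(1) by (simp add: E_def)
      also have "\<dots> \<le> cmod (cauchy_transform (\<sigma> k) z) + cmod (cauchy_transform (\<sigma> k) z - cauchy_transform \<mu> z)"
        using norm_triangle_ineq2[of "cauchy_transform \<mu> z" "cauchy_transform (\<sigma> k) z"] by (simp add: norm_minus_commute)
      also have "\<dots> < cmod (cauchy_transform (\<sigma> k) z) + 1 / (2 * real (Suc m))" using e2 \<tau>(3) by linarith
      finally have "1 / real (Suc m) < cmod (cauchy_transform (\<sigma> k) z) + 1 / (2 * real (Suc m))" .
      moreover have "1 / real (Suc m) = 1 / (2 * real (Suc m)) + 1 / (2 * real (Suc m))" by (simp add: field_simps)
      moreover have "x < y + h \<Longrightarrow> x = h + h \<Longrightarrow> h < y" for x y h :: real by linarith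
      ultimately show ?thesis by blast
    qed
    have lnC: "ln (1 / (2 * real (Suc m))) \<le> ln (cmod (cauchy_transform (\<sigma> k) z))"
      using C by (intro ln_mono) auto
    have pk: "b - \<epsilon> / 4 \<le> potential (\<sigma> k) z" using e1 \<tau>(2) z(1) by (auto simp: E_def)
    have "- (\<epsilon> / 4) \<le> d / N" using elim(2) by (simp add: N_def)
    also have "\<dots> \<le> (potential (\<sigma> k) z + ln (cmod (cauchy_transform (\<sigma> k) z))) / N"
      using pk lnC N unfolding d_def by (intro divide_right_mono) auto
    finally have "b - \<epsilon> / 2 \<le> potential (\<sigma>' k) z" using z(2) pk by (auto simp: Nk_def N_def)
    also have "\<dots> \<le> log_potential (\<sigma>' k) s z"
      using z(2) s by (intro s'.potential_le_log_potential) (auto simp: Nk_def)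
    also have "\<dots> \<le> log_potential (\<sigma>' k) s x + cmod (z - x) / s"
      using s'.log_potential_lipschitz[OF s, of z x] by linarith
    also have "cmod (z - x) / s \<le> \<rho> / s"
      using z(1) s by (intro divide_right_mono) (auto simp: E_def dist_norm norm_minus_commute)
    finally show ?case using \<rho> \<epsilon> by simp
  qed
qed

end

section \<open>Cauchy transforms off the support\<close>

lemma integral_norm_bound_AE:
  fixes f :: "'a \<Rightarrow> 'b :: {banach, second_countable_topology}"
  assumes "AE x in M. norm (f x) \<le> g x" "integrable M f" "integrable M g"
  shows "norm (integral\<^sup>L M f) \<le> integral\<^sup>L M g"
proof -
  have "norm (integral\<^sup>L M f) \<le> (\<integral>x. norm (f x) \<partial>M)" by (rule integral_norm_bound)
  also have "\<dots> \<le> integral\<^sup>L M g" using assms by (intro integral_mono_AE) auto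
  finally show ?thesis .
qed

lemma closed_msupport: "closed (msupport \<sigma>)" if "sets \<sigma> = sets borel"
proof -
  have "open (- msupport \<sigma>)"
    unfolding open_contains_ball
  proof
    fix x assume "x \<in> - msupport \<sigma>"
    then obtain e where e: "e > 0" "emeasure \<sigma> (ball x e) = 0" by (auto simp: msupport_def not_gr_zero)
    have "ball x e \<subseteq> - msupport \<sigma>"
    proof
      fix y assume "y \<in> ball x e"
      then obtain d where d: "d > 0" "ball y d \<subseteq> ball x e" using open_contains_ball open_ball by blast
      then have "emeasure \<sigma> (ball y d) \<le> emeasure \<sigma> (ball x e)" using that by (intro emeasure_mono) auto
      then show "y \<in> - msupport \<sigma>" using e d by (auto simp: msupport_def)
    qed
    then show "\<exists>e>0. ball x e \<subseteq> - msupport \<sigma>" using e by blast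
  qed
  then show ?thesis by (simp add: closed_def)
qed

text \<open>The complement of the support is covered by null balls, and by Lindelof countably many
  of them suffice.\<close>

lemma AE_in_msupport:
  assumes [simp]: "sets \<sigma> = sets borel"
  shows "AE y in \<sigma>. y \<in> msupport \<sigma>"
proof -
  define F where "F = {B. \<exists>x e. B = ball x e \<and> emeasure \<sigma> (ball x e) = 0}"
  obtain F' where F': "F' \<subseteq> F" "countable F'" "\<Union>F' = \<Union>F"
    using Lindelof[of F] by (auto simp: F_def)
  have "(\<Union>B\<in>F'. B) \<in> null_sets \<sigma>"
  proof (rule null_sets_UN')
    show "countable F'" by (rule F')
    show "B \<in> null_sets \<sigma>" if "B \<in> F'" for B
      using that F'(1) by (auto simp: F_def null_sets_def)
  qed
  then have "\<Union>F \<in> null_sets \<sigma>" using F'(3) by simp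
  moreover have "- msupport \<sigma> \<in> sets \<sigma>" using closed_msupport[OF assms] by auto
  moreover have "- msupport \<sigma> \<subseteq> \<Union>F"
  proof
    fix x assume "x \<in> - msupport \<sigma>"
    then obtain e where "e > 0" "emeasure \<sigma> (ball x e) = 0" by (auto simp: msupport_def not_gr_zero)
    then show "x \<in> \<Union>F" by (intro UnionI[of "ball x e"]) (auto simp: F_def)
  qed
  ultimately have "- msupport \<sigma> \<in> null_sets \<sigma>" by (rule null_sets_subset)
  then show ?thesis by (rule AE_not_in[THEN eventually_mono]) auto
qed

lemma AE_continuous_const:
  fixes f :: "complex \<Rightarrow> real"
  assumes ae: "AE z in lborel. z \<in> U \<longrightarrow> f z = \<kappa>" and U: "open U" and f: "continuous_on U f" and z: "z \<in> U"
  shows "f z = \<kappa>"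
proof (rule ccontr)
  assume neq: "f z \<noteq> \<kappa>"
  have "open (U \<inter> f -` (- {\<kappa>}))" by (rule continuous_open_preimage[OF f U]) auto
  then obtain d where d: "d > 0" "ball z d \<subseteq> U \<inter> f -` (- {\<kappa>})"
    using z neq open_contains_ball by (metis Compl_iff IntI singletonD vimage_eq)
  have "AE w in lborel. w \<notin> ball z d" using ae by eventually_elim (use d in auto)
  then have "ball z d \<in> null_sets lborel" by (subst AE_iff_null_sets) auto
  then have "emeasure lborel (ball z d) = 0" by auto
  then have "ennreal (pi * d\<^sup>2) = 0" using d emeasure_lborel_ball_complex[of d z] by simp
  then show False using d pi_gt_zero by (simp add: ennreal_eq_0_iff mult_le_0_iff)
qed

section \<open>Derivatives of the Cauchy transform and of the potential\<close>

context disc_prob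
begin

lemma AE_dist_ge:
  assumes "ball z d \<inter> msupport \<sigma> = {}"
  shows "AE y in \<sigma>. d \<le> cmod (z - y)"
  using AE_in_msupport[OF sets_eq_borel]
  by eventually_elim (use assms in \<open>force simp: dist_norm\<close>)

lemma off_support_regular:
  assumes d: "0 < d" and z: "ball z d \<inter> msupport \<sigma> = {}"
  shows "regular_point \<sigma> z"
proof -
  have ae: "AE y in \<sigma>. d \<le> cmod (z - y)" by (rule AE_dist_ge[OF z])
  have "integrable \<sigma> (\<lambda>y. 1 / cmod (z - y))"
  proof (rule integrable_const_bound[where B="1 / d"])
    show "AE y in \<sigma>. norm (1 / cmod (z - y)) \<le> 1 / d"
      using ae by eventually_elim (use d in \<open>auto intro!: divide_left_mono mult_pos_pos\<close>)
  qed measurable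
  moreover have "AE y in \<sigma>. y \<noteq> z" using ae by eventually_elim (use d in auto)
  ultimately show ?thesis by (simp add: regular_point_def)
qed

lemma log_potential_off_support:
  assumes r: "0 < r" "r \<le> d" and z: "ball z d \<inter> msupport \<sigma> = {}"
  shows "log_potential \<sigma> r z = potential \<sigma> z"
  unfolding log_potential_def potential_def
proof (rule integral_cong_AE)
  show "AE y in \<sigma>. ln (max r (cmod (z - y))) = ln (cmod (z - y))"
    using AE_dist_ge[OF z] by eventually_elim (use r in \<open>auto simp: max_def\<close>)
qed measurable

text \<open>Differentiation under the integral. The remainder of the kernel is (w - z)^2 / ((w - y)
  (z - y)^2), which is at most a constant times |w - z|^2 because the support has distance at least
  d from z and d / 2 from w.\<close>

lemma cauchy_has_derivative:
  assumes z: "z \<notin> msupport \<sigma>"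
  shows "cauchy_transform \<sigma> field_differentiable at z"
proof -
  obtain d where d: "0 < d" "ball z d \<inter> msupport \<sigma> = {}"
    using z closed_msupport[OF sets_eq_borel] by (metis Compl_iff closed_def disjoint_eq_subset_Compl open_contains_ball)
  define D where "D = (\<integral>y. - 1 / (z - y)\<^sup>2 \<partial>\<sigma>)"
  have "(cauchy_transform \<sigma> has_field_derivative D) (at z)"
    unfolding has_field_derivative_def has_derivative_at_alt
  proof (intro conjI allI impI)
    fix e :: real assume e: "0 < e"
    define \<delta> where "\<delta> = min (d / 2) (e * d ^ 3 / 2)"
    have \<delta>: "0 < \<delta>" "\<delta> \<le> d / 2" "\<delta> * (2 / d ^ 3) \<le> e"
      using d e by (auto simp: \<delta>_def min_def field_simps)
    show "\<exists>\<delta>>0. \<forall>w. cmod (w - z) < \<delta> \<longrightarrow> cmod (cauchy_transform \<sigma> w - cauchy_transform \<sigma> z - D * (w - z)) \<le> e * cmod (w - z)"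
    proof (intro exI conjI allI impI)
      fix w assume w: "cmod (w - z) < \<delta>"
      define h where "h = cmod (w - z)"
      have disjw: "ball w (d / 2) \<inter> msupport \<sigma> = {}"
      proof -
        have "ball w (d / 2) \<subseteq> ball z d"
        proof
          fix u assume "u \<in> ball w (d / 2)"
          then show "u \<in> ball z d" using w \<delta> dist_triangle[of z u w] by (simp add: dist_norm norm_minus_commute)
        qed
        then show ?thesis using d by blast
      qed
      have aew: "AE y in \<sigma>. d / 2 \<le> cmod (w - y)" by (rule AE_dist_ge[OF disjw])
      have regw: "regular_point \<sigma> w" using off_support_regular[OF _ disjw] d by simp
      have aez: "AE y in \<sigma>. d \<le> cmod (z - y)" by (rule AE_dist_ge[OF d(2)])
      have regz: "regular_point \<sigma> z" by (rule off_support_regular[OF d])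
      have i: "integrable \<sigma> (\<lambda>y. - 1 / (z - y)\<^sup>2)"
      proof (rule integrable_const_bound[where B="1 / d\<^sup>2"])
        show "AE y in \<sigma>. cmod (- 1 / (z - y)\<^sup>2) \<le> 1 / d\<^sup>2"
          using aez by eventually_elim (use d in \<open>auto simp: norm_divide norm_power intro!: divide_left_mono power_mono mult_pos_pos\<close>)
      qed measurable
      have "cauchy_transform \<sigma> w - cauchy_transform \<sigma> z - D * (w - z) = (\<integral>y. 1 / (w - y) - 1 / (z - y) - (- 1 / (z - y)\<^sup>2) * (w - z) \<partial>\<sigma>)"
        unfolding Bochner_Integration.integral_diff[OF Bochner_Integration.integrable_diff[OF regular_point_integrable(2)[OF regw] regular_point_integrable(2)[OF regz]] integrable_mult_left[OF i]]
          Bochner_Integration.integral_diff[OF regular_point_integrable(2)[OF regw] regular_point_integrable(2)[OF regz]]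
          cauchy_transform_def D_def integral_mult_left_zero ..
      also have "cmod \<dots> \<le> (\<integral>y. 2 / d ^ 3 * h\<^sup>2 \<partial>\<sigma>)"
      proof (rule integral_norm_bound_AE)
        show "AE y in \<sigma>. cmod (1 / (w - y) - 1 / (z - y) - (- 1 / (z - y)\<^sup>2) * (w - z)) \<le> 2 / d ^ 3 * h\<^sup>2"
          using aew aez
        proof eventually_elim
          case (elim y)
          have nz: "w - y \<noteq> 0" "z - y \<noteq> 0" using elim d by auto
          have alg: "1 / a - 1 / b - (- 1 / b\<^sup>2) * (a - b) = (a - b)\<^sup>2 / (a * b\<^sup>2)" if "a \<noteq> 0" "b \<noteq> 0" for a b :: complex
            using that by (simp add: field_simps power2_eq_square)
          have "1 / (w - y) - 1 / (z - y) - (- 1 / (z - y)\<^sup>2) * (w - z) = (w - z)\<^sup>2 / ((w - y) * (z - y)\<^sup>2)"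
            using alg[OF nz] by simp
          then have "cmod (1 / (w - y) - 1 / (z - y) - (- 1 / (z - y)\<^sup>2) * (w - z)) = h\<^sup>2 / (cmod (w - y) * (cmod (z - y))\<^sup>2)"
            by (simp only: norm_divide norm_mult norm_power h_def)
          also have "\<dots> \<le> h\<^sup>2 / (d / 2 * d\<^sup>2)"
            using elim d by (intro divide_left_mono mult_mono power_mono mult_pos_pos) auto
          finally show ?case using d by (simp add: power2_eq_square power3_eq_cube field_simps)
        qed
        show "integrable \<sigma> (\<lambda>y. 1 / (w - y) - 1 / (z - y) - (- 1 / (z - y)\<^sup>2) * (w - z))"
          by (intro Bochner_Integration.integrable_diff integrable_mult_left i regular_point_integrable(2) regw regz)
      qed auto
      also have "\<dots> = (h * (2 / d ^ 3)) * h" by (simp add: prob_space[simplified] power2_eq_square)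
      also have "\<dots> \<le> e * h"
      proof (rule mult_right_mono)
        have "h * (2 / d ^ 3) \<le> \<delta> * (2 / d ^ 3)" using w d by (intro mult_right_mono) (auto simp: h_def)
        then show "h * (2 / d ^ 3) \<le> e" using \<delta> by linarith
      qed (simp add: h_def)
      finally show "cmod (cauchy_transform \<sigma> w - cauchy_transform \<sigma> z - D * (w - z)) \<le> e * cmod (w - z)" by (simp add: h_def)
    qed (use \<delta> in auto)
  qed (rule bounded_linear_mult_right)
  then show ?thesis by (auto simp: field_differentiable_def)
qed

lemma cauchy_holomorphic: "A \<inter> msupport \<sigma> = {} \<Longrightarrow> cauchy_transform \<sigma> holomorphic_on A"
  unfolding holomorphic_on_def
  using cauchy_has_derivative field_differentiable_at_within by blast

text \<open>With u = (w - z) / (z - y) the remainder of the logarithmic kernel is the real part of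
  Ln (1 + u) - u, which is quadratic in u.\<close>

lemma potential_has_derivative:
  assumes z: "z \<notin> msupport \<sigma>"
  shows "(potential \<sigma> has_derivative (\<lambda>h. Re (h * cauchy_transform \<sigma> z))) (at z)"
proof -
  obtain d where d: "0 < d" "ball z d \<inter> msupport \<sigma> = {}"
    using z closed_msupport[OF sets_eq_borel] by (metis Compl_iff closed_def disjoint_eq_subset_Compl open_contains_ball)
  show ?thesis
    unfolding has_derivative_at_alt
  proof (intro conjI allI impI)
    show "bounded_linear (\<lambda>h. Re (h * cauchy_transform \<sigma> z))"
      by (intro bounded_linear_compose[OF bounded_linear_Re] bounded_linear_mult_left)
    fix e :: real assume e: "0 < e"
    define \<delta> where "\<delta> = min (d / 2) (e * d\<^sup>2 / 2)"
    have \<delta>: "0 < \<delta>" "\<delta> \<le> d / 2" "\<delta> * (2 / d\<^sup>2) \<le> e"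
      using d e by (auto simp: \<delta>_def min_def field_simps)
    show "\<exists>\<delta>>0. \<forall>w. cmod (w - z) < \<delta> \<longrightarrow> norm (potential \<sigma> w - potential \<sigma> z - Re ((w - z) * cauchy_transform \<sigma> z)) \<le> e * cmod (w - z)"
    proof (intro exI conjI allI impI)
      fix w assume w: "cmod (w - z) < \<delta>"
      define h where "h = cmod (w - z)"
      have h: "0 \<le> h" "h < d / 2" using w \<delta> by (auto simp: h_def)
      have "ball w (d / 2) \<inter> msupport \<sigma> = {}"
      proof -
        have "ball w (d / 2) \<subseteq> ball z d"
        proof
          fix u assume "u \<in> ball w (d / 2)"
          then show "u \<in> ball z d" using w \<delta> dist_triangle[of z u w] by (simp add: dist_norm norm_minus_commute)
        qed
        then show ?thesis using d by blast
      qed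
      then have regw: "regular_point \<sigma> w" using off_support_regular[of "d / 2" w] d by auto
      have aez: "AE y in \<sigma>. d \<le> cmod (z - y)" by (rule AE_dist_ge[OF d(2)])
      have regz: "regular_point \<sigma> z" by (rule off_support_regular[OF d])
      note i = regular_point_integrable(3)[OF regw] regular_point_integrable(3)[OF regz] regular_point_integrable(2)[OF regz]
      have i4: "integrable \<sigma> (\<lambda>y. (w - z) * (1 / (z - y)))" using i(3) by (rule integrable_mult_right)
      have "Re ((w - z) * cauchy_transform \<sigma> z) = (\<integral>y. Re ((w - z) * (1 / (z - y))) \<partial>\<sigma>)"
        using integral_Re[OF i4] by (simp only: cauchy_transform_def integral_mult_right_zero)
      then have "potential \<sigma> w - potential \<sigma> z - Re ((w - z) * cauchy_transform \<sigma> z)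
        = (\<integral>y. ln (cmod (w - y)) - ln (cmod (z - y)) - Re ((w - z) * (1 / (z - y))) \<partial>\<sigma>)"
        unfolding potential_def using i integrable_Re[OF i4] by simp
      also have "norm \<dots> \<le> (\<integral>y. 2 / d\<^sup>2 * h\<^sup>2 \<partial>\<sigma>)"
      proof (rule integral_norm_bound_AE)
        show "AE y in \<sigma>. norm (ln (cmod (w - y)) - ln (cmod (z - y)) - Re ((w - z) * (1 / (z - y)))) \<le> 2 / d\<^sup>2 * h\<^sup>2"
          using aez
        proof eventually_elim
          case (elim y)
          have nz: "z - y \<noteq> 0" using elim d by auto
          define u where "u = (w - z) / (z - y)"
          have u: "cmod u \<le> h / d" using elim d h(1)
            by (auto simp: u_def norm_divide h_def intro!: divide_left_mono mult_pos_pos)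
          have hd: "h / d \<le> 1 / 2" using h d by (simp add: field_simps)
          then have u1: "cmod u < 1" using u by linarith
          have wy: "w - y = (z - y) * (1 + u)" using nz by (simp add: u_def field_simps)
          have "1 + u \<noteq> 0" using u1 by (metis add_eq_0_iff norm_minus_cancel norm_one less_irrefl)
          then have "ln (cmod (w - y)) - ln (cmod (z - y)) = Re (Ln (1 + u))"
            using nz ln_norm_one_plus[OF u1] by (simp add: wy norm_mult ln_mult)
          then have "norm (ln (cmod (w - y)) - ln (cmod (z - y)) - Re ((w - z) * (1 / (z - y)))) = \<bar>Re (Ln (1 + u) - u)\<bar>"
            by (simp add: u_def)
          also have "\<dots> \<le> cmod (Ln (1 + u) - u)" by (rule abs_Re_le_cmod)
          also have "\<dots> \<le> (cmod u)\<^sup>2 / (1 - cmod u)" by (rule Ln_approx_linear[OF u1])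
          also have "\<dots> \<le> (h / d)\<^sup>2 / (1 / 2)"
          proof (intro frac_le power_mono u)
            show "1 / 2 \<le> 1 - cmod u" using u hd by linarith
          qed auto
          finally show ?case using d by (simp add: power_divide field_simps)
        qed
      qed (use i integrable_Re[OF i4] in auto)
      also have "\<dots> = (h * (2 / d\<^sup>2)) * h" by (simp add: prob_space[simplified] power2_eq_square)
      also have "\<dots> \<le> e * h"
      proof (rule mult_right_mono)
        have "h * (2 / d\<^sup>2) \<le> \<delta> * (2 / d\<^sup>2)" using w d by (intro mult_right_mono) (auto simp: h_def)
        then show "h * (2 / d\<^sup>2) \<le> e" using \<delta> by linarith
      qed (simp add: h_def)
      finally show "norm (potential \<sigma> w - potential \<sigma> z - Re ((w - z) * cauchy_transform \<sigma> z)) \<le> e * cmod (w - z)" by (simp add: h_def)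
    qed (use \<delta> in auto)
  qed
qed

lemma continuous_potential: "A \<inter> msupport \<sigma> = {} \<Longrightarrow> continuous_on A (potential \<sigma>)"
  using potential_has_derivative has_derivative_continuous
  by (metis continuous_at_imp_continuous_on disjoint_iff)

lemma cauchy_zero_of_potential_const:
  assumes "open U" "U \<inter> msupport \<sigma> = {}" "\<And>z. z \<in> U \<Longrightarrow> potential \<sigma> z = \<kappa>" "z \<in> U"
  shows "cauchy_transform \<sigma> z = 0"
proof -
  have "((\<lambda>_. \<kappa>) has_derivative (\<lambda>_. 0)) (at z)" by simp
  then have "(potential \<sigma> has_derivative (\<lambda>_. 0)) (at z)"
    by (rule has_derivative_transform_within_open[OF _ assms(1,4)]) (use assms in auto)
  moreover have "(potential \<sigma> has_derivative (\<lambda>h. Re (h * cauchy_transform \<sigma> z))) (at z)"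
    using potential_has_derivative assms by blast
  ultimately have "(\<lambda>h. Re (h * cauchy_transform \<sigma> z)) = (\<lambda>_. 0)" by (rule has_derivative_unique[symmetric])
  \<comment> \<open>The directions 1 and i read off the real part and, up to sign, the imaginary
    part of the transform.\<close>
  from fun_cong[OF this, of 1] fun_cong[OF this, of \<i>] show ?thesis by (simp add: complex_eq_iff)
qed

lemma potential_const_of_cauchy_zero:
  assumes "open U" "connected U" "U \<inter> msupport \<sigma> = {}" "\<And>z. z \<in> U \<Longrightarrow> cauchy_transform \<sigma> z = 0"
  shows "\<exists>c. \<forall>z\<in>U. potential \<sigma> z = c"
proof -
  have "(potential \<sigma> has_derivative (\<lambda>h. 0)) (at z within U)" if "z \<in> U" for z
    using potential_has_derivative[of z] assms that has_derivative_at_withinI by fastforce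
  then show ?thesis
    using has_derivative_zero_connected_constant_on[OF assms(2,1), of "{}" "potential \<sigma>"]
      continuous_potential[OF assms(3)] by (auto simp: constant_on_def)
qed

text \<open>Independent of the division into \<open>Us\<close> and \<open>Vs\<close>: as the
  potential is non-constant on each U_i, every member is one of the V_j. Off these components the
  lower bound comes from nearby points with nonzero Cauchy transform.\<close>

definition const_comps :: "complex set set" where
  "const_comps = {V \<in> components (- msupport \<sigma>). \<exists>c. \<forall>z\<in>V. potential \<sigma> z = c}"

lemma open_component: "V \<in> components (- msupport \<sigma>) \<Longrightarrow> open V"
  using closed_msupport[OF sets_eq_borel] open_components by blast

lemma closed_Compl_const_comps: "closed (- \<Union>const_comps)"
proof -
  have "open (\<Union>const_comps)" by (intro open_Union) (auto simp: const_comps_def open_component)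
  then show ?thesis by (simp add: closed_def)
qed

text \<open>By contraposition: otherwise the potential is constant on a massless ball about x, so C
  = 0 on this ball, hence on the whole component of x by the identity theorem, and this component
  belongs to \<open>const_comps\<close>.\<close>

lemma emeasure_pos_nonconst:
  assumes x: "x \<notin> \<Union>const_comps" and b: "b' < b" "\<And>r. 0 < r \<Longrightarrow> b \<le> log_potential \<sigma> r x" and \<rho>: "0 < \<rho>"
  shows "emeasure lborel {z \<in> ball x \<rho>. cauchy_transform \<sigma> z \<noteq> 0 \<and> b' < potential \<sigma> z} \<noteq> 0"
proof
  assume 0: "emeasure lborel {z \<in> ball x \<rho>. cauchy_transform \<sigma> z \<noteq> 0 \<and> b' < potential \<sigma> z} = 0"
  have [measurable]: "ball x \<rho> \<in> sets borel" by simp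
  have "{z \<in> ball x \<rho>. cauchy_transform \<sigma> z \<noteq> 0 \<and> b' < potential \<sigma> z} \<in> null_sets lborel"
    using 0 by (intro null_setsI) measurable
  then have "AE z in lborel. z \<in> ball x \<rho> \<longrightarrow> cauchy_transform \<sigma> z = 0 \<or> potential \<sigma> z \<le> b'"
    by (rule AE_not_in[THEN eventually_mono]) auto
  from potential_const_of_AE[OF \<rho> this b] obtain r \<kappa> where r: "r > 0" "emeasure \<sigma> (ball x r) = 0"
    and \<kappa>: "AE z in lborel. z \<in> ball x r \<longrightarrow> potential \<sigma> z = \<kappa>" by blast
  have disj: "ball x r \<inter> msupport \<sigma> = {}"
  proof (rule ccontr)
    assume "ball x r \<inter> msupport \<sigma> \<noteq> {}"
    then obtain y where y: "y \<in> ball x r" "y \<in> msupport \<sigma>" by blast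
    then obtain d where d: "d > 0" "ball y d \<subseteq> ball x r" using open_contains_ball open_ball by blast
    then have "emeasure \<sigma> (ball y d) \<le> emeasure \<sigma> (ball x r)" using sets_eq_borel by (intro emeasure_mono) auto
    then show False using y d r by (auto simp: msupport_def)
  qed
  have p: "potential \<sigma> z = \<kappa>" if "z \<in> ball x r" for z
    using AE_continuous_const[OF \<kappa> _ continuous_potential[OF disj] that] by simp
  define U where "U = connected_component_set (- msupport \<sigma>) x"
  have x_in: "x \<in> - msupport \<sigma>"
  proof
    assume "x \<in> msupport \<sigma>"
    moreover have "x \<in> ball x r" using r by simp
    ultimately show False using disj by blast
  qed
  have U: "U \<in> components (- msupport \<sigma>)" unfolding U_def using x_in by (rule componentsI)
  have Uo: "open U" by (rule open_component[OF U])
  have Uc: "connected U" by (rule in_components_connected[OF U])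
  have Ud: "U \<inter> msupport \<sigma> = {}" using in_components_subset[OF U] by blast
  have sub: "ball x r \<subseteq> U" unfolding U_def
    using disj r by (intro connected_component_maximal) auto
  have ne: "ball x r \<noteq> {}" using r by simp
  have C0: "cauchy_transform \<sigma> z = 0" if "z \<in> U" for z
    by (rule analytic_continuation_open[OF open_ball Uo ne Uc sub cauchy_holomorphic[OF Ud] holomorphic_on_const _ that])
      (rule cauchy_zero_of_potential_const[OF open_ball disj p])
  have "\<exists>c. \<forall>z\<in>U. potential \<sigma> z = c"
    by (rule potential_const_of_cauchy_zero[OF Uo Uc Ud C0])
  then have "U \<in> const_comps" using U by (simp add: const_comps_def)
  then show False using x x_in unfolding U_def by auto
qed

end

text \<open>A finite subcover, with the least of its radii; monotonicity in r lets this one radius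
  serve on every patch.\<close>

lemma compact_uniformly:
  fixes Q :: "real \<Rightarrow> nat \<Rightarrow> 'a :: metric_space \<Rightarrow> bool"
  assumes K: "compact K"
    and loc: "\<And>x. x \<in> K \<Longrightarrow> \<exists>r>0. \<exists>\<delta>>0. \<forall>\<^sub>F k in sequentially. \<forall>y\<in>ball x \<delta>. Q r k y"
    and mono: "\<And>r r' k y. 0 < r' \<Longrightarrow> r' \<le> r \<Longrightarrow> Q r k y \<Longrightarrow> Q r' k y"
  shows "\<exists>r>0. \<forall>\<^sub>F k in sequentially. \<forall>y\<in>K. Q r k y"
proof -
  obtain r \<delta> where rd: "\<And>x. x \<in> K \<Longrightarrow> r x > 0 \<and> \<delta> x > 0 \<and> (\<forall>\<^sub>F k in sequentially. \<forall>y\<in>ball x (\<delta> x). Q (r x) k y)"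
    using loc by metis
  have "K \<subseteq> (\<Union>x\<in>K. ball x (\<delta> x))" using rd by force
  then obtain D where D: "D \<subseteq> K" "finite D" "K \<subseteq> (\<Union>x\<in>D. ball x (\<delta> x))"
    using compactE_image[OF K, of K "\<lambda>x. ball x (\<delta> x)"] by auto
  define r0 where "r0 = Min (insert 1 (r ` D))"
  have r0: "0 < r0" unfolding r0_def using D rd by (subst Min_gr_iff) auto
  have r0_le: "r0 \<le> r x" if "x \<in> D" for x unfolding r0_def using D that by (intro Min_le) auto
  have "\<forall>\<^sub>F k in sequentially. \<forall>x\<in>D. \<forall>y\<in>ball x (\<delta> x). Q (r x) k y"
    using D rd by (intro eventually_ball_finite) auto
  then have "\<forall>\<^sub>F k in sequentially. \<forall>y\<in>K. Q r0 k y"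
  proof eventually_elim
    case (elim k)
    show ?case
    proof
      fix y assume "y \<in> K"
      then obtain x where "x \<in> D" "y \<in> ball x (\<delta> x)" using D by blast
      then show "Q r0 k y" using elim mono[OF r0 r0_le] by blast
    qed
  qed
  then show ?thesis using r0 by blast
qed

context root_seq
begin

text \<open>The condition on \<open>b\<close> says that \<open>b\<close> is at most the true
  potential at x, expressed through the regularised potentials, which decrease with r. The constant
  \<open>potential \<mu> x\<close> cannot stand in its place: where the integral diverges to -
  infinity, the Bochner integral is 0.\<close>

definition lower_at :: "complex \<Rightarrow> bool" where
  "lower_at x \<longleftrightarrow> (\<forall>b s \<epsilon>. 0 < s \<longrightarrow> 0 < \<epsilon> \<longrightarrow> (\<forall>r>0. b \<le> log_potential \<mu> r x) \<longrightarrow>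
     (\<forall>\<^sub>F k in sequentially. b - \<epsilon> \<le> log_potential (\<sigma>' k) s x))"

lemma lower_at_nonconst: "x \<notin> \<Union>lim.const_comps \<Longrightarrow> lower_at x"
  unfolding lower_at_def
proof (intro allI impI)
  fix b s \<epsilon> :: real assume x: "x \<notin> \<Union>lim.const_comps" and s: "0 < s" "0 < \<epsilon>" and b: "\<forall>r>0. b \<le> log_potential \<mu> r x"
  have "\<forall>\<^sub>F k in sequentially. (b - \<epsilon> / 2) - \<epsilon> / 2 \<le> log_potential (\<sigma>' k) s x"
  proof (rule log_potential_pderiv_lower)
    show "emeasure lborel {z \<in> ball x \<rho>. cauchy_transform \<mu> z \<noteq> 0 \<and> b - \<epsilon> / 2 < potential \<mu> z} \<noteq> 0" if "0 < \<rho>" for \<rho>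
      by (rule lim.emeasure_pos_nonconst[OF x, where b=b]) (use s b that in auto)
  qed (use s in auto)
  then show "\<forall>\<^sub>F k in sequentially. b - \<epsilon> \<le> log_potential (\<sigma>' k) s x" by simp
qed

text \<open>At x a radius r is taken for which \<open>log_potential \<mu> r x\<close> is close to
  its infimum over all radii. Both sides are Lipschitz, so the bound extends to a ball about x, and
  compactness applies because a smaller r only weakens the claim.\<close>

lemma lower_uniformly:
  assumes K: "compact K" "\<And>x. x \<in> K \<Longrightarrow> lower_at x" and s: "0 < s" and \<epsilon>: "0 < \<epsilon>"
  shows "\<exists>r>0. \<forall>\<^sub>F k in sequentially. \<forall>y\<in>K. log_potential \<mu> r y - \<epsilon> \<le> log_potential (\<sigma>' k) s y"
proof (rule compact_uniformly[OF K(1)])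
  fix x assume x: "x \<in> K"
  have "\<exists>r>0. \<forall>\<^sub>F k in sequentially. log_potential \<mu> r x - \<epsilon> / 2 \<le> log_potential (\<sigma>' k) s x"
  \<comment> \<open>The first case includes an infimum of - infinity. It is trivial, as the
    potential of the derivative regularised at radius s never lies below ln s.\<close>
  proof (cases "\<exists>r>0. log_potential \<mu> r x \<le> ln s")
    case True
    then obtain r where r: "r > 0" "log_potential \<mu> r x \<le> ln s" by blast
    have "log_potential \<mu> r x - \<epsilon> / 2 \<le> log_potential (\<sigma>' k) s x" for k
      using disc_prob.log_potential_ge_ln[OF disc_k'[of k] s, of x] r \<epsilon> by linarith
    then show ?thesis using r by (intro exI[of _ r]) simp
  next
    case False
    define b where "b = Inf ((\<lambda>r. log_potential \<mu> r x) ` {0<..})"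
    have bdd: "bdd_below ((\<lambda>r. log_potential \<mu> r x) ` {0<..})"
      using False by (intro bdd_belowI[of _ "ln s"]) (auto simp: not_le intro: less_imp_le)
    have b1: "\<forall>r>0. b \<le> log_potential \<mu> r x" unfolding b_def using bdd by (auto intro: cInf_lower)
    have "\<exists>y\<in>(\<lambda>r. log_potential \<mu> r x) ` {0<..}. y < b + \<epsilon> / 4"
      using bdd \<epsilon> unfolding b_def by (subst cInf_less_iff[symmetric]) (auto intro: exI[of _ 1])
    then obtain r where r: "r > 0" "log_potential \<mu> r x < b + \<epsilon> / 4" by auto
    have "\<forall>\<^sub>F k in sequentially. b - \<epsilon> / 4 \<le> log_potential (\<sigma>' k) s x"
      using K(2)[OF x] s \<epsilon> b1 unfolding lower_at_def by auto
    then have "\<forall>\<^sub>F k in sequentially. log_potential \<mu> r x - \<epsilon> / 2 \<le> log_potential (\<sigma>' k) s x"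
      by eventually_elim (use r in linarith)
    then show ?thesis using r by blast
  qed
  then obtain r where r: "r > 0" "\<forall>\<^sub>F k in sequentially. log_potential \<mu> r x - \<epsilon> / 2 \<le> log_potential (\<sigma>' k) s x" by blast
  define \<delta> where "\<delta> = min r s * \<epsilon> / 4"
  have \<delta>: "0 < \<delta>" "\<delta> / r \<le> \<epsilon> / 4" "\<delta> / s \<le> \<epsilon> / 4"
    using r s \<epsilon> by (auto simp: \<delta>_def field_simps min_def mult_le_cancel_left1)
  have "\<forall>\<^sub>F k in sequentially. \<forall>y\<in>ball x \<delta>. log_potential \<mu> r y - \<epsilon> \<le> log_potential (\<sigma>' k) s y"
    using r(2)
  proof eventually_elim
    case (elim k)
    show ?case
    proof
      fix y assume "y \<in> ball x \<delta>"
      then have d: "cmod (x - y) \<le> \<delta>" by (simp add: dist_norm)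
      have "cmod (x - y) / r \<le> \<epsilon> / 4" "cmod (x - y) / s \<le> \<epsilon> / 4"
        using d \<delta> r s divide_right_mono[OF d, of r] divide_right_mono[OF d, of s] by linarith+
      then show "log_potential \<mu> r y - \<epsilon> \<le> log_potential (\<sigma>' k) s y"
        using lim.log_potential_lipschitz[OF r(1), of x y] disc_prob.log_potential_lipschitz[OF disc_k'[of k] s, of x y] elim
        by linarith
    qed
  qed
  then show "\<exists>r>0. \<exists>\<delta>>0. \<forall>\<^sub>F k in sequentially. \<forall>y\<in>ball x \<delta>. log_potential \<mu> r y - \<epsilon> \<le> log_potential (\<sigma>' k) s y"
    using r \<delta> by blast
next
  show "log_potential \<mu> r' y - \<epsilon> \<le> log_potential (\<sigma>' k) s y" if "0 < r'" "r' \<le> r" "log_potential \<mu> r y - \<epsilon> \<le> log_potential (\<sigma>' k) s y" for r r' k y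
    using lim.log_potential_mono[OF that(1,2), of y] that(3) by linarith
qed

end

section \<open>Components on which the potential is constant\<close>

lemma integral_lborel_translate:
  fixes g :: "complex \<Rightarrow> 'b :: {banach, second_countable_topology}" and c :: complex
  assumes [measurable]: "g \<in> borel_measurable borel"
  shows "(\<integral>z. g (z + c) \<partial>lborel) = (\<integral>z. g z \<partial>lborel)"
proof -
  have "(\<integral>z. g z \<partial>lborel) = (\<integral>z. g z \<partial>distr lborel borel ((+) c))"
    by (simp add: lborel_distr_plus)
  also have "\<dots> = (\<integral>z. g (c + z) \<partial>lborel)"
    by (subst integral_distr) auto
  finally show ?thesis by (simp add: add.commute)
qed

lemma integrable_bounded_support:
  fixes g :: "complex \<Rightarrow> 'b :: {banach, second_countable_topology}"
  assumes [measurable]: "g \<in> borel_measurable borel"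
    and le: "\<And>z. norm (g z) \<le> B" and supp: "\<And>z. z \<notin> cball 0 b \<Longrightarrow> g z = 0"
  shows "integrable lborel g"
proof (rule integrableI_bounded_set[where A="cball 0 b" and B=B])
  show "emeasure lborel (cball (0::complex) b) < \<infinity>" by (rule emeasure_bounded_finite[OF bounded_cball])
qed (use le supp in auto)

lemma circ_cis: "(\<integral>t. cis t \<partial>circ) = 0"
proof -
  have "(\<lambda>z::complex. z) holomorphic_on ball 0 2" by (intro holomorphic_intros)
  from circ_mean_holomorphic[OF this, of 1] show ?thesis by simp
qed

text \<open>By translation invariance the circle mean is self-adjoint with respect to Lebesgue
  measure, and the mean of |w|^2 exceeds its value at the centre by r^2. No continuity of
  \<open>h\<close> is asked for, because it will be cut off by the indicator of a component.\<close>

lemma integral_circle_mean_square: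
  fixes h :: "complex \<Rightarrow> real"
  assumes h [measurable]: "h \<in> borel_measurable borel"
    and le: "\<And>z. \<bar>h z\<bar> \<le> B" and supp: "\<And>z. z \<notin> cball 0 b \<Longrightarrow> h z = 0" and r: "0 < r"
  shows "(\<integral>z. (circle_mean h z r - h z) * (cmod z)\<^sup>2 \<partial>lborel) = r\<^sup>2 * (\<integral>z. h z \<partial>lborel)"
    and "integrable lborel (\<lambda>z. (circle_mean h z r - h z) * (cmod z)\<^sup>2)"
proof -
  interpret pc: pair_sigma_finite lborel circ
    by (intro pair_sigma_finite.intro lborel.sigma_finite_measure_axioms circ.sigma_finite_measure_axioms)
  have B: "0 \<le> B" using le[of 0] by linarith
  define f where "f z t = h (z + r * cis t) * (cmod z)\<^sup>2" for z t
  have fm [measurable]: "case_prod f \<in> borel_measurable (lborel \<Otimes>\<^sub>M circ)" unfolding f_def by measurable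
  define K where "K = B * (\<bar>b\<bar> + r)\<^sup>2"
  have K: "0 \<le> K" using B by (simp add: K_def)
  have f_supp: "f z t = 0" if "z \<notin> cball 0 (\<bar>b\<bar> + r)" for z t
  proof -
    have "cmod z \<le> cmod (z + r * cis t) + r"
      using norm_triangle_ineq4[of "z + r * cis t" "r * cis t"] r by (simp add: norm_mult)
    then have "z + r * cis t \<notin> cball 0 b" using that by auto
    then show ?thesis using supp by (simp add: f_def)
  qed
  have f_le: "\<bar>f z t\<bar> \<le> K" for z t
  proof (cases "z \<in> cball 0 (\<bar>b\<bar> + r)")
    case True
    then have "(cmod z)\<^sup>2 \<le> (\<bar>b\<bar> + r)\<^sup>2" by (intro power_mono) auto
    then show ?thesis unfolding f_def K_def abs_mult using le B by (intro mult_mono) auto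
  qed (use f_supp K in auto)
  have inner_m: "(\<lambda>z. \<integral>t. norm (f z t) \<partial>circ) \<in> borel_measurable borel"
    unfolding f_def by measurable
  have inner_i: "integrable circ (\<lambda>t. f z t)" for z
    using f_le by (intro integrable_circ_bounded[where B=K]) (auto simp: f_def)
  have int: "integrable (lborel \<Otimes>\<^sub>M circ) (case_prod f)"
  proof (rule pc.Fubini_integrable)
    show "integrable lborel (\<lambda>z. \<integral>t. norm (case_prod f (z, t)) \<partial>circ)"
    proof (rule integrable_bounded_support[where B=K and b="\<bar>b\<bar> + r"])
      fix z
      have "(\<integral>t. \<bar>f z t\<bar> \<partial>circ) \<le> (\<integral>t. K \<partial>circ)"
        using f_le inner_i[of z] by (intro integral_mono) auto
      moreover have "0 \<le> (\<integral>t. \<bar>f z t\<bar> \<partial>circ)" by (intro Bochner_Integration.integral_nonneg) auto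
      ultimately show "norm (\<integral>t. norm (case_prod f (z, t)) \<partial>circ) \<le> K" by (simp add: circ.prob_space[simplified])
    qed (use f_supp inner_m in auto)
  qed (use inner_i in auto)
  have h_int: "integrable lborel h" using le supp by (intro integrable_bounded_support) auto
  have hz2: "integrable lborel (\<lambda>z. h z * (cmod z)\<^sup>2)"
  proof (rule integrable_bounded_support[where B="B * b\<^sup>2" and b=b])
    fix z
    show "norm (h z * (cmod z)\<^sup>2) \<le> B * b\<^sup>2"
    proof (cases "z \<in> cball 0 b")
      case True
      then have "(cmod z)\<^sup>2 \<le> b\<^sup>2" by (intro power_mono) auto
      then show ?thesis unfolding real_norm_def abs_mult using le B by (intro mult_mono) auto
    qed (use supp B in auto)
  qed (use supp in auto)
  have hz: "integrable lborel (\<lambda>z. h z *\<^sub>R z)"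
  proof (rule integrable_bounded_support[where B="B * \<bar>b\<bar>" and b=b])
    fix z
    show "norm (h z *\<^sub>R z) \<le> B * \<bar>b\<bar>"
    proof (cases "z \<in> cball 0 b")
      case True
      then show ?thesis unfolding norm_scaleR using le B by (intro mult_mono) auto
    qed (use supp B in auto)
  qed (use supp in auto)
  \<comment> \<open>The first moment of \<open>h\<close> is the coefficient of the cross term in |w
    - r cis t|^2; this term disappears in the mean over t, since \<open>cis\<close> has mean
    0.\<close>
  define Z where "Z = (\<integral>z. h z *\<^sub>R z \<partial>lborel)"
  have ft: "(\<integral>z. f z t \<partial>lborel) = (\<integral>z. h z * (cmod z)\<^sup>2 \<partial>lborel) + r\<^sup>2 * (\<integral>z. h z \<partial>lborel) - 2 * r * (Z \<bullet> cis t)" for t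
  proof -
    have "(\<integral>z. f z t \<partial>lborel) = (\<integral>z. (\<lambda>w. h w * (cmod (w - r * cis t))\<^sup>2) (z + r * cis t) \<partial>lborel)"
      by (simp add: f_def)
    also have "\<dots> = (\<integral>w. h w * (cmod (w - r * cis t))\<^sup>2 \<partial>lborel)"
      by (rule integral_lborel_translate) measurable
    also have "\<dots> = (\<integral>w. h w * (cmod w)\<^sup>2 + r\<^sup>2 * h w - 2 * r * ((h w *\<^sub>R w) \<bullet> cis t) \<partial>lborel)"
    proof (intro Bochner_Integration.integral_cong refl)
      fix w
      have e: "(cmod (w - r * cis t))\<^sup>2 = (cmod w)\<^sup>2 + r\<^sup>2 - 2 * r * (w \<bullet> cis t)"
      proof -
        have "r * cis t = r *\<^sub>R cis t" by (simp add: scaleR_conv_of_real)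
        then have "(cmod (w - r * cis t))\<^sup>2 = w \<bullet> w + r\<^sup>2 * (cis t \<bullet> cis t) - 2 * r * (w \<bullet> cis t)"
          unfolding power2_norm_eq_inner
          by (simp add: inner_diff_left inner_diff_right inner_commute power2_eq_square algebra_simps)
        then show ?thesis by (simp add: power2_norm_eq_inner[symmetric])
      qed
      show "h w * (cmod (w - r * cis t))\<^sup>2 = h w * (cmod w)\<^sup>2 + r\<^sup>2 * h w - 2 * r * ((h w *\<^sub>R w) \<bullet> cis t)"
        unfolding e by (simp add: algebra_simps)
    qed
    also have "\<dots> = (\<integral>z. h z * (cmod z)\<^sup>2 \<partial>lborel) + r\<^sup>2 * (\<integral>z. h z \<partial>lborel) - 2 * r * (Z \<bullet> cis t)"
    proof -
      have "integrable lborel (\<lambda>z. (h z *\<^sub>R z) \<bullet> cis t)" using hz by (intro integrable_inner_left)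
      moreover have "(\<integral>z. (h z *\<^sub>R z) \<bullet> cis t \<partial>lborel) = Z \<bullet> cis t"
        unfolding Z_def using hz by (intro integral_inner_left)
      ultimately show ?thesis using hz2 h_int by (simp del: inner_scaleR_left)
    qed
    finally show ?thesis .
  qed
  have Zc: "(\<integral>t. Z \<bullet> cis t \<partial>circ) = 0"
  proof -
    have "integrable circ cis" by (intro integrable_circ_continuous continuous_intros)
    then show ?thesis by (subst integral_inner_right) (simp_all add: circ_cis)
  qed
  have icis: "integrable circ (\<lambda>t. Z \<bullet> cis t)" by (intro integrable_circ_continuous continuous_intros)
  have "(\<integral>z. (\<integral>t. f z t \<partial>circ) \<partial>lborel) = (\<integral>t. (\<integral>z. f z t \<partial>lborel) \<partial>circ)"
    by (rule pc.Fubini_integral[OF int, symmetric])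
  also have "\<dots> = (\<integral>z. h z * (cmod z)\<^sup>2 \<partial>lborel) + r\<^sup>2 * (\<integral>z. h z \<partial>lborel)"
    unfolding ft using icis Zc by (simp add: circ.prob_space[simplified])
  finally have e: "(\<integral>z. (\<integral>t. f z t \<partial>circ) \<partial>lborel) = (\<integral>z. h z * (cmod z)\<^sup>2 \<partial>lborel) + r\<^sup>2 * (\<integral>z. h z \<partial>lborel)" .
  have cm: "(\<integral>t. f z t \<partial>circ) = circle_mean h z r * (cmod z)\<^sup>2" for z
    by (simp add: f_def circle_mean_def)
  have i1: "integrable lborel (\<lambda>z. circle_mean h z r * (cmod z)\<^sup>2)"
    using pc.integrable_fst[OF int] by (simp add: cm)
  have eq: "(\<lambda>z. (circle_mean h z r - h z) * (cmod z)\<^sup>2) = (\<lambda>z. circle_mean h z r * (cmod z)\<^sup>2 - h z * (cmod z)\<^sup>2)"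
    by (simp add: left_diff_distrib)
  show "integrable lborel (\<lambda>z. (circle_mean h z r - h z) * (cmod z)\<^sup>2)"
    unfolding eq using i1 hz2 by simp
  show "(\<integral>z. (circle_mean h z r - h z) * (cmod z)\<^sup>2 \<partial>lborel) = r\<^sup>2 * (\<integral>z. h z \<partial>lborel)"
    unfolding eq using i1 hz2 e by (simp add: cm)
qed

text \<open>Each \<^term>\<open>W\<close> is a component on whose frontier \<^term>\<open>P\<close> dominates the constant value \<^term>\<open>m\<close>.
  Only this pointwise domination, and no separation between the components, is available.\<close>

lemma glued_max_submean:
  fixes P m :: "complex \<Rightarrow> real" and WW :: "complex set set"
  assumes s: "0 < s"
    and lip: "\<And>z z'. \<bar>P z - P z'\<bar> \<le> cmod (z - z') / s"
    and sub: "\<And>z r. 0 < r \<Longrightarrow> r < s \<Longrightarrow> P z \<le> circle_mean P z r"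
    and op: "\<And>W. W \<in> WW \<Longrightarrow> open W"
    and const: "\<And>W z z'. W \<in> WW \<Longrightarrow> z \<in> W \<Longrightarrow> z' \<in> W \<Longrightarrow> m z = m z'"
    and fr: "\<And>W y z. W \<in> WW \<Longrightarrow> y \<in> frontier W \<Longrightarrow> z \<in> W \<Longrightarrow> m z \<le> P y"
  defines "v \<equiv> \<lambda>z. if z \<in> \<Union>WW then max (P z) (m z) else P z"
  shows "continuous_on A v" and "0 < r \<Longrightarrow> v z \<le> circle_mean v z r"
proof -
  have Pv: "P z \<le> v z" for z by (simp add: v_def)
  have P1: "P z \<le> P z' + cmod (z - z') / s" for z z' using lip[of z z'] by linarith
  have one: "v z \<le> v z' + cmod (z - z') / s" for z z'
  proof (cases "z \<in> \<Union>WW")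
    case False
    then show ?thesis using P1[of z z'] Pv[of z'] by (simp add: v_def)
  next
    case True
    then obtain W where W: "W \<in> WW" "z \<in> W" by blast
    then have vz: "v z = max (P z) (m z)" by (auto simp: v_def)
    have "m z \<le> v z' + cmod (z - z') / s"
    proof (cases "z' \<in> W")
      case True
      then have "m z = m z'" "z' \<in> \<Union>WW" using const W by blast+
      then have "m z \<le> v z'" by (simp add: v_def)
      then show ?thesis using s by (simp add: add_increasing2)
    next
      case False
      \<comment> \<open>The segment leaves \<open>W\<close> and so meets its frontier, where
        \<open>P\<close> dominates the constant; from there on the Lipschitz bound of
        \<open>P\<close> takes over.\<close>
      have "closed_segment z z' \<inter> frontier W \<noteq> {}"
        using W False by (intro connected_Int_frontier) auto
      then obtain y where y: "y \<in> closed_segment z z'" "y \<in> frontier W" by blast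
      have "m z \<le> P y" using fr W y by blast
      also have "\<dots> \<le> P z' + cmod (y - z') / s" by (rule P1)
      also have "cmod (y - z') / s \<le> cmod (z - z') / s"
        using segment_bound(2)[OF y(1)] s by (intro divide_right_mono) (auto simp: norm_minus_commute)
      finally show ?thesis using Pv[of z'] by linarith
    qed
    then show ?thesis using P1[of z z'] Pv[of z'] unfolding vz by linarith
  qed
  have "(1/s)-lipschitz_on UNIV v"
  proof (rule lipschitz_onI)
    fix z z'
    show "dist (v z) (v z') \<le> 1 / s * dist z z'"
      using one[of z z'] one[of z' z] by (simp add: dist_real_def dist_norm norm_minus_commute abs_le_iff)
  qed (use s in auto)
  then have cont: "continuous_on UNIV v" by (rule lipschitz_on_continuous_on)
  then show "continuous_on A v" by (rule continuous_on_subset) simp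
  have contP: "continuous_on UNIV P"
  proof -
    have "(1/s)-lipschitz_on UNIV P"
      using lip s by (intro lipschitz_onI) (auto simp: dist_real_def dist_norm)
    then show ?thesis by (rule lipschitz_on_continuous_on)
  qed
  have PM: "P z \<le> circle_mean v z r" if "0 < r" "r < s" for z r
  proof -
    have "P z \<le> circle_mean P z r" using sub that by blast
    also have "\<dots> \<le> circle_mean v z r"
      unfolding circle_mean_def using Pv by (intro integral_mono integrable_circle cont contP) auto
    finally show ?thesis .
  qed
  \<comment> \<open>Off the components \<open>v\<close> agrees with \<open>P\<close>, whose submean
    inequality survives because P <= v. Inside a component \<open>m\<close> is constant on small
    circles and stays below \<open>v\<close>. The admissible radius depends on z, which is all that
    \<open>local_submean_imp_submean\<close> requires.\<close>
  have loc: "\<exists>\<rho>>0. \<forall>r. 0 < r \<and> r < \<rho> \<longrightarrow> v z \<le> circle_mean v z r" for z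
  proof (cases "z \<in> \<Union>WW")
    case False
    then show ?thesis using PM s by (intro exI[of _ s]) (auto simp: v_def)
  next
    case True
    then obtain W where W: "W \<in> WW" "z \<in> W" by blast
    then obtain d where d: "d > 0" "ball z d \<subseteq> W" using op open_contains_ball by metis
    have "v z \<le> circle_mean v z r" if r: "0 < r" "r < min s d" for r
    proof -
      have "m z \<le> v (z + r * cis t)" for t
      proof -
        have "z + r * cis t \<in> ball z d" using r by (simp add: dist_norm norm_mult)
        then have "z + r * cis t \<in> W" using d by blast
        then have "m z = m (z + r * cis t)" "z + r * cis t \<in> \<Union>WW" using const W by blast+
        then show ?thesis by (simp add: v_def)
      qed
      then have "(\<integral>t. m z \<partial>circ) \<le> circle_mean v z r"
        unfolding circle_mean_def by (intro integral_mono integrable_circle cont) auto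
      then have "m z \<le> circle_mean v z r" by (simp add: circ.prob_space[simplified])
      then show ?thesis using PM[of r z] r W by (auto simp: v_def)
    qed
    then show ?thesis using d s by (intro exI[of _ "min s d"]) auto
  qed
  show "v z \<le> circle_mean v z r" if "0 < r"
    by (rule local_submean_imp_submean[OF cont loc that])
qed

lemma integral_le_of_nn_integral_le:
  fixes X G :: "'a \<Rightarrow> real"
  assumes X: "integrable M X" and ae: "AE x in M. X x \<le> G x" and G: "\<And>x. 0 \<le> G x" "G \<in> borel_measurable M"
    and le: "(\<integral>\<^sup>+x. ennreal (G x) \<partial>M) \<le> ennreal C" and C: "0 \<le> C"
  shows "integral\<^sup>L M X \<le> C"
proof -
  have i: "integrable M G"
    using G le by (intro integrableI_bounded) (auto intro: le_less_trans)
  have "integral\<^sup>L M X \<le> integral\<^sup>L M G" using X i ae by (rule integral_mono_AE)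
  moreover have "ennreal (integral\<^sup>L M G) \<le> ennreal C"
    using nn_integral_eq_integral[OF i] G le by simp
  ultimately show ?thesis using C by (simp add: ennreal_le_iff)
qed

lemma (in disc_prob) msupport_subset_cball: "msupport \<sigma> \<subseteq> cball 0 R"
proof
  fix z assume z: "z \<in> msupport \<sigma>"
  show "z \<in> cball 0 R"
  proof (rule ccontr)
    assume "z \<notin> cball 0 R"
    then have d: "0 < cmod z - R" by simp
    have "AE y in \<sigma>. y \<notin> ball z (cmod z - R)"
      using AE_in_disc
    proof eventually_elim
      case (elim y)
      then show ?case using norm_triangle_ineq2[of z y] by (simp add: dist_norm)
    qed
    then have "ball z (cmod z - R) \<in> null_sets \<sigma>"
      by (subst AE_iff_null_sets) (auto simp: sets_eq_borel)
    then have "emeasure \<sigma> (ball z (cmod z - R)) = 0" by auto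
    moreover have "0 < emeasure \<sigma> (ball z (cmod z - R))" using z d by (simp add: msupport_def)
    ultimately show False by simp
  qed
qed

text \<open>Components of an open set are open and disjoint, so a frontier point of one of them
  belongs to none.\<close>

lemma (in disc_prob) frontier_const_comp:
  assumes W: "W \<in> const_comps" and y: "y \<in> frontier W"
  shows "y \<in> msupport \<sigma>" "y \<notin> \<Union>const_comps"
proof -
  have W': "W \<in> components (- msupport \<sigma>)" using W by (simp add: const_comps_def)
  have yW: "y \<notin> W" "y \<in> closure W" using y open_component[OF W'] by (auto simp: frontier_def interior_open)
  have disj: "y \<notin> W2" if "W2 \<in> components (- msupport \<sigma>)" for W2
  proof
    assume y2: "y \<in> W2"
    have "W2 \<inter> W \<noteq> {}"
      using yW(2) y2 open_component[OF that] by (metis closure_iff_nhds_not_empty order_refl inf_commute)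
    then have "W2 = W" using components_eq[OF that W'] by blast
    then show False using yW y2 by simp
  qed
  show "y \<in> msupport \<sigma>"
  proof (rule ccontr)
    assume "y \<notin> msupport \<sigma>"
    then have "y \<in> \<Union>(components (- msupport \<sigma>))" by simp
    then show False using disj by blast
  qed
  show "y \<notin> \<Union>const_comps" using disj by (auto simp: const_comps_def)
qed

lemma (in disc_prob) potential_const_comp:
  assumes "W \<in> const_comps" "z \<in> W" "z' \<in> W"
  shows "potential \<sigma> z = potential \<sigma> z'"
  using assms unfolding const_comps_def by auto

text \<open>On \<open>W\<close> the constant value is at most the regularised potential; the latter
  is continuous, so the inequality passes to the closure.\<close>

lemma (in disc_prob) potential_le_log_potential_frontier:
  assumes W: "W \<in> const_comps" and y: "y \<in> frontier W" and z: "z \<in> W" and r: "0 < r"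
  shows "potential \<sigma> z \<le> log_potential \<sigma> r y"
proof -
  have W': "W \<in> components (- msupport \<sigma>)" using W by (simp add: const_comps_def)
  have "W \<subseteq> log_potential \<sigma> r -` {potential \<sigma> z..}"
  proof
    fix w assume w: "w \<in> W"
    then obtain d where d: "d > 0" "ball w d \<subseteq> W" using open_component[OF W'] open_contains_ball by blast
    then have "ball w d \<inter> msupport \<sigma> = {}" using in_components_subset[OF W'] by blast
    then have "regular_point \<sigma> w" using off_support_regular d by blast
    then have "potential \<sigma> w \<le> log_potential \<sigma> r w" using potential_le_log_potential r by blast
    then show "w \<in> log_potential \<sigma> r -` {potential \<sigma> z..}" using potential_const_comp[OF W w z] by simp
  qed
  then have "closure W \<subseteq> log_potential \<sigma> r -` {potential \<sigma> z..}"
    by (intro closure_minimal closed_vimage continuous_log_potential r) auto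
  moreover have "y \<in> closure W" using y by (simp add: frontier_def)
  ultimately show ?thesis by blast
qed

context root_seq
begin

text \<open>Write M for the circle mean of radius r. Then M h <= M f + \<epsilon>, next M f <= (M p
  - p) + f because \<open>v\<close> is submean, and f - h is small. Hence M h - h is bounded by near
  potentials of \<mu> and \<epsilon> on the r-neighbourhood of \<open>V\<close> and vanishes
  elsewhere. Testing with |z|^2 gives r^2 times the integral of \<open>h\<close>. Two scales occur:
  s regularises the potentials, r is the radius of the test circles.\<close>

lemma const_comp_estimate:
  fixes V :: "complex set" and s r r0 \<epsilon> b0 :: real and k :: nat
  assumes V: "V \<in> lim.const_comps" and Vb: "V \<subseteq> cball 0 b0" and b0: "R \<le> b0" "0 \<le> b0"
    and s: "0 < s" "s \<le> r" and \<epsilon>: "0 < \<epsilon>" and r0: "0 < r0"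
    and H1: "\<And>z. z \<in> cball 0 (b0 + 2 * r) \<Longrightarrow> log_potential (\<sigma>' k) s z \<le> log_potential \<mu> s z + \<epsilon>"
    and H2: "\<And>z. z \<in> cball 0 (b0 + 2 * r) \<Longrightarrow> z \<notin> \<Union>lim.const_comps \<Longrightarrow> log_potential \<mu> r0 z - \<epsilon> \<le> log_potential (\<sigma>' k) s z"
  defines "h \<equiv> \<lambda>z. indicator V z * (log_potential \<mu> s z - log_potential (\<sigma>' k) s z)"
  shows "r\<^sup>2 * (\<integral>z. h z \<partial>lborel) \<le> (b0 + r)\<^sup>2 * (32 * r\<^sup>2 * measure \<mu> {y. infdist y V \<le> 3 * r} + 16 * s\<^sup>2
      + 2 * \<epsilon> * measure lborel (cball (0::complex) (b0 + r)))"
    and "integrable lborel h"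
proof -
  interpret s': disc_prob "\<sigma>' k" R by (rule disc_k')
  have r: "0 < r" using s by simp
  define P where "P = log_potential (\<sigma>' k) s"
  define p where "p = log_potential \<mu> s"
  have V': "V \<in> components (- msupport \<mu>)" using V by (simp add: lim.const_comps_def)
  have Vo: "open V" by (rule lim.open_component[OF V'])
  have Vne: "V \<noteq> {}" by (rule in_components_nonempty[OF V'])
  have [measurable]: "V \<in> sets borel" using Vo by simp
  have Pm [measurable]: "P \<in> borel_measurable borel" "p \<in> borel_measurable borel"
    unfolding P_def p_def using s by (auto intro: s'.measurable_log_potential lim.measurable_log_potential)
  have Pc: "continuous_on A P" "continuous_on A p" for A
    unfolding P_def p_def using s by (auto intro: s'.continuous_log_potential lim.continuous_log_potential)
  define WW where "WW = lim.const_comps - {V}"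
  \<comment> \<open>On the other constant components the value p - \<epsilon> enters as a maximum
    with \<open>P\<close>. On their frontiers only P >= m is known, so plain replacement could break
    continuity.\<close>
  define m where "m z = potential \<mu> z - \<epsilon>" for z
  define v where "v z = (if z \<in> \<Union>WW then max (P z) (m z) else P z)" for z
  have WWd: "W \<inter> V = {}" if "W \<in> WW" for W
    using that V' components_nonoverlap[of V "- msupport \<mu>" W] unfolding WW_def lim.const_comps_def by auto
  have vV: "v z = P z" if "z \<in> V" for z using WWd that by (auto simp: v_def)
  have fr: "m z \<le> P y" if W: "W \<in> WW" and y: "y \<in> frontier W" and z: "z \<in> W" for W y z
  proof -
    have Wc: "W \<in> lim.const_comps" using W by (simp add: WW_def)
    have "y \<in> cball 0 (b0 + 2 * r)"
      using lim.frontier_const_comp(1)[OF Wc y] lim.msupport_subset_cball b0 r by force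
    then have "log_potential \<mu> r0 y - \<epsilon> \<le> P y"
      using H2 lim.frontier_const_comp(2)[OF Wc y] unfolding P_def by blast
    then show ?thesis using lim.potential_le_log_potential_frontier[OF Wc y z r0] by (simp add: m_def)
  qed
  have v_cont: "continuous_on UNIV v" and v_sub: "v z \<le> circle_mean v z r" for z
  proof -
    have lipP: "\<bar>P z - P z'\<bar> \<le> cmod (z - z') / s" for z z' unfolding P_def by (rule s'.log_potential_lipschitz[OF s(1)])
    have subP: "P z \<le> circle_mean P z r" if "0 < r" "r < s" for z r unfolding P_def by (rule s'.log_potential_local_submean[OF that])
    have opW: "open W" if "W \<in> WW" for W using that lim.open_component by (auto simp: WW_def lim.const_comps_def)
    have cW: "m z = m z'" if "W \<in> WW" "z \<in> W" "z' \<in> W" for W z z'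
      using lim.potential_const_comp[of W z z'] that by (simp add: m_def WW_def)
    show "continuous_on UNIV v" unfolding v_def by (rule glued_max_submean(1)[OF s(1) lipP subP opW cW fr])
    show "v z \<le> circle_mean v z r" unfolding v_def by (rule glued_max_submean(2)[OF s(1) lipP subP opW cW fr r])
  qed
  define f where "f z = p z - v z" for z
  have f_cont: "continuous_on UNIV f" unfolding f_def by (intro continuous_intros v_cont Pc)
  have reg_comp: "potential \<mu> z \<le> log_potential \<mu> t z" if zt: "z \<in> \<Union>lim.const_comps" "0 < t" for z t
  proof -
    obtain W where "W \<in> lim.const_comps" "z \<in> W" using zt(1) by blast
    then have W: "W \<in> components (- msupport \<mu>)" "z \<in> W" by (auto simp: lim.const_comps_def)
    then obtain d where d: "d > 0" "ball z d \<subseteq> W" using lim.open_component open_contains_ball by metis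
    then have "ball z d \<inter> msupport \<mu> = {}" using in_components_subset[OF W(1)] by blast
    then show ?thesis using lim.off_support_regular[OF d(1)] lim.potential_le_log_potential zt by blast
  qed
  have f_lower: "- \<epsilon> \<le> f z" if "z \<in> cball 0 (b0 + 2 * r)" for z
  proof (cases "z \<in> \<Union>WW")
    case True
    then have "potential \<mu> z \<le> p z" unfolding p_def using reg_comp s by (auto simp: WW_def)
    then show ?thesis using True H1[OF that] \<epsilon> by (simp add: f_def v_def m_def P_def p_def)
  next
    case False
    then show ?thesis using H1[OF that] by (simp add: f_def v_def P_def p_def)
  qed
  have h_f: "h z \<le> f z + \<epsilon>" if "z \<in> cball 0 (b0 + 2 * r)" for z
  proof (cases "z \<in> V")
    case True
    then show ?thesis using vV[OF True] \<epsilon> by (simp add: h_def f_def P_def p_def)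
  next
    case False
    then show ?thesis using f_lower[OF that] by (simp add: h_def)
  qed
  have hm [measurable]: "h \<in> borel_measurable borel" unfolding h_def P_def[symmetric] p_def[symmetric] by measurable
  have "compact ((\<lambda>z. p z - P z) ` cball 0 b0)" by (intro compact_continuous_image continuous_intros Pc) auto
  then have "bounded ((\<lambda>z. p z - P z) ` cball 0 b0)" by (rule compact_imp_bounded)
  then obtain B where B: "\<forall>x\<in>(\<lambda>z. p z - P z) ` cball 0 b0. norm x \<le> B" unfolding bounded_iff by auto
  have h_le: "\<bar>h z\<bar> \<le> \<bar>B\<bar>" for z
  proof (cases "z \<in> V")
    case True
    then have "norm (p z - P z) \<le> B" using B Vb by blast
    then show ?thesis using True by (simp add: h_def p_def P_def)
  qed (simp add: h_def)
  have h_supp: "h z = 0" if "z \<notin> cball 0 b0" for z using that Vb by (auto simp: h_def indicator_def)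
  show h_int: "integrable lborel h" using h_le h_supp by (intro integrable_bounded_support) auto
  \<comment> \<open>Outside this closed neighbourhood both \<open>h\<close> and its circle mean of
    radius r vanish.\<close>
  define N where "N = {z. infdist z V \<le> r}"
  have Ncl: "closed N" unfolding N_def by (intro closed_Collect_le continuous_intros)
  have [measurable]: "N \<in> sets borel" using Ncl by simp
  have N_sub: "N \<subseteq> cball 0 (b0 + r)"
  proof
    fix z assume z: "z \<in> N"
    have ne: "closure V \<noteq> {}" using Vne by simp
    obtain w where w: "w \<in> closure V" "infdist z (closure V) = dist z w"
      using infdist_attains_inf[OF closed_closure ne] by blast
    have "closure V \<subseteq> cball 0 b0" using Vb by (intro closure_minimal) auto
    then have "cmod w \<le> b0" using w by auto
    moreover have "dist z w \<le> r" using w(2) z infdist_mono[OF closure_subset Vne, of z] by (simp add: N_def)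
    ultimately have "cmod z \<le> b0 + r" using norm_triangle_ineq2[of z w] by (simp add: dist_norm)
    then show "z \<in> cball 0 (b0 + r)" by simp
  qed
  have h_circ_int: "integrable circ (\<lambda>t. h (z + r * cis t))" for z
    using h_le by (intro integrable_circ_bounded[where B="\<bar>B\<bar>"]) auto
  have key: "AE z in lborel. (circle_mean h z r - h z) * (cmod z)\<^sup>2
     \<le> (b0 + r)\<^sup>2 * (indicator N z * (r * near_potential \<mu> (r + s) z + s * near_potential \<mu> s z + 2 * \<epsilon>))"
    using lim.AE_regular_point
  proof eventually_elim
    case (elim z)
    show ?case
    proof (cases "z \<in> N")
      case False
      have "z + r * cis t \<notin> V" for t
      proof
        assume "z + r * cis t \<in> V"
        then have "infdist z V \<le> dist z (z + r * cis t)" by (rule infdist_le)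
        then show False using False r by (simp add: N_def dist_norm norm_mult)
      qed
      then have "circle_mean h z r = 0" by (simp add: circle_mean_def h_def)
      moreover have "z \<notin> V"
      proof
        assume "z \<in> V"
        then have "infdist z V = 0" by simp
        then show False using False r by (simp add: N_def)
      qed
      ultimately show ?thesis using False by (simp add: h_def)
    next
      case True
      then have zb: "cmod z \<le> b0 + r" using N_sub by auto
      have in_b: "z + r * cis t \<in> cball 0 (b0 + 2 * r)" for t
        using norm_triangle_ineq[of z "r * cis t"] zb r by (simp add: norm_mult)
      have zb2: "z \<in> cball 0 (b0 + 2 * r)" using zb r by simp
      have "circle_mean h z r \<le> (\<integral>t. f (z + r * cis t) + \<epsilon> \<partial>circ)"
        unfolding circle_mean_def using h_f[OF in_b] h_circ_int integrable_circle[OF f_cont, of z r]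
        by (intro integral_mono) auto
      also have "\<dots> = circle_mean p z r - circle_mean v z r + \<epsilon>"
        unfolding circle_mean_def f_def
        using integrable_circle[OF Pc(2), of z r] integrable_circle[OF v_cont, of z r]
        by (simp add: circ.prob_space[simplified])
      also have "\<dots> \<le> (circle_mean p z r - p z) + f z + \<epsilon>" using v_sub[of z] by (simp add: f_def)
      also have "circle_mean p z r - p z \<le> r * near_potential \<mu> (r + s) z"
        unfolding p_def by (rule lim.circle_mean_log_potential_le[OF elim r s(1)])
      finally have 1: "circle_mean h z r \<le> r * near_potential \<mu> (r + s) z + f z + \<epsilon>" by simp
      \<comment> \<open>A point off \<open>V\<close> either lies in another constant component,
        where v >= \<open>potential \<mu>\<close> - \<epsilon> by construction, or in none, where
        \<open>H2\<close> applies. In both cases \<open>f\<close> is at most \<epsilon> plus the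
        error of regularising the potential of \<mu> at radius s.\<close>
      have 2: "f z - h z \<le> s * near_potential \<mu> s z + \<epsilon>"
      proof (cases "z \<in> V")
        case True
        then have "f z = h z" using vV[OF True] by (simp add: h_def f_def P_def p_def)
        then show ?thesis using \<epsilon> s lim.near_potential_nonneg[of s z] by simp
      next
        case False
        have "potential \<mu> z - \<epsilon> \<le> v z"
        proof (cases "z \<in> \<Union>WW")
          case True
          then show ?thesis by (simp add: v_def m_def)
        next
          case False': False
          then have "z \<notin> \<Union>lim.const_comps" using False by (auto simp: WW_def)
          then have "log_potential \<mu> r0 z - \<epsilon> \<le> P z" using H2[OF zb2] by (simp add: P_def)
          moreover have "potential \<mu> z \<le> log_potential \<mu> r0 z" by (rule lim.potential_le_log_potential[OF elim r0])
          ultimately show ?thesis using False' by (simp add: v_def)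
        qed
        moreover have "p z - potential \<mu> z \<le> s * near_potential \<mu> s z"
          unfolding p_def by (rule lim.log_potential_minus_potential_le[OF elim s(1)])
        ultimately show ?thesis using False by (simp add: f_def h_def)
      qed
      have G0: "0 \<le> r * near_potential \<mu> (r + s) z + s * near_potential \<mu> s z + 2 * \<epsilon>"
        using r s \<epsilon> lim.near_potential_nonneg by (intro add_nonneg_nonneg mult_nonneg_nonneg) auto
      have "(circle_mean h z r - h z) * (cmod z)\<^sup>2 \<le> (r * near_potential \<mu> (r + s) z + s * near_potential \<mu> s z + 2 * \<epsilon>) * (cmod z)\<^sup>2"
        using 1 2 by (intro mult_right_mono) auto
      also have "\<dots> \<le> (r * near_potential \<mu> (r + s) z + s * near_potential \<mu> s z + 2 * \<epsilon>) * (b0 + r)\<^sup>2"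
        using zb G0 by (intro mult_left_mono power_mono) auto
      finally show ?thesis using True by (simp add: mult.commute)
    qed
  qed
  \<comment> \<open>Balls of radius r + s <= 2 r about points of \<open>N\<close> stay within
    distance 3 r of \<open>V\<close>.\<close>
  define A where "A = {y. infdist y V \<le> 3 * r}"
  have Acl: "closed A" unfolding A_def by (intro closed_Collect_le continuous_intros)
  have [measurable]: "A \<in> sets borel" using Acl by simp
  have NA: "ball z (r + s) \<subseteq> A" if "z \<in> N" for z
  proof
    fix y assume y: "y \<in> ball z (r + s)"
    have "infdist y V \<le> infdist z V + dist y z" by (rule infdist_triangle)
    then show "y \<in> A" using y that s by (simp add: A_def N_def dist_commute)
  qed
  define ar where "ar = measure lborel (cball (0::complex) (b0 + r))"
  have emN: "emeasure lborel N \<le> ennreal ar"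
  proof -
    have "emeasure lborel N \<le> emeasure lborel (cball (0::complex) (b0 + r))" using N_sub by (intro emeasure_mono) auto
    also have "\<dots> = ennreal ar" unfolding ar_def
      using emeasure_bounded_finite[OF bounded_cball, of "0 :: complex" "b0 + r"] by (intro emeasure_eq_ennreal_measure) auto
    finally show ?thesis .
  qed
  \<comment> \<open>The three errors: 16 r (r + s) <= 32 r^2 times the mass near \<open>V\<close>,
    then 16 s^2 from regularisation with total mass 1, and 2 \<epsilon> times an area; the factor in
    front bounds |z|^2 on \<open>N\<close>.\<close>
  define C where "C = (b0 + r)\<^sup>2 * (32 * r\<^sup>2 * measure \<mu> A + 16 * s\<^sup>2 + 2 * \<epsilon> * ar)"
  have C: "0 \<le> C" using \<epsilon> by (simp add: C_def ar_def)
  have "(\<integral>z. (circle_mean h z r - h z) * (cmod z)\<^sup>2 \<partial>lborel) \<le> C"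
  proof (rule integral_le_of_nn_integral_le[OF integral_circle_mean_square(2)[OF hm h_le h_supp r] key _ _ _ C])
    show "0 \<le> (b0 + r)\<^sup>2 * (indicator N z * (r * near_potential \<mu> (r + s) z + s * near_potential \<mu> s z + 2 * \<epsilon>))" for z
      using r s \<epsilon> lim.near_potential_nonneg by (intro add_nonneg_nonneg mult_nonneg_nonneg) auto
    show "(\<lambda>z. (b0 + r)\<^sup>2 * (indicator N z * (r * near_potential \<mu> (r + s) z + s * near_potential \<mu> s z + 2 * \<epsilon>))) \<in> borel_measurable lborel"
      by measurable
    have nm: "(\<lambda>z. indicator N z * ennreal (near_potential \<mu> t z)) \<in> borel_measurable lborel" for t by measurable
    have nm2: "(\<lambda>z. ennreal (2 * \<epsilon>) * indicator N z) \<in> borel_measurable lborel" by measurable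
    have "(\<integral>\<^sup>+z. ennreal ((b0 + r)\<^sup>2 * (indicator N z * (r * near_potential \<mu> (r + s) z + s * near_potential \<mu> s z + 2 * \<epsilon>))) \<partial>lborel)
      = (\<integral>\<^sup>+z. ennreal ((b0 + r)\<^sup>2) * (ennreal r * (indicator N z * ennreal (near_potential \<mu> (r + s) z)) 
          + (ennreal s * (indicator N z * ennreal (near_potential \<mu> s z)) + ennreal (2 * \<epsilon>) * indicator N z)) \<partial>lborel)"
    proof (intro nn_integral_cong)
      fix z
      have "ennreal ((b0 + r)\<^sup>2 * (r * near_potential \<mu> (r + s) z + (s * near_potential \<mu> s z + 2 * \<epsilon>)))
        = ennreal ((b0 + r)\<^sup>2) * (ennreal r * ennreal (near_potential \<mu> (r + s) z) + (ennreal s * ennreal (near_potential \<mu> s z) + ennreal (2 * \<epsilon>)))"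
        using r s \<epsilon> lim.near_potential_nonneg[of "r + s" z] lim.near_potential_nonneg[of s z]
        by (simp add: ennreal_mult ennreal_plus)
      then show "ennreal ((b0 + r)\<^sup>2 * (indicator N z * (r * near_potential \<mu> (r + s) z + s * near_potential \<mu> s z + 2 * \<epsilon>)))
        = ennreal ((b0 + r)\<^sup>2) * (ennreal r * (indicator N z * ennreal (near_potential \<mu> (r + s) z)) 
          + (ennreal s * (indicator N z * ennreal (near_potential \<mu> s z)) + ennreal (2 * \<epsilon>) * indicator N z))"
        by (cases "z \<in> N") (simp_all add: add.assoc)
    qed
    also have "\<dots> = ennreal ((b0 + r)\<^sup>2) * (ennreal r * (\<integral>\<^sup>+z. indicator N z * ennreal (near_potential \<mu> (r + s) z) \<partial>lborel)
       + (ennreal s * (\<integral>\<^sup>+z. indicator N z * ennreal (near_potential \<mu> s z) \<partial>lborel) + ennreal (2 * \<epsilon>) * emeasure lborel N))"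
      using nm nm2 by (subst nn_integral_cmult, simp, subst nn_integral_add, simp, simp, subst nn_integral_cmult, simp,
          subst nn_integral_add, simp, simp, subst nn_integral_cmult, simp, subst nn_integral_cmult_indicator, simp_all)
    also have "\<dots> \<le> ennreal ((b0 + r)\<^sup>2) * (ennreal r * ennreal (16 * (r + s) * measure \<mu> A)
       + (ennreal s * ennreal (16 * s * measure \<mu> UNIV) + ennreal (2 * \<epsilon>) * ennreal ar))"
      using r s by (intro mult_left_mono add_mono lim.nn_integral_near_potential_le emN NA) auto
    also have "\<dots> = ennreal ((b0 + r)\<^sup>2 * (r * (16 * (r + s) * measure \<mu> A) + (s * (16 * s) + 2 * \<epsilon> * ar)))"
      using r s \<epsilon> by (simp add: ennreal_mult ennreal_plus lim.prob_space[simplified] ar_def)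
    also have "\<dots> \<le> ennreal C"
      unfolding C_def
    proof (intro ennreal_leI mult_left_mono)
      have "r * (16 * (r + s) * measure \<mu> A) \<le> r * (16 * (r + r) * measure \<mu> A)"
        using s r by (intro mult_left_mono mult_right_mono) auto
      also have "\<dots> = 32 * r\<^sup>2 * measure \<mu> A" by (simp add: power2_eq_square)
      finally show "r * (16 * (r + s) * measure \<mu> A) + (s * (16 * s) + 2 * \<epsilon> * ar) \<le> 32 * r\<^sup>2 * measure \<mu> A + 16 * s\<^sup>2 + 2 * \<epsilon> * ar"
        by (simp add: power2_eq_square)
    qed auto
    finally show "(\<integral>\<^sup>+z. ennreal ((b0 + r)\<^sup>2 * (indicator N z * (r * near_potential \<mu> (r + s) z + s * near_potential \<mu> s z + 2 * \<epsilon>))) \<partial>lborel) \<le> ennreal C" .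
  qed
  then show "r\<^sup>2 * (\<integral>z. h z \<partial>lborel) \<le> (b0 + r)\<^sup>2 * (32 * r\<^sup>2 * measure \<mu> {y. infdist y V \<le> 3 * r} + 16 * s\<^sup>2
      + 2 * \<epsilon> * measure lborel (cball (0::complex) (b0 + r)))"
    using integral_circle_mean_square(1)[OF hm h_le h_supp r] unfolding C_def ar_def A_def by simp
qed

end

section \<open>The lower bound on null components, and convergence of regularised potentials\<close>

context root_seq
begin

text \<open>If the potential of the derivative were below c - \<epsilon>0 at x0, the Lipschitz bound
  would keep \<open>h\<close> above a positive constant on a fixed disc, and \<open>h\<close> is
  nowhere below - \<epsilon>, so its integral would be at least T up to a multiple of \<epsilon>.
  Against this, the local mass, the regularisation and \<epsilon> contribute at most T / 4 each in
  \<open>const_comp_estimate\<close>.\<close>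

lemma lower_at_const:
  assumes V: "V \<in> lim.const_comps" and bV: "bounded V" and null: "measure \<mu> (closure V) = 0" and x0: "x0 \<in> V"
  shows "lower_at x0"
  unfolding lower_at_def
proof (intro allI impI)
  fix b s0 \<epsilon>0 :: real
  assume s0: "0 < s0" and \<epsilon>0: "0 < \<epsilon>0" and hb: "\<forall>r>0. b \<le> log_potential \<mu> r x0"
  define c where "c = potential \<mu> x0"
  have V': "V \<in> components (- msupport \<mu>)" using V by (simp add: lim.const_comps_def)
  obtain d where d: "0 < d" "ball x0 d \<subseteq> V" using lim.open_component[OF V'] x0 open_contains_ball by blast
  have off: "ball z e \<inter> msupport \<mu> = {}" if "ball z e \<subseteq> V" for z e
    using that in_components_subset[OF V'] by blast
  have "log_potential \<mu> d x0 = c"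
    unfolding c_def by (rule lim.log_potential_off_support[OF d(1) order_refl off[OF d(2)]])
  then have bc: "b \<le> c" using hb d by force
  \<comment> \<open>A smaller radius lowers the regularised potential, so the assumed failure at s0
    is inherited by s1. Radii up to d / 2 meet no mass of \<mu> from points of
    \<open>ball x0 (d / 2)\<close>, so the limit potential is exactly c there.\<close>
  define s1 where "s1 = min s0 (d / 2)"
  have s1: "0 < s1" "s1 \<le> s0" "s1 \<le> d / 2" using s0 d by (auto simp: s1_def)
  define \<rho> where "\<rho> = min (d / 2) (s1 * \<epsilon>0 / 4)"
  have \<rho>: "0 < \<rho>" "\<rho> \<le> d / 2" "\<rho> / s1 \<le> \<epsilon>0 / 4" using d s1 \<epsilon>0 by (auto simp: \<rho>_def min_def field_simps)
  \<comment> \<open>3/4 \<epsilon>0 is what the Lipschitz loss leaves of \<epsilon>0 on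
    \<open>ball x0 \<rho>\<close>, and T is its integral over this ball.\<close>
  define T where "T = 3 / 4 * \<epsilon>0 * (pi * \<rho>\<^sup>2)"
  have T: "0 < T" using \<epsilon>0 \<rho> by (simp add: T_def)
  obtain B where "\<forall>z\<in>V. norm z \<le> B" using bV unfolding bounded_iff by auto
  then have B: "V \<subseteq> cball 0 B" by auto
  define b0 where "b0 = max R B"
  have b0: "V \<subseteq> cball 0 b0" "R \<le> b0" "0 \<le> b0" using B lim.R_nonneg by (auto simp: b0_def)
  define b1 where "b1 = b0 + 1"
  have b1: "0 < b1" using b0 by (simp add: b1_def)
  \<comment> \<open>Closed neighbourhoods that shrink to the closure of \<open>V\<close>; their
    masses tend to the mass of the closure, which is 0.\<close>
  define A where "A n = {y. infdist y V \<le> 3 * (1 / real (Suc n))}" for n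
  have Acl: "closed (A n)" for n unfolding A_def by (intro closed_Collect_le continuous_intros)
  have "(\<lambda>n. measure \<mu> (A n)) \<longlonglongrightarrow> measure \<mu> (\<Inter>n. A n)"
  proof (rule lim.finite_Lim_measure_decseq)
    show "range A \<subseteq> lim.events" using Acl by auto
    show "decseq A"
    proof (rule decseq_SucI)
      fix n
      have "1 / real (Suc (Suc n)) \<le> 1 / real (Suc n)" by (intro divide_left_mono) auto
      then show "A (Suc n) \<subseteq> A n" unfolding A_def by auto
    qed
  qed
  also have "(\<Inter>n. A n) = closure V"
  proof -
    have Vne: "V \<noteq> {}" using x0 by auto
    have "(\<forall>n. infdist y V \<le> 3 * (1 / real (Suc n))) \<longleftrightarrow> infdist y V = 0" for y
    proof
      assume a: "\<forall>n. infdist y V \<le> 3 * (1 / real (Suc n))"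
      show "infdist y V = 0"
      proof (rule ccontr)
        assume "infdist y V \<noteq> 0"
        then have "0 < infdist y V / 3" using infdist_nonneg[of y V] by simp
        then obtain n where "1 / real (Suc n) < infdist y V / 3" using nat_approx_posE by blast
        then show False using a[rule_format, of n] by simp
      qed
    qed auto
    then show ?thesis using in_closure_iff_infdist_zero[OF Vne] by (auto simp: A_def)
  qed
  finally have "(\<lambda>n. measure \<mu> (A n)) \<longlonglongrightarrow> 0" using null by simp
  then have "(\<lambda>n. 32 * b1\<^sup>2 * measure \<mu> (A n)) \<longlonglongrightarrow> 32 * b1\<^sup>2 * 0" by (intro tendsto_intros)
  then have "\<forall>\<^sub>F n in sequentially. 32 * b1\<^sup>2 * measure \<mu> (A n) < T / 4" using T by (intro order_tendstoD(2)) auto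
  then obtain n where n: "32 * b1\<^sup>2 * measure \<mu> (A n) < T / 4" by (auto dest!: eventually_happens)
  define r where "r = 1 / real (Suc n)"
  have r: "0 < r" "r \<le> 1" by (auto simp: r_def)
  have muA: "32 * b1\<^sup>2 * measure \<mu> {y. infdist y V \<le> 3 * r} < T / 4" using n by (simp add: A_def r_def)
  \<comment> \<open>The ratio s / r at which the regularisation error 16 b1^2 s^2 / r^2 equals T /
    4.\<close>
  define qq where "qq = sqrt (T / (64 * b1\<^sup>2))"
  have qq: "0 < qq" "qq\<^sup>2 = T / (64 * b1\<^sup>2)" using T b1 by (auto simp: qq_def)
  define s where "s = min (min r s1) (r * qq)"
  have s: "0 < s" "s \<le> r" "s \<le> s1" "s \<le> r * qq" using r s1 qq by (auto simp: s_def)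
  have s2: "16 * b1\<^sup>2 * (s\<^sup>2 / r\<^sup>2) \<le> T / 4"
  proof -
    have "s\<^sup>2 \<le> (r * qq)\<^sup>2" using s by (intro power_mono) auto
    then have "s\<^sup>2 / r\<^sup>2 \<le> qq\<^sup>2" using r by (simp add: field_simps)
    then have "16 * b1\<^sup>2 * (s\<^sup>2 / r\<^sup>2) \<le> 16 * b1\<^sup>2 * qq\<^sup>2" by (intro mult_left_mono) auto
    also have "\<dots> = T / 4" using b1 by (simp add: qq)
    finally show ?thesis .
  qed
  define a1 where "a1 = measure lborel (cball (0::complex) b1)"
  have a1: "0 \<le> a1" by (simp add: a1_def)
  \<comment> \<open>Collects the coefficients of \<epsilon>: the area term after division by r^2,
    and the loss from h >= - \<epsilon>. The summand 1 keeps it positive.\<close>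
  define KK where "KK = 2 * b1\<^sup>2 * a1 / r\<^sup>2 + a1 + 1"
  have KK: "0 < KK" using a1 r by (simp add: KK_def add_nonneg_pos)
  define \<epsilon> where "\<epsilon> = T / (4 * KK)"
  have \<epsilon>: "0 < \<epsilon>" "\<epsilon> * KK = T / 4" using T KK by (auto simp: \<epsilon>_def)
  have area_mono: "measure lborel (cball (0::complex) t) \<le> a1" if "t \<le> b1" for t
  proof -
    have "cball (0::complex) t \<subseteq> cball 0 b1" using that by auto
    then show ?thesis unfolding a1_def
      using emeasure_bounded_finite[OF bounded_cball, of "0 :: complex" b1]
      by (intro measure_mono_fmeasurable) (auto simp: fmeasurable_def)
  qed
  define R2 where "R2 = b0 + 2 * r"
  have "compact (cball 0 R2 \<inter> - \<Union>lim.const_comps)"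
    by (intro compact_Int_closed compact_cball lim.closed_Compl_const_comps)
  from lower_uniformly[OF this _ s(1) \<epsilon>(1)] obtain r0 where r0: "r0 > 0"
    and ev2: "\<forall>\<^sub>F k in sequentially. \<forall>y\<in>cball 0 R2 \<inter> - \<Union>lim.const_comps. log_potential \<mu> r0 y - \<epsilon> \<le> log_potential (\<sigma>' k) s y"
    using lower_at_nonconst by blast
  show "\<forall>\<^sub>F k in sequentially. b - \<epsilon>0 \<le> log_potential (\<sigma>' k) s0 x0"
    using ev2 log_potential_pderiv_upper[OF s(1) \<epsilon>(1), of R2]
  proof eventually_elim
    case (elim k)
    interpret s': disc_prob "\<sigma>' k" R by (rule disc_k')
    define h where "h z = indicator V z * (log_potential \<mu> s z - log_potential (\<sigma>' k) s z)" for z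
    have H1: "log_potential (\<sigma>' k) s z \<le> log_potential \<mu> s z + \<epsilon>" if "z \<in> cball 0 (b0 + 2 * r)" for z
      using elim that by (simp add: R2_def)
    have H2: "log_potential \<mu> r0 z - \<epsilon> \<le> log_potential (\<sigma>' k) s z" if "z \<in> cball 0 (b0 + 2 * r)" "z \<notin> \<Union>lim.const_comps" for z
      using elim that by (auto simp: R2_def)
    note est = const_comp_estimate[OF V b0 s(1,2) \<epsilon>(1) r0 H1 H2, folded h_def]
    have hi: "integrable lborel h" using est(2) by (simp add: h_def[abs_def])
    show ?case
    proof (rule ccontr)
      assume "\<not> ?case"
      then have "log_potential (\<sigma>' k) s0 x0 < c - \<epsilon>0" using bc by simp
      then have P1: "log_potential (\<sigma>' k) s1 x0 < c - \<epsilon>0" using s'.log_potential_mono[OF s1(1,2), of x0] by simp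
      have ball_V: "ball x0 \<rho> \<subseteq> V" using d \<rho> by (intro order_trans[OF _ d(2)]) auto
      have big: "3 / 4 * \<epsilon>0 \<le> h z" if z: "z \<in> ball x0 \<rho>" for z
      proof -
        have "ball z (d / 2) \<subseteq> ball x0 d"
        proof
          fix u assume "u \<in> ball z (d / 2)"
          then show "u \<in> ball x0 d" using z \<rho> dist_triangle[of x0 u z] by simp
        qed
        then have "log_potential \<mu> s z = potential \<mu> z"
          using s s1 d by (intro lim.log_potential_off_support[where d="d / 2"] off) auto
        also have "\<dots> = c" unfolding c_def using lim.potential_const_comp[OF V _ x0] z ball_V by blast
        finally have pz: "log_potential \<mu> s z = c" .
        have "log_potential (\<sigma>' k) s z \<le> log_potential (\<sigma>' k) s1 z" by (rule s'.log_potential_mono[OF s(1,3)])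
        also have "\<dots> \<le> log_potential (\<sigma>' k) s1 x0 + cmod (z - x0) / s1"
          using s'.log_potential_lipschitz[OF s1(1), of z x0] by linarith
        also have "cmod (z - x0) / s1 \<le> \<rho> / s1" using z s1 by (intro divide_right_mono) (auto simp: dist_norm norm_minus_commute)
        finally have "log_potential (\<sigma>' k) s z \<le> c - 3 / 4 * \<epsilon>0" using P1 \<rho>(3) by linarith
        then show ?thesis using pz z ball_V by (auto simp: h_def)
      qed
      have low: "- \<epsilon> \<le> h z" for z
      proof (cases "z \<in> V")
        case True
        then have "z \<in> cball 0 (b0 + 2 * r)" using b0 r by force
        then show ?thesis using H1 True by (force simp: h_def)
      qed (use \<epsilon> in \<open>simp add: h_def\<close>)
      have ib: "integrable lborel (indicator (ball x0 \<rho>) :: complex \<Rightarrow> real)"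
        using emeasure_bounded_finite[OF bounded_ball, of x0 \<rho>] by (intro integrable_real_indicator) auto
      have ic: "integrable lborel (indicator (cball 0 b0) :: complex \<Rightarrow> real)"
        using emeasure_bounded_finite[OF bounded_cball, of "0::complex" b0] by (intro integrable_real_indicator) auto
      have "(\<integral>z. 3 / 4 * \<epsilon>0 * indicator (ball x0 \<rho>) z \<partial>lborel) \<le> (\<integral>z. h z + \<epsilon> * indicator (cball 0 b0) z \<partial>lborel)"
      proof (intro integral_mono)
        fix z
        show "3 / 4 * \<epsilon>0 * indicator (ball x0 \<rho>) z \<le> h z + \<epsilon> * indicator (cball 0 b0) z"
        proof (cases "z \<in> ball x0 \<rho>")
          case True
          then show ?thesis using big[of z] \<epsilon> by (simp add: add_increasing2)
        next
          case False
          show ?thesis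
          proof (cases "z \<in> V")
            case True
            then have "z \<in> cball 0 b0" using b0 by blast
            then show ?thesis using False low[of z] by simp
          qed (use False \<epsilon> in \<open>simp add: h_def\<close>)
        qed
      qed (use hi ib ic in auto)
      also have "\<dots> = (\<integral>z. h z \<partial>lborel) + \<epsilon> * measure lborel (cball (0::complex) b0)" using hi ic by simp
      also have "\<dots> \<le> (\<integral>z. h z \<partial>lborel) + \<epsilon> * a1"
        using area_mono[of b0] \<epsilon> by (intro add_left_mono mult_left_mono) (auto simp: b1_def)
      also have "(\<integral>z. 3 / 4 * \<epsilon>0 * indicator (ball x0 \<rho>) z \<partial>lborel) = T"
        using emeasure_lborel_ball_complex[of \<rho> x0] \<rho> by (simp add: T_def measure_def)
      finally have L: "T \<le> (\<integral>z. h z \<partial>lborel) + \<epsilon> * a1" .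
      have "r\<^sup>2 * (\<integral>z. h z \<partial>lborel) \<le> (b0 + r)\<^sup>2 * (32 * r\<^sup>2 * measure \<mu> {y. infdist y V \<le> 3 * r} + 16 * s\<^sup>2
         + 2 * \<epsilon> * measure lborel (cball (0::complex) (b0 + r)))"
        using est(1) by (simp add: h_def[abs_def])
      also have "\<dots> \<le> b1\<^sup>2 * (32 * r\<^sup>2 * measure \<mu> {y. infdist y V \<le> 3 * r} + 16 * s\<^sup>2 + 2 * \<epsilon> * a1)"
        using r b0 \<epsilon> area_mono[of "b0 + r"]
        by (intro mult_mono power_mono add_left_mono mult_left_mono add_nonneg_nonneg mult_nonneg_nonneg) (auto simp: b1_def)
      finally have "(\<integral>z. h z \<partial>lborel) \<le> b1\<^sup>2 * (32 * r\<^sup>2 * measure \<mu> {y. infdist y V \<le> 3 * r} + 16 * s\<^sup>2 + 2 * \<epsilon> * a1) / r\<^sup>2"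
        using r by (simp add: pos_le_divide_eq mult.commute)
      also have "\<dots> = 32 * b1\<^sup>2 * measure \<mu> {y. infdist y V \<le> 3 * r} + 16 * b1\<^sup>2 * (s\<^sup>2 / r\<^sup>2) + \<epsilon> * (2 * b1\<^sup>2 * a1 / r\<^sup>2)"
        using r by (simp add: field_simps)
      finally have "(\<integral>z. h z \<partial>lborel) + \<epsilon> * a1 < T / 4 + T / 4 + \<epsilon> * (2 * b1\<^sup>2 * a1 / r\<^sup>2 + a1)"
        using muA s2 by (simp add: distrib_left)
      also have "\<epsilon> * (2 * b1\<^sup>2 * a1 / r\<^sup>2 + a1) \<le> \<epsilon> * KK" using \<epsilon> by (intro mult_left_mono) (auto simp: KK_def)
      finally show False using L \<epsilon> T by simp
    qed
  qed
qed

lemma log_potential_pderiv_tendsto: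
  assumes low: "\<And>x. lower_at x" and s: "0 < s"
  shows "(\<lambda>k. log_potential (\<sigma>' k) s z) \<longlonglongrightarrow> log_potential \<mu> s z"
proof (rule tendstoI)
  fix \<epsilon> :: real assume \<epsilon>: "0 < \<epsilon>"
  have up: "\<forall>\<^sub>F k in sequentially. log_potential (\<sigma>' k) s z \<le> log_potential \<mu> s z + \<epsilon> / 2"
    using log_potential_pderiv_upper[OF s, of "\<epsilon> / 2" "cmod z"] \<epsilon> by (auto elim!: eventually_mono)
  define \<eta> where "\<eta> = \<epsilon> * s / 8"
  have \<eta>: "0 < \<eta>" "2 * \<eta> / s = \<epsilon> / 4" using s \<epsilon> by (auto simp: \<eta>_def)
  define R1 where "R1 = cmod z + \<eta> + s"
  define w where "w = pi * \<eta>\<^sup>2"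
  have w: "0 < w" using \<eta> by (simp add: w_def)
  define t where "t = sqrt (\<epsilon> * w / 128)"
  have t: "0 < t" "16 * t\<^sup>2 = \<epsilon> * w / 8" using \<epsilon> w by (auto simp: t_def)
  define a where "a = measure lborel (cball (0::complex) R1)"
  have a: "0 \<le> a" by (simp add: a_def)
  define \<epsilon>1 where "\<epsilon>1 = \<epsilon> * w / (8 * (a + 1))"
  have \<epsilon>1: "0 < \<epsilon>1" using \<epsilon> w a by (simp add: \<epsilon>1_def)
  have "\<epsilon>1 * a \<le> \<epsilon>1 * (a + 1)" using \<epsilon>1 by (intro mult_left_mono) auto
  also have "\<dots> = \<epsilon> * w / 8" using a by (simp add: \<epsilon>1_def divide_simps)
  finally have \<epsilon>1a: "\<epsilon>1 * a \<le> \<epsilon> * w / 8" .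
  from lower_uniformly[OF compact_cball[of 0 R1] low t(1) \<epsilon>1] obtain r0 where r0: "r0 > 0"
    and ev: "\<forall>\<^sub>F k in sequentially. \<forall>y\<in>cball 0 R1. log_potential \<mu> r0 y - \<epsilon>1 \<le> log_potential (\<sigma>' k) t y" by blast
  show "\<forall>\<^sub>F k in sequentially. dist (log_potential (\<sigma>' k) s z) (log_potential \<mu> s z) < \<epsilon>"
    using up ev
  proof eventually_elim
    case (elim k)
    interpret s': disc_prob "\<sigma>' k" R by (rule disc_k')
    define e where "e z = ennreal \<epsilon>1 + ennreal (t * near_potential (\<sigma>' k) t z)" for z
    have em [measurable]: "e \<in> borel_measurable borel" unfolding e_def by measurable
    have ae: "AE z in lborel. z \<in> cball 0 R1 \<longrightarrow> ennreal (potential \<mu> z - potential (\<sigma>' k) z) \<le> e z"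
      using s'.AE_regular_point lim.AE_regular_point
    proof eventually_elim
      case (elim z)
      show ?case
      proof
        assume z: "z \<in> cball 0 R1"
        have "potential \<mu> z \<le> log_potential \<mu> r0 z" by (rule lim.potential_le_log_potential[OF elim(2) r0])
        moreover have "log_potential \<mu> r0 z - \<epsilon>1 \<le> log_potential (\<sigma>' k) t z"
          using \<open>\<forall>y\<in>cball 0 R1. log_potential \<mu> r0 y - \<epsilon>1 \<le> log_potential (\<sigma>' k) t y\<close> z by blast
        moreover have "log_potential (\<sigma>' k) t z - potential (\<sigma>' k) z \<le> t * near_potential (\<sigma>' k) t z"
          by (rule s'.log_potential_minus_potential_le[OF elim(1) t(1)])
        ultimately have "ennreal (potential \<mu> z - potential (\<sigma>' k) z) \<le> ennreal (\<epsilon>1 + t * near_potential (\<sigma>' k) t z)"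
          by (intro ennreal_leI) linarith
        also have "\<dots> \<le> e z" unfolding e_def by (rule ennreal_add_le)
        finally show "ennreal (potential \<mu> z - potential (\<sigma>' k) z) \<le> e z" .
      qed
    qed
    have cb: "cball (0::complex) R1 \<in> sets borel" by simp
    have le: "(\<integral>\<^sup>+z. indicator (cball 0 R1) z * e z \<partial>lborel) \<le> ennreal (\<epsilon> * w / 4)"
    proof -
      have m1: "(\<lambda>z. ennreal \<epsilon>1 * indicator (cball (0::complex) R1) z) \<in> borel_measurable lborel" using cb by measurable
      have m2: "(\<lambda>z. indicator (cball 0 R1) z * ennreal (near_potential (\<sigma>' k) t z)) \<in> borel_measurable lborel" using cb by measurable
      have "(\<integral>\<^sup>+z. indicator (cball 0 R1) z * e z \<partial>lborel)
        = (\<integral>\<^sup>+z. ennreal \<epsilon>1 * indicator (cball 0 R1) z + ennreal t * (indicator (cball 0 R1) z * ennreal (near_potential (\<sigma>' k) t z)) \<partial>lborel)"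
        using t s'.near_potential_nonneg by (intro nn_integral_cong) (auto simp: e_def indicator_def ennreal_mult)
      also have "\<dots> = ennreal \<epsilon>1 * emeasure lborel (cball (0::complex) R1) + ennreal t * (\<integral>\<^sup>+z. indicator (cball 0 R1) z * ennreal (near_potential (\<sigma>' k) t z) \<partial>lborel)"
        using m1 m2 by (subst nn_integral_add, simp, simp, subst nn_integral_cmult_indicator, simp, subst nn_integral_cmult, simp_all)
      also have "\<dots> \<le> ennreal \<epsilon>1 * ennreal a + ennreal t * ennreal (16 * t * measure (\<sigma>' k) UNIV)"
      proof (intro add_mono mult_left_mono s'.nn_integral_near_potential_le t)
        show "emeasure lborel (cball (0::complex) R1) \<le> ennreal a"
          unfolding a_def using emeasure_bounded_finite[OF bounded_cball, of "0 :: complex" R1]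
          by (intro eq_refl emeasure_eq_ennreal_measure) auto
      qed auto
      also have "\<dots> = ennreal (\<epsilon>1 * a + 16 * t\<^sup>2)"
      proof -
        have "measure (\<sigma>' k) UNIV = 1" by (rule s'.prob_space[simplified])
        moreover have "ennreal t * ennreal (16 * t) = ennreal (t * (16 * t))" using t by (intro ennreal_mult[symmetric]) auto
        moreover have "ennreal \<epsilon>1 * ennreal a = ennreal (\<epsilon>1 * a)" using \<epsilon>1 a by (intro ennreal_mult[symmetric]) auto
        moreover have "ennreal (\<epsilon>1 * a) + ennreal (t * (16 * t)) = ennreal (\<epsilon>1 * a + t * (16 * t))"
          using \<epsilon>1 a t by (intro ennreal_plus[symmetric]) auto
        moreover have "t * (16 * t) = 16 * t\<^sup>2" by (simp add: power2_eq_square)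
        ultimately show ?thesis by simp
      qed
      also have "\<dots> \<le> ennreal (\<epsilon> * w / 4)"
        using \<epsilon>1a t(2) by (intro ennreal_leI) linarith
      finally show ?thesis .
    qed
    have "log_potential \<mu> s z - log_potential (\<sigma>' k) s z \<le> 2 * \<eta> / s + (\<epsilon> * w / 4) / (pi * \<eta>\<^sup>2)"
      by (rule log_potential_compare[OF lim_disc disc_k' s \<eta>(1) _ em ae le]) (use \<epsilon> w in \<open>auto simp: R1_def\<close>)
    also have "\<dots> = \<epsilon> / 2" using w \<eta> by (simp add: w_def[symmetric])
    finally show ?case using elim(1) \<epsilon> by (simp add: dist_real_def abs_if)
  qed
qed

end

section \<open>Weak convergence from potentials\<close>

text \<open>The truncated kernels at s and s / 2 differ by a nonnegative bump \<open>j\<close>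
  supported in the disc of radius s, so the regularised potentials differ by a mollification of
  \<sigma>. Tested with \<open>g\<close>, it returns the integral of \<open>g\<close> up to the
  oscillation of \<open>g\<close> at scale s. This recovers the measure without a Laplacian.\<close>

lemma (in disc_prob) log_potential_mollify:
  fixes g :: "complex \<Rightarrow> real"
  assumes g: "continuous_on UNIV g" and G: "\<And>z. \<bar>g z\<bar> \<le> G" and supp: "\<And>z. z \<notin> cball 0 b \<Longrightarrow> g z = 0"
    and s: "0 < s" and osc: "\<And>x y. cmod (x - y) < s \<Longrightarrow> \<bar>g x - g y\<bar> \<le> \<epsilon>"
  defines "j \<equiv> \<lambda>\<zeta>. ln (max s (cmod \<zeta>)) - ln (max (s/2) (cmod \<zeta>))"
  shows "\<bar>(\<integral>z. g z * (log_potential \<sigma> s z - log_potential \<sigma> (s/2) z) \<partial>lborel) - (\<integral>\<zeta>. j \<zeta> \<partial>lborel) * (\<integral>y. g y \<partial>\<sigma>)\<bar> \<le> \<epsilon> * (\<integral>\<zeta>. j \<zeta> \<partial>lborel)"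
proof -
  interpret lp: pair_sigma_finite lborel \<sigma> ..
  have \<epsilon>: "0 \<le> \<epsilon>" using osc[of 0 0] s by simp
  have G0: "0 \<le> G" using G[of 0] by linarith
  have j0: "0 \<le> j \<zeta>" for \<zeta>
  proof -
    have "ln (max (s/2) (cmod \<zeta>)) \<le> ln (max s (cmod \<zeta>))" using s by (intro ln_mono) (auto simp: less_max_iff_disj)
    then show ?thesis by (simp add: j_def)
  qed
  have js: "j \<zeta> = 0" if "s \<le> cmod \<zeta>" for \<zeta> using that s by (simp add: j_def max_def)
  have j1: "j \<zeta> \<le> ln 2" for \<zeta>
  proof -
    have "ln (max s (cmod \<zeta>)) \<le> ln (2 * max (s/2) (cmod \<zeta>))"
      using s by (intro ln_mono) (auto simp: less_max_iff_disj)
    also have "\<dots> = ln 2 + ln (max (s/2) (cmod \<zeta>))" using s by (intro ln_mult_pos) (auto simp: less_max_iff_disj)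
    finally show ?thesis by (simp add: j_def)
  qed
  have [measurable]: "j \<in> borel_measurable borel" "g \<in> borel_measurable borel"
    unfolding j_def using borel_measurable_continuous_onI[OF g] by measurable
  have ji: "integrable lborel j"
    using j0 j1 js by (intro integrable_bounded_support[where B="ln 2" and b=s]) auto
  have jt: "(\<integral>z. j (z - y) \<partial>lborel) = (\<integral>\<zeta>. j \<zeta> \<partial>lborel)" for y
    using integral_lborel_translate[of j "- y"] by simp
  have jti: "integrable lborel (\<lambda>z. j (z - y))" for y
  proof (rule integrable_bounded_support[where B="ln 2" and b="s + cmod y"])
    fix z :: complex assume "z \<notin> cball 0 (s + cmod y)"
    then show "j (z - y) = 0" using norm_triangle_ineq2[of z y] by (intro js) simp
  qed (use j0 j1 in auto)
  have gji: "integrable lborel (\<lambda>z. g z * j (z - y))" for y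
  proof (rule integrable_bounded_support[where B="G * ln 2" and b=b])
    show "norm (g z * j (z - y)) \<le> G * ln 2" for z
      unfolding real_norm_def abs_mult using G j0 j1 G0 by (intro mult_mono) auto
  qed (use supp in auto)
  define f where "f z y = g z * j (z - y)" for z y
  have fle: "\<bar>f z y\<bar> \<le> G * ln 2" for z y
    unfolding f_def abs_mult using G j0 j1 G0 by (intro mult_mono) auto
  have fi: "integrable \<sigma> (f z)" for z
  proof (rule integrable_const_bound[where B="G * ln 2"])
    show "f z \<in> borel_measurable \<sigma>" unfolding f_def[abs_def] by measurable
  qed (use fle in auto)
  have int: "integrable (lborel \<Otimes>\<^sub>M \<sigma>) (case_prod f)"
  proof (rule lp.Fubini_integrable)
    show "case_prod f \<in> borel_measurable (lborel \<Otimes>\<^sub>M \<sigma>)" unfolding f_def by measurable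
    show "integrable lborel (\<lambda>z. \<integral>y. norm (case_prod f (z, y)) \<partial>\<sigma>)"
    proof (rule integrable_bounded_support[where B="G * ln 2" and b=b])
      fix z
      have "(\<integral>y. \<bar>f z y\<bar> \<partial>\<sigma>) \<le> (\<integral>y. G * ln 2 \<partial>\<sigma>)"
        using fle fi[of z] by (intro integral_mono) auto
      moreover have "0 \<le> (\<integral>y. \<bar>f z y\<bar> \<partial>\<sigma>)" by (intro Bochner_Integration.integral_nonneg) auto
      ultimately show "norm (\<integral>y. norm (case_prod f (z, y)) \<partial>\<sigma>) \<le> G * ln 2" by (simp add: prob_space[simplified])
    next
      show "(\<lambda>z. \<integral>y. norm (case_prod f (z, y)) \<partial>\<sigma>) \<in> borel_measurable borel" unfolding f_def by measurable
    qed (use supp in \<open>simp add: f_def\<close>)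
  qed (use fi in auto)
  have "(\<integral>z. g z * (log_potential \<sigma> s z - log_potential \<sigma> (s/2) z) \<partial>lborel) = (\<integral>z. (\<integral>y. f z y \<partial>\<sigma>) \<partial>lborel)"
  proof (intro Bochner_Integration.integral_cong refl)
    fix z
    have "log_potential \<sigma> s z - log_potential \<sigma> (s/2) z = (\<integral>y. j (z - y) \<partial>\<sigma>)"
      unfolding log_potential_def j_def using integrable_ln_max[of s z] integrable_ln_max[of "s/2" z] s by simp
    then show "g z * (log_potential \<sigma> s z - log_potential \<sigma> (s/2) z) = (\<integral>y. f z y \<partial>\<sigma>)"
      by (simp add: f_def)
  qed
  also have "\<dots> = (\<integral>y. (\<integral>z. f z y \<partial>lborel) \<partial>\<sigma>)" by (rule lp.Fubini_integral[OF int, symmetric])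
  finally have e: "(\<integral>z. g z * (log_potential \<sigma> s z - log_potential \<sigma> (s/2) z) \<partial>lborel) = (\<integral>y. (\<integral>z. f z y \<partial>lborel) \<partial>\<sigma>)" .
  have pt: "\<bar>(\<integral>z. f z y \<partial>lborel) - (\<integral>\<zeta>. j \<zeta> \<partial>lborel) * g y\<bar> \<le> \<epsilon> * (\<integral>\<zeta>. j \<zeta> \<partial>lborel)" for y
  proof -
    have "(\<integral>z. f z y \<partial>lborel) - (\<integral>\<zeta>. j \<zeta> \<partial>lborel) * g y = (\<integral>z. g z * j (z - y) - g y * j (z - y) \<partial>lborel)"
      using gji[of y] jti[of y] by (simp add: f_def jt)
    also have "\<bar>\<dots>\<bar> \<le> (\<integral>z. \<epsilon> * j (z - y) \<partial>lborel)"
    proof (rule integral_norm_bound_AE[where 'b=real, unfolded real_norm_def])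
      show "AE z in lborel. \<bar>g z * j (z - y) - g y * j (z - y)\<bar> \<le> \<epsilon> * j (z - y)"
      proof (intro AE_I2)
        fix z
        show "\<bar>g z * j (z - y) - g y * j (z - y)\<bar> \<le> \<epsilon> * j (z - y)"
        proof (cases "cmod (z - y) < s")
          case True
          then show ?thesis using osc[OF True] j0[of "z - y"]
            by (simp add: left_diff_distrib[symmetric] abs_mult mult_right_mono)
        qed (use js in simp)
      qed
    qed (use gji[of y] jti[of y] in auto)
    also have "\<dots> = \<epsilon> * (\<integral>\<zeta>. j \<zeta> \<partial>lborel)" by (simp add: jt)
    finally show ?thesis .
  qed
  have i1: "integrable \<sigma> (\<lambda>y. \<integral>z. f z y \<partial>lborel)" by (rule lp.integrable_snd[OF int])
  have i2: "integrable \<sigma> g" by (rule integrable_continuous_fun[OF g])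
  have "(\<integral>y. (\<integral>z. f z y \<partial>lborel) \<partial>\<sigma>) - (\<integral>\<zeta>. j \<zeta> \<partial>lborel) * (\<integral>y. g y \<partial>\<sigma>) = (\<integral>y. (\<integral>z. f z y \<partial>lborel) - (\<integral>\<zeta>. j \<zeta> \<partial>lborel) * g y \<partial>\<sigma>)"
    using i1 i2 by simp
  also have "\<bar>\<dots>\<bar> \<le> (\<integral>y. \<epsilon> * (\<integral>\<zeta>. j \<zeta> \<partial>lborel) \<partial>\<sigma>)"
    by (rule integral_norm_bound_AE[where 'b=real, unfolded real_norm_def]) (use pt i1 i2 in auto)
  also have "\<dots> = \<epsilon> * (\<integral>\<zeta>. j \<zeta> \<partial>lborel)" by (simp add: prob_space[simplified])
  finally show ?thesis unfolding e .
qed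

text \<open>On the disc of radius s / 2 the bump is the constant ln 2.\<close>

lemma mollifier_integral_pos:
  assumes s: "0 < s"
  shows "0 < (\<integral>\<zeta>. ln (max s (cmod \<zeta>)) - ln (max (s/2) (cmod \<zeta>)) \<partial>lborel)"
proof -
  define j where "j \<zeta> = ln (max s (cmod \<zeta>)) - ln (max (s/2) (cmod \<zeta>))" for \<zeta> :: complex
  have j0: "0 \<le> j \<zeta>" for \<zeta>
  proof -
    have "ln (max (s/2) (cmod \<zeta>)) \<le> ln (max s (cmod \<zeta>))" using s by (intro ln_mono) (auto simp: less_max_iff_disj)
    then show ?thesis by (simp add: j_def)
  qed
  have js: "j \<zeta> = 0" if "s \<le> cmod \<zeta>" for \<zeta> using that s by (simp add: j_def max_def)
  have j1: "j \<zeta> \<le> ln 2" for \<zeta>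
  proof -
    have "ln (max s (cmod \<zeta>)) \<le> ln (2 * max (s/2) (cmod \<zeta>))"
      using s by (intro ln_mono) (auto simp: less_max_iff_disj)
    also have "\<dots> = ln 2 + ln (max (s/2) (cmod \<zeta>))" using s by (intro ln_mult_pos) (auto simp: less_max_iff_disj)
    finally show ?thesis by (simp add: j_def)
  qed
  have [measurable]: "j \<in> borel_measurable borel" unfolding j_def by measurable
  have ji: "integrable lborel j"
    using j0 j1 js by (intro integrable_bounded_support[where B="ln 2" and b=s]) auto
  have ib: "integrable lborel (indicator (ball 0 (s/2)) :: complex \<Rightarrow> real)"
    using emeasure_bounded_finite[OF bounded_ball, of "0::complex" "s/2"] by (intro integrable_real_indicator) auto
  have "0 < ln 2 * (pi * (s/2)\<^sup>2)" using s by simp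
  also have "\<dots> = (\<integral>\<zeta>. ln 2 * indicator (ball (0::complex) (s/2)) \<zeta> \<partial>lborel)"
    using emeasure_lborel_ball_complex[of "s/2" 0] s by (simp add: measure_def)
  also have "\<dots> \<le> (\<integral>\<zeta>. j \<zeta> \<partial>lborel)"
  proof (intro integral_mono)
    fix \<zeta> :: complex
    show "ln 2 * indicator (ball (0::complex) (s/2)) \<zeta> \<le> j \<zeta>"
    proof (cases "cmod \<zeta> < s/2")
      case True
      then have "j \<zeta> = ln s - ln (s/2)" using s by (simp add: j_def max_def)
      then show ?thesis using True s by (simp add: ln_div)
    qed (use j0 in simp)
  qed (use ji ib in auto)
  finally show ?thesis by (simp add: j_def)
qed

text \<open>The regularised potentials at s and s / 2 differ by at most ln 2, so their pointwise
  convergence can be integrated against \<open>g\<close> by dominated convergence; the mollification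
  links this integral to that of \<open>g\<close>, for each measure with the same error.\<close>

lemma weak_star_conv_of_log_potential:
  assumes \<tau>: "\<And>k. disc_prob (\<tau> k) R" and \<mu>: "disc_prob \<mu> R"
    and lim: "\<And>s z. 0 < s \<Longrightarrow> (\<lambda>k. log_potential (\<tau> k) s z) \<longlonglongrightarrow> log_potential \<mu> s z"
  shows "weak_star_conv \<tau> \<mu>"
  unfolding weak_star_conv_def
proof (intro allI impI)
  fix g :: "complex \<Rightarrow> real"
  assume "continuous_on UNIV g \<and> compact (closure {z. g z \<noteq> 0})"
  then have g: "continuous_on UNIV g" and comp: "compact (closure {z. g z \<noteq> 0})" by auto
  obtain b where "\<forall>x\<in>closure {z. g z \<noteq> 0}. norm x \<le> b" using compact_imp_bounded[OF comp] unfolding bounded_iff by auto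
  then have supp: "g z = 0" if "z \<notin> cball 0 b" for z using that closure_subset[of "{z. g z \<noteq> 0}"] by auto
  have "bounded (g ` cball 0 b)"
    by (intro compact_imp_bounded compact_continuous_image continuous_on_subset[OF g]) auto
  then obtain G' where G': "\<forall>x\<in>g ` cball 0 b. norm x \<le> G'" unfolding bounded_iff by auto
  define G where "G = \<bar>G'\<bar>"
  have G: "\<bar>g z\<bar> \<le> G" for z
    using G' supp[of z] by (cases "z \<in> cball 0 b") (force simp: G_def)+
  have [measurable]: "g \<in> borel_measurable borel" by (rule borel_measurable_continuous_onI[OF g])
  show "(\<lambda>k. integral\<^sup>L (\<tau> k) g) \<longlonglongrightarrow> integral\<^sup>L \<mu> g"
  proof (rule tendstoI)
    fix e :: real assume e: "0 < e"
    \<comment> \<open>One third for each of the two mollification errors and one for the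
      convergence.\<close>
    define \<epsilon> where "\<epsilon> = e / 3"
    have \<epsilon>: "0 < \<epsilon>" using e by (simp add: \<epsilon>_def)
    have "uniformly_continuous_on (cball 0 (\<bar>b\<bar> + 1)) g"
      by (intro compact_uniformly_continuous continuous_on_subset[OF g]) auto
    then obtain d where d: "d > 0" "\<And>x y. x \<in> cball 0 (\<bar>b\<bar> + 1) \<Longrightarrow> y \<in> cball 0 (\<bar>b\<bar> + 1) \<Longrightarrow> dist y x < d \<Longrightarrow> dist (g y) (g x) < \<epsilon>"
      using \<epsilon> unfolding uniformly_continuous_on_def by metis
    define s where "s = min d 1"
    have s: "0 < s" "s \<le> d" "s \<le> 1" using d by (auto simp: s_def)
    have osc: "\<bar>g x - g y\<bar> \<le> \<epsilon>" if xy: "cmod (x - y) < s" for x y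
    proof (cases "x \<in> cball 0 b \<or> y \<in> cball 0 b")
      case True
      then have "x \<in> cball 0 (\<bar>b\<bar> + 1)" "y \<in> cball 0 (\<bar>b\<bar> + 1)"
        using xy s norm_triangle_ineq2[of x y] norm_triangle_ineq2[of y x] by (auto simp: norm_minus_commute)
      then show ?thesis using d(2)[of y x] xy s by (simp add: dist_norm)
    next
      case False
      then show ?thesis using supp[of x] supp[of y] \<epsilon> by simp
    qed
    define J where "J = (\<integral>\<zeta>. ln (max s (cmod \<zeta>)) - ln (max (s/2) (cmod \<zeta>)) \<partial>lborel)"
    have J: "0 < J" unfolding J_def by (rule mollifier_integral_pos[OF s(1)])
    define I where "I \<nu> = (\<integral>z. g z * (log_potential \<nu> s z - log_potential \<nu> (s/2) z) \<partial>lborel)" for \<nu>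
    have moll: "\<bar>I \<nu> - J * (\<integral>y. g y \<partial>\<nu>)\<bar> \<le> \<epsilon> * J" if "disc_prob \<nu> R" for \<nu>
      unfolding I_def J_def by (rule disc_prob.log_potential_mollify[OF that g G supp s(1) osc])
    have diffs: "\<bar>log_potential \<nu> s z - log_potential \<nu> (s/2) z\<bar> \<le> ln 2" if \<nu>: "disc_prob \<nu> R" for \<nu> z
    proof -
      interpret n: disc_prob \<nu> R by fact
      have s2: "0 < s / 2" using s by simp
      have "log_potential \<nu> s z \<le> (\<integral>y. ln 2 + ln (max (s/2) (cmod (z - y))) \<partial>\<nu>)"
        unfolding log_potential_def
      proof (intro integral_mono)
        fix y
        have "ln (max s (cmod (z - y))) \<le> ln (2 * max (s/2) (cmod (z - y)))"
          using s by (intro ln_mono) (auto simp: less_max_iff_disj)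
        also have "\<dots> = ln 2 + ln (max (s/2) (cmod (z - y)))" using s by (intro ln_mult_pos) (auto simp: less_max_iff_disj)
        finally show "ln (max s (cmod (z - y))) \<le> ln 2 + ln (max (s/2) (cmod (z - y)))" .
      qed (use n.integrable_ln_max[OF s(1)] n.integrable_ln_max[OF s2] in auto)
      also have "\<dots> = ln 2 + log_potential \<nu> (s/2) z"
        using n.integrable_ln_max[OF s2, of z] by (simp add: log_potential_def n.prob_space[simplified])
      finally show ?thesis using n.log_potential_mono[of "s/2" s z] s by simp
    qed
    have "(\<lambda>k. I (\<tau> k)) \<longlonglongrightarrow> I \<mu>"
      unfolding I_def
    proof (rule integral_dominated_convergence[where w="\<lambda>z. G * ln 2 * indicator (cball (0::complex) b) z"])
      have s2: "0 < s / 2" using s by simp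
      show "(\<lambda>z. g z * (log_potential \<mu> s z - log_potential \<mu> (s/2) z)) \<in> borel_measurable lborel"
        using disc_prob.measurable_log_potential[OF \<mu> s(1)] disc_prob.measurable_log_potential[OF \<mu> s2] by measurable
      show "(\<lambda>z. g z * (log_potential (\<tau> k) s z - log_potential (\<tau> k) (s/2) z)) \<in> borel_measurable lborel" for k
        using disc_prob.measurable_log_potential[OF \<tau> s(1)] disc_prob.measurable_log_potential[OF \<tau> s2] by measurable
      show "integrable lborel (\<lambda>z. G * ln 2 * indicator (cball (0::complex) b) z)"
        using emeasure_bounded_finite[OF bounded_cball, of "0::complex" b] by (intro integrable_mult_right integrable_real_indicator) auto
      show "AE z in lborel. (\<lambda>k. g z * (log_potential (\<tau> k) s z - log_potential (\<tau> k) (s/2) z)) \<longlonglongrightarrow> g z * (log_potential \<mu> s z - log_potential \<mu> (s/2) z)"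
        using s by (intro AE_I2 tendsto_intros lim) auto
      show "AE z in lborel. norm (g z * (log_potential (\<tau> k) s z - log_potential (\<tau> k) (s/2) z)) \<le> G * ln 2 * indicator (cball (0::complex) b) z" for k
      proof (intro AE_I2)
        fix z
        show "norm (g z * (log_potential (\<tau> k) s z - log_potential (\<tau> k) (s/2) z)) \<le> G * ln 2 * indicator (cball (0::complex) b) z"
        proof (cases "z \<in> cball 0 b")
          case True
          have "norm (g z * (log_potential (\<tau> k) s z - log_potential (\<tau> k) (s/2) z)) \<le> G * ln 2"
            unfolding real_norm_def abs_mult using G[of z] diffs[OF \<tau>, of k z] by (intro mult_mono) (auto simp: G_def)
          then show ?thesis using True by simp
        qed (use supp in simp)
      qed
    qed
    then have "\<forall>\<^sub>F k in sequentially. dist (I (\<tau> k)) (I \<mu>) < \<epsilon> * J"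
      using \<epsilon> J by (intro tendstoD) auto
    then show "\<forall>\<^sub>F k in sequentially. dist (integral\<^sup>L (\<tau> k) g) (integral\<^sup>L \<mu> g) < e"
    proof eventually_elim
      case (elim k)
      have "\<bar>J * integral\<^sup>L (\<tau> k) g - J * integral\<^sup>L \<mu> g\<bar> < 3 * (\<epsilon> * J)"
        using moll[OF \<tau>, of k] moll[OF \<mu>] elim unfolding dist_real_def by linarith
      then have "J * \<bar>integral\<^sup>L (\<tau> k) g - integral\<^sup>L \<mu> g\<bar> < J * e"
        using J by (simp add: right_diff_distrib[symmetric] abs_mult \<epsilon>_def mult.commute)
      then show ?case using J by (simp add: dist_real_def)
    qed
  qed
qed

section \<open>Counting critical points\<close>

lemma norm_prod_mset_le:
  fixes z :: complex
  assumes "\<And>w. w \<in># A \<Longrightarrow> cmod (z - w) \<le> D"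
  shows "cmod (\<Prod>w\<in>#A. z - w) \<le> D ^ size A"
  using assms
proof (induction A)
  case (add x A)
  have "0 \<le> D" using order_trans[OF norm_ge_zero add.prems[of x]] by simp
  then show ?case using add by (simp add: norm_mult mult_mono)
qed simp

lemma norm_prod_mset_ge:
  fixes z :: complex
  assumes "\<And>w. w \<in># A \<Longrightarrow> D \<le> cmod (z - w)" and D: "0 \<le> D"
  shows "D ^ size A \<le> cmod (\<Prod>w\<in>#A. z - w)"
  using assms(1)
proof (induction A)
  case (add x A)
  then show ?case using D by (simp add: norm_mult mult_mono)
qed simp

lemma poly_prod_roots: "poly (\<Prod>x\<in>#A. [:-x, 1:]) z = (\<Prod>w\<in>#A. z - w)" for z :: complex
  by (simp add: poly_prod_mset multiset.map_comp o_def)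

text \<open>Induction by the product rule; D >= 1 absorbs the summand in which the new factor has
  been differentiated.\<close>

lemma norm_pderiv_prod_mset_le:
  fixes z :: complex
  assumes "\<And>w. w \<in># A \<Longrightarrow> cmod (z - w) \<le> D" and D: "1 \<le> D"
  shows "cmod (poly (pderiv (\<Prod>x\<in>#A. [:-x, 1:])) z) \<le> real (size A) * D ^ size A"
  using assms(1)
proof (induction A)
  case (add x A)
  have "poly (pderiv (\<Prod>x\<in>#add_mset x A. [:-x, 1:])) z
     = (z - x) * poly (pderiv (\<Prod>x\<in>#A. [:-x, 1:])) z + (\<Prod>w\<in>#A. z - w)"
    by (simp add: pderiv_mult pderiv_pCons poly_prod_roots algebra_simps del: mult_pCons_left)
  then have "cmod (poly (pderiv (\<Prod>x\<in>#add_mset x A. [:-x, 1:])) z)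
    \<le> cmod (z - x) * cmod (poly (pderiv (\<Prod>x\<in>#A. [:-x, 1:])) z) + cmod (\<Prod>w\<in>#A. z - w)"
    by (metis norm_triangle_ineq norm_mult)
  also have "\<dots> \<le> D * (real (size A) * D ^ size A) + D ^ size A"
    using add D by (intro add_mono mult_mono norm_prod_mset_le) auto
  also have "\<dots> \<le> D * (real (size A) * D ^ size A) + D * D ^ size A"
    using D by simp
  also have "\<dots> = real (size (add_mset x A)) * D ^ size (add_mset x A)" by (simp add: algebra_simps)
  finally show ?case .
qed (simp add: pderiv_1)

lemma card_set_mset_le: "card (set_mset A) \<le> size A"
  by (induction A) (auto simp: card_insert_if)

lemma norm_sum_mset_le:
  fixes f :: "'a \<Rightarrow> complex"
  assumes "\<And>w. w \<in># A \<Longrightarrow> cmod (f w) \<le> c"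
  shows "cmod (\<Sum>w\<in>#A. f w) \<le> real (size A) * c"
  using assms
proof (induction A)
  case (add x A)
  then have "cmod (f x + (\<Sum>w\<in>#A. f w)) \<le> c + real (size A) * c"
    by (intro order_trans[OF norm_triangle_ineq] add_mono) auto
  then show ?case by (simp add: algebra_simps)
qed simp

text \<open>A Jensen-type count: after the roots of \<^term>\<open>q\<close> in the larger disc are divided out of the logarithmic
  derivative, every root of \<^term>\<open>pderiv q\<close> in the small disc gains a factor \<open>2/3\<close> in the maximum principle.\<close>

lemma zeros_in_pderiv_bound:
  fixes q :: "complex poly" and x a :: complex
  assumes n: "2 \<le> degree q" and \<rho>: "0 < \<rho>"
    and M: "zeros_in q (cball x (6 * \<rho>)) \<le> M"
    and a: "a \<in> ball x \<rho>" "poly q a \<noteq> 0" and \<eta>: "0 < \<eta>" "\<eta> \<le> 1"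
    and sep: "\<And>w. poly q w = 0 \<Longrightarrow> w \<in> cball x (6 * \<rho>) \<Longrightarrow> \<eta> \<le> cmod (a - w)"
    and \<delta>: "0 < \<delta>" "\<delta> \<le> cmod (cauchy_transform (root_measure q) a)"
  shows "\<delta> * \<eta> ^ M \<le> (max 1 (10 * \<rho>)) ^ M * (real M + 1 / (2 * \<rho>)) * (2 / 3) ^ zeros_in (pderiv q) (cball x \<rho>)"
proof -
  have q0: "q \<noteq> 0" and q'0: "pderiv q \<noteq> 0" using n by (auto simp: pderiv_eq_0_iff)
  \<comment> \<open>A point of the circle of radius 4 \<rho> has distance at most 10 \<rho> from a
    root within 6 \<rho> of x.\<close>
  define D where "D = max 1 (10 * \<rho>)"
  have D: "1 \<le> D" "10 * \<rho> \<le> D" by (auto simp: D_def)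
  define In where "In = filter_mset (\<lambda>w. w \<in> cball x (6 * \<rho>)) (proots q)"
  define Out where "Out = filter_mset (\<lambda>w. w \<notin> cball x (6 * \<rho>)) (proots q)"
  define In' where "In' = filter_mset (\<lambda>w. w \<in> cball x \<rho>) (proots (pderiv q))"
  define Out' where "Out' = filter_mset (\<lambda>w. w \<notin> cball x \<rho>) (proots (pderiv q))"
  have split: "proots q = In + Out" "proots (pderiv q) = In' + Out'"
    unfolding In_def Out_def In'_def Out'_def by (simp_all add: multiset_partition[symmetric])
  have sIn: "size In \<le> M" using M by (simp add: zeros_in_def In_def)
  define N where "N = size In'"
  have N: "zeros_in (pderiv q) (cball x \<rho>) = N" by (simp add: zeros_in_def N_def In'_def)
  define nn where "nn = real (degree q)"
  have nn: "0 < nn" using n by (simp add: nn_def)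
  have sOut: "real (size Out) \<le> nn" using split(1) size_proots_complex[of q] by (simp add: nn_def)
  define A where "A = (\<Prod>x\<in>#In. [:-x, 1:])"
  define B where "B z = (\<Prod>w\<in>#Out. z - w)" for z
  define B1 where "B1 z = (\<Prod>w\<in>#Out'. z - w)" for z
  define A1 where "A1 z = (\<Prod>w\<in>#In'. z - w)" for z
  define \<gamma> where "\<gamma> = lead_coeff q"
  have \<gamma>: "\<gamma> \<noteq> 0" using q0 by (simp add: \<gamma>_def)
  have q_eq: "poly q z = \<gamma> * (poly A z * B z)" for z
    by (simp add: poly_eq_prod_roots[of q] split A_def B_def poly_prod_roots \<gamma>_def)
  have lc: "lead_coeff (pderiv q) = of_nat (degree q) * \<gamma>"
    using n by (simp add: coeff_pderiv degree_pderiv \<gamma>_def)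
  have q'_eq: "poly (pderiv q) z = nn * \<gamma> * (A1 z * B1 z)" for z
    using poly_eq_prod_roots[of "pderiv q" z] unfolding lc by (simp add: split A1_def B1_def nn_def)
  have B_nz: "B z \<noteq> 0" if "z \<in> cball x (5 * \<rho>)" for z
    using that \<rho> by (auto simp: B_def Out_def prod_mset_zero_iff)
  \<comment> \<open>Away from the roots of q, A1 g equals A q' / q: multiplication by
    \<open>A\<close> removes the poles near x, and division by \<open>A1\<close> removes the roots
    of q' that are to be counted. So \<open>g\<close> is holomorphic, and on the larger circle each
    counted root divides its bound by 3 \<rho>.\<close>
  define g where "g z = nn * B1 z / B z" for z
  have g_hol: "g holomorphic_on cball x (5 * \<rho>)"
  proof -
    have "(\<lambda>z. \<Prod>w\<in>#X. z - w) = poly (\<Prod>x\<in>#X. [:-x, 1:])" for X :: "complex multiset"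
      by (simp add: fun_eq_iff poly_prod_roots)
    then have "B holomorphic_on S" "B1 holomorphic_on S" for S
      unfolding B_def B1_def by (auto intro!: holomorphic_intros)
    then show ?thesis unfolding g_def using B_nz by (intro holomorphic_intros) auto
  qed
  have key: "A1 z * g z = poly (pderiv A) z + poly A z * (\<Sum>w\<in>#Out. 1 / (z - w))" if z: "z \<in> cball x (5 * \<rho>)" for z
  proof -
    have zo: "z \<notin># Out" using z \<rho> by (auto simp: Out_def)
    define Bp where "Bp = (\<Prod>x\<in>#Out. [:-x, 1:])"
    have "q = smult \<gamma> (\<Prod>x\<in>#proots q. [:-x, 1:])"
      unfolding \<gamma>_def by (simp only: complex_poly_decompose_multiset)
    then have "q = smult \<gamma> (A * Bp)" by (simp add: split(1) A_def Bp_def)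
    then have "poly (pderiv q) z = \<gamma> * (poly (pderiv A) z * poly Bp z + poly A z * poly (pderiv Bp) z)"
      by (metis (no_types, lifting) pderiv_smult pderiv_mult poly_smult poly_add poly_mult mult.commute add.commute)
    also have "poly (pderiv Bp) z = B z * (\<Sum>w\<in>#Out. 1 / (z - w))"
      unfolding Bp_def B_def by (rule poly_pderiv_prod_mset[OF zo])
    also have "poly Bp z = B z" by (simp add: Bp_def B_def poly_prod_roots)
    finally have "nn * \<gamma> * (A1 z * B1 z) = \<gamma> * (poly (pderiv A) z * B z + poly A z * (B z * (\<Sum>w\<in>#Out. 1 / (z - w))))"
      unfolding q'_eq .
    then have "\<gamma> * (nn * (A1 z * B1 z)) = \<gamma> * ((poly (pderiv A) z + poly A z * (\<Sum>w\<in>#Out. 1 / (z - w))) * B z)"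
      by (simp add: algebra_simps)
    then have "nn * (A1 z * B1 z) = (poly (pderiv A) z + poly A z * (\<Sum>w\<in>#Out. 1 / (z - w))) * B z"
      using \<gamma> mult_left_cancel by blast
    then show ?thesis using B_nz[OF z] by (simp add: g_def field_simps)
  qed
  define K where "K = D ^ M * (real M + 1 / (2 * \<rho>))"
  have K: "0 \<le> K" using D \<rho> by (simp add: K_def)
  \<comment> \<open>On |z - x| = 4 \<rho> the roots of q in \<open>Out\<close> have distance at
    least 2 \<rho> and the counted roots of q' at least 3 \<rho>; from \<open>a\<close> the latter
    have distance at most 2 \<rho>. This is the origin of the radii and of the factor 2 / 3 per
    root.\<close>
  have sphere: "cmod (g z) \<le> nn * K / (3 * \<rho>) ^ N" if z: "z \<in> frontier (ball x (4 * \<rho>))" for z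
  proof -
    have dz: "cmod (x - z) = 4 * \<rho>" using z \<rho> by (simp add: dist_norm)
    then have z5: "z \<in> cball x (5 * \<rho>)" using \<rho> by (simp add: dist_norm)
    have InD: "cmod (z - w) \<le> D" if "w \<in># In" for w
    proof -
      have "cmod (x - w) \<le> 6 * \<rho>" using that by (simp add: In_def dist_norm)
      then have "cmod (z - w) \<le> 10 * \<rho>" using norm_triangle_ineq4[of "x - w" "x - z"] dz by simp
      then show ?thesis using D by linarith
    qed
    have pM: "D ^ size In \<le> D ^ M" using D sIn by (intro power_increasing) auto
    have 1: "cmod (poly (pderiv A) z) \<le> real M * D ^ M"
    proof -
      have "cmod (poly (pderiv A) z) \<le> real (size In) * D ^ size In"
        unfolding A_def by (rule norm_pderiv_prod_mset_le[OF InD D(1)])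
      also have "\<dots> \<le> real M * D ^ M" using sIn pM D by (intro mult_mono) auto
      finally show ?thesis .
    qed
    have 2: "cmod (poly A z) \<le> D ^ M"
      unfolding A_def poly_prod_roots using norm_prod_mset_le[OF InD] pM by (meson order_trans)
    have 3: "cmod (\<Sum>w\<in>#Out. 1 / (z - w)) \<le> nn * (1 / (2 * \<rho>))"
    proof -
      have "cmod (\<Sum>w\<in>#Out. 1 / (z - w)) \<le> real (size Out) * (1 / (2 * \<rho>))"
      proof (rule norm_sum_mset_le)
        fix w assume "w \<in># Out"
        then have "6 * \<rho> < cmod (x - w)" by (simp add: Out_def dist_norm)
        then have "2 * \<rho> \<le> cmod (z - w)" using norm_triangle_ineq[of "x - z" "z - w"] dz by simp
        then show "cmod (1 / (z - w)) \<le> 1 / (2 * \<rho>)" using \<rho> by (simp add: norm_divide divide_left_mono frac_le)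
      qed
      also have "\<dots> \<le> nn * (1 / (2 * \<rho>))" using sOut \<rho> by (intro mult_right_mono) auto
      finally show ?thesis .
    qed
    have n1: "1 \<le> nn" using n by (simp add: nn_def)
    have "cmod (A1 z * g z) \<le> cmod (poly (pderiv A) z) + cmod (poly A z) * cmod (\<Sum>w\<in>#Out. 1 / (z - w))"
      unfolding key[OF z5] by (metis norm_triangle_ineq norm_mult)
    also have "\<dots> \<le> real M * D ^ M + D ^ M * (nn * (1 / (2 * \<rho>)))"
      using 1 2 3 D by (intro add_mono mult_mono) auto
    also have "\<dots> \<le> nn * (real M * D ^ M) + D ^ M * (nn * (1 / (2 * \<rho>)))"
      using mult_right_mono[OF n1, of "real M * D ^ M"] D by (intro add_right_mono) simp
    also have "\<dots> = nn * K" by (simp add: K_def algebra_simps)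
    finally have up: "cmod (A1 z) * cmod (g z) \<le> nn * K" by (simp add: norm_mult)
    have lo: "(3 * \<rho>) ^ N \<le> cmod (A1 z)"
      unfolding A1_def N_def
    proof (rule norm_prod_mset_ge)
      fix w assume "w \<in># In'"
      then have "cmod (x - w) \<le> \<rho>" by (simp add: In'_def dist_norm)
      then show "3 * \<rho> \<le> cmod (z - w)" using norm_triangle_ineq2[of "x - z" "x - w"] dz by (simp add: norm_minus_commute)
    qed (use \<rho> in simp)
    have p3: "0 < (3 * \<rho>) ^ N" using \<rho> by simp
    have "(3 * \<rho>) ^ N * cmod (g z) \<le> nn * K" using mult_right_mono[OF lo, of "cmod (g z)"] up by simp
    then show ?thesis using p3 by (simp add: pos_le_divide_eq mult.commute)
  qed
  have ga: "cmod (g a) \<le> nn * K / (3 * \<rho>) ^ N"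
  proof (rule maximum_modulus_frontier[where f=g and \<xi>=a and S="ball x (4 * \<rho>)"])
    show "g holomorphic_on interior (ball x (4 * \<rho>))"
      using \<rho> by (intro holomorphic_on_subset[OF g_hol]) auto
    have "closure (ball x (4 * \<rho>)) \<subseteq> cball x (5 * \<rho>)"
      using \<rho> by auto
    then show "continuous_on (closure (ball x (4 * \<rho>))) g"
      using \<rho> by (intro holomorphic_on_imp_continuous_on holomorphic_on_subset[OF g_hol]) auto
    show "a \<in> ball x (4 * \<rho>)" using a \<rho> by auto
  qed (use sphere in auto)
  have a5: "a \<in> cball x (5 * \<rho>)" using a \<rho> by auto
  have Aa: "\<eta> ^ M \<le> cmod (poly A a)"
  proof -
    have "\<eta> ^ M \<le> \<eta> ^ size In" using \<eta> sIn by (intro power_decreasing) auto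
    also have "\<dots> \<le> cmod (poly A a)"
      unfolding A_def poly_prod_roots using sep q0 \<eta> by (intro norm_prod_mset_ge) (auto simp: In_def)
    finally show ?thesis .
  qed
  have A1a: "cmod (A1 a) \<le> (2 * \<rho>) ^ N"
    unfolding A1_def N_def
  proof (rule norm_prod_mset_le)
    fix w assume "w \<in># In'"
    then have "cmod (x - w) \<le> \<rho>" by (simp add: In'_def dist_norm)
    then show "cmod (a - w) \<le> 2 * \<rho>" using a norm_triangle_ineq4[of "x - w" "x - a"] by (simp add: dist_norm)
  qed
  have "nn * (\<delta> * \<eta> ^ M) \<le> nn * (cmod (cauchy_transform (root_measure q) a) * cmod (poly A a))"
    using nn \<delta> Aa \<eta> by (intro mult_left_mono mult_mono) auto
  also have "\<dots> = cmod (A1 a * g a)"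
  proof -
    have "nn * cauchy_transform (root_measure q) a * poly A a = nn * (nn * \<gamma> * (A1 a * B1 a)) / (nn * (\<gamma> * (poly A a * B a))) * poly A a"
      using cauchy_root_measure[of q a] n a by (simp add: q_eq q'_eq nn_def)
    also have "\<dots> = A1 a * g a"
      using nn \<gamma> a(2) B_nz[OF a5] unfolding q_eq by (simp add: g_def)
    finally show ?thesis using nn by (metis norm_mult norm_of_real abs_of_pos mult.assoc)
  qed
  also have "\<dots> \<le> (2 * \<rho>) ^ N * (nn * K / (3 * \<rho>) ^ N)"
    unfolding norm_mult using A1a ga \<rho> by (intro mult_mono) auto
  also have "\<dots> = nn * (K * (2 / 3) ^ N)"
    using \<rho> by (simp add: power_mult_distrib power_divide)
  finally have "\<delta> * \<eta> ^ M \<le> K * (2 / 3) ^ N" using nn by simp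
  then show ?thesis by (simp add: K_def D_def N)
qed

text \<open>Markov's inequality on what is left of \<open>E\<close>. The avoided sets may have
  positive measure as long as they cannot fill \<open>E\<close>, because the test point has to keep
  a distance from the roots of q_k.\<close>

lemma eventually_ex_small_avoiding:
  fixes e :: "nat \<Rightarrow> 'a :: euclidean_space \<Rightarrow> ennreal"
  assumes lim: "(\<lambda>k. \<integral>\<^sup>+z. indicator E z * e k z \<partial>lborel) \<longlonglongrightarrow> 0"
    and E: "E \<in> sets borel" and \<tau>: "0 < \<tau>"
    and N: "\<And>k. N k \<in> sets borel" "\<And>k. emeasure lborel (N k) \<le> c" and c: "c < emeasure lborel E"
  shows "\<forall>\<^sub>F k in sequentially. \<exists>z\<in>E - N k. e k z < ennreal \<tau>"
proof -
  have cfin: "c < top" using c by (rule less_le_trans) simp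
  have "0 < emeasure lborel E - c" using c by (simp add: diff_gt_0_iff_gt_ennreal)
  then have "0 < ennreal \<tau> * (emeasure lborel E - c)" using \<tau> by (simp add: ennreal_zero_less_mult_iff)
  with lim have "\<forall>\<^sub>F k in sequentially. (\<integral>\<^sup>+z. indicator E z * e k z \<partial>lborel) < ennreal \<tau> * (emeasure lborel E - c)"
    by (rule order_tendstoD(2))
  then show ?thesis
  proof eventually_elim
    case (elim k)
    show ?case
    proof (rule ccontr)
      assume neg: "\<not> ?case"
      have "emeasure lborel E \<le> emeasure lborel (E - N k) + emeasure lborel (N k)"
      proof -
        have "emeasure lborel E \<le> emeasure lborel ((E - N k) \<union> N k)" using E N(1)[of k] by (intro emeasure_mono) auto
        also have "\<dots> \<le> emeasure lborel (E - N k) + emeasure lborel (N k)" using E N(1)[of k] by (intro emeasure_subadditive) auto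
        finally show ?thesis .
      qed
      also have "\<dots> \<le> emeasure lborel (E - N k) + c" using N(2) by (intro add_left_mono)
      finally have "emeasure lborel E - c \<le> emeasure lborel (E - N k)"
        using cfin by (auto simp: ennreal_minus_le_iff add.commute)
      then have "ennreal \<tau> * (emeasure lborel E - c) \<le> ennreal \<tau> * emeasure lborel (E - N k)" by (rule mult_left_mono) simp
      also have "\<dots> = (\<integral>\<^sup>+z. ennreal \<tau> * indicator (E - N k) z \<partial>lborel)"
        using E N(1)[of k] by (subst nn_integral_cmult_indicator) auto
      also have "\<dots> \<le> (\<integral>\<^sup>+z. indicator E z * e k z \<partial>lborel)"
        using neg by (intro nn_integral_mono) (auto simp: indicator_def not_less)
      finally show False using elim by simp
    qed
  qed
qed

context root_seq
begin

text \<open>Some level |C| > 2 \<delta> is attained on a set of positive area near x. At most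
  \<open>M\<close> roots lie nearby, so small discs about them do not cover this set, and a point
  outside the discs with C_k close to C serves as \<open>a\<close> in
  \<open>zeros_in_pderiv_bound\<close>. There the left side no longer depends on k, which bounds the
  exponent of 2 / 3.\<close>

lemma zeros_in_pderiv_locally_bounded:
  assumes x: "x \<notin> msupport \<mu>" "x \<notin> \<Union>lim.const_comps" and \<rho>: "0 < \<rho>"
    and M: "\<And>k. zeros_in (q k) (cball x (6 * \<rho>)) \<le> M"
  shows "\<exists>L. \<forall>\<^sub>F k in sequentially. zeros_in (pderiv (q k)) (cball x \<rho>) \<le> L"
proof -
  obtain d where d: "0 < d" "ball x d \<inter> msupport \<mu> = {}"
    using x closed_msupport[OF lim.sets_eq_borel] by (metis Compl_iff closed_def disjoint_eq_subset_Compl open_contains_ball)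
  have reg: "regular_point \<mu> x" by (rule lim.off_support_regular[OF d])
  have pos: "emeasure lborel {z \<in> ball x \<rho>. cauchy_transform \<mu> z \<noteq> 0 \<and> potential \<mu> x - 1 < potential \<mu> z} \<noteq> 0"
    by (rule lim.emeasure_pos_nonconst[OF x(2), where b="potential \<mu> x"])
       (use lim.potential_le_log_potential[OF reg] \<rho> in auto)
  define E where "E m = {z \<in> ball x \<rho>. 1 / real (Suc m) < cmod (cauchy_transform \<mu> z)}" for m
  have bm [measurable]: "ball x \<rho> \<in> sets borel" by simp
  have Em: "E m \<in> sets borel" for m unfolding E_def by measurable
  have "\<exists>m. emeasure lborel (E m) \<noteq> 0"
  proof (rule ccontr)
    assume "\<nexists>m. emeasure lborel (E m) \<noteq> 0"
    then have n0: "(\<Union>m. E m) \<in> null_sets lborel" using Em by (intro null_sets_UN) (auto simp: null_sets_def)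
    have "{z \<in> ball x \<rho>. cauchy_transform \<mu> z \<noteq> 0 \<and> potential \<mu> x - 1 < potential \<mu> z} \<subseteq> (\<Union>m. E m)"
    proof
      fix z assume z: "z \<in> {z \<in> ball x \<rho>. cauchy_transform \<mu> z \<noteq> 0 \<and> potential \<mu> x - 1 < potential \<mu> z}"
      then obtain m where "inverse (real (Suc m)) < cmod (cauchy_transform \<mu> z)"
        using reals_Archimedean[of "cmod (cauchy_transform \<mu> z)"] by auto
      then have "z \<in> E m" using z by (simp add: E_def inverse_eq_divide)
      then show "z \<in> (\<Union>m. E m)" by blast
    qed
    moreover have "{z \<in> ball x \<rho>. cauchy_transform \<mu> z \<noteq> 0 \<and> potential \<mu> x - 1 < potential \<mu> z} \<in> sets lborel" by measurable
    ultimately have "{z \<in> ball x \<rho>. cauchy_transform \<mu> z \<noteq> 0 \<and> potential \<mu> x - 1 < potential \<mu> z} \<in> null_sets lborel"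
      using n0 by (meson null_sets_subset)
    then show False using pos by auto
  qed
  then obtain m where m: "emeasure lborel (E m) \<noteq> 0" by blast
  define \<delta> where "\<delta> = 1 / (2 * real (Suc m))"
  have \<delta>: "0 < \<delta>" "1 / real (Suc m) = \<delta> + \<delta>" by (auto simp: \<delta>_def field_simps)
  define \<rho>' where "\<rho>' = cmod x + \<rho>"
  have E_sub: "E m \<subseteq> cball 0 \<rho>'"
  proof
    fix z assume "z \<in> E m"
    then show "z \<in> cball 0 \<rho>'" using norm_triangle_ineq2[of z x] by (simp add: E_def \<rho>'_def dist_norm norm_minus_commute)
  qed
  have Efin: "emeasure lborel (E m) < top"
    using emeasure_bounded_finite[of "E m"] E_sub bounded_subset[OF bounded_cball E_sub] by simp
  then obtain m0 where m0: "emeasure lborel (E m) = ennreal m0" "0 < m0"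
    using m by (cases "emeasure lborel (E m)") auto
  \<comment> \<open>Chosen so that \<open>M\<close> discs of radius \<eta> have total area below m0;
    \<open>Suc M\<close> avoids division by 0.\<close>
  define \<eta> where "\<eta> = min 1 (sqrt (m0 / (2 * pi * real (Suc M))))"
  have \<eta>: "0 < \<eta>" "\<eta> \<le> 1" using m0 by (auto simp: \<eta>_def)
  have \<eta>2: "real M * (pi * \<eta>\<^sup>2) < m0"
  proof -
    have "\<eta>\<^sup>2 \<le> (sqrt (m0 / (2 * pi * real (Suc M))))\<^sup>2" using \<eta> by (intro power_mono) (auto simp: \<eta>_def)
    also have "\<dots> = m0 / (2 * pi * real (Suc M))" using m0 by simp
    finally have "real M * (pi * \<eta>\<^sup>2) \<le> real M * (pi * (m0 / (2 * pi * real (Suc M))))" by (intro mult_left_mono) auto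
    also have "\<dots> = m0 / 2 * (real M / real (Suc M))"     proof -
      have "a * (pi * (b / (2 * pi * c))) = b / 2 * (a / c)" for a b c :: real
        by (cases "c = 0") (simp_all add: field_simps)
      then show ?thesis .
    qed
    also have "\<dots> \<le> m0 / 2 * 1" using m0 by (intro mult_left_mono) auto
    also have "\<dots> < m0" using m0 by simp
    finally show ?thesis .
  qed
  define Z where "Z k = {w. poly (q k) w = 0 \<and> w \<in> cball x (6 * \<rho>)}" for k
  have Zfin: "finite (Z k)" for k
    unfolding Z_def using poly_roots_finite[OF pderiv_nonzero(2)[of k]] by (rule finite_subset[rotated]) auto
  have Zcard: "card (Z k) \<le> M" for k
  proof -
    have "Z k = set_mset (filter_mset (\<lambda>w. w \<in> cball x (6 * \<rho>)) (proots (q k)))"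
      using pderiv_nonzero(2)[of k] by (auto simp: Z_def)
    then have "card (Z k) \<le> zeros_in (q k) (cball x (6 * \<rho>))"
      unfolding zeros_in_def by (metis card_set_mset_le)
    then show ?thesis using M[of k] by simp
  qed
  define N where "N k = (\<Union>w\<in>Z k. ball w \<eta>) \<union> {w. poly (q k) w = 0}" for k
  have roots_null: "{w. poly (q k) w = 0} \<in> null_sets lborel" for k
    using poly_roots_finite[OF pderiv_nonzero(2)[of k]] by (intro finite_imp_null_set_lborel)
  have NB: "N k \<in> sets borel" for k
    unfolding N_def using roots_null[of k] Zfin[of k] by (intro sets.Un sets.finite_UN) (auto simp: null_sets_def)
  have Nle: "emeasure lborel (N k) \<le> ennreal (real M * (pi * \<eta>\<^sup>2))" for k
  proof -
    have "emeasure lborel (N k) \<le> emeasure lborel (\<Union>w\<in>Z k. ball w \<eta>) + emeasure lborel {w. poly (q k) w = 0}"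
      unfolding N_def using roots_null[of k] Zfin[of k] by (intro emeasure_subadditive sets.finite_UN) (auto simp: null_sets_def)
    also have "\<dots> = emeasure lborel (\<Union>w\<in>Z k. ball w \<eta>)" using roots_null[of k] by (simp add: null_sets_def)
    also have "\<dots> \<le> (\<Sum>w\<in>Z k. emeasure lborel (ball w \<eta>))" using Zfin[of k] by (intro emeasure_subadditive_finite) auto
    also have "\<dots> = of_nat (card (Z k)) * ennreal (pi * \<eta>\<^sup>2)"
      using \<eta> by (simp add: emeasure_lborel_ball_complex)
    also have "\<dots> \<le> of_nat M * ennreal (pi * \<eta>\<^sup>2)" using Zcard[of k] by (intro mult_right_mono) auto
    also have "\<dots> = ennreal (real M * (pi * \<eta>\<^sup>2))" by (simp add: ennreal_mult ennreal_of_nat_eq_real_of_nat)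
    finally show ?thesis .
  qed
  define e where "e k z = ennreal (cmod (cauchy_transform (\<sigma> k) z - cauchy_transform \<mu> z))" for k z
  have le2: "(\<integral>\<^sup>+z. indicator (E m) z * e k z \<partial>lborel) \<le> (\<integral>\<^sup>+z. indicator (cball 0 \<rho>') z * ennreal (cmod (cauchy_transform (\<sigma> k) z - cauchy_transform \<mu> z)) \<partial>lborel)" for k
    using E_sub by (intro nn_integral_mono) (auto simp: e_def indicator_def)
  have lim0: "(\<lambda>k. \<integral>\<^sup>+z. indicator (E m) z * e k z \<partial>lborel) \<longlonglongrightarrow> 0"
    using le2 by (intro tendsto_sandwich[OF _ _ tendsto_const L1_tendsto_cauchy[of \<rho>']] always_eventually allI) simp_all
  have ex: "\<forall>\<^sub>F k in sequentially. \<exists>z\<in>E m - N k. e k z < ennreal \<delta>"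
    by (rule eventually_ex_small_avoiding[OF lim0 Em \<delta>(1) NB Nle]) (use \<eta>2 m0 in \<open>simp add: ennreal_less_iff\<close>)
  define K where "K = (max 1 (10 * \<rho>)) ^ M * (real M + 1 / (2 * \<rho>))"
  have K: "0 < K" using \<rho> by (auto simp: K_def intro!: mult_pos_pos add_nonneg_pos zero_less_power)
  have "0 < \<delta> * \<eta> ^ M / K" using \<delta> \<eta> K by simp
  then obtain L where L: "(2 / 3 :: real) ^ L < \<delta> * \<eta> ^ M / K" using real_arch_pow_inv[of _ "2/3 :: real"] by force
  have "\<forall>\<^sub>F k in sequentially. zeros_in (pderiv (q k)) (cball x \<rho>) \<le> L"
    using ex
  proof eventually_elim
    case (elim k)
    then obtain z where z: "z \<in> E m" "z \<notin> N k" "e k z < ennreal \<delta>" by blast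
    have C: "\<delta> \<le> cmod (cauchy_transform (\<sigma> k) z)"
    proof -
      have "cmod (cauchy_transform (\<sigma> k) z - cauchy_transform \<mu> z) < \<delta>"
        using z(3) unfolding e_def by (subst (asm) ennreal_less_iff) auto
      moreover have "\<delta> + \<delta> < cmod (cauchy_transform \<mu> z)" using z(1) \<delta>(2) by (simp add: E_def)
      ultimately show ?thesis
        using norm_triangle_ineq2[of "cauchy_transform \<mu> z" "cauchy_transform (\<sigma> k) z"] by (simp add: norm_minus_commute)
    qed
    have zb: "z \<in> ball x \<rho>" using z(1) by (simp add: E_def)
    have qz: "poly (q k) z \<noteq> 0" using z(2) by (auto simp: N_def)
    have sep: "\<eta> \<le> cmod (z - w)" if "poly (q k) w = 0" "w \<in> cball x (6 * \<rho>)" for w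
    proof -
      have "z \<notin> ball w \<eta>" using z(2) that by (auto simp: N_def Z_def)
      then show ?thesis by (simp add: dist_norm norm_minus_commute)
    qed
    have "\<delta> * \<eta> ^ M \<le> K * (2 / 3) ^ zeros_in (pderiv (q k)) (cball x \<rho>)"
      unfolding K_def by (rule zeros_in_pderiv_bound[OF degree_ge_2 \<rho> M zb qz \<eta> sep \<delta>(1) C])
    then have "\<delta> * \<eta> ^ M / K \<le> (2 / 3) ^ zeros_in (pderiv (q k)) (cball x \<rho>)" using K by (simp add: field_simps)
    with L have "(2 / 3 :: real) ^ L < (2 / 3) ^ zeros_in (pderiv (q k)) (cball x \<rho>)" by (rule less_le_trans)
    then show ?case
      using power_decreasing[of L "zeros_in (pderiv (q k)) (cball x \<rho>)" "2 / 3 :: real"] by (cases "L \<le> zeros_in (pderiv (q k)) (cball x \<rho>)") auto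
  qed
  then show ?thesis by blast
qed

end

section \<open>The theorem\<close>

lemma size_filter_mset_cover:
  assumes "finite D" "\<And>z. z \<in># A \<Longrightarrow> z \<in> L \<Longrightarrow> \<exists>i\<in>D. z \<in> B i"
  shows "size (filter_mset (\<lambda>z. z \<in> L) A) \<le> (\<Sum>i\<in>D. size (filter_mset (\<lambda>z. z \<in> B i) A))"
  using assms(2)
proof (induction A)
  case (add z A)
  have "(\<Sum>i\<in>D. size (filter_mset (\<lambda>z. z \<in> B i) (add_mset z A)))
    = (\<Sum>i\<in>D. size (filter_mset (\<lambda>z. z \<in> B i) A)) + (\<Sum>i\<in>D. if z \<in> B i then 1 else 0)"
    unfolding sum.distrib[symmetric] by (intro sum.cong) auto
  moreover have "(if z \<in> L then 1 else 0) \<le> (\<Sum>i\<in>D. if z \<in> B i then 1 else (0::nat))"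
  proof (cases "z \<in> L")
    case True
    then obtain i where i: "i \<in> D" "z \<in> B i" using add.prems[of z] by auto
    have "(if z \<in> B i then 1 else (0::nat)) \<le> (\<Sum>i\<in>D. if z \<in> B i then 1 else 0)"
      using assms(1) i by (intro member_le_sum) auto
    then show ?thesis using i by simp
  qed simp
  moreover have "size (filter_mset (\<lambda>z. z \<in> L) A) \<le> (\<Sum>i\<in>D. size (filter_mset (\<lambda>z. z \<in> B i) A))"
    using add by auto
  ultimately show ?case by (auto split: if_splits)
qed simp

lemma zeros_in_le_degree: "zeros_in p L \<le> degree p" for p :: "complex poly"
  unfolding zeros_in_def using size_filter_mset_lesseq[of _ "proots p"] size_proots_complex[of p] by simp

text \<open>Makes the union of the closures of the V_j a Borel set, so that its vanishing measure
  bounds the measure of each closure.\<close>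

lemma countable_components: "open S \<Longrightarrow> countable (components S)" for S :: "complex set"
  using pairwise_disjoint_components[of S]
  by (intro countable_disjoint_open_subsets) (auto intro: open_components simp: disjnt_def[abs_def])

text \<open>The constant components are among the V_j. They are bounded, since the unbounded
  component is one of the U_i, and their closures are null, so the lower bound holds at every point
  of the plane. The local bounds on the number of critical points add up to a bound on L by
  compactness of its part in the disc that contains all roots.\<close>

lemma noble_seq_pderiv:
  assumes deg: "filterlim (\<lambda>k. degree (q k)) at_top sequentially"
    and noble: "noble_seq q \<mu> Us Vs"
  shows "noble_seq (\<lambda>k. pderiv (q k)) \<mu> Us Vs"
proof -
  have nm: "noble_measure \<mu> Us Vs" and cen: "centers_on q (- \<Union>Us)" and weak: "weak_star_conv (\<lambda>k. root_dist (q k)) \<mu>"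
    using noble by (auto simp: noble_seq_def)
  have prob: "prob_space \<mu>" and sets: "sets \<mu> = sets borel" and comp: "compact (msupport \<mu>)"
    and UV: "Us \<union> Vs = components (- msupport \<mu>)"
    and unb: "\<exists>U\<in>Us. \<not> bounded U"
    and nonconst: "\<And>U. U \<in> Us \<Longrightarrow> \<exists>z1\<in>U. \<exists>z2\<in>U. potential \<mu> z1 \<noteq> potential \<mu> z2"
    and null: "measure \<mu> (\<Union>V\<in>Vs. closure V) = 0"
    using nm unfolding noble_measure_def Let_def by auto
  from cen[unfolded centers_on_def] obtain R0 k0 where R0: "R0 > 0"
    and roots': "\<forall>k\<ge>k0. \<forall>z. poly (q k) z = 0 \<longrightarrow> z \<in> ball 0 R0"
    and zin': "\<forall>L. closed L \<and> L \<inter> - \<Union>Us = {} \<longrightarrow> (\<exists>M. \<forall>k\<ge>k0. zeros_in (q k) L \<le> M)"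
    by (elim exE conjE)
  have roots: "z \<in> ball 0 R0" if "k \<ge> k0" "poly (q k) z = 0" for k z using roots' that by blast
  have zin: "\<exists>M. \<forall>k\<ge>k0. zeros_in (q k) L \<le> M" if "closed L" "L \<inter> - \<Union>Us = {}" for L using zin' that by blast
  obtain Rs where Rs: "\<forall>y\<in>msupport \<mu>. norm y \<le> Rs" using compact_imp_bounded[OF comp] unfolding bounded_iff by auto
  define R where "R = max R0 Rs"
  have R: "0 < R" "R0 \<le> R" "Rs \<le> R" using R0 by (auto simp: R_def)
  have "eventually (\<lambda>k. 2 \<le> degree (q k)) sequentially"
    using deg by (simp add: filterlim_at_top)
  then obtain k2 where k2: "\<And>k. k \<ge> k2 \<Longrightarrow> 2 \<le> degree (q k)" by (auto simp: eventually_sequentially)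
  \<comment> \<open>Dropping finitely many terms brings the sequence into \<open>root_seq\<close>;
    the same index is the threshold in \<open>centers_on\<close>.\<close>
  define k1 where "k1 = max k0 k2"
  define p where "p j = q (j + k1)" for j
  interpret root_seq p \<mu> R
  proof (rule root_seq.intro)
    show "2 \<le> degree (p k)" for k using k2[of "k + k1"] by (simp add: p_def k1_def)
    have "filterlim (\<lambda>k. k + k1) at_top sequentially" by (rule filterlim_add_const_nat_at_top)
    then show "filterlim (\<lambda>k. degree (p k)) at_top sequentially"
      unfolding p_def by (rule filterlim_compose[OF deg])
    show "cmod z < R" if "poly (p k) z = 0" for k z
    proof -
      have "k0 \<le> k + k1" by (simp add: k1_def)
      then have "z \<in> ball 0 R0" using that unfolding p_def by (rule roots)
      then show ?thesis using R by simp
    qed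
    have "AE y in \<mu>. cmod y \<le> R"
      using AE_in_msupport[OF sets] by eventually_elim (use Rs R in force)
    then show "disc_prob \<mu> R" using prob sets by (simp add: disc_prob_def disc_prob_axioms_def)
    show "weak_star_conv (\<lambda>k. root_dist (p k)) \<mu>"
      using weak unfolding weak_star_conv_def p_def by (auto intro: LIMSEQ_ignore_initial_segment)
  qed
  have not_U: "V \<notin> Us" if "V \<in> lim.const_comps" for V
    using nonconst[of V] that by (auto simp: lim.const_comps_def)
  have const_V: "V \<in> Vs" if "V \<in> lim.const_comps" for V
    using not_U[OF that] that UV by (auto simp: lim.const_comps_def)
  have const_bounded: "bounded V" if V: "V \<in> lim.const_comps" for V
  proof (rule ccontr)
    assume nb: "\<not> bounded V"
    obtain U where U: "U \<in> Us" "\<not> bounded U" using unb by blast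
    have "U = V"
      using cobounded_unique_unbounded_components[of "- msupport \<mu>" U V] compact_imp_bounded[OF comp] U nb V UV
      by (auto simp: lim.const_comps_def)
    then show False using U not_U[OF V] by simp
  qed
  have const_null: "measure \<mu> (closure V) = 0" if V: "V \<in> lim.const_comps" for V
  proof -
    have "open (- msupport \<mu>)" using comp by (simp add: compact_imp_closed open_Compl)
    then have "countable Vs" using UV by (intro countable_subset[OF _ countable_components]) auto
    then have "(\<Union>V\<in>Vs. closure V) \<in> sets borel" by (intro sets.countable_UN') auto
    then have "measure \<mu> (closure V) \<le> measure \<mu> (\<Union>V\<in>Vs. closure V)"
      using const_V[OF V] sets by (intro lim.finite_measure_mono) auto
    then show ?thesis using null measure_nonneg[of \<mu> "closure V"] by simp
  qed
  have low: "lower_at x" for x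
  proof (cases "x \<in> \<Union>lim.const_comps")
    case True
    then obtain V where "V \<in> lim.const_comps" "x \<in> V" by blast
    then show ?thesis using lower_at_const const_bounded const_null by blast
  qed (rule lower_at_nonconst)
  have "weak_star_conv \<sigma>' \<mu>"
    by (rule weak_star_conv_of_log_potential[OF disc_k' lim_disc log_potential_pderiv_tendsto[OF low]])
  then have "weak_star_conv (\<lambda>j. root_dist (pderiv (p j))) \<mu>"
    by (simp add: weak_star_conv_root_measure)
  then have weak': "weak_star_conv (\<lambda>k. root_dist (pderiv (q k))) \<mu>"
    unfolding weak_star_conv_def p_def by (auto intro: LIMSEQ_offset)
  have "centers_on (\<lambda>k. pderiv (q k)) (- \<Union>Us)"
    unfolding centers_on_def
  proof (rule exI[of _ R], rule conjI[OF R(1)], rule exI[of _ k1], intro conjI allI impI)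
    have pk: "q k = p (k - k1)" if "k1 \<le> k" for k using that by (simp add: p_def)
    have pR: "cmod z < R" if "poly (pderiv (p j)) z = 0" for j z
      using pderiv_roots_in_disc[of "p j" R z] degree_ge_2[of j] roots_in_disc[of j] that by auto
    show "z \<in> ball 0 R" if "k1 \<le> k" "poly (pderiv (q k)) z = 0" for k z
      using pR[of "k - k1" z] that pk by simp
    fix L assume L: "closed L \<and> L \<inter> - \<Union>Us = {}"
    have cK: "compact (L \<inter> cball 0 R)" using L by (simp add: closed_Int_compact)
    have "\<exists>\<rho>>0. \<exists>N. \<forall>\<^sub>F j in sequentially. zeros_in (pderiv (p j)) (cball x \<rho>) \<le> N" if x: "x \<in> L" for x
    proof -
      obtain U where U: "U \<in> Us" "x \<in> U" using x L by blast
      have Uc: "U \<in> components (- msupport \<mu>)" using U UV by blast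
      obtain d where d: "d > 0" "cball x d \<subseteq> U" using lim.open_component[OF Uc] U open_contains_cball by blast
      have "closed (cball x d)" "cball x d \<inter> - \<Union>Us = {}" using d U by auto
      then obtain M where M: "\<forall>k\<ge>k0. zeros_in (q k) (cball x d) \<le> M" using zin by blast
      have 1: "x \<notin> msupport \<mu>" using U in_components_subset[OF Uc] by blast
      have 2: "x \<notin> \<Union>lim.const_comps"
      proof
        assume "x \<in> \<Union>lim.const_comps"
        then obtain V where V: "V \<in> lim.const_comps" "x \<in> V" by blast
        then have "V = U" using components_eq[of V "- msupport \<mu>" U] Uc U by (auto simp: lim.const_comps_def)
        then show False using not_U[OF V(1)] U by simp
      qed
      \<comment> \<open>To count critical points in a disc, the roots of q must be counted in a disc
        of six times the radius, hence d / 6.\<close>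
      have "zeros_in (p j) (cball x (6 * (d / 6))) \<le> M" for j
        using M[rule_format, of "j + k1"] by (simp add: p_def k1_def)
      from zeros_in_pderiv_locally_bounded[OF 1 2 _ this] show ?thesis using d by (intro exI[of _ "d / 6"]) auto
    qed
    then obtain \<rho> N where \<rho>N: "\<And>x. x \<in> L \<Longrightarrow> 0 < \<rho> x \<and> (\<forall>\<^sub>F j in sequentially. zeros_in (pderiv (p j)) (cball x (\<rho> x)) \<le> N x)"
      by metis
    have "L \<inter> cball 0 R \<subseteq> (\<Union>x\<in>L \<inter> cball 0 R. ball x (\<rho> x))" using \<rho>N by force
    then obtain D where D: "D \<subseteq> L \<inter> cball 0 R" "finite D" "L \<inter> cball 0 R \<subseteq> (\<Union>x\<in>D. ball x (\<rho> x))"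
      using compactE_image[OF cK, of "L \<inter> cball 0 R" "\<lambda>x. ball x (\<rho> x)"] by auto
    have "\<forall>\<^sub>F j in sequentially. \<forall>x\<in>D. zeros_in (pderiv (p j)) (cball x (\<rho> x)) \<le> N x"
      using D \<rho>N by (intro eventually_ball_finite) auto
    then obtain J where J: "\<And>j. j \<ge> J \<Longrightarrow> \<forall>x\<in>D. zeros_in (pderiv (p j)) (cball x (\<rho> x)) \<le> N x"
      by (auto simp: eventually_sequentially)
    \<comment> \<open>\<open>centers_on\<close> fixes the threshold before L is given, whereas
      \<open>J\<close> depends on L. For the finitely many indices in between, the degree bounds the
      count.\<close>
    define M where "M = (\<Sum>x\<in>D. N x) + (\<Sum>j<J. degree (pderiv (p j)))"
    have "zeros_in (pderiv (q k)) L \<le> M" if k: "k1 \<le> k" for k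
    proof -
      define j where "j = k - k1"
      have "zeros_in (pderiv (p j)) L \<le> M"
      proof (cases "j < J")
        case True
        have "zeros_in (pderiv (p j)) L \<le> degree (pderiv (p j))" by (rule zeros_in_le_degree)
        also have "\<dots> \<le> (\<Sum>j<J. degree (pderiv (p j)))"
          using True by (intro member_le_sum) auto
        finally show ?thesis by (simp add: M_def)
      next
        case False
        have "zeros_in (pderiv (p j)) L \<le> (\<Sum>x\<in>D. zeros_in (pderiv (p j)) (cball x (\<rho> x)))"
          unfolding zeros_in_def
        proof (rule size_filter_mset_cover[OF D(2), where B="\<lambda>x. cball x (\<rho> x)"])
          fix z assume z: "z \<in># proots (pderiv (p j))" "z \<in> L"
          then have "poly (pderiv (p j)) z = 0" using pderiv_nonzero(1)[of j] by simp
          then have "z \<in> L \<inter> cball 0 R" using pR z by (auto intro: less_imp_le)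
          then show "\<exists>x\<in>D. z \<in> cball x (\<rho> x)" using D(3) by force
        qed
        also have "\<dots> \<le> (\<Sum>x\<in>D. N x)" using J[of j] False by (intro sum_mono) auto
        finally show ?thesis by (simp add: M_def)
      qed
      then show ?thesis using pk[OF k] by (simp add: j_def)
    qed
    then show "\<exists>M. \<forall>k\<ge>k1. zeros_in (pderiv (q k)) L \<le> M" by blast
  qed
  then show ?thesis using nm weak' by (simp add: noble_seq_def)
qed

lemma filterlim_degree_pderiv:
  fixes q :: "nat \<Rightarrow> complex poly"
  assumes "filterlim (\<lambda>k. degree (q k)) at_top sequentially"
  shows "filterlim (\<lambda>k. degree (pderiv (q k))) at_top sequentially"
  unfolding degree_pderiv filterlim_at_top
proof
  fix Z :: nat
  have "\<forall>\<^sub>F k in sequentially. Suc Z \<le> degree (q k)" using assms by (simp add: filterlim_at_top)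
  then show "\<forall>\<^sub>F k in sequentially. Z \<le> degree (q k) - 1" by eventually_elim simp
qed

theorem theoremB:
  fixes \<mu> :: "complex measure" and S :: "complex set"
    and Us Vs :: "complex set set" and q :: "nat \<Rightarrow> complex poly"
  assumes "compact S"
    and "prob_space \<mu>" and "sets \<mu> = sets borel" and "msupport \<mu> = S"
    and "noble_measure \<mu> Us Vs"
    and "\<forall>k. q k \<noteq> 0"
    and "filterlim (\<lambda>k. degree (q k)) at_top sequentially"
    and "noble_seq q \<mu> Us Vs"
  shows "noble_seq (\<lambda>k. pderiv (q k)) \<mu> Us Vs \<and>
         (\<forall>m::nat. weak_star_conv (\<lambda>k. root_dist ((pderiv ^^ m) (q k))) \<mu>)"
proof -
  \<comment> \<open>The growth of the degrees is carried along in the induction, since each further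
    derivative needs it as a hypothesis.\<close>
  have "filterlim (\<lambda>k. degree ((pderiv ^^ m) (q k))) at_top sequentially \<and> noble_seq (\<lambda>k. (pderiv ^^ m) (q k)) \<mu> Us Vs" for m
  proof (induction m)
    case (Suc m)
    then show ?case by (simp add: filterlim_degree_pderiv noble_seq_pderiv)
  qed (use assms in simp)
  then have "weak_star_conv (\<lambda>k. root_dist ((pderiv ^^ m) (q k))) \<mu>" for m by (simp add: noble_seq_def)
  with noble_seq_pderiv[OF assms(7,8)] show ?thesis by blast
qed

end
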